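(* Let $(\mathcal{C},\Sigma^n,\Theta)$ be a ($k$-linear, Hom-finite, Krull–Schmidt) $(n+2)$-angulated category over a field $k$ with a Serre functor $\mathbb{S}$, and let $\mathcal{X}$ be a strongly functorially finite subcategory of $\mathcal{C}$. Then the pre-$(n+2)$-angulated category $\mathcal{C}/\mathcal{X}$ is $(n+2)$-angulated if and only if $\mathbb{S}\mathcal{X}=\Sigma^n\mathcal{X}$.
   Context: $n\ge1$. **$(n+2)$-angulated categories (Geiss–Keller–Oppermann).** $\mathcal{C}$ is additive, $\Sigma^n$ an additive automorphism of $\mathcal{C}$, and $\Theta$ a class of sequences $A_0\xrightarrow{f_0}A_1\to\cdots\xrightarrow{f_n}A_{n+1}\xrightarrow{f_{n+1}}\Sigma^nA_0$, called $(n+2)$-angles, such that: (F1) $\Theta$ is closed under isomorphisms, direct sums and direct summands, contains $A\xrightarrow{1}A\to0\to\cdots\to0\to\Sigma^nA$ for each $A$, and each morphism of $\mathcal{C}$ is the first morphism of some member of $\Theta$; (F2) a sequence is in $\Theta$ if and only if $A_1\xrightarrow{f_1}\cdots\to A_{n+1}\xrightarrow{f_{n+1}}\Sigma^nA_0\xrightarrow{(-1)^n\Sigma^nf_0}\Sigma^nA_1$ is; (F3) a commutative first square between two members of $\Theta$ extends to a morphism $(\varphi_0,\dots,\varphi_{n+1})$ of sequences (last vertical map $\Sigma^n\varphi_0$); (F4) in (F3) the extension can be chosen so that the mapping cone $A_1\oplus B_0\to A_2\oplus B_1\to\cdots\to\Sigma^nA_0\oplus B_{n+1}\to\Sigma^nA_1\oplus\Sigma^nB_0$,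 with differentials $\begin{pmatrix}-f_{i+1}&0\\ \varphi_{i+1}&g_i\end{pmatrix}$ ($0\le i\le n$) and last one $\begin{pmatrix}-\Sigma^nf_0&0\\ \Sigma^n\varphi_0&g_{n+1}\end{pmatrix}$, is in $\Theta$. **Serre functor.** An auto-equivalence $\mathbb{S}$ of $\mathcal{C}$ with natural isomorphisms $\mathcal{C}(X,Y)\simeq D\,\mathcal{C}(Y,\mathbb{S}X)$, $D=\mathrm{Hom}_k(-,k)$. **Subcategories and quotient.** $\mathcal{X}$ is a full subcategory closed under isomorphisms, finite direct sums and direct summands. $f\colon A\to B$ is $\mathcal{X}$-monic if $\mathcal{C}(f,X)$ is surjective for all $X\in\mathcal{X}$. A left (resp. right) $\mathcal{X}$-approximation of $C$ is a morphism $C\to X$ (resp. $X\to C$), $X\in\mathcal{X}$, through which every morphism from $C$ to (resp. to $C$ from) an object of $\mathcal{X}$ factors. $\mathcal{X}$ is strongly functorially finite if each $C\in\mathcal{C}$ admits $(n+2)$-angles $(1)\ C\xrightarrow{a}X_1\to\cdots\to X_n\to\mathbb{G}C\to\Sigma^nC$ and $(2)\ \mathbb{H}C\to Y_1\to\cdots\to Y_n\xrightarrow{v}C\to\Sigma^n\mathbb{H}C$ with all $X_i,Y_i\in\mathcal{X}$, $a$ a left and $v$ a right $\mathcal{X}$-approximation; fix such choices. $\mathcal{C}/\mathcal{X}$ has the objects of $\mathcal{C}$ and morphisms of $\mathcal{C}$ modulo those factoring through an object of $\mathcal{X}$; $\overline{f}$ is the class of $f$. $\mathbb{S}\mathcal{X}$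 and $\Sigma^n\mathcal{X}$ denote the classes of objects isomorphic to $\mathbb{S}X$, resp. $\Sigma^nX$, with $X\in\mathcal{X}$. **Pre-$(n+2)$-angulated structure on $\mathcal{C}/\mathcal{X}$.** $\mathbb{G}$ is the endofunctor of $\mathcal{C}/\mathcal{X}$ with $\mathbb{G}\overline{\varphi}=\overline{\psi}$, where $(\varphi,\dots,\psi)$ is a morphism of $(n+2)$-angles (1); $\mathbb{H}$ is defined dually from (2); they form an adjoint pair $(\mathbb{G},\mathbb{H})$. The right $(n+2)$-angles of $\mathcal{C}/\mathcal{X}$ are the sequences isomorphic to $A_0\xrightarrow{\overline{g_0}}A_1\to\cdots\xrightarrow{\overline{g_n}}A_{n+1}\xrightarrow{\overline{\varphi_{n+1}}}\mathbb{G}A_0$, where $A_0\xrightarrow{g_0}\cdots\xrightarrow{g_n}A_{n+1}\to\Sigma^nA_0$ is an $(n+2)$-angle with $g_0$ $\mathcal{X}$-monic and $(1_{A_0},\varphi_1,\dots,\varphi_{n+1})$ is a morphism of $(n+2)$-angles to (1) of $A_0$; the left $(n+2)$-angles are defined dually using $\mathbb{H}$. "The pre-$(n+2)$-angulated category $\mathcal{C}/\mathcal{X}$ is $(n+2)$-angulated" means: $\mathbb{G}$ is an autoequivalence (equivalently, the adjoint pair $(\mathbb{G},\mathbb{H})$ is an adjoint equivalence) and $\mathcal{C}/\mathcal{X}$ with $\mathbb{G}$ and its class of right $(n+2)$-angles satisfies (F1)–(F4) (with "autoequivalence" in place of "automorphism"). *)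

theory Defs
  imports Main "HOL-Library.FuncSet"
begin

section \<open>Preadditive categories\<close>

text \<open>
  The objects of a category form the type \<open>'o\<close>. The morphisms form a subset \<open>arr\<close> of the
  type \<open>'m\<close>, and each morphism knows its source and target. The operations are only
  meaningful on composable, respectively parallel, morphisms; nothing is assumed about them
  elsewhere.
\<close>

record ('o, 'm) precat =
  arr :: "'m set"
  src :: "'m \<Rightarrow> 'o"
  tgt :: "'m \<Rightarrow> 'o"
  ide :: "'o \<Rightarrow> 'm"
  cmp :: "'m \<Rightarrow> 'm \<Rightarrow> 'm" (infixr "\<cdot>\<index>" 70)
  madd :: "'m \<Rightarrow> 'm \<Rightarrow> 'm" (infixl "\<oplus>\<index>" 65)
  mzero :: "'o \<Rightarrow> 'o \<Rightarrow> 'm"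
  mneg :: "'m \<Rightarrow> 'm"

definition Hom :: "('o, 'm, 'z) precat_scheme \<Rightarrow> 'o \<Rightarrow> 'o \<Rightarrow> 'm set" where
  "Hom C A B = {f \<in> arr C. src C f = A \<and> tgt C f = B}"

locale category =
  fixes C :: "('o, 'm, 'z) precat_scheme" (structure)
  assumes ide_Hom: "ide C A \<in> Hom C A A"
    and cmp_Hom: "f \<in> Hom C A B \<Longrightarrow> g \<in> Hom C B D \<Longrightarrow> g \<cdot> f \<in> Hom C A D"
    and cmp_ide_right: "f \<in> Hom C A B \<Longrightarrow> f \<cdot> ide C A = f"
    and cmp_ide_left: "f \<in> Hom C A B \<Longrightarrow> ide C B \<cdot> f = f"
    and cmp_assoc: "f \<in> Hom C A B \<Longrightarrow> g \<in> Hom C B D \<Longrightarrow> h \<in> Hom C D E \<Longrightarrow>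
      (h \<cdot> g) \<cdot> f = h \<cdot> (g \<cdot> f)"

locale preadditive_category = category +
  assumes madd_Hom: "f \<in> Hom C A B \<Longrightarrow> g \<in> Hom C A B \<Longrightarrow> f \<oplus> g \<in> Hom C A B"
    and mzero_Hom: "mzero C A B \<in> Hom C A B"
    and mneg_Hom: "f \<in> Hom C A B \<Longrightarrow> mneg C f \<in> Hom C A B"
    and madd_assoc: "f \<in> Hom C A B \<Longrightarrow> g \<in> Hom C A B \<Longrightarrow> h \<in> Hom C A B \<Longrightarrow>
      (f \<oplus> g) \<oplus> h = f \<oplus> (g \<oplus> h)"
    and madd_commute: "f \<in> Hom C A B \<Longrightarrow> g \<in> Hom C A B \<Longrightarrow> f \<oplus> g = g \<oplus> f"
    and madd_mzero: "f \<in> Hom C A B \<Longrightarrow> f \<oplus> mzero C A B = f"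
    and madd_mneg: "f \<in> Hom C A B \<Longrightarrow> f \<oplus> mneg C f = mzero C A B"
    and cmp_madd_right: "f \<in> Hom C A B \<Longrightarrow> f' \<in> Hom C A B \<Longrightarrow> g \<in> Hom C B D \<Longrightarrow>
      g \<cdot> (f \<oplus> f') = (g \<cdot> f) \<oplus> (g \<cdot> f')"
    and cmp_madd_left: "f \<in> Hom C A B \<Longrightarrow> g \<in> Hom C B D \<Longrightarrow> g' \<in> Hom C B D \<Longrightarrow>
      (g \<oplus> g') \<cdot> f = (g \<cdot> f) \<oplus> (g' \<cdot> f)"

definition is_iso :: "('o, 'm, 'z) precat_scheme \<Rightarrow> 'm \<Rightarrow> bool" where
  "is_iso C f \<longleftrightarrow> f \<in> arr C \<and>
    (\<exists>g \<in> Hom C (tgt C f) (src C f). g \<cdot>\<^bsub>C\<^esub> f = ide C (src C f) \<and> f \<cdot>\<^bsub>C\<^esub> g = ide C (tgt C f))"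

definition isomorphic :: "('o, 'm, 'z) precat_scheme \<Rightarrow> 'o \<Rightarrow> 'o \<Rightarrow> bool" where
  "isomorphic C A B \<longleftrightarrow> (\<exists>f \<in> Hom C A B. is_iso C f)"

definition zero_object :: "('o, 'm, 'z) precat_scheme \<Rightarrow> 'o \<Rightarrow> bool" where
  "zero_object C Z \<longleftrightarrow> (\<forall>A. (\<exists>!f. f \<in> Hom C A Z) \<and> (\<exists>!f. f \<in> Hom C Z A))"

definition biproduct ::
  "('o, 'm, 'z) precat_scheme \<Rightarrow> 'o \<Rightarrow> 'o \<Rightarrow> 'o \<Rightarrow> 'm \<Rightarrow> 'm \<Rightarrow> 'm \<Rightarrow> 'm \<Rightarrow> bool" where
  "biproduct C A B P i1 i2 p1 p2 \<longleftrightarrow>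
    i1 \<in> Hom C A P \<and> i2 \<in> Hom C B P \<and> p1 \<in> Hom C P A \<and> p2 \<in> Hom C P B \<and>
    p1 \<cdot>\<^bsub>C\<^esub> i1 = ide C A \<and> p2 \<cdot>\<^bsub>C\<^esub> i2 = ide C B \<and>
    p1 \<cdot>\<^bsub>C\<^esub> i2 = mzero C B A \<and> p2 \<cdot>\<^bsub>C\<^esub> i1 = mzero C A B \<and>
    (i1 \<cdot>\<^bsub>C\<^esub> p1) \<oplus>\<^bsub>C\<^esub> (i2 \<cdot>\<^bsub>C\<^esub> p2) = ide C P"

definition direct_sum :: "('o, 'm, 'z) precat_scheme \<Rightarrow> 'o \<Rightarrow> 'o \<Rightarrow> 'o \<Rightarrow> bool" where
  "direct_sum C A B P \<longleftrightarrow> (\<exists>i1 i2 p1 p2. biproduct C A B P i1 i2 p1 p2)"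

locale additive_category = preadditive_category +
  assumes has_zero_object: "\<exists>Z. zero_object C Z"
    and has_direct_sums: "\<exists>P. direct_sum C A B P"


section \<open>Functors\<close>

record ('o, 'm) endo =
  ob :: "'o \<Rightarrow> 'o"
  ar :: "'m \<Rightarrow> 'm"

definition endofunctor :: "('o, 'm, 'z) precat_scheme \<Rightarrow> ('o, 'm) endo \<Rightarrow> bool" where
  "endofunctor C F \<longleftrightarrow>
    (\<forall>A B. \<forall>f \<in> Hom C A B. ar F f \<in> Hom C (ob F A) (ob F B)) \<and>
    (\<forall>A. ar F (ide C A) = ide C (ob F A)) \<and>
    (\<forall>A B D. \<forall>f \<in> Hom C A B. \<forall>g \<in> Hom C B D. ar F (g \<cdot>\<^bsub>C\<^esub> f) = ar F g \<cdot>\<^bsub>C\<^esub> ar F f)"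

definition additive_endofunctor :: "('o, 'm, 'z) precat_scheme \<Rightarrow> ('o, 'm) endo \<Rightarrow> bool" where
  "additive_endofunctor C F \<longleftrightarrow> endofunctor C F \<and>
    (\<forall>A B. \<forall>f \<in> Hom C A B. \<forall>g \<in> Hom C A B. ar F (f \<oplus>\<^bsub>C\<^esub> g) = ar F f \<oplus>\<^bsub>C\<^esub> ar F g)"

definition automorphism :: "('o, 'm, 'z) precat_scheme \<Rightarrow> ('o, 'm) endo \<Rightarrow> bool" where
  "automorphism C F \<longleftrightarrow> endofunctor C F \<and> bij (ob F) \<and> bij_betw (ar F) (arr C) (arr C)"

definition naturally_isomorphic ::
  "('o, 'm, 'z) precat_scheme \<Rightarrow> ('o, 'm) endo \<Rightarrow> ('o, 'm) endo \<Rightarrow> bool" where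
  "naturally_isomorphic C F G \<longleftrightarrow>
    (\<exists>\<eta>. (\<forall>A. \<eta> A \<in> Hom C (ob F A) (ob G A) \<and> is_iso C (\<eta> A)) \<and>
         (\<forall>A B. \<forall>f \<in> Hom C A B. \<eta> B \<cdot>\<^bsub>C\<^esub> ar F f = ar G f \<cdot>\<^bsub>C\<^esub> \<eta> A))"

definition id_endo :: "('o, 'm) endo" where
  "id_endo = \<lparr>ob = id, ar = id\<rparr>"

definition comp_endo :: "('o, 'm) endo \<Rightarrow> ('o, 'm) endo \<Rightarrow> ('o, 'm) endo" where
  "comp_endo G F = \<lparr>ob = ob G \<circ> ob F, ar = ar G \<circ> ar F\<rparr>"

definition autoequivalence :: "('o, 'm, 'z) precat_scheme \<Rightarrow> ('o, 'm) endo \<Rightarrow> bool" where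
  "autoequivalence C F \<longleftrightarrow> endofunctor C F \<and>
    (\<exists>G. endofunctor C G \<and> naturally_isomorphic C (comp_endo G F) id_endo \<and>
         naturally_isomorphic C (comp_endo F G) id_endo)"


section \<open>\<open>(n+2)\<close>-angulated categories\<close>

text \<open>
  A sequence \<open>A\<^sub>0 \<rightarrow> A\<^sub>1 \<rightarrow> \<dots> \<rightarrow> A\<^sub>n\<^sub>+\<^sub>1 \<rightarrow> T A\<^sub>0\<close> is given by its morphisms \<open>f 0, \<dots>, f (n+1)\<close>, so
  that \<open>A\<^sub>i = src C (f i)\<close>. The values \<open>f i\<close> for \<open>i > n + 1\<close> are irrelevant: classes of
  sequences that are closed under isomorphisms do not depend on them.
\<close>

definition nseq :: "nat \<Rightarrow> ('o, 'm, 'z) precat_scheme \<Rightarrow> ('o, 'm) endo \<Rightarrow> (nat \<Rightarrow> 'm) \<Rightarrow> bool" where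
  "nseq n C T f \<longleftrightarrow> (\<forall>i \<le> n + 1. f i \<in> arr C) \<and>
    (\<forall>i \<le> n. tgt C (f i) = src C (f (i + 1))) \<and> tgt C (f (n + 1)) = ob T (src C (f 0))"

definition nseq_morphism :: "nat \<Rightarrow> ('o, 'm, 'z) precat_scheme \<Rightarrow> ('o, 'm) endo \<Rightarrow>
    (nat \<Rightarrow> 'm) \<Rightarrow> (nat \<Rightarrow> 'm) \<Rightarrow> (nat \<Rightarrow> 'm) \<Rightarrow> bool" where
  "nseq_morphism n C T f g \<phi> \<longleftrightarrow> nseq n C T f \<and> nseq n C T g \<and>
    (\<forall>i \<le> n + 1. \<phi> i \<in> Hom C (src C (f i)) (src C (g i))) \<and>
    (\<forall>i \<le> n. \<phi> (i + 1) \<cdot>\<^bsub>C\<^esub> f i = g i \<cdot>\<^bsub>C\<^esub> \<phi> i) \<and>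
    ar T (\<phi> 0) \<cdot>\<^bsub>C\<^esub> f (n + 1) = g (n + 1) \<cdot>\<^bsub>C\<^esub> \<phi> (n + 1)"

definition nseq_isomorphic :: "nat \<Rightarrow> ('o, 'm, 'z) precat_scheme \<Rightarrow> ('o, 'm) endo \<Rightarrow>
    (nat \<Rightarrow> 'm) \<Rightarrow> (nat \<Rightarrow> 'm) \<Rightarrow> bool" where
  "nseq_isomorphic n C T f g \<longleftrightarrow>
    (\<exists>\<phi>. nseq_morphism n C T f g \<phi> \<and> (\<forall>i \<le> n + 1. is_iso C (\<phi> i)))"

definition nseq_direct_sum :: "nat \<Rightarrow> ('o, 'm, 'z) precat_scheme \<Rightarrow> ('o, 'm) endo \<Rightarrow>
    (nat \<Rightarrow> 'm) \<Rightarrow> (nat \<Rightarrow> 'm) \<Rightarrow> (nat \<Rightarrow> 'm) \<Rightarrow> bool" where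
  "nseq_direct_sum n C T f g h \<longleftrightarrow>
    (\<exists>i1 i2 p1 p2. nseq_morphism n C T f h i1 \<and> nseq_morphism n C T g h i2 \<and>
      nseq_morphism n C T h f p1 \<and> nseq_morphism n C T h g p2 \<and>
      (\<forall>j \<le> n + 1. biproduct C (src C (f j)) (src C (g j)) (src C (h j)) (i1 j) (i2 j) (p1 j) (p2 j)))"

definition trivial_nseq ::
  "nat \<Rightarrow> ('o, 'm, 'z) precat_scheme \<Rightarrow> ('o, 'm) endo \<Rightarrow> 'o \<Rightarrow> (nat \<Rightarrow> 'm) \<Rightarrow> bool" where
  "trivial_nseq n C T A f \<longleftrightarrow> nseq n C T f \<and> f 0 = ide C A \<and>
    (\<forall>i \<in> {2..n + 1}. zero_object C (src C (f i)))"

definition rotate_nseq ::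
  "nat \<Rightarrow> ('o, 'm, 'z) precat_scheme \<Rightarrow> ('o, 'm) endo \<Rightarrow> (nat \<Rightarrow> 'm) \<Rightarrow> (nat \<Rightarrow> 'm)" where
  "rotate_nseq n C T f = (\<lambda>i. if i \<le> n then f (i + 1)
     else if even n then ar T (f 0) else mneg C (ar T (f 0)))"

text \<open>
  The morphism \<open>h\<close> between two biproducts has the matrix with rows \<open>(a, 0)\<close> and \<open>(c, d)\<close>, with
  respect to the injections \<open>i1, i2\<close> of its source and the projections \<open>q1, q2\<close> of its target.
\<close>

definition has_matrix :: "('o, 'm, 'z) precat_scheme \<Rightarrow> 'm \<Rightarrow> 'm \<Rightarrow> 'm \<Rightarrow> 'm \<Rightarrow> 'm \<Rightarrow>
    'm \<Rightarrow> 'm \<Rightarrow> 'm \<Rightarrow> bool" where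
  "has_matrix C i1 i2 q1 q2 h a c d \<longleftrightarrow>
    q1 \<cdot>\<^bsub>C\<^esub> (h \<cdot>\<^bsub>C\<^esub> i1) = a \<and> q1 \<cdot>\<^bsub>C\<^esub> (h \<cdot>\<^bsub>C\<^esub> i2) = mzero C (src C i2) (tgt C q1) \<and>
    q2 \<cdot>\<^bsub>C\<^esub> (h \<cdot>\<^bsub>C\<^esub> i1) = c \<and> q2 \<cdot>\<^bsub>C\<^esub> (h \<cdot>\<^bsub>C\<^esub> i2) = d"

text \<open>
  The \<open>j\<close>-th object of the mapping cone is \<open>A\<^sub>j\<^sub>+\<^sub>1 \<oplus> B\<^sub>j\<close>, where \<open>A\<^sub>j\<^sub>+\<^sub>1\<close> is the target of \<open>f j\<close>; for
  \<open>j = n + 1\<close> this target is \<open>T A\<^sub>0\<close>. The target of the last differential is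
  \<open>T (A\<^sub>1 \<oplus> B\<^sub>0)\<close>, a biproduct of \<open>T A\<^sub>1\<close> and \<open>T B\<^sub>0\<close> via the images of the projections.
\<close>

definition mapping_cone :: "nat \<Rightarrow> ('o, 'm, 'z) precat_scheme \<Rightarrow> ('o, 'm) endo \<Rightarrow>
    (nat \<Rightarrow> 'm) \<Rightarrow> (nat \<Rightarrow> 'm) \<Rightarrow> (nat \<Rightarrow> 'm) \<Rightarrow> (nat \<Rightarrow> 'm) \<Rightarrow> bool" where
  "mapping_cone n C T f g \<phi> h \<longleftrightarrow> nseq n C T h \<and>
    (\<exists>i1 i2 p1 p2.
      (\<forall>j \<le> n + 1. biproduct C (tgt C (f j)) (src C (g j)) (src C (h j)) (i1 j) (i2 j) (p1 j) (p2 j)) \<and>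
      (\<forall>j \<le> n. has_matrix C (i1 j) (i2 j) (p1 (j + 1)) (p2 (j + 1)) (h j)
         (mneg C (f (j + 1))) (\<phi> (j + 1)) (g j)) \<and>
      has_matrix C (i1 (n + 1)) (i2 (n + 1)) (ar T (p1 0)) (ar T (p2 0)) (h (n + 1))
         (mneg C (ar T (f 0))) (ar T (\<phi> 0)) (g (n + 1)))"

text \<open>The axioms (F1)--(F4), for an arbitrary endofunctor \<open>T\<close> in the role of \<open>\<Sigma>\<^sup>n\<close>.\<close>

locale angulation_axioms =
  fixes n :: nat
    and C :: "('o, 'm, 'z) precat_scheme"
    and T :: "('o, 'm) endo"
    and \<Theta> :: "(nat \<Rightarrow> 'm) set"
  assumes angle_nseq: "f \<in> \<Theta> \<Longrightarrow> nseq n C T f"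
    and F1_iso: "f \<in> \<Theta> \<Longrightarrow> nseq_isomorphic n C T f g \<Longrightarrow> g \<in> \<Theta>"
    and F1_sum: "f \<in> \<Theta> \<Longrightarrow> g \<in> \<Theta> \<Longrightarrow> nseq_direct_sum n C T f g h \<Longrightarrow> h \<in> \<Theta>"
    and F1_summand: "h \<in> \<Theta> \<Longrightarrow> nseq_direct_sum n C T f g h \<Longrightarrow> f \<in> \<Theta>"
    and F1_trivial: "trivial_nseq n C T A f \<Longrightarrow> f \<in> \<Theta>"
    and F1_extend: "a \<in> arr C \<Longrightarrow> \<exists>f \<in> \<Theta>. f 0 = a"
    and F2: "nseq n C T f \<Longrightarrow> f \<in> \<Theta> \<longleftrightarrow> rotate_nseq n C T f \<in> \<Theta>"
    and F3: "f \<in> \<Theta> \<Longrightarrow> g \<in> \<Theta> \<Longrightarrow>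
      \<phi>\<^sub>0 \<in> Hom C (src C (f 0)) (src C (g 0)) \<Longrightarrow> \<phi>\<^sub>1 \<in> Hom C (src C (f 1)) (src C (g 1)) \<Longrightarrow>
      \<phi>\<^sub>1 \<cdot>\<^bsub>C\<^esub> f 0 = g 0 \<cdot>\<^bsub>C\<^esub> \<phi>\<^sub>0 \<Longrightarrow>
      \<exists>\<phi>. nseq_morphism n C T f g \<phi> \<and> \<phi> 0 = \<phi>\<^sub>0 \<and> \<phi> 1 = \<phi>\<^sub>1"
    and F4: "f \<in> \<Theta> \<Longrightarrow> g \<in> \<Theta> \<Longrightarrow>
      \<phi>\<^sub>0 \<in> Hom C (src C (f 0)) (src C (g 0)) \<Longrightarrow> \<phi>\<^sub>1 \<in> Hom C (src C (f 1)) (src C (g 1)) \<Longrightarrow>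
      \<phi>\<^sub>1 \<cdot>\<^bsub>C\<^esub> f 0 = g 0 \<cdot>\<^bsub>C\<^esub> \<phi>\<^sub>0 \<Longrightarrow>
      \<exists>\<phi> h. nseq_morphism n C T f g \<phi> \<and> \<phi> 0 = \<phi>\<^sub>0 \<and> \<phi> 1 = \<phi>\<^sub>1 \<and>
            mapping_cone n C T f g \<phi> h \<and> h \<in> \<Theta>"

text \<open>
  In the definition of Geiss, Keller and Oppermann, \<open>T\<close> is an automorphism; in the weak version it
  is only an autoequivalence.
\<close>

definition angulated_category ::
  "nat \<Rightarrow> ('o, 'm, 'z) precat_scheme \<Rightarrow> ('o, 'm) endo \<Rightarrow> (nat \<Rightarrow> 'm) set \<Rightarrow> bool" where
  "angulated_category n C T \<Theta> \<longleftrightarrow> additive_category C \<and> additive_endofunctor C T \<and>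
    automorphism C T \<and> angulation_axioms n C T \<Theta>"

definition weakly_angulated_category ::
  "nat \<Rightarrow> ('o, 'm, 'z) precat_scheme \<Rightarrow> ('o, 'm) endo \<Rightarrow> (nat \<Rightarrow> 'm) set \<Rightarrow> bool" where
  "weakly_angulated_category n C T \<Theta> \<longleftrightarrow> additive_category C \<and> additive_endofunctor C T \<and>
    autoequivalence C T \<and> angulation_axioms n C T \<Theta>"


section \<open>Linear categories and Serre functors\<close>

record ('o, 'm, 'k) lincat = "('o, 'm) precat" +
  smul :: "'k \<Rightarrow> 'm \<Rightarrow> 'm"

locale linear_category = preadditive_category C
  for C :: "('o, 'm, 'k::field, 'z) lincat_scheme" (structure) +
  assumes smul_Hom: "f \<in> Hom C A B \<Longrightarrow> smul C c f \<in> Hom C A B"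
    and smul_madd: "f \<in> Hom C A B \<Longrightarrow> g \<in> Hom C A B \<Longrightarrow>
      smul C c (f \<oplus> g) = smul C c f \<oplus> smul C c g"
    and smul_add: "f \<in> Hom C A B \<Longrightarrow> smul C (c + d) f = smul C c f \<oplus> smul C d f"
    and smul_smul: "f \<in> Hom C A B \<Longrightarrow> smul C c (smul C d f) = smul C (c * d) f"
    and smul_one: "f \<in> Hom C A B \<Longrightarrow> smul C 1 f = f"
    and smul_cmp_left: "f \<in> Hom C A B \<Longrightarrow> g \<in> Hom C B D \<Longrightarrow> smul C c g \<cdot> f = smul C c (g \<cdot> f)"
    and smul_cmp_right: "f \<in> Hom C A B \<Longrightarrow> g \<in> Hom C B D \<Longrightarrow> g \<cdot> smul C c f = smul C c (g \<cdot> f)"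

definition Hom_subspace ::
  "('o, 'm, 'k::field, 'z) lincat_scheme \<Rightarrow> 'o \<Rightarrow> 'o \<Rightarrow> 'm set \<Rightarrow> bool" where
  "Hom_subspace C A B V \<longleftrightarrow> V \<subseteq> Hom C A B \<and> mzero C A B \<in> V \<and>
    (\<forall>f \<in> V. \<forall>g \<in> V. f \<oplus>\<^bsub>C\<^esub> g \<in> V) \<and> (\<forall>c. \<forall>f \<in> V. smul C c f \<in> V)"

definition Hom_span ::
  "('o, 'm, 'k::field, 'z) lincat_scheme \<Rightarrow> 'o \<Rightarrow> 'o \<Rightarrow> 'm set \<Rightarrow> 'm set" where
  "Hom_span C A B G = \<Inter> {V. Hom_subspace C A B V \<and> G \<subseteq> V}"

definition Hom_finite :: "('o, 'm, 'k::field, 'z) lincat_scheme \<Rightarrow> bool" where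
  "Hom_finite C \<longleftrightarrow> (\<forall>A B. \<exists>G. finite G \<and> G \<subseteq> Hom C A B \<and> Hom_span C A B G = Hom C A B)"

text \<open>A ring is local if it is nonzero and its non-units are closed under addition.\<close>

definition local_End :: "('o, 'm, 'z) precat_scheme \<Rightarrow> 'o \<Rightarrow> bool" where
  "local_End C A \<longleftrightarrow> ide C A \<noteq> mzero C A A \<and>
    (\<forall>f \<in> Hom C A A. \<forall>g \<in> Hom C A A. \<not> is_iso C f \<longrightarrow> \<not> is_iso C g \<longrightarrow> \<not> is_iso C (f \<oplus>\<^bsub>C\<^esub> g))"

inductive sum_of_locals :: "('o, 'm, 'z) precat_scheme \<Rightarrow> 'o \<Rightarrow> bool"
  for C :: "('o, 'm, 'z) precat_scheme" where
  empty: "zero_object C Z \<Longrightarrow> sum_of_locals C Z"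
| add: "local_End C A \<Longrightarrow> sum_of_locals C B \<Longrightarrow> direct_sum C A B P \<Longrightarrow> sum_of_locals C P"

definition krull_schmidt :: "('o, 'm, 'z) precat_scheme \<Rightarrow> bool" where
  "krull_schmidt C \<longleftrightarrow> (\<forall>A. sum_of_locals C A)"

text \<open>
  The dual space \<open>Hom\<^sub>k(Hom C A B, k)\<close>; a functional is a function on \<open>Hom C A B\<close>, represented
  as \<open>undefined\<close> elsewhere.
\<close>

definition Hom_dual ::
  "('o, 'm, 'k::field, 'z) lincat_scheme \<Rightarrow> 'o \<Rightarrow> 'o \<Rightarrow> ('m \<Rightarrow> 'k) set" where
  "Hom_dual C A B = {u \<in> extensional (Hom C A B).
    (\<forall>f \<in> Hom C A B. \<forall>g \<in> Hom C A B. u (f \<oplus>\<^bsub>C\<^esub> g) = u f + u g) \<and>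
    (\<forall>c. \<forall>f \<in> Hom C A B. u (smul C c f) = c * u f)}"

text \<open>
  \<open>\<eta> A B\<close> is a linear isomorphism from \<open>Hom C A B\<close> to the dual of \<open>Hom C B (S A)\<close>; the last
  clause is naturality in \<open>A\<close> and \<open>B\<close> simultaneously.
\<close>

definition serre_functor ::
  "('o, 'm, 'k::field, 'z) lincat_scheme \<Rightarrow> ('o, 'm) endo \<Rightarrow> bool" where
  "serre_functor C S \<longleftrightarrow> autoequivalence C S \<and>
    (\<exists>\<eta> :: 'o \<Rightarrow> 'o \<Rightarrow> 'm \<Rightarrow> 'm \<Rightarrow> 'k.
      (\<forall>A B. bij_betw (\<eta> A B) (Hom C A B) (Hom_dual C B (ob S A))) \<and>
      (\<forall>A B. \<forall>f \<in> Hom C A B. \<forall>g \<in> Hom C A B. \<forall>h \<in> Hom C B (ob S A).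
        \<eta> A B (f \<oplus>\<^bsub>C\<^esub> g) h = \<eta> A B f h + \<eta> A B g h) \<and>
      (\<forall>A B c. \<forall>f \<in> Hom C A B. \<forall>h \<in> Hom C B (ob S A).
        \<eta> A B (smul C c f) h = c * \<eta> A B f h) \<and>
      (\<forall>A A' B B'. \<forall>a \<in> Hom C A' A. \<forall>b \<in> Hom C B B'. \<forall>f \<in> Hom C A B. \<forall>h \<in> Hom C B' (ob S A').
        \<eta> A' B' (b \<cdot>\<^bsub>C\<^esub> (f \<cdot>\<^bsub>C\<^esub> a)) h = \<eta> A B f (ar S a \<cdot>\<^bsub>C\<^esub> (h \<cdot>\<^bsub>C\<^esub> b))))"


section \<open>Subcategories and approximations\<close>

text \<open>A full subcategory is identified with its set of objects.\<close>

definition additive_subcategory :: "('o, 'm, 'z) precat_scheme \<Rightarrow> 'o set \<Rightarrow> bool" where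
  "additive_subcategory C X \<longleftrightarrow>
    (\<forall>A B. A \<in> X \<longrightarrow> isomorphic C A B \<longrightarrow> B \<in> X) \<and>
    (\<forall>Z. zero_object C Z \<longrightarrow> Z \<in> X) \<and>
    (\<forall>A B P. A \<in> X \<longrightarrow> B \<in> X \<longrightarrow> direct_sum C A B P \<longrightarrow> P \<in> X) \<and>
    (\<forall>A B P. P \<in> X \<longrightarrow> direct_sum C A B P \<longrightarrow> A \<in> X)"

definition X_monic :: "('o, 'm, 'z) precat_scheme \<Rightarrow> 'o set \<Rightarrow> 'm \<Rightarrow> bool" where
  "X_monic C X f \<longleftrightarrow> f \<in> arr C \<and>
    (\<forall>D \<in> X. (\<lambda>h. h \<cdot>\<^bsub>C\<^esub> f) ` Hom C (tgt C f) D = Hom C (src C f) D)"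

definition left_approximation ::
  "('o, 'm, 'z) precat_scheme \<Rightarrow> 'o set \<Rightarrow> 'o \<Rightarrow> 'm \<Rightarrow> bool" where
  "left_approximation C X A a \<longleftrightarrow> a \<in> arr C \<and> src C a = A \<and> tgt C a \<in> X \<and>
    (\<forall>D \<in> X. \<forall>h \<in> Hom C A D. \<exists>h' \<in> Hom C (tgt C a) D. h = h' \<cdot>\<^bsub>C\<^esub> a)"

definition right_approximation ::
  "('o, 'm, 'z) precat_scheme \<Rightarrow> 'o set \<Rightarrow> 'o \<Rightarrow> 'm \<Rightarrow> bool" where
  "right_approximation C X A v \<longleftrightarrow> v \<in> arr C \<and> tgt C v = A \<and> src C v \<in> X \<and>
    (\<forall>D \<in> X. \<forall>h \<in> Hom C D A. \<exists>h' \<in> Hom C D (src C v). h = v \<cdot>\<^bsub>C\<^esub> h')"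

text \<open>The angles \<open>A \<rightarrow> X\<^sub>1 \<rightarrow> \<dots> \<rightarrow> X\<^sub>n \<rightarrow> G A \<rightarrow> \<Sigma>\<^sup>n A\<close> and \<open>H A \<rightarrow> Y\<^sub>1 \<rightarrow> \<dots> \<rightarrow> Y\<^sub>n \<rightarrow> A \<rightarrow> \<Sigma>\<^sup>n H A\<close>.\<close>

definition left_approximation_angle :: "nat \<Rightarrow> ('o, 'm, 'z) precat_scheme \<Rightarrow>
    (nat \<Rightarrow> 'm) set \<Rightarrow> 'o set \<Rightarrow> 'o \<Rightarrow> (nat \<Rightarrow> 'm) \<Rightarrow> bool" where
  "left_approximation_angle n C \<Theta> X A f \<longleftrightarrow> f \<in> \<Theta> \<and> src C (f 0) = A \<and>
    (\<forall>i \<in> {1..n}. src C (f i) \<in> X) \<and> left_approximation C X A (f 0)"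

definition right_approximation_angle :: "nat \<Rightarrow> ('o, 'm, 'z) precat_scheme \<Rightarrow>
    (nat \<Rightarrow> 'm) set \<Rightarrow> 'o set \<Rightarrow> 'o \<Rightarrow> (nat \<Rightarrow> 'm) \<Rightarrow> bool" where
  "right_approximation_angle n C \<Theta> X A f \<longleftrightarrow> f \<in> \<Theta> \<and> src C (f (n + 1)) = A \<and>
    (\<forall>i \<in> {1..n}. src C (f i) \<in> X) \<and> right_approximation C X A (f n)"

definition strongly_functorially_finite ::
  "nat \<Rightarrow> ('o, 'm, 'z) precat_scheme \<Rightarrow> (nat \<Rightarrow> 'm) set \<Rightarrow> 'o set \<Rightarrow> bool" where
  "strongly_functorially_finite n C \<Theta> X \<longleftrightarrow> additive_subcategory C X \<and>
    (\<forall>A. (\<exists>f. left_approximation_angle n C \<Theta> X A f) \<and>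
         (\<exists>f. right_approximation_angle n C \<Theta> X A f))"

definition iso_image :: "('o, 'm, 'z) precat_scheme \<Rightarrow> ('o, 'm) endo \<Rightarrow> 'o set \<Rightarrow> 'o set" where
  "iso_image C F X = {A. \<exists>D \<in> X. isomorphic C A (ob F D)}"


section \<open>The quotient category\<close>

definition factors_through :: "('o, 'm, 'z) precat_scheme \<Rightarrow> 'o set \<Rightarrow> 'm \<Rightarrow> bool" where
  "factors_through C X f \<longleftrightarrow>
    (\<exists>D \<in> X. \<exists>g \<in> Hom C (src C f) D. \<exists>h \<in> Hom C D (tgt C f). f = h \<cdot>\<^bsub>C\<^esub> g)"

definition cls :: "('o, 'm, 'z) precat_scheme \<Rightarrow> 'o set \<Rightarrow> 'm \<Rightarrow> 'm set" where
  "cls C X f = {g \<in> Hom C (src C f) (tgt C f). factors_through C X (f \<oplus>\<^bsub>C\<^esub> mneg C g)}"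

definition rep :: "'m set \<Rightarrow> 'm" where
  "rep F = (SOME f. f \<in> F)"

definition quotient_cat ::
  "('o, 'm, 'z) precat_scheme \<Rightarrow> 'o set \<Rightarrow> ('o, 'm set) precat" where
  "quotient_cat C X = \<lparr>
     arr = cls C X ` arr C,
     src = (\<lambda>F. src C (rep F)),
     tgt = (\<lambda>F. tgt C (rep F)),
     ide = (\<lambda>A. cls C X (ide C A)),
     cmp = (\<lambda>G F. cls C X (rep G \<cdot>\<^bsub>C\<^esub> rep F)),
     madd = (\<lambda>F G. cls C X (rep F \<oplus>\<^bsub>C\<^esub> rep G)),
     mzero = (\<lambda>A B. cls C X (mzero C A B)),
     mneg = (\<lambda>F. cls C X (mneg C (rep F)))\<rparr>"

text \<open>
  \<open>L A\<close> is the chosen angle \<open>A \<rightarrow> X\<^sub>1 \<rightarrow> \<dots> \<rightarrow> X\<^sub>n \<rightarrow> G A \<rightarrow> \<Sigma>\<^sup>n A\<close>. On a class \<open>F\<close> of morphisms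
  from \<open>A\<close> to \<open>B\<close>, the functor \<open>G\<close> is given by the class of the component at \<open>n + 1\<close> of any
  morphism of angles from \<open>L A\<close> to \<open>L B\<close> whose component at \<open>0\<close> lies in \<open>F\<close>; this class is unique.
\<close>

definition G_functor :: "nat \<Rightarrow> ('o, 'm, 'z) precat_scheme \<Rightarrow> ('o, 'm) endo \<Rightarrow> 'o set \<Rightarrow>
    ('o \<Rightarrow> nat \<Rightarrow> 'm) \<Rightarrow> ('o, 'm set) endo" where
  "G_functor n C T X L = \<lparr>
     ob = (\<lambda>A. src C (L A (n + 1))),
     ar = (\<lambda>F. THE \<Psi>. \<exists>\<mu>. nseq_morphism n C T (L (src C (rep F))) (L (tgt C (rep F))) \<mu> \<and>
             cls C X (\<mu> 0) = F \<and> cls C X (\<mu> (n + 1)) = \<Psi>)\<rparr>"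

definition standard_right_angle :: "nat \<Rightarrow> ('o, 'm, 'z) precat_scheme \<Rightarrow> ('o, 'm) endo \<Rightarrow>
    (nat \<Rightarrow> 'm) set \<Rightarrow> 'o set \<Rightarrow> ('o \<Rightarrow> nat \<Rightarrow> 'm) \<Rightarrow> (nat \<Rightarrow> 'm set) \<Rightarrow> bool" where
  "standard_right_angle n C T \<Theta> X L F \<longleftrightarrow>
    (\<exists>g \<in> \<Theta>. \<exists>\<phi>. X_monic C X (g 0) \<and> nseq_morphism n C T g (L (src C (g 0))) \<phi> \<and>
      \<phi> 0 = ide C (src C (g 0)) \<and>
      F = (\<lambda>i. if i \<le> n then cls C X (g i) else cls C X (\<phi> (n + 1))))"

definition right_angles :: "nat \<Rightarrow> ('o, 'm, 'z) precat_scheme \<Rightarrow> ('o, 'm) endo \<Rightarrow>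
    (nat \<Rightarrow> 'm) set \<Rightarrow> 'o set \<Rightarrow> ('o \<Rightarrow> nat \<Rightarrow> 'm) \<Rightarrow> (nat \<Rightarrow> 'm set) set" where
  "right_angles n C T \<Theta> X L = {F. \<exists>E. standard_right_angle n C T \<Theta> X L E \<and>
     nseq_isomorphic n (quotient_cat C X) (G_functor n C T X L) E F}"

end

theory Submission
  imports Defs
begin

text \<open>
  Everything rests on the Frobenius condition: for an angle \<open>e\<close>, the map \<open>e 0\<close> is \<open>X\<close>-monic iff
  \<open>e (n + 1)\<close> kills every morphism from an object of \<open>X\<close>. By weak cokernels, \<open>e 0\<close> is \<open>X\<close>-monic iff
  \<open>e (n + 1)\<close> is killed by every morphism to an object of \<open>T X\<close>, and by Serre duality the second
  property means that \<open>e (n + 1)\<close> is killed by every morphism to an object of \<open>S X\<close>; so \<open>S X = T X\<close> implies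
  the condition. Under it, \<open>X\<close> behaves like the projective-injective objects of a Frobenius
  category: \<open>G\<close> is an equivalence because its inverse comes from the angles (2), a morphism of right
  angles becomes, after adding the angle (1) of \<open>A\<^sub>0\<close> to its target, one whose mapping cone has an
  \<open>X\<close>-monic first map, and a direct summand of a right angle is turned into a standard right angle
  by exchanging its objects one at a time.

  Conversely let \<open>G\<close> be an autoequivalence, and let \<open>h : D \<rightarrow> S D\<close> be the almost vanishing morphism of
  an indecomposable \<open>D\<close>. If \<open>D \<in> X\<close> and \<open>S D = T A\<close>, realize \<open>h\<close> as the last map of an angle starting at
  \<open>A\<close>; if \<open>A \<notin> X\<close>, fullness and faithfulness of \<open>G\<close> make the first map of this angle a split
  monomorphism, hence \<open>h = 0\<close>. If \<open>S D \<cong> T E\<close> with \<open>E \<in> X\<close> and \<open>D \<notin> X\<close>, density of \<open>G\<close> shows in the same way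
  that the map to \<open>D\<close> is a split epimorphism.
\<close>

section \<open>Preadditive categories\<close>

text \<open>A right angle is only isomorphic, in the quotient, to the image of an
  \<open>X\<close>-monic angle, so every axiom requires lifting data to \<open>C\<close>. Two facts
  allow this. A square on an \<open>X\<close>-monic map that commutes in the quotient commutes in
  \<open>C\<close> after changing its second vertical map by a map through \<open>X\<close>. Under
  the Frobenius condition, two maps into \<open>G A\<close> have the same class iff they agree after
  the connecting morphism \<open>G A \<rightarrow> T A\<close>; so identities about last maps become
  equations in \<open>C\<close>. Two axioms resist. \<open>G\<close> is merely an equivalence, so a
  sequence cannot be rotated back on the nose: an inverse rotation is found up to isomorphism as a
  reduced cone over an angle (2), and full faithfulness of \<open>G\<close> cancels the rotation. A
  direct summand of a right angle is cut out by idempotents of the quotient only; what it visibly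
  inherits is exactness. This makes each object of a comparing right angle a summand, modulo
  \<open>X\<close>, of its next object plus the corresponding object of the given summand, which is
  what the exchange consumes.\<close>

lemma Hom_iff [simp]: "f \<in> Hom C A B \<longleftrightarrow> f \<in> arr C \<and> src C f = A \<and> tgt C f = B"
  by (simp add: Hom_def)

context category
begin

lemma arr_ide [simp]: "ide C A \<in> arr C" "src C (ide C A) = A" "tgt C (ide C A) = A"
  using ide_Hom[of A] by simp_all

lemma arr_cmp [simp]:
  assumes "f \<in> arr C" "g \<in> arr C" "tgt C f = src C g"
  shows "g \<cdot> f \<in> arr C" "src C (g \<cdot> f) = src C f" "tgt C (g \<cdot> f) = tgt C g"
  using cmp_Hom[of f "src C f" "tgt C f" g "tgt C g"] assms by simp_all

lemma cmp_ide [simp]: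
  "f \<in> arr C \<Longrightarrow> src C f = A \<Longrightarrow> f \<cdot> ide C A = f"
  "f \<in> arr C \<Longrightarrow> tgt C f = A \<Longrightarrow> ide C A \<cdot> f = f"
  using cmp_ide_left[of f "src C f" "tgt C f"] cmp_ide_right[of f "src C f" "tgt C f"] by auto

lemma assoc [simp]:
  assumes "f \<in> arr C" "g \<in> arr C" "h \<in> arr C" "tgt C f = src C g" "tgt C g = src C h"
  shows "(h \<cdot> g) \<cdot> f = h \<cdot> (g \<cdot> f)"
  using cmp_assoc[of f "src C f" "tgt C f" g "tgt C g" h "tgt C h"] assms by simp

text \<open>Simp nests composites to the right, where \<open>g \<cdot> f\<close> is no longer a
  subterm of a longer composite. This is the form of an equation that still rewrites there;
  \<open>cmp_eq_assoc3\<close> does the same for three factors.\<close>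

lemma cmp_eq_assoc:
  assumes "g \<cdot> f = h" "f \<in> arr C" "g \<in> arr C" "tgt C f = src C g" "x \<in> arr C" "tgt C x = src C f"
  shows "g \<cdot> (f \<cdot> x) = h \<cdot> x"
  using assms by (metis assoc)

lemma cmp_eq_assoc3:
  assumes "g \<cdot> (f \<cdot> k) = h" "f \<in> arr C" "g \<in> arr C" "k \<in> arr C" "tgt C f = src C g" "tgt C k = src C f"
    "x \<in> arr C" "tgt C x = src C k"
  shows "g \<cdot> (f \<cdot> (k \<cdot> x)) = h \<cdot> x"
  using assms by (metis assoc arr_cmp)

end

lemma is_isoD:
  assumes "is_iso C f"
  shows "f \<in> arr C"
  using assms by (simp add: is_iso_def)

lemma is_isoE:
  assumes "is_iso C f"
  obtains g where "g \<in> arr C" "src C g = tgt C f" "tgt C g = src C f"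
    "g \<cdot>\<^bsub>C\<^esub> f = ide C (src C f)" "f \<cdot>\<^bsub>C\<^esub> g = ide C (tgt C f)"
  using assms by (auto simp: is_iso_def)

context category
begin

lemma is_isoI:
  assumes "f \<in> arr C" "g \<in> arr C" "src C g = tgt C f" "tgt C g = src C f"
    "g \<cdot> f = ide C (src C f)" "f \<cdot> g = ide C (tgt C f)"
  shows "is_iso C f"
  using assms by (auto simp: is_iso_def)

lemma iso_ide [simp]: "is_iso C (ide C A)"
  by (rule is_isoI[of _ "ide C A"]) auto

lemma iso_cmp:
  assumes "is_iso C f" "is_iso C g" "tgt C f = src C g"
  shows "is_iso C (g \<cdot> f)"
proof -
  obtain f' where f': "f' \<in> arr C" "src C f' = tgt C f" "tgt C f' = src C f"
    "f' \<cdot> f = ide C (src C f)" "f \<cdot> f' = ide C (tgt C f)" using assms(1) by (rule is_isoE)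
  obtain g' where g': "g' \<in> arr C" "src C g' = tgt C g" "tgt C g' = src C g"
    "g' \<cdot> g = ide C (src C g)" "g \<cdot> g' = ide C (tgt C g)" using assms(2) by (rule is_isoE)
  show ?thesis
    by (rule is_isoI[where g="f' \<cdot> g'"])
      (use assms is_isoD[OF assms(1)] is_isoD[OF assms(2)] f' g' in
        \<open>simp_all add: f'(5)[THEN cmp_eq_assoc] g'(4)[THEN cmp_eq_assoc]\<close>)
qed

lemma isomorphic_refl: "isomorphic C A A"
  unfolding isomorphic_def by (rule bexI[of _ "ide C A"]) auto

lemma isomorphic_sym: "isomorphic C A B \<Longrightarrow> isomorphic C B A"
  unfolding isomorphic_def
proof (elim bexE)
  fix f assume f: "f \<in> Hom C A B" "is_iso C f"
  from f(2) obtain g where g: "g \<in> arr C" "src C g = tgt C f" "tgt C g = src C f"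
    "g \<cdot> f = ide C (src C f)" "f \<cdot> g = ide C (tgt C f)" by (rule is_isoE)
  then have "is_iso C g" using f is_isoI[of g f] by simp
  then show "\<exists>f\<in>Hom C B A. is_iso C f" using f g by auto
qed

lemma isomorphic_trans: "isomorphic C A B \<Longrightarrow> isomorphic C B D \<Longrightarrow> isomorphic C A D"
  unfolding isomorphic_def
proof (elim bexE)
  fix f g assume "f \<in> Hom C A B" "is_iso C f" "g \<in> Hom C B D" "is_iso C g"
  then show "\<exists>h\<in>Hom C A D. is_iso C h" using iso_cmp[of f g] by (intro bexI[of _ "g \<cdot> f"]) auto
qed

end

context preadditive_category
begin

lemma arr_madd [simp]:
  assumes "f \<in> arr C" "g \<in> arr C" "src C f = src C g" "tgt C f = tgt C g"
  shows "f \<oplus> g \<in> arr C" "src C (f \<oplus> g) = src C g" "tgt C (f \<oplus> g) = tgt C g"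
  using madd_Hom[of f "src C f" "tgt C f" g] assms by simp_all

lemma arr_mzero [simp]: "mzero C A B \<in> arr C" "src C (mzero C A B) = A" "tgt C (mzero C A B) = B"
  using mzero_Hom[of A B] by simp_all

lemma arr_mneg [simp]:
  assumes "f \<in> arr C"
  shows "mneg C f \<in> arr C" "src C (mneg C f) = src C f" "tgt C (mneg C f) = tgt C f"
  using mneg_Hom[of f "src C f" "tgt C f"] assms by simp_all

lemma add_assoc [simp]:
  assumes "f \<in> arr C" "g \<in> arr C" "h \<in> arr C" "src C f = src C g" "src C g = src C h"
    "tgt C f = tgt C g" "tgt C g = tgt C h"
  shows "(f \<oplus> g) \<oplus> h = f \<oplus> (g \<oplus> h)"
  using madd_assoc[of f "src C f" "tgt C f" g h] assms by simp

lemma add_commute: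
  assumes "f \<in> arr C" "g \<in> arr C" "src C f = src C g" "tgt C f = tgt C g"
  shows "f \<oplus> g = g \<oplus> f"
  using madd_commute[of f "src C f" "tgt C f" g] assms by simp

lemma add_left_commute:
  assumes "f \<in> arr C" "g \<in> arr C" "h \<in> arr C" "src C f = src C g" "src C g = src C h"
    "tgt C f = tgt C g" "tgt C g = tgt C h"
  shows "f \<oplus> (g \<oplus> h) = g \<oplus> (f \<oplus> h)"
  using assms add_assoc[of f g h] add_assoc[of g f h] add_commute[of f g] by simp

lemmas add_ac = add_commute add_left_commute

lemma add_zero [simp]:
  "f \<in> arr C \<Longrightarrow> src C f = A \<Longrightarrow> tgt C f = B \<Longrightarrow> f \<oplus> mzero C A B = f"
  "f \<in> arr C \<Longrightarrow> src C f = A \<Longrightarrow> tgt C f = B \<Longrightarrow> mzero C A B \<oplus> f = f"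
  using madd_mzero[of f A B] add_commute[of f "mzero C A B"] by simp_all

lemma add_neg [simp]:
  "f \<in> arr C \<Longrightarrow> f \<oplus> mneg C f = mzero C (src C f) (tgt C f)"
  "f \<in> arr C \<Longrightarrow> mneg C f \<oplus> f = mzero C (src C f) (tgt C f)"
  using madd_mneg[of f "src C f" "tgt C f"] add_commute[of f "mneg C f"] by simp_all

lemma add_neg_cancel [simp]:
  assumes "f \<in> arr C" "g \<in> arr C" "src C f = src C g" "tgt C f = tgt C g"
  shows "f \<oplus> (mneg C f \<oplus> g) = g" "mneg C f \<oplus> (f \<oplus> g) = g"
  using assms add_assoc[of f "mneg C f" g] add_assoc[of "mneg C f" f g] by simp_all

lemma add_neg_cancel' [simp]:
  assumes "f \<in> arr C" "g \<in> arr C" "src C f = src C g" "tgt C f = tgt C g"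
  shows "f \<oplus> (g \<oplus> mneg C f) = g" "mneg C f \<oplus> (g \<oplus> f) = g"
  using assms add_commute[of g "mneg C f"] add_commute[of g f] by simp_all

lemma add_left_cancel:
  assumes "f \<in> arr C" "g \<in> arr C" "h \<in> arr C" "src C f = src C g" "src C g = src C h"
    "tgt C f = tgt C g" "tgt C g = tgt C h" "f \<oplus> g = f \<oplus> h"
  shows "g = h"
  using assms by (metis add_neg_cancel(2))

lemma eq_neg:
  assumes "f \<in> arr C" "g \<in> arr C" "src C f = A" "src C g = A"
    "tgt C f = B" "tgt C g = B" "f \<oplus> g = mzero C A B"
  shows "g = mneg C f"
  by (rule add_left_cancel[of f]) (use assms in auto)

lemma neg_neg [simp]: "f \<in> arr C \<Longrightarrow> mneg C (mneg C f) = f"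
  by (rule eq_neg[symmetric, of _ _ "src C f" "tgt C f"]) auto

lemma neg_zero [simp]: "mneg C (mzero C A B) = mzero C A B"
  by (rule eq_neg[symmetric, of _ _ A B]) auto

lemma neg_add [simp]:
  assumes "f \<in> arr C" "g \<in> arr C" "src C f = src C g" "tgt C f = tgt C g"
  shows "mneg C (f \<oplus> g) = mneg C f \<oplus> mneg C g"
  by (rule eq_neg[symmetric, of _ _ "src C f" "tgt C f"]) (use assms in \<open>auto simp: add_ac\<close>)

lemma cmp_add [simp]:
  "f \<in> arr C \<Longrightarrow> f' \<in> arr C \<Longrightarrow> g \<in> arr C \<Longrightarrow> src C f = src C f' \<Longrightarrow> tgt C f = src C g \<Longrightarrow>
    tgt C f' = src C g \<Longrightarrow> g \<cdot> (f \<oplus> f') = (g \<cdot> f) \<oplus> (g \<cdot> f')"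
  "f \<in> arr C \<Longrightarrow> g \<in> arr C \<Longrightarrow> g' \<in> arr C \<Longrightarrow> tgt C f = src C g \<Longrightarrow> tgt C f = src C g' \<Longrightarrow>
    tgt C g = tgt C g' \<Longrightarrow> (g \<oplus> g') \<cdot> f = (g \<cdot> f) \<oplus> (g' \<cdot> f)"
  using cmp_madd_right[of f "src C f" "tgt C f" f' g "tgt C g"]
    cmp_madd_left[of f "src C f" "tgt C f" g "tgt C g" g'] by simp_all

lemma add_self_zero:
  assumes "f \<in> arr C" "f \<oplus> f = f"
  shows "f = mzero C (src C f) (tgt C f)"
  using assms by (metis add_neg(2) add_neg_cancel(2))

lemma cmp_zero [simp]:
  "f \<in> arr C \<Longrightarrow> tgt C f = B \<Longrightarrow> mzero C B D \<cdot> f = mzero C (src C f) D"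
  "f \<in> arr C \<Longrightarrow> src C f = B \<Longrightarrow> f \<cdot> mzero C A B = mzero C A (tgt C f)"
proof -
  assume f: "f \<in> arr C" "tgt C f = B"
  have "(mzero C B D \<cdot> f) \<oplus> (mzero C B D \<cdot> f) = (mzero C B D \<oplus> mzero C B D) \<cdot> f"
    using f by (subst cmp_add) auto
  then have "(mzero C B D \<cdot> f) \<oplus> (mzero C B D \<cdot> f) = mzero C B D \<cdot> f" using f by simp
  then show "mzero C B D \<cdot> f = mzero C (src C f) D" using f by (auto dest: add_self_zero[rotated])
next
  assume f: "f \<in> arr C" "src C f = B"
  have "(f \<cdot> mzero C A B) \<oplus> (f \<cdot> mzero C A B) = f \<cdot> (mzero C A B \<oplus> mzero C A B)"
    using f by (subst cmp_add) auto
  then have "(f \<cdot> mzero C A B) \<oplus> (f \<cdot> mzero C A B) = f \<cdot> mzero C A B" using f by simp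
  then show "f \<cdot> mzero C A B = mzero C A (tgt C f)" using f by (auto dest: add_self_zero[rotated])
qed

lemma cmp_neg [simp]:
  "f \<in> arr C \<Longrightarrow> g \<in> arr C \<Longrightarrow> tgt C f = src C g \<Longrightarrow> mneg C g \<cdot> f = mneg C (g \<cdot> f)"
  "f \<in> arr C \<Longrightarrow> g \<in> arr C \<Longrightarrow> tgt C f = src C g \<Longrightarrow> g \<cdot> mneg C f = mneg C (g \<cdot> f)"
proof -
  assume f: "f \<in> arr C" "g \<in> arr C" "tgt C f = src C g"
  show "mneg C g \<cdot> f = mneg C (g \<cdot> f)"
    by (rule eq_neg[of _ _ "src C f" "tgt C g"])
      (use f cmp_add(2)[of f g "mneg C g", symmetric] in \<open>simp_all del: cmp_add\<close>)
  show "g \<cdot> mneg C f = mneg C (g \<cdot> f)"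
    by (rule eq_neg[of _ _ "src C f" "tgt C g"])
      (use f cmp_add(1)[of f "mneg C f" g, symmetric] in \<open>simp_all del: cmp_add\<close>)
qed

lemma diff_zero_iff:
  assumes "f \<in> arr C" "g \<in> arr C" "src C f = src C g" "tgt C f = tgt C g"
  shows "f \<oplus> mneg C g = mzero C (src C g) (tgt C g) \<longleftrightarrow> f = g"
  using assms eq_neg[of "mneg C g" f "src C g" "tgt C g"] add_commute[of f "mneg C g"] by auto

lemma iso_neg: "is_iso C f \<Longrightarrow> is_iso C (mneg C f)"
proof -
  assume f: "is_iso C f"
  then obtain g where g: "g \<in> arr C" "src C g = tgt C f" "tgt C g = src C f"
    "g \<cdot> f = ide C (src C f)" "f \<cdot> g = ide C (tgt C f)" by (rule is_isoE)
  then show ?thesis using is_isoD[OF f] is_isoI[of "mneg C f" "mneg C g"] by simp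
qed

lemma zero_object_iff: "zero_object C Z \<longleftrightarrow> ide C Z = mzero C Z Z"
proof
  assume "zero_object C Z"
  then show "ide C Z = mzero C Z Z" unfolding zero_object_def
    by (metis Hom_iff arr_ide arr_mzero)
next
  assume *: "ide C Z = mzero C Z Z"
  have 1: "f = mzero C A Z" if "f \<in> Hom C A Z" for f A
  proof -
    have "f = ide C Z \<cdot> f" using that by simp
    then show ?thesis unfolding * using that by simp
  qed
  have 2: "f = mzero C Z A" if "f \<in> Hom C Z A" for f A
  proof -
    have "f = f \<cdot> ide C Z" using that by simp
    then show ?thesis unfolding * using that by simp
  qed
  show "zero_object C Z" unfolding zero_object_def
    using 1 2 mzero_Hom by blast
qed

lemma zero_objectD:
  assumes "zero_object C Z" "f \<in> arr C"
  shows "tgt C f = Z \<Longrightarrow> f = mzero C (src C f) Z" "src C f = Z \<Longrightarrow> f = mzero C Z (tgt C f)"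
  using assms unfolding zero_object_def by (metis Hom_iff arr_mzero)+

lemma zero_eqI:
  assumes "zero_object C Z" "f \<in> arr C" "g \<in> arr C" "src C f = src C g" "tgt C f = tgt C g"
    "tgt C g = Z \<or> src C g = Z"
  shows "f = g"
  using zero_objectD[OF assms(1), of f] zero_objectD[OF assms(1), of g] assms by metis

lemma iso_zero:
  assumes "zero_object C A" "zero_object C B"
  shows "is_iso C (mzero C A B)"
  using assms by (intro is_isoI[of _ "mzero C B A"]) (auto simp: zero_object_iff)

end

lemma biproductD:
  assumes "biproduct C A B P i1 i2 p1 p2"
  shows "i1 \<in> arr C" "src C i1 = A" "tgt C i1 = P" "i2 \<in> arr C" "src C i2 = B" "tgt C i2 = P"
    "p1 \<in> arr C" "src C p1 = P" "tgt C p1 = A" "p2 \<in> arr C" "src C p2 = P" "tgt C p2 = B"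
    "p1 \<cdot>\<^bsub>C\<^esub> i1 = ide C A" "p2 \<cdot>\<^bsub>C\<^esub> i2 = ide C B" "p1 \<cdot>\<^bsub>C\<^esub> i2 = mzero C B A" "p2 \<cdot>\<^bsub>C\<^esub> i1 = mzero C A B"
    "(i1 \<cdot>\<^bsub>C\<^esub> p1) \<oplus>\<^bsub>C\<^esub> (i2 \<cdot>\<^bsub>C\<^esub> p2) = ide C P"
  using assms by (simp_all add: biproduct_def)

context preadditive_category
begin

lemma biproduct_assoc:
  assumes "biproduct C A B P i1 i2 p1 p2"
  shows "x \<in> arr C \<Longrightarrow> tgt C x = A \<Longrightarrow> p1 \<cdot> (i1 \<cdot> x) = x"
    "x \<in> arr C \<Longrightarrow> tgt C x = B \<Longrightarrow> p2 \<cdot> (i2 \<cdot> x) = x"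
    "x \<in> arr C \<Longrightarrow> tgt C x = B \<Longrightarrow> p1 \<cdot> (i2 \<cdot> x) = mzero C (src C x) A"
    "x \<in> arr C \<Longrightarrow> tgt C x = A \<Longrightarrow> p2 \<cdot> (i1 \<cdot> x) = mzero C (src C x) B"
  using biproductD[OF assms] by (simp_all flip: assoc)

lemmas biproduct_simps = biproductD(1-16) biproduct_assoc

lemma biproduct_split:
  assumes "biproduct C A B P i1 i2 p1 p2" "x \<in> arr C"
  shows "src C x = P \<Longrightarrow> x = ((x \<cdot> i1) \<cdot> p1) \<oplus> ((x \<cdot> i2) \<cdot> p2)"
    "tgt C x = P \<Longrightarrow> x = (i1 \<cdot> (p1 \<cdot> x)) \<oplus> (i2 \<cdot> (p2 \<cdot> x))"
proof -
  note b = biproductD[OF assms(1)]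
  show "x = ((x \<cdot> i1) \<cdot> p1) \<oplus> ((x \<cdot> i2) \<cdot> p2)" if "src C x = P"
  proof -
    have "x = x \<cdot> ((i1 \<cdot> p1) \<oplus> (i2 \<cdot> p2))" using b that assms(2) by (simp del: cmp_add)
    also have "\<dots> = ((x \<cdot> i1) \<cdot> p1) \<oplus> ((x \<cdot> i2) \<cdot> p2)"
      using b(1-12) that assms(2) by simp
    finally show ?thesis .
  qed
  show "x = (i1 \<cdot> (p1 \<cdot> x)) \<oplus> (i2 \<cdot> (p2 \<cdot> x))" if "tgt C x = P"
  proof -
    have "x = ((i1 \<cdot> p1) \<oplus> (i2 \<cdot> p2)) \<cdot> x" using b that assms(2) by (simp del: cmp_add)
    also have "\<dots> = (i1 \<cdot> (p1 \<cdot> x)) \<oplus> (i2 \<cdot> (p2 \<cdot> x))"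
      using b(1-12) that assms(2) by simp
    finally show ?thesis .
  qed
qed

lemma biproduct_eqI:
  assumes b: "biproduct C A B P i1 i2 p1 p2" and x: "x \<in> arr C" "y \<in> arr C"
  shows "src C x = P \<Longrightarrow> src C y = P \<Longrightarrow> x \<cdot> i1 = y \<cdot> i1 \<Longrightarrow> x \<cdot> i2 = y \<cdot> i2 \<Longrightarrow> x = y"
    "tgt C x = P \<Longrightarrow> tgt C y = P \<Longrightarrow> p1 \<cdot> x = p1 \<cdot> y \<Longrightarrow> p2 \<cdot> x = p2 \<cdot> y \<Longrightarrow> x = y"
  using biproduct_split[OF b x(1)] biproduct_split[OF b x(2)] by (metis (no_types))+

lemma biproduct_sym:
  assumes "biproduct C A B P i1 i2 p1 p2"
  shows "biproduct C B A P i2 i1 p2 p1"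
  using assms add_commute[of "i1 \<cdot> p1" "i2 \<cdot> p2"] by (auto simp: biproduct_def)

lemma direct_sum_sym: "direct_sum C A B P \<Longrightarrow> direct_sum C B A P"
  unfolding direct_sum_def using biproduct_sym by blast

lemma biproduct_zero:
  assumes "zero_object C Z"
  shows "biproduct C A Z A (ide C A) (mzero C Z A) (ide C A) (mzero C A Z)"
  using assms by (auto simp: biproduct_def zero_object_iff)

lemma biproduct_unique:
  assumes b: "biproduct C A B P i1 i2 p1 p2" and c: "biproduct C A B Q j1 j2 q1 q2"
  shows "is_iso C ((j1 \<cdot> p1) \<oplus> (j2 \<cdot> p2))"
proof (rule is_isoI[of _ "(i1 \<cdot> q1) \<oplus> (i2 \<cdot> q2)"])
  note s = biproduct_simps[OF b] biproduct_simps[OF c]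
  show "((i1 \<cdot> q1) \<oplus> (i2 \<cdot> q2)) \<cdot> ((j1 \<cdot> p1) \<oplus> (j2 \<cdot> p2)) = ide C (src C ((j1 \<cdot> p1) \<oplus> (j2 \<cdot> p2)))"
    using biproductD(17)[OF b] by (simp add: s)
  show "((j1 \<cdot> p1) \<oplus> (j2 \<cdot> p2)) \<cdot> ((i1 \<cdot> q1) \<oplus> (i2 \<cdot> q2)) = ide C (tgt C ((j1 \<cdot> p1) \<oplus> (j2 \<cdot> p2)))"
    using biproductD(17)[OF c] by (simp add: s)
qed (simp_all add: biproduct_simps[OF b] biproduct_simps[OF c])

lemma biproduct_iso:
  assumes b: "biproduct C A B P i1 i2 p1 p2" and "is_iso C a" "src C a = A'" "tgt C a = A"
  obtains a' where "a' \<in> arr C" "src C a' = A" "tgt C a' = A'" "a' \<cdot> a = ide C A'" "a \<cdot> a' = ide C A"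
    "biproduct C A' B P (i1 \<cdot> a) i2 (a' \<cdot> p1) p2"
proof -
  obtain a' where a': "a' \<in> arr C" "src C a' = A" "tgt C a' = A'" "a' \<cdot> a = ide C A'" "a \<cdot> a' = ide C A"
    using is_isoE[OF assms(2)] assms(3,4) by metis
  have "a \<in> arr C" using assms is_isoD by auto
  then have "biproduct C A' B P (i1 \<cdot> a) i2 (a' \<cdot> p1) p2"
    unfolding biproduct_def using biproductD(17)[OF b] assms(3,4) a'
    by (simp add: biproduct_simps[OF b] a'(5)[THEN cmp_eq_assoc] )
  then show thesis using that a' by blast
qed

end

text \<open>Multiplication by (-1)^k. Rotation carries the sign with exponent n, and the isomorphism
  from a cone over a zero sequence to a rotation alternates with the position; one operation with
  its own simp rules lets most proofs treat both parities at once.\<close>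

definition sgn_mor :: "('o, 'm, 'z) precat_scheme \<Rightarrow> nat \<Rightarrow> 'm \<Rightarrow> 'm" where
  "sgn_mor C k f = (if even k then f else mneg C f)"

context preadditive_category
begin

lemma arr_sgn [simp]:
  assumes "f \<in> arr C"
  shows "sgn_mor C k f \<in> arr C" "src C (sgn_mor C k f) = src C f" "tgt C (sgn_mor C k f) = tgt C f"
  using assms by (simp_all add: sgn_mor_def)

lemma cmp_sgn [simp]:
  "f \<in> arr C \<Longrightarrow> g \<in> arr C \<Longrightarrow> tgt C f = src C g \<Longrightarrow> sgn_mor C k g \<cdot> f = sgn_mor C k (g \<cdot> f)"
  "f \<in> arr C \<Longrightarrow> g \<in> arr C \<Longrightarrow> tgt C f = src C g \<Longrightarrow> g \<cdot> sgn_mor C k f = sgn_mor C k (g \<cdot> f)"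
  by (simp_all add: sgn_mor_def)

lemma sgn_sgn [simp]: "f \<in> arr C \<Longrightarrow> sgn_mor C k (sgn_mor C k f) = f"
  by (simp add: sgn_mor_def)

lemma sgn_zero [simp]: "sgn_mor C k (mzero C A B) = mzero C A B"
  by (simp add: sgn_mor_def)

lemma sgn_eq_iff: "f \<in> arr C \<Longrightarrow> g \<in> arr C \<Longrightarrow> sgn_mor C k f = sgn_mor C k g \<longleftrightarrow> f = g"
  by (metis sgn_sgn)

lemma iso_sgn: "is_iso C f \<Longrightarrow> is_iso C (sgn_mor C k f)"
  by (simp add: sgn_mor_def iso_neg)

end

lemma rotate_nseq_sgn:
  "rotate_nseq n C T f = (\<lambda>i. if i \<le> n then f (Suc i) else sgn_mor C n (ar T (f 0)))"
  by (auto simp: rotate_nseq_def sgn_mor_def)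

locale add_functor = preadditive_category C
  for C :: "('o, 'm, 'z) precat_scheme" (structure) and T :: "('o, 'm) endo" +
  assumes add_endo: "additive_endofunctor C T"
begin

lemma endo: "endofunctor C T" using add_endo by (simp add: additive_endofunctor_def)

lemma arr_ar [simp]:
  assumes "f \<in> arr C"
  shows "ar T f \<in> arr C" "src C (ar T f) = ob T (src C f)" "tgt C (ar T f) = ob T (tgt C f)"
  using endo assms unfolding endofunctor_def by (auto simp: Hom_iff)

lemma ar_ide [simp]: "ar T (ide C A) = ide C (ob T A)"
  using endo unfolding endofunctor_def by auto

lemma ar_cmp [simp]:
  assumes "f \<in> arr C" "g \<in> arr C" "tgt C f = src C g"
  shows "ar T (g \<cdot> f) = ar T g \<cdot> ar T f"
  using endo assms unfolding endofunctor_def by (auto simp: Hom_iff)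

lemma ar_madd [simp]:
  assumes "f \<in> arr C" "g \<in> arr C" "src C f = src C g" "tgt C f = tgt C g"
  shows "ar T (f \<oplus> g) = ar T f \<oplus> ar T g"
  using add_endo assms unfolding additive_endofunctor_def by auto

lemma ar_mzero [simp]: "ar T (mzero C A B) = mzero C (ob T A) (ob T B)"
  using add_self_zero[of "ar T (mzero C A B)"] ar_madd[of "mzero C A B" "mzero C A B"]
  by (simp del: ar_madd)

lemma ar_mneg [simp]: "f \<in> arr C \<Longrightarrow> ar T (mneg C f) = mneg C (ar T f)"
  by (rule eq_neg[of _ _ "ob T (src C f)" "ob T (tgt C f)"])
    (use ar_madd[of f "mneg C f"] in \<open>simp_all del: ar_madd\<close>)

lemma ar_sgn [simp]: "f \<in> arr C \<Longrightarrow> ar T (sgn_mor C k f) = sgn_mor C k (ar T f)"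
  by (simp add: sgn_mor_def)

lemma ar_iso: "is_iso C f \<Longrightarrow> is_iso C (ar T f)"
proof -
  assume f: "is_iso C f"
  then obtain g where g: "g \<in> arr C" "src C g = tgt C f" "tgt C g = src C f"
    "g \<cdot> f = ide C (src C f)" "f \<cdot> g = ide C (tgt C f)" by (rule is_isoE)
  then show ?thesis using is_isoD[OF f] by (intro is_isoI[of _ "ar T g"]) (simp_all flip: ar_cmp)
qed

lemma ob_zero: "zero_object C Z \<Longrightarrow> zero_object C (ob T Z)"
  unfolding zero_object_iff using ar_ide[of Z] by simp

lemma ar_biproduct:
  assumes "biproduct C A B P i1 i2 p1 p2"
  shows "biproduct C (ob T A) (ob T B) (ob T P) (ar T i1) (ar T i2) (ar T p1) (ar T p2)"
proof -
  note b = biproductD[OF assms]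
  have "ar T (i1 \<cdot> p1) \<oplus> ar T (i2 \<cdot> p2) = ide C (ob T P)"
    using b by (simp flip: ar_madd del: ar_cmp)
  then show ?thesis unfolding biproduct_def using b by (simp flip: ar_cmp)
qed

end

section \<open>Sequences and mapping cones\<close>

lemma nseqD:
  assumes "nseq n C T f"
  shows "i \<le> Suc n \<Longrightarrow> f i \<in> arr C" "f 0 \<in> arr C" "f (Suc 0) \<in> arr C" "i \<le> n \<Longrightarrow> tgt C (f i) = src C (f (Suc i))"
    "tgt C (f 0) = src C (f (Suc 0))" "tgt C (f (Suc n)) = ob T (src C (f 0))"
  using assms by (auto simp: nseq_def)

lemma nseqI:
  assumes "\<And>i. i \<le> Suc n \<Longrightarrow> f i \<in> arr C" "\<And>i. i \<le> n \<Longrightarrow> tgt C (f i) = src C (f (Suc i))"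
    "tgt C (f (Suc n)) = ob T (src C (f 0))"
  shows "nseq n C T f"
  using assms by (auto simp: nseq_def)

lemma nseq_morphismD:
  assumes "nseq_morphism n C T f g \<phi>"
  shows "nseq n C T f" "nseq n C T g" "i \<le> Suc n \<Longrightarrow> \<phi> i \<in> arr C"
    "i \<le> Suc n \<Longrightarrow> src C (\<phi> i) = src C (f i)" "i \<le> Suc n \<Longrightarrow> tgt C (\<phi> i) = src C (g i)"
    "i \<le> n \<Longrightarrow> \<phi> (Suc i) \<cdot>\<^bsub>C\<^esub> f i = g i \<cdot>\<^bsub>C\<^esub> \<phi> i"
    "ar T (\<phi> 0) \<cdot>\<^bsub>C\<^esub> f (Suc n) = g (Suc n) \<cdot>\<^bsub>C\<^esub> \<phi> (Suc n)"
  using assms by (auto simp: nseq_morphism_def)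

lemma nseq_morphismI:
  assumes "nseq n C T f" "nseq n C T g" "\<And>i. i \<le> Suc n \<Longrightarrow> \<phi> i \<in> Hom C (src C (f i)) (src C (g i))"
    "\<And>i. i \<le> n \<Longrightarrow> \<phi> (Suc i) \<cdot>\<^bsub>C\<^esub> f i = g i \<cdot>\<^bsub>C\<^esub> \<phi> i"
    "ar T (\<phi> 0) \<cdot>\<^bsub>C\<^esub> f (Suc n) = g (Suc n) \<cdot>\<^bsub>C\<^esub> \<phi> (Suc n)"
  shows "nseq_morphism n C T f g \<phi>"
  using assms by (auto simp: nseq_morphism_def)

lemma (in preadditive_category) biproduct_choice:
  assumes "\<And>j. \<exists>P. direct_sum C (A j) (B j) P"
  obtains P i1 i2 p1 p2 where "\<And>j. biproduct C (A j) (B j) (P j) (i1 j) (i2 j) (p1 j) (p2 j)"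
proof -
  \<comment> \<open>The five components are packed into one tuple, so that a single application of
    choice suffices.\<close>
  have "\<forall>j. \<exists>t. biproduct C (A j) (B j) (fst t) (fst (snd t)) (fst (snd (snd t)))
    (fst (snd (snd (snd t)))) (snd (snd (snd (snd t))))"
  proof
    fix j
    obtain P i1 i2 p1 p2 where "biproduct C (A j) (B j) P i1 i2 p1 p2"
      using assms unfolding direct_sum_def by blast
    then show "\<exists>t. biproduct C (A j) (B j) (fst t) (fst (snd t)) (fst (snd (snd t)))
        (fst (snd (snd (snd t)))) (snd (snd (snd (snd t))))"
      by (intro exI[of _ "(P, i1, i2, p1, p2)"]) simp
  qed
  then obtain t where "\<And>j. biproduct C (A j) (B j) (fst (t j)) (fst (snd (t j))) (fst (snd (snd (t j))))
    (fst (snd (snd (snd (t j))))) (snd (snd (snd (snd (t j)))))" using choice by metis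
  then show thesis by (rule that)
qed

locale seq_functor = add_functor +
  fixes n :: nat
begin

abbreviation sq where "sq \<equiv> nseq n C T"
abbreviation mor where "mor \<equiv> nseq_morphism n C T"
abbreviation siso where "siso \<equiv> nseq_isomorphic n C T"
abbreviation dsum where "dsum \<equiv> nseq_direct_sum n C T"
abbreviation rot where "rot \<equiv> rotate_nseq n C T"

lemma mor_assoc:
  assumes "mor f g \<phi>"
  shows "i \<le> n \<Longrightarrow> x \<in> arr C \<Longrightarrow> tgt C x = src C (f i) \<Longrightarrow> \<phi> (Suc i) \<cdot> (f i \<cdot> x) = g i \<cdot> (\<phi> i \<cdot> x)"
    "x \<in> arr C \<Longrightarrow> tgt C x = src C (f (Suc n)) \<Longrightarrow>
      ar T (\<phi> 0) \<cdot> (f (Suc n) \<cdot> x) = g (Suc n) \<cdot> (\<phi> (Suc n) \<cdot> x)"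
proof -
  note m = nseq_morphismD[OF assms] and f = nseqD[OF nseq_morphismD(1)[OF assms]]
    and g = nseqD[OF nseq_morphismD(2)[OF assms]]
  show "\<phi> (Suc i) \<cdot> (f i \<cdot> x) = g i \<cdot> (\<phi> i \<cdot> x)" if "i \<le> n" "x \<in> arr C" "tgt C x = src C (f i)"
    using that m(6)[OF that(1), THEN cmp_eq_assoc, of x] by (simp add: m f g)
  show "ar T (\<phi> 0) \<cdot> (f (Suc n) \<cdot> x) = g (Suc n) \<cdot> (\<phi> (Suc n) \<cdot> x)"
    if "x \<in> arr C" "tgt C x = src C (f (Suc n))"
    using that m(7)[THEN cmp_eq_assoc, of x] by (simp add: m f g)
qed

lemmas mor_simps = nseq_morphismD(3-) mor_assoc

lemma mor_ide: "sq f \<Longrightarrow> mor f f (\<lambda>i. ide C (src C (f i)))"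
  by (rule nseq_morphismI) (simp_all add: nseqD)

lemma mor_cmp:
  assumes "mor f g \<phi>" "mor g h \<psi>"
  shows "mor f h (\<lambda>i. \<psi> i \<cdot> \<phi> i)"
  using nseq_morphismD(1,2)[OF assms(1)] nseq_morphismD(2)[OF assms(2)]
  by (intro nseq_morphismI) (simp_all add: nseqD mor_simps[OF assms(1)] mor_simps[OF assms(2)])

lemma mor_add:
  assumes "mor f g \<phi>" "mor f g \<psi>"
  shows "mor f g (\<lambda>i. \<phi> i \<oplus> \<psi> i)"
  using nseq_morphismD(1,2)[OF assms(1)]
  by (intro nseq_morphismI) (simp_all add: nseqD mor_simps[OF assms(1)] mor_simps[OF assms(2)])

lemma sisoI:
  assumes "mor f g \<phi>" "\<And>i. i \<le> Suc n \<Longrightarrow> is_iso C (\<phi> i)"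
  shows "siso f g"
  using assms by (auto simp: nseq_isomorphic_def)

text \<open>The componentwise inverses commute with the differentials automatically: insert
  \<open>\<phi> i \<cdot> \<psi> i\<close>, move the differential across, cancel. In the closing
  square the inverse of \<open>ar T (\<phi> 0)\<close> is \<open>ar T (\<psi> 0)\<close>.\<close>

lemma sisoE:
  assumes "siso f g"
  obtains \<phi> \<psi> where "mor f g \<phi>" "mor g f \<psi>" "\<And>i. i \<le> Suc n \<Longrightarrow> \<psi> i \<cdot> \<phi> i = ide C (src C (f i))"
    "\<And>i. i \<le> Suc n \<Longrightarrow> \<phi> i \<cdot> \<psi> i = ide C (src C (g i))"
proof -
  obtain \<phi> where p: "mor f g \<phi>" "\<And>i. i \<le> Suc n \<Longrightarrow> is_iso C (\<phi> i)"
    using assms by (auto simp: nseq_isomorphic_def)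
  note f = nseqD[OF nseq_morphismD(1)[OF p(1)]] and g = nseqD[OF nseq_morphismD(2)[OF p(1)]]
  have "\<exists>q. i \<le> Suc n \<longrightarrow> q \<in> arr C \<and> src C q = src C (g i) \<and> tgt C q = src C (f i) \<and>
    q \<cdot> \<phi> i = ide C (src C (f i)) \<and> \<phi> i \<cdot> q = ide C (src C (g i))" for i
  proof (cases "i \<le> Suc n")
    case True
    from p(2)[OF True] show ?thesis
      by (rule is_isoE) (use mor_simps[OF p(1)] True in auto)
  qed simp
  then obtain \<psi> where q: "\<And>i. i \<le> Suc n \<Longrightarrow> \<psi> i \<in> arr C \<and> src C (\<psi> i) = src C (g i) \<and> tgt C (\<psi> i) = src C (f i) \<and>
    \<psi> i \<cdot> \<phi> i = ide C (src C (f i)) \<and> \<phi> i \<cdot> \<psi> i = ide C (src C (g i))" by metis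
  have m: "mor g f \<psi>"
  proof (rule nseq_morphismI)
    show "sq g" "sq f" using p by (auto dest: nseq_morphismD)
    show "\<psi> i \<in> Hom C (src C (g i)) (src C (f i))" if "i \<le> Suc n" for i using q[OF that] by simp
    show "\<psi> (Suc i) \<cdot> g i = f i \<cdot> \<psi> i" if "i \<le> n" for i
    proof -
      have i: "i \<le> Suc n" "Suc i \<le> Suc n" using that by auto
      note [simp] = q[OF i(1)] q[OF i(2)] mor_simps[OF p(1)] f g
      have "\<psi> (Suc i) \<cdot> g i = \<psi> (Suc i) \<cdot> (g i \<cdot> (\<phi> i \<cdot> \<psi> i))" using that i by simp
      also have "\<dots> = \<psi> (Suc i) \<cdot> (\<phi> (Suc i) \<cdot> (f i \<cdot> \<psi> i))" using that i by simp
      also have "\<dots> = (\<psi> (Suc i) \<cdot> \<phi> (Suc i)) \<cdot> (f i \<cdot> \<psi> i)" by (rule assoc[symmetric]) (use that i in simp_all)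
      also have "\<dots> = f i \<cdot> \<psi> i" using that i by (simp del: assoc)
      finally show ?thesis .
    qed
    note [simp] = q[of 0, simplified] q[of "Suc n", simplified] mor_simps[OF p(1)] f g
    have "ar T (\<psi> 0) \<cdot> g (Suc n) = ar T (\<psi> 0) \<cdot> (g (Suc n) \<cdot> (\<phi> (Suc n) \<cdot> \<psi> (Suc n)))" by simp
    also have "\<dots> = ar T (\<psi> 0) \<cdot> (ar T (\<phi> 0) \<cdot> (f (Suc n) \<cdot> \<psi> (Suc n)))" by simp
    also have "\<dots> = ar T (\<psi> 0 \<cdot> \<phi> 0) \<cdot> (f (Suc n) \<cdot> \<psi> (Suc n))" by (subst ar_cmp) simp_all
    also have "\<dots> = f (Suc n) \<cdot> \<psi> (Suc n)" by (simp del: assoc ar_cmp)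
    finally show "ar T (\<psi> 0) \<cdot> g (Suc n) = f (Suc n) \<cdot> \<psi> (Suc n)" .
  qed
  show thesis by (rule that[OF p(1) m]) (use q in auto)
qed

lemma siso_refl: "sq f \<Longrightarrow> siso f f"
  using sisoI[OF mor_ide] by simp

lemma siso_sym:
  assumes "siso f g"
  shows "siso g f"
proof -
  from assms obtain \<phi> \<psi> where p: "mor f g \<phi>" "mor g f \<psi>"
    "\<And>i. i \<le> Suc n \<Longrightarrow> \<psi> i \<cdot> \<phi> i = ide C (src C (f i))"
    "\<And>i. i \<le> Suc n \<Longrightarrow> \<phi> i \<cdot> \<psi> i = ide C (src C (g i))" by (rule sisoE) blast
  show ?thesis
  proof (rule sisoI[OF p(2)])
    show "is_iso C (\<psi> i)" if "i \<le> Suc n" for i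
      by (rule is_isoI[of _ "\<phi> i"]) (use that in \<open>simp_all add: p(3,4) mor_simps[OF p(1)] mor_simps[OF p(2)]\<close>)
  qed
qed

lemma siso_trans:
  assumes "siso f g" "siso g h"
  shows "siso f h"
proof -
  obtain \<phi> where p: "mor f g \<phi>" "\<And>i. i \<le> Suc n \<Longrightarrow> is_iso C (\<phi> i)"
    using assms by (auto simp: nseq_isomorphic_def)
  obtain \<psi> where q: "mor g h \<psi>" "\<And>i. i \<le> Suc n \<Longrightarrow> is_iso C (\<psi> i)"
    using assms by (auto simp: nseq_isomorphic_def)
  show ?thesis
    by (rule sisoI[OF mor_cmp[OF p(1) q(1)]], rule iso_cmp)
      (simp_all add: p q mor_simps[OF p(1)] mor_simps[OF q(1)])
qed

lemma sq_rot:
  assumes "sq f"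
  shows "sq (rot f)"
  unfolding rotate_nseq_sgn
proof (rule nseqI)
  note [simp] = nseqD[OF assms]
  show "(if i \<le> n then f (Suc i) else sgn_mor C n (ar T (f 0))) \<in> arr C" if "i \<le> Suc n" for i
    using that by simp
  show "tgt C (if i \<le> n then f (Suc i) else sgn_mor C n (ar T (f 0))) =
      src C (if Suc i \<le> n then f (Suc (Suc i)) else sgn_mor C n (ar T (f 0)))" if "i \<le> n" for i
    using that by (cases "i = n") simp_all
qed (simp add: nseqD[OF assms])

lemma dsumE:
  assumes "dsum f g h"
  obtains i1 i2 p1 p2 where "mor f h i1" "mor g h i2" "mor h f p1" "mor h g p2"
    "\<And>j. j \<le> Suc n \<Longrightarrow> biproduct C (src C (f j)) (src C (g j)) (src C (h j)) (i1 j) (i2 j) (p1 j) (p2 j)"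
  using assms unfolding nseq_direct_sum_def by auto

lemma dsumI:
  assumes "mor f h i1" "mor g h i2" "mor h f p1" "mor h g p2"
    "\<And>j. j \<le> Suc n \<Longrightarrow> biproduct C (src C (f j)) (src C (g j)) (src C (h j)) (i1 j) (i2 j) (p1 j) (p2 j)"
  shows "dsum f g h"
  using assms unfolding nseq_direct_sum_def by auto

text \<open>The differentials are diagonal matrices. The last one lands in
  \<open>ob T (P 0)\<close>, which is a biproduct because \<open>T\<close> is additive.\<close>

lemma dsum_exists:
  assumes "sq f" "sq g" and P: "\<And>A B. \<exists>P. direct_sum C A B P"
  shows "\<exists>h. dsum f g h"
proof -
  note [simp] = nseqD[OF assms(1)] nseqD[OF assms(2)]
  obtain P i1 i2 p1 p2 where b:
    "\<And>j. biproduct C (src C (f j)) (src C (g j)) (P j) (i1 j) (i2 j) (p1 j) (p2 j)"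
    using biproduct_choice[of "\<lambda>j. src C (f j)" "\<lambda>j. src C (g j)"] P by blast
  define h where "h = (\<lambda>j. if j \<le> n then (i1 (Suc j) \<cdot> (f j \<cdot> p1 j)) \<oplus> (i2 (Suc j) \<cdot> (g j \<cdot> p2 j))
    else (ar T (i1 0) \<cdot> (f j \<cdot> p1 j)) \<oplus> (ar T (i2 0) \<cdot> (g j \<cdot> p2 j)))"
  note [simp] = biproduct_simps[OF b] biproduct_simps[OF ar_biproduct[OF b]]
  have [simp]: "h j \<in> arr C \<and> src C (h j) = P j" if "j \<le> Suc n" for j
  proof -
    consider "j \<le> n" | "j = Suc n" using \<open>j \<le> Suc n\<close> by linarith
    then show ?thesis by cases (simp_all add: h_def)
  qed
  have [simp]: "j \<le> n \<Longrightarrow> tgt C (h j) = P (Suc j)" "tgt C (h (Suc n)) = ob T (P 0)" for j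
    by (simp_all add: h_def)
  have h: "sq h" by (rule nseqI) simp_all
  have [simp]: "j \<le> n \<Longrightarrow> h j \<cdot> i1 j = i1 (Suc j) \<cdot> f j" "j \<le> n \<Longrightarrow> h j \<cdot> i2 j = i2 (Suc j) \<cdot> g j"
    "j \<le> n \<Longrightarrow> p1 (Suc j) \<cdot> h j = f j \<cdot> p1 j" "j \<le> n \<Longrightarrow> p2 (Suc j) \<cdot> h j = g j \<cdot> p2 j"
    "h (Suc n) \<cdot> i1 (Suc n) = ar T (i1 0) \<cdot> f (Suc n)" "h (Suc n) \<cdot> i2 (Suc n) = ar T (i2 0) \<cdot> g (Suc n)"
    "ar T (p1 0) \<cdot> h (Suc n) = f (Suc n) \<cdot> p1 (Suc n)" "ar T (p2 0) \<cdot> h (Suc n) = g (Suc n) \<cdot> p2 (Suc n)" for j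
    by (simp_all add: h_def)
  have "dsum f g h"
    by (rule dsumI[of _ _ i1 _ i2 p1 p2]; (intro nseq_morphismI)?)
      (use h assms(1,2) b in simp_all)
  then show ?thesis by blast
qed

text \<open>It transfers the sum of two standard right angles to an arbitrary sum of sequences that
  are merely isomorphic to them.\<close>

lemma dsum_unique:
  assumes "siso f f'" "siso g g'" "dsum f g h" "dsum f' g' h'"
  shows "siso h h'"
proof -
  obtain \<phi> where p: "mor f f' \<phi>" "\<And>i. i \<le> Suc n \<Longrightarrow> is_iso C (\<phi> i)"
    using assms by (auto simp: nseq_isomorphic_def)
  obtain \<psi> where q: "mor g g' \<psi>" "\<And>i. i \<le> Suc n \<Longrightarrow> is_iso C (\<psi> i)"
    using assms by (auto simp: nseq_isomorphic_def)
  from assms(3) obtain i1 i2 p1 p2 where d: "mor f h i1" "mor g h i2" "mor h f p1" "mor h g p2"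
    "\<And>j. j \<le> Suc n \<Longrightarrow> biproduct C (src C (f j)) (src C (g j)) (src C (h j)) (i1 j) (i2 j) (p1 j) (p2 j)"
    by (rule dsumE) blast
  from assms(4) obtain i1' i2' p1' p2' where e: "mor f' h' i1'" "mor g' h' i2'" "mor h' f' p1'" "mor h' g' p2'"
    "\<And>j. j \<le> Suc n \<Longrightarrow> biproduct C (src C (f' j)) (src C (g' j)) (src C (h' j)) (i1' j) (i2' j) (p1' j) (p2' j)"
    by (rule dsumE) blast
  have m: "mor h h' (\<lambda>j. (i1' j \<cdot> (\<phi> j \<cdot> p1 j)) \<oplus> (i2' j \<cdot> (\<psi> j \<cdot> p2 j)))"
    by (intro mor_add mor_cmp[of _ _ _ _ i1'] mor_cmp[of _ _ _ _ i2'] mor_cmp[of _ _ p1] mor_cmp[of _ _ p2]) (fact d p q e)+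
  show ?thesis
  proof (rule sisoI[OF m])
    fix j assume j: "j \<le> Suc n"
    obtain a where a: "a \<in> arr C" "src C a = src C (f' j)" "tgt C a = src C (f j)"
      "a \<cdot> \<phi> j = ide C (src C (f j))" "\<phi> j \<cdot> a = ide C (src C (f' j))"
      using p(2)[OF j] by (rule is_isoE) (use mor_simps[OF p(1)] j in auto)
    obtain b where b: "b \<in> arr C" "src C b = src C (g' j)" "tgt C b = src C (g j)"
      "b \<cdot> \<psi> j = ide C (src C (g j))" "\<psi> j \<cdot> b = ide C (src C (g' j))"
      using q(2)[OF j] by (rule is_isoE) (use mor_simps[OF q(1)] j in auto)
    note [simp] = a b a(4,5)[THEN cmp_eq_assoc] b(4,5)[THEN cmp_eq_assoc] mor_simps(1-3)[OF p(1) j] mor_simps(1-3)[OF q(1) j]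
      biproduct_simps[OF d(5)[OF j]] biproduct_simps[OF e(5)[OF j]]
    show "is_iso C ((i1' j \<cdot> (\<phi> j \<cdot> p1 j)) \<oplus> (i2' j \<cdot> (\<psi> j \<cdot> p2 j)))"
      by (rule is_isoI[where g = "(i1 j \<cdot> (a \<cdot> p1' j)) \<oplus> (i2 j \<cdot> (b \<cdot> p2' j))"])
        (simp_all add: biproductD(17)[OF d(5)[OF j]] biproductD(17)[OF e(5)[OF j]])
  qed
qed

text \<open>The complementary idempotents 1 - \<iota>\<pi> commute with the differentials of
  \<open>h\<close>, and their images form the complementary sequence. Hence closure under direct
  summands gives closure under retracts once idempotents split.\<close>

lemma retract_dsum:
  assumes split: "\<And>A e. e \<in> Hom C A A \<Longrightarrow> e \<cdot> e = e \<Longrightarrow>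
      \<exists>Z. \<exists>\<zeta>\<in>Hom C Z A. \<exists>\<rho>\<in>Hom C A Z. \<rho> \<cdot> \<zeta> = ide C Z \<and> \<zeta> \<cdot> \<rho> = e"
    and m: "mor f h \<iota>" "mor h f \<pi>" and r: "\<And>i. i \<le> Suc n \<Longrightarrow> \<pi> i \<cdot> \<iota> i = ide C (src C (f i))"
  shows "\<exists>g. dsum f g h"
proof -
  note [simp] = nseqD[OF nseq_morphismD(1)[OF m(1)]] nseqD[OF nseq_morphismD(2)[OF m(1)]]
    mor_simps[OF m(1)] mor_simps[OF m(2)] r r[THEN cmp_eq_assoc]
  define q where "q i = ide C (src C (h i)) \<oplus> mneg C (\<iota> i \<cdot> \<pi> i)" for i
  have q [simp]: "q i \<in> arr C" "src C (q i) = src C (h i)" "tgt C (q i) = src C (h i)" "q i \<cdot> q i = q i"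
    "q i \<cdot> \<iota> i = mzero C (src C (f i)) (src C (h i))" "\<pi> i \<cdot> q i = mzero C (src C (h i)) (src C (f i))"
    if "i \<le> Suc n" for i using that unfolding q_def by simp_all
  have "\<exists>Z \<zeta> \<rho>. i \<le> Suc n \<longrightarrow> \<zeta> \<in> Hom C Z (src C (h i)) \<and> \<rho> \<in> Hom C (src C (h i)) Z \<and>
      \<rho> \<cdot> \<zeta> = ide C Z \<and> \<zeta> \<cdot> \<rho> = q i" for i
    using split[of "q i" "src C (h i)"] q(1-4)[of i] by (metis Hom_iff)
  then obtain Z \<zeta> \<rho> where z: "\<And>i. i \<le> Suc n \<Longrightarrow> \<zeta> i \<in> Hom C (Z i) (src C (h i)) \<and> \<rho> i \<in> Hom C (src C (h i)) (Z i) \<and>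
      \<rho> i \<cdot> \<zeta> i = ide C (Z i) \<and> \<zeta> i \<cdot> \<rho> i = q i" by metis
  have z1 [simp]: "\<zeta> i \<in> arr C" "src C (\<zeta> i) = Z i" "tgt C (\<zeta> i) = src C (h i)" "\<rho> i \<in> arr C"
    "src C (\<rho> i) = src C (h i)" "tgt C (\<rho> i) = Z i" "\<rho> i \<cdot> \<zeta> i = ide C (Z i)" "\<zeta> i \<cdot> \<rho> i = q i" if "i \<le> Suc n" for i
    using z[OF that] by auto
  have z2 [simp]: "\<rho> i \<cdot> \<iota> i = mzero C (src C (f i)) (Z i)" "\<pi> i \<cdot> \<zeta> i = mzero C (Z i) (src C (f i))"
    if i: "i \<le> Suc n" for i
  proof -
    have "\<rho> i \<cdot> \<iota> i = (\<rho> i \<cdot> \<zeta> i) \<cdot> (\<rho> i \<cdot> \<iota> i)" using i by (simp del: assoc)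
    also have "\<dots> = \<rho> i \<cdot> (\<zeta> i \<cdot> \<rho> i \<cdot> \<iota> i)" by (rule assoc) (use i in simp_all)
    also have "\<dots> = mzero C (src C (f i)) (Z i)" using i by (simp add: z1(8)[THEN cmp_eq_assoc] del: z1(8))
    finally show "\<rho> i \<cdot> \<iota> i = mzero C (src C (f i)) (Z i)" .
    have "\<pi> i \<cdot> \<zeta> i = \<pi> i \<cdot> (\<zeta> i \<cdot> (\<rho> i \<cdot> \<zeta> i))" using i by simp
    also have "\<dots> = (\<pi> i \<cdot> q i) \<cdot> \<zeta> i" using i by (simp add: z1(8)[THEN cmp_eq_assoc] del: q(6) z1(7,8))
    also have "\<dots> = mzero C (Z i) (src C (f i))" using i by (simp del: assoc)
    finally show "\<pi> i \<cdot> \<zeta> i = mzero C (Z i) (src C (f i))" .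
  qed
  note [simp] = z1(7)[THEN cmp_eq_assoc] z1(8)[THEN cmp_eq_assoc] z2(1)[THEN cmp_eq_assoc] z2(2)[THEN cmp_eq_assoc]
  define g where "g = (\<lambda>i. if i \<le> n then \<rho> (Suc i) \<cdot> (h i \<cdot> \<zeta> i) else ar T (\<rho> 0) \<cdot> (h i \<cdot> \<zeta> i))"
  have [simp]: "g i \<in> arr C \<and> src C (g i) = Z i" if "i \<le> Suc n" for i
  proof -
    consider "i \<le> n" | "i = Suc n" using \<open>i \<le> Suc n\<close> by linarith
    then show ?thesis by cases (simp_all add: g_def)
  qed
  have [simp]: "i \<le> n \<Longrightarrow> tgt C (g i) = Z (Suc i)" "tgt C (g (Suc n)) = ob T (Z 0)" for i
    by (simp_all add: g_def)
  have g: "sq g" by (rule nseqI) simp_all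
  have [simp]: "ar T (\<zeta> 0) \<cdot> (ar T (\<rho> 0) \<cdot> x) = ar T (q 0) \<cdot> x" if "x \<in> arr C" "tgt C x = ob T (src C (h 0))" for x
    using that by (simp flip: assoc ar_cmp)
  have 1: "mor g h \<zeta>"
  proof (rule nseq_morphismI)
    show "\<zeta> (Suc i) \<cdot> g i = h i \<cdot> \<zeta> i" if "i \<le> n" for i
      using that by (simp add: g_def q_def)
    show "ar T (\<zeta> 0) \<cdot> g (Suc n) = h (Suc n) \<cdot> \<zeta> (Suc n)"
      by (simp add: g_def q_def)
  qed (use g nseq_morphismD(2)[OF m(1)] in simp_all)
  have 2: "mor h g \<rho>"
  proof (rule nseq_morphismI)
    show "\<rho> (Suc i) \<cdot> h i = g i \<cdot> \<rho> i" if "i \<le> n" for i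
    proof -
      have "h i \<cdot> q i = h i \<oplus> mneg C (\<iota> (Suc i) \<cdot> (f i \<cdot> \<pi> i))" using that by (simp add: q_def)
      then have "\<rho> (Suc i) \<cdot> (h i \<cdot> q i) = \<rho> (Suc i) \<cdot> h i"
        using that by (simp del: mor_assoc(1)[OF m(1)])
      then show ?thesis using that by (simp add: g_def)
    qed
    show "ar T (\<rho> 0) \<cdot> h (Suc n) = g (Suc n) \<cdot> \<rho> (Suc n)"
    proof -
      have "h (Suc n) \<cdot> q (Suc n) = h (Suc n) \<oplus> mneg C (ar T (\<iota> 0) \<cdot> (f (Suc n) \<cdot> \<pi> (Suc n)))" by (simp add: q_def)
      moreover have "ar T (\<rho> 0) \<cdot> (ar T (\<iota> 0) \<cdot> (f (Suc n) \<cdot> \<pi> (Suc n))) = ar T (\<rho> 0 \<cdot> \<iota> 0) \<cdot> (f (Suc n) \<cdot> \<pi> (Suc n))"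
        by (subst ar_cmp) (simp_all del: mor_assoc(2)[OF m(1)])
      ultimately have "ar T (\<rho> 0) \<cdot> (h (Suc n) \<cdot> q (Suc n)) = ar T (\<rho> 0) \<cdot> h (Suc n)"
        by (simp del: mor_assoc(2)[OF m(1)] ar_cmp)
      then show ?thesis by (simp add: g_def)
    qed
  qed (use g nseq_morphismD(2)[OF m(1)] in simp_all)
  have "dsum f g h"
    by (rule dsumI[OF m(1) 1 m(2) 2]) (simp add: biproduct_def, simp add: q_def)
  then show ?thesis by blast
qed

end

section \<open>Criteria for autoequivalences\<close>

context category
begin

lemma endofunctorD:
  assumes "endofunctor C F"
  shows "f \<in> arr C \<Longrightarrow> ar F f \<in> arr C" "f \<in> arr C \<Longrightarrow> src C (ar F f) = ob F (src C f)"
    "f \<in> arr C \<Longrightarrow> tgt C (ar F f) = ob F (tgt C f)" "ar F (ide C A) = ide C (ob F A)"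
    "f \<in> arr C \<Longrightarrow> g \<in> arr C \<Longrightarrow> tgt C f = src C g \<Longrightarrow> ar F (g \<cdot> f) = ar F g \<cdot> ar F f"
  using assms unfolding endofunctor_def by auto

lemma iso_reflect:
  assumes F: "endofunctor C F"
    and full: "\<And>A B g. g \<in> Hom C (ob F A) (ob F B) \<Longrightarrow> \<exists>f\<in>Hom C A B. ar F f = g"
    and faithful: "\<And>A B f g. f \<in> Hom C A B \<Longrightarrow> g \<in> Hom C A B \<Longrightarrow> ar F f = ar F g \<Longrightarrow> f = g"
    and f: "f \<in> arr C" "is_iso C (ar F f)"
  shows "is_iso C f"
proof -
  note [simp] = endofunctorD[OF F]
  from f(2) obtain g where g: "g \<in> arr C" "src C g = tgt C (ar F f)" "tgt C g = src C (ar F f)"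
    "g \<cdot> ar F f = ide C (src C (ar F f))" "ar F f \<cdot> g = ide C (tgt C (ar F f))" by (rule is_isoE)
  obtain h where h: "h \<in> Hom C (tgt C f) (src C f)" "ar F h = g"
    using full[of g "tgt C f" "src C f"] g f by auto
  have "h \<cdot> f = ide C (src C f)"
    by (rule faithful[of _ "src C f" "src C f"]) (use f g h in auto)
  moreover have "f \<cdot> h = ide C (tgt C f)"
    by (rule faithful[of _ "tgt C f" "tgt C f"]) (use f g h in auto)
  ultimately show ?thesis using f h by (intro is_isoI[of f h]) auto
qed

text \<open>The quasi-inverse is built by choice: by density \<open>K A\<close> with an isomorphism
  \<open>e A\<close> from \<open>ob F (K A)\<close> to \<open>A\<close>, and on morphisms the unique
  preimage of the conjugate under these isomorphisms. Functoriality and naturality are tested after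
  applying \<open>F\<close>.\<close>

lemma autoequivalenceI:
  assumes F: "endofunctor C F"
    and full: "\<And>A B g. g \<in> Hom C (ob F A) (ob F B) \<Longrightarrow> \<exists>f\<in>Hom C A B. ar F f = g"
    and faithful: "\<And>A B f g. f \<in> Hom C A B \<Longrightarrow> g \<in> Hom C A B \<Longrightarrow> ar F f = ar F g \<Longrightarrow> f = g"
    and dense: "\<And>A. \<exists>B. isomorphic C (ob F B) A"
  shows "autoequivalence C F"
proof -
  note [simp] = endofunctorD[OF F]
  have "\<exists>B e e'. e \<in> Hom C (ob F B) A \<and> e' \<in> Hom C A (ob F B) \<and> e' \<cdot> e = ide C (ob F B) \<and> e \<cdot> e' = ide C A" for A
  proof -
    obtain B e where e: "e \<in> Hom C (ob F B) A" "is_iso C e" using dense unfolding isomorphic_def by blast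
    from e(2) show ?thesis by (rule is_isoE) (use e(1) in auto)
  qed
  then obtain K e e' where e: "\<And>A. e A \<in> Hom C (ob F (K A)) A \<and> e' A \<in> Hom C A (ob F (K A)) \<and>
      e' A \<cdot> e A = ide C (ob F (K A)) \<and> e A \<cdot> e' A = ide C A" by metis
  then have e1 [simp]: "e A \<in> arr C" "src C (e A) = ob F (K A)" "tgt C (e A) = A" "e' A \<in> arr C"
    "src C (e' A) = A" "tgt C (e' A) = ob F (K A)" "e' A \<cdot> e A = ide C (ob F (K A))" "e A \<cdot> e' A = ide C A" for A
    by auto
  note [simp] = e1(7)[THEN cmp_eq_assoc] e1(8)[THEN cmp_eq_assoc]
  define r where "r f = (SOME g. g \<in> Hom C (K (src C f)) (K (tgt C f)) \<and>
    ar F g = e' (tgt C f) \<cdot> (f \<cdot> e (src C f)))" for f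
  have r: "r f \<in> Hom C (K (src C f)) (K (tgt C f)) \<and> ar F (r f) = e' (tgt C f) \<cdot> (f \<cdot> e (src C f))"
    if "f \<in> arr C" for f
    unfolding r_def by (rule someI_ex) (use full[of "e' (tgt C f) \<cdot> (f \<cdot> e (src C f))" "K (src C f)" "K (tgt C f)"] that in auto)
  then have [simp]: "f \<in> arr C \<Longrightarrow> r f \<in> arr C" "f \<in> arr C \<Longrightarrow> src C (r f) = K (src C f)"
    "f \<in> arr C \<Longrightarrow> tgt C (r f) = K (tgt C f)" "f \<in> arr C \<Longrightarrow> ar F (r f) = e' (tgt C f) \<cdot> (f \<cdot> e (src C f))" for f
    by auto
  define G where "G = \<lparr>ob = K, ar = r\<rparr>"
  have [simp]: "ob G = K" "ar G = r" by (simp_all add: G_def)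
  have G: "endofunctor C G"
    unfolding endofunctor_def
  proof (intro conjI allI ballI)
    show "ar G (ide C A) = ide C (ob G A)" for A
      by (rule faithful[of _ "K A" "K A"]) auto
    show "ar G (g \<cdot> f) = ar G g \<cdot> ar G f" if "f \<in> Hom C A B" "g \<in> Hom C B D" for A B D f g
      by (rule faithful[of _ "K A" "K D"]) (use that in auto)
  qed auto
  have iso_e: "is_iso C (e A)" for A by (rule is_isoI[of _ "e' A"]) auto
  have FG: "naturally_isomorphic C (comp_endo F G) id_endo"
    unfolding naturally_isomorphic_def
    by (rule exI[of _ e]) (auto simp: comp_endo_def id_endo_def iso_e)
  have "\<exists>d. d \<in> Hom C (K (ob F A)) A \<and> ar F d = e (ob F A)" for A
    using full[of "e (ob F A)" "K (ob F A)" A] by auto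
  then obtain d where d: "\<And>A. d A \<in> Hom C (K (ob F A)) A \<and> ar F (d A) = e (ob F A)" by metis
  then have [simp]: "d A \<in> arr C" "src C (d A) = K (ob F A)" "tgt C (d A) = A" "ar F (d A) = e (ob F A)" for A
    by auto
  have iso_d: "is_iso C (d A)" for A
  proof (rule iso_reflect[OF F])
    show "\<exists>f\<in>Hom C A B. ar F f = g" if "g \<in> Hom C (ob F A) (ob F B)" for A B g using full that .
    show "f = g" if "f \<in> Hom C A B" "g \<in> Hom C A B" "ar F f = ar F g" for A B f g using faithful that .
  qed (simp_all add: iso_e)
  have GF: "naturally_isomorphic C (comp_endo G F) id_endo"
    unfolding naturally_isomorphic_def
  proof (rule exI[of _ d], intro conjI allI ballI)
    show "d B \<cdot> ar (comp_endo G F) f = ar id_endo f \<cdot> d A" if "f \<in> Hom C A B" for A B f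
      by (rule faithful[of _ "K (ob F A)" B]) (use that in \<open>auto simp: comp_endo_def id_endo_def\<close>)
  qed (auto simp: comp_endo_def id_endo_def iso_d)
  show ?thesis unfolding autoequivalence_def using F G FG GF by blast
qed

lemma naturally_isomorphic_idE:
  assumes "naturally_isomorphic C (comp_endo G F) id_endo"
  obtains \<eta> where "\<And>A. \<eta> A \<in> Hom C (ob G (ob F A)) A" "\<And>A. is_iso C (\<eta> A)"
    "\<And>A B f. f \<in> Hom C A B \<Longrightarrow> \<eta> B \<cdot> ar G (ar F f) = f \<cdot> \<eta> A"
proof -
  obtain \<eta> where *: "\<forall>A. \<eta> A \<in> Hom C (ob G (ob F A)) A \<and> is_iso C (\<eta> A)"
    "\<forall>A B. \<forall>f\<in>Hom C A B. \<eta> B \<cdot> ar G (ar F f) = f \<cdot> \<eta> A"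
    using assms unfolding naturally_isomorphic_def comp_endo_def id_endo_def endo.select_convs o_apply id_apply
    by blast
  show thesis
    by (rule that[of \<eta>]) (use * in \<open>simp_all add: comp_endo_def id_endo_def\<close>)
qed

lemma faithful_of_retract:
  assumes "endofunctor C F" "endofunctor C G" "naturally_isomorphic C (comp_endo G F) id_endo"
    and f: "f \<in> Hom C A B" "g \<in> Hom C A B" "ar F f = ar F g"
  shows "f = g"
proof -
  from assms(3) obtain \<eta> where "\<And>A. \<eta> A \<in> Hom C (ob G (ob F A)) A" "\<And>A. is_iso C (\<eta> A)"
      "\<And>A B f. f \<in> Hom C A B \<Longrightarrow> \<eta> B \<cdot> ar G (ar F f) = f \<cdot> \<eta> A"
    by (rule naturally_isomorphic_idE) blast
  then have h: "\<And>A. \<eta> A \<in> Hom C (ob G (ob F A)) A \<and> is_iso C (\<eta> A)"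
      "\<And>A B f. f \<in> Hom C A B \<Longrightarrow> \<eta> B \<cdot> ar G (ar F f) = f \<cdot> \<eta> A" by blast+
  from h(1)[of A] obtain k where k: "k \<in> arr C" "src C k = A" "\<eta> A \<in> arr C" "tgt C (\<eta> A) = A"
     "\<eta> A \<cdot> k = ide C A" "tgt C k = src C (\<eta> A)" by (metis Hom_iff is_isoE)
  have "f = (f \<cdot> \<eta> A) \<cdot> k" using f k by simp
  also have "\<dots> = (g \<cdot> \<eta> A) \<cdot> k" using h(2)[of f A B] h(2)[of g A B] f by metis
  also have "\<dots> = g" using f k by simp
  finally show ?thesis .
qed

text \<open>For fullness, the candidate preimage of \<open>g\<close> is \<open>ar G g\<close>
  conjugated by the isomorphisms of \<open>comp_endo G F\<close> with the identity. It is correct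
  after applying \<open>G\<close>, which is faithful because \<open>comp_endo F G\<close> is
  isomorphic to the identity.\<close>

lemma autoequivalenceD:
  assumes "autoequivalence C F"
  shows "endofunctor C F"
    and "f \<in> Hom C A B \<Longrightarrow> g \<in> Hom C A B \<Longrightarrow> ar F f = ar F g \<Longrightarrow> f = g"
    and "g \<in> Hom C (ob F A) (ob F B) \<Longrightarrow> \<exists>f\<in>Hom C A B. ar F f = g"
    and "\<exists>B. isomorphic C (ob F B) A"
proof -
  from assms obtain G where F: "endofunctor C F" and G: "endofunctor C G"
    and n1: "naturally_isomorphic C (comp_endo G F) id_endo"
    and n2: "naturally_isomorphic C (comp_endo F G) id_endo"
    unfolding autoequivalence_def by blast
  note [simp] = endofunctorD[OF F] endofunctorD[OF G]
  show "endofunctor C F" by fact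
  show "f = g" if "f \<in> Hom C A B" "g \<in> Hom C A B" "ar F f = ar F g" for f g A B
    using faithful_of_retract[OF F G n1] that .
  show "\<exists>f\<in>Hom C A B. ar F f = g" if g: "g \<in> Hom C (ob F A) (ob F B)" for g A B
  proof -
    from n1 obtain \<eta> where "\<And>A. \<eta> A \<in> Hom C (ob G (ob F A)) A" "\<And>A. is_iso C (\<eta> A)"
        "\<And>A B f. f \<in> Hom C A B \<Longrightarrow> \<eta> B \<cdot> ar G (ar F f) = f \<cdot> \<eta> A"
      by (rule naturally_isomorphic_idE) blast
    then have h: "\<And>A. \<eta> A \<in> Hom C (ob G (ob F A)) A \<and> is_iso C (\<eta> A)"
        "\<And>A B f. f \<in> Hom C A B \<Longrightarrow> \<eta> B \<cdot> ar G (ar F f) = f \<cdot> \<eta> A" by blast+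
    from h(1) have h1 [simp]: "\<eta> A \<in> arr C" "src C (\<eta> A) = ob G (ob F A)" "tgt C (\<eta> A) = A" for A by auto
    have "\<exists>k. k \<in> arr C \<and> src C k = A \<and> tgt C k = ob G (ob F A) \<and> k \<cdot> \<eta> A = ide C (ob G (ob F A))
      \<and> \<eta> A \<cdot> k = ide C A" for A
      using h(1)[of A] by (metis Hom_iff is_isoE)
    then obtain k where k [simp]: "\<And>A. k A \<in> arr C" "\<And>A. src C (k A) = A" "\<And>A. tgt C (k A) = ob G (ob F A)"
      "\<And>A. k A \<cdot> \<eta> A = ide C (ob G (ob F A))" "\<And>A. \<eta> A \<cdot> k A = ide C A" by metis
    note [simp] = k(4)[THEN cmp_eq_assoc] k(5)[THEN cmp_eq_assoc]
    define f where "f = \<eta> B \<cdot> (ar G g \<cdot> k A)"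
    have f: "f \<in> Hom C A B" using g by (simp add: f_def)
    have "ar G (ar F f) = k B \<cdot> (\<eta> B \<cdot> ar G (ar F f))" using f by simp
    also have "\<dots> = ar G g" using g by (simp add: h(2)[OF f]) (simp add: f_def)
    finally have "ar F f = g"
      using faithful_of_retract[OF G F n2, of "ar F f" "ob F A" "ob F B" g] f g by auto
    then show ?thesis using f by blast
  qed
  show "\<exists>B. isomorphic C (ob F B) A"
    using n2 unfolding naturally_isomorphic_def isomorphic_def
    by (auto simp: comp_endo_def id_endo_def simp del: Hom_iff)
qed

end

section \<open>Mapping cones: transport along isomorphisms, and cones over zero sequences\<close>

context seq_functor
begin

text \<open>The component following position \<open>j\<close>, which is \<open>T\<close> of the
  first one once the sequence has ended. It makes the closing square an instance of the general
  one.\<close>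

abbreviation nxt :: "(nat \<Rightarrow> 'b) \<Rightarrow> nat \<Rightarrow> 'b" where
  "nxt \<phi> j \<equiv> (if j \<le> n then \<phi> (Suc j) else ar T (\<phi> 0))"

lemma nxt_simps:
  assumes "mor f g \<phi>" "j \<le> Suc n"
  shows "nxt \<phi> j \<in> arr C" "src C (nxt \<phi> j) = tgt C (f j)" "tgt C (nxt \<phi> j) = tgt C (g j)"
    "nxt \<phi> j \<cdot> f j = g j \<cdot> \<phi> j"
    "x \<in> arr C \<Longrightarrow> tgt C x = src C (f j) \<Longrightarrow> nxt \<phi> j \<cdot> (f j \<cdot> x) = g j \<cdot> (\<phi> j \<cdot> x)"
proof -
  note [simp] = mor_simps[OF assms(1)] nseqD[OF nseq_morphismD(1)[OF assms(1)]] nseqD[OF nseq_morphismD(2)[OF assms(1)]]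
  consider "j \<le> n" | "j = Suc n" using assms(2) by linarith
  note c = this
  show "nxt \<phi> j \<in> arr C" "src C (nxt \<phi> j) = tgt C (f j)" "tgt C (nxt \<phi> j) = tgt C (g j)"
    "nxt \<phi> j \<cdot> f j = g j \<cdot> \<phi> j"
    "x \<in> arr C \<Longrightarrow> tgt C x = src C (f j) \<Longrightarrow> nxt \<phi> j \<cdot> (f j \<cdot> x) = g j \<cdot> (\<phi> j \<cdot> x)"
    by (rule c; simp)+
qed

lemma nxt_inv:
  assumes "mor f g \<phi>" "mor g f \<psi>" "\<And>i. i \<le> Suc n \<Longrightarrow> \<psi> i \<cdot> \<phi> i = ide C (src C (f i))" "j \<le> Suc n"
  shows "nxt \<psi> j \<cdot> nxt \<phi> j = ide C (tgt C (f j))"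
proof -
  note [simp] = mor_simps[OF assms(1)] mor_simps[OF assms(2)]
    nseqD[OF nseq_morphismD(1)[OF assms(1)]] nseqD[OF nseq_morphismD(2)[OF assms(1)]]
  consider "j \<le> n" | "j = Suc n" using assms(4) by linarith
  then show ?thesis by cases (simp_all add: assms(3) flip: ar_cmp)
qed

lemma coneE:
  assumes "mapping_cone n C T f g \<phi> h"
  obtains i1 i2 p1 p2 where "sq h"
    "\<And>j. j \<le> Suc n \<Longrightarrow> biproduct C (tgt C (f j)) (src C (g j)) (src C (h j)) (i1 j) (i2 j) (p1 j) (p2 j)"
    "\<And>j. j \<le> n \<Longrightarrow> p1 (Suc j) \<cdot> (h j \<cdot> i1 j) = mneg C (f (Suc j))"
    "\<And>j. j \<le> n \<Longrightarrow> p1 (Suc j) \<cdot> (h j \<cdot> i2 j) = mzero C (src C (g j)) (tgt C (f (Suc j)))"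
    "\<And>j. j \<le> n \<Longrightarrow> p2 (Suc j) \<cdot> (h j \<cdot> i1 j) = \<phi> (Suc j)"
    "\<And>j. j \<le> n \<Longrightarrow> p2 (Suc j) \<cdot> (h j \<cdot> i2 j) = g j"
    "ar T (p1 0) \<cdot> (h (Suc n) \<cdot> i1 (Suc n)) = mneg C (ar T (f 0))"
    "ar T (p1 0) \<cdot> (h (Suc n) \<cdot> i2 (Suc n)) = mzero C (src C (g (Suc n))) (ob T (tgt C (f 0)))"
    "ar T (p2 0) \<cdot> (h (Suc n) \<cdot> i1 (Suc n)) = ar T (\<phi> 0)"
    "ar T (p2 0) \<cdot> (h (Suc n) \<cdot> i2 (Suc n)) = g (Suc n)"
proof -
  from assms obtain i1 i2 p1 p2 where *: "sq h"
    "\<And>j. j \<le> Suc n \<Longrightarrow> biproduct C (tgt C (f j)) (src C (g j)) (src C (h j)) (i1 j) (i2 j) (p1 j) (p2 j)"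
    "\<And>j. j \<le> n \<Longrightarrow> has_matrix C (i1 j) (i2 j) (p1 (Suc j)) (p2 (Suc j)) (h j)
         (mneg C (f (Suc j))) (\<phi> (Suc j)) (g j)"
    "has_matrix C (i1 (Suc n)) (i2 (Suc n)) (ar T (p1 0)) (ar T (p2 0)) (h (Suc n))
         (mneg C (ar T (f 0))) (ar T (\<phi> 0)) (g (Suc n))"
    unfolding mapping_cone_def by auto
  have b: "i2 j \<in> arr C" "src C (i2 j) = src C (g j)" "p1 j \<in> arr C" "tgt C (p1 j) = tgt C (f j)" if "j \<le> Suc n" for j
    using biproductD[OF *(2)[OF that]] by simp_all
  show thesis
    by (rule that[of i1 i2 p1 p2]) (use * b in \<open>simp_all add: has_matrix_def\<close>)
qed

lemma coneI:
  assumes "sq h"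
    "\<And>j. j \<le> Suc n \<Longrightarrow> biproduct C (tgt C (f j)) (src C (g j)) (src C (h j)) (i1 j) (i2 j) (p1 j) (p2 j)"
    "\<And>j. j \<le> n \<Longrightarrow> p1 (Suc j) \<cdot> (h j \<cdot> i1 j) = mneg C (f (Suc j))"
    "\<And>j. j \<le> n \<Longrightarrow> p1 (Suc j) \<cdot> (h j \<cdot> i2 j) = mzero C (src C (g j)) (tgt C (f (Suc j)))"
    "\<And>j. j \<le> n \<Longrightarrow> p2 (Suc j) \<cdot> (h j \<cdot> i1 j) = \<phi> (Suc j)"
    "\<And>j. j \<le> n \<Longrightarrow> p2 (Suc j) \<cdot> (h j \<cdot> i2 j) = g j"
    "ar T (p1 0) \<cdot> (h (Suc n) \<cdot> i1 (Suc n)) = mneg C (ar T (f 0))"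
    "ar T (p1 0) \<cdot> (h (Suc n) \<cdot> i2 (Suc n)) = mzero C (src C (g (Suc n))) (ob T (tgt C (f 0)))"
    "ar T (p2 0) \<cdot> (h (Suc n) \<cdot> i1 (Suc n)) = ar T (\<phi> 0)"
    "ar T (p2 0) \<cdot> (h (Suc n) \<cdot> i2 (Suc n)) = g (Suc n)"
  shows "mapping_cone n C T f g \<phi> h"
proof -
  have b: "i2 j \<in> arr C \<and> src C (i2 j) = src C (g j) \<and> p1 j \<in> arr C \<and> tgt C (p1 j) = tgt C (f j)" if "j \<le> Suc n" for j
    using biproductD[OF assms(2)[OF that]] by simp
  show ?thesis
    unfolding mapping_cone_def has_matrix_def
    using assms b by (intro conjI exI[of _ i1] exI[of _ i2] exI[of _ p1] exI[of _ p2]) simp_all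
qed

text \<open>The same sequence \<open>h\<close> serves as a cone for isomorphic data; only the
  injections and projections of its biproducts are composed with the isomorphisms.\<close>

lemma cone_iso:
  assumes t: "mor f' f \<theta>" "mor f f' \<theta>'" "\<And>i. i \<le> Suc n \<Longrightarrow> \<theta>' i \<cdot> \<theta> i = ide C (src C (f' i))"
      "\<And>i. i \<le> Suc n \<Longrightarrow> \<theta> i \<cdot> \<theta>' i = ide C (src C (f i))"
    and z: "mor g' g \<zeta>" "mor g g' \<zeta>'" "\<And>i. i \<le> Suc n \<Longrightarrow> \<zeta>' i \<cdot> \<zeta> i = ide C (src C (g' i))"
      "\<And>i. i \<le> Suc n \<Longrightarrow> \<zeta> i \<cdot> \<zeta>' i = ide C (src C (g i))"
    and p: "mor f g \<psi>" and c: "mapping_cone n C T f g \<psi> h"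
  shows "mapping_cone n C T f' g' (\<lambda>i. \<zeta>' i \<cdot> (\<psi> i \<cdot> \<theta> i)) h"
proof -
  from c obtain i1 i2 p1 p2 where h: "sq h"
    "\<And>j. j \<le> Suc n \<Longrightarrow> biproduct C (tgt C (f j)) (src C (g j)) (src C (h j)) (i1 j) (i2 j) (p1 j) (p2 j)"
    "\<And>j. j \<le> n \<Longrightarrow> p1 (Suc j) \<cdot> (h j \<cdot> i1 j) = mneg C (f (Suc j))"
    "\<And>j. j \<le> n \<Longrightarrow> p1 (Suc j) \<cdot> (h j \<cdot> i2 j) = mzero C (src C (g j)) (tgt C (f (Suc j)))"
    "\<And>j. j \<le> n \<Longrightarrow> p2 (Suc j) \<cdot> (h j \<cdot> i1 j) = \<psi> (Suc j)"
    "\<And>j. j \<le> n \<Longrightarrow> p2 (Suc j) \<cdot> (h j \<cdot> i2 j) = g j"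
    "ar T (p1 0) \<cdot> (h (Suc n) \<cdot> i1 (Suc n)) = mneg C (ar T (f 0))"
    "ar T (p1 0) \<cdot> (h (Suc n) \<cdot> i2 (Suc n)) = mzero C (src C (g (Suc n))) (ob T (tgt C (f 0)))"
    "ar T (p2 0) \<cdot> (h (Suc n) \<cdot> i1 (Suc n)) = ar T (\<psi> 0)"
    "ar T (p2 0) \<cdot> (h (Suc n) \<cdot> i2 (Suc n)) = g (Suc n)"
    by (rule coneE) blast
  define t1 t1' where "t1 = nxt \<theta>" and "t1' = nxt \<theta>'"
  have [simp]: "j \<le> Suc n \<Longrightarrow> t1 j \<in> arr C" "j \<le> Suc n \<Longrightarrow> src C (t1 j) = tgt C (f' j)"
    "j \<le> Suc n \<Longrightarrow> tgt C (t1 j) = tgt C (f j)" for j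
    unfolding t1_def by (rule nxt_simps[OF t(1)]; assumption)+
  have [simp]: "j \<le> Suc n \<Longrightarrow> t1' j \<in> arr C" "j \<le> Suc n \<Longrightarrow> src C (t1' j) = tgt C (f j)"
    "j \<le> Suc n \<Longrightarrow> tgt C (t1' j) = tgt C (f' j)" "j \<le> Suc n \<Longrightarrow> t1' j \<cdot> f j = f' j \<cdot> \<theta>' j"
    "j \<le> Suc n \<Longrightarrow> x \<in> arr C \<Longrightarrow> tgt C x = src C (f j) \<Longrightarrow> t1' j \<cdot> (f j \<cdot> x) = f' j \<cdot> (\<theta>' j \<cdot> x)" for j x
    unfolding t1'_def by (rule nxt_simps[OF t(2)]; assumption)+
  note [simp] = mor_simps(1-3)[OF t(1)] mor_simps(1-3)[OF t(2)]
    mor_simps(1-3)[OF z(1)] mor_simps[OF z(2)] mor_simps[OF p] t(3,4) z(3,4)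
    t(3)[THEN cmp_eq_assoc] t(4)[THEN cmp_eq_assoc] z(3)[THEN cmp_eq_assoc] z(4)[THEN cmp_eq_assoc]
    nseqD[OF nseq_morphismD(1)[OF t(1)]] nseqD[OF nseq_morphismD(2)[OF t(1)]]
    nseqD[OF nseq_morphismD(1)[OF z(1)]] nseqD[OF nseq_morphismD(2)[OF z(1)]] nseqD[OF h(1)]
    biproduct_simps[OF h(2)]
  have t3 [simp]: "j \<le> Suc n \<Longrightarrow> t1' j \<cdot> t1 j = ide C (tgt C (f' j))"
    "j \<le> Suc n \<Longrightarrow> t1 j \<cdot> t1' j = ide C (tgt C (f j))" for j
    unfolding t1_def t1'_def by (rule nxt_inv[OF t(1,2,3)] nxt_inv[OF t(2,1,4)]; assumption)+
  note [simp] = t3[THEN cmp_eq_assoc]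
  have t1 [simp]: "j \<le> n \<Longrightarrow> t1 j = \<theta> (Suc j)" "t1 (Suc n) = ar T (\<theta> 0)" for j
    by (simp_all add: t1_def)
  have [simp]: "f' j \<cdot> (\<theta>' j \<cdot> \<theta> j) = f' j" if "j \<le> Suc n" for j using that by simp
  note hs = h(3)[THEN cmp_eq_assoc3] h(4)[THEN cmp_eq_assoc3] h(5)[THEN cmp_eq_assoc3] h(6)[THEN cmp_eq_assoc3]
    h(7)[THEN cmp_eq_assoc3] h(8)[THEN cmp_eq_assoc3] h(9)[THEN cmp_eq_assoc3] h(10)[THEN cmp_eq_assoc3]
  have T0: "ar T (t1' 0) \<cdot> (ar T (f 0) \<cdot> t1 (Suc n)) = ar T (f' 0)"
  proof -
    have "ar T (t1' 0 \<cdot> (f 0 \<cdot> \<theta> 0)) = ar T (f' 0)" by simp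
    moreover have "ar T (t1' 0 \<cdot> (f 0 \<cdot> \<theta> 0)) = ar T (t1' 0) \<cdot> (ar T (f 0) \<cdot> t1 (Suc n))"
      by (subst ar_cmp; (subst ar_cmp)?; simp)
    ultimately show ?thesis by simp
  qed
  show ?thesis
  proof (rule coneI[where ?i1.0 = "\<lambda>j. i1 j \<cdot> t1 j" and ?i2.0 = "\<lambda>j. i2 j \<cdot> \<zeta> j" and ?p1.0 = "\<lambda>j. t1' j \<cdot> p1 j"
        and ?p2.0 = "\<lambda>j. \<zeta>' j \<cdot> p2 j"])
    fix j assume j: "j \<le> Suc n"
    have "(i1 j \<cdot> (t1 j \<cdot> (t1' j \<cdot> p1 j))) \<oplus> (i2 j \<cdot> (\<zeta> j \<cdot> (\<zeta>' j \<cdot> p2 j))) = ide C (src C (h j))"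
      using biproductD(17)[OF h(2)[OF j]] j by (simp del: t1)
    then show "biproduct C (tgt C (f' j)) (src C (g' j)) (src C (h j)) (i1 j \<cdot> t1 j) (i2 j \<cdot> \<zeta> j)
          (t1' j \<cdot> p1 j) (\<zeta>' j \<cdot> p2 j)"
      using j by (simp add: biproduct_def del: t1)
  qed (simp_all add: h(1) hs T0 del: t1(2), simp add: t1)
qed

text \<open>Right angles are known only up to isomorphism with standard ones, so F4 is proved for
  the latter and transported. \<open>R\<close> stands for the class that has to contain the
  cone.\<close>

lemma F4_iso:
  assumes f: "siso f' f" and g: "siso g' g"
    and F4: "\<And>a b. a \<in> Hom C (src C (f 0)) (src C (g 0)) \<Longrightarrow> b \<in> Hom C (src C (f 1)) (src C (g 1)) \<Longrightarrow>
      b \<cdot> f 0 = g 0 \<cdot> a \<Longrightarrow> \<exists>\<phi> h. mor f g \<phi> \<and> \<phi> 0 = a \<and> \<phi> 1 = b \<and> mapping_cone n C T f g \<phi> h \<and> h \<in> R"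
    and a: "a \<in> Hom C (src C (f' 0)) (src C (g' 0))" "b \<in> Hom C (src C (f' 1)) (src C (g' 1))" "b \<cdot> f' 0 = g' 0 \<cdot> a"
  shows "\<exists>\<phi> h. mor f' g' \<phi> \<and> \<phi> 0 = a \<and> \<phi> 1 = b \<and> mapping_cone n C T f' g' \<phi> h \<and> h \<in> R"
proof -
  from f obtain \<theta> \<theta>' where t: "mor f' f \<theta>" "mor f f' \<theta>'" "\<And>i. i \<le> Suc n \<Longrightarrow> \<theta>' i \<cdot> \<theta> i = ide C (src C (f' i))"
      "\<And>i. i \<le> Suc n \<Longrightarrow> \<theta> i \<cdot> \<theta>' i = ide C (src C (f i))" by (rule sisoE) blast
  from g obtain \<zeta> \<zeta>' where z: "mor g' g \<zeta>" "mor g g' \<zeta>'" "\<And>i. i \<le> Suc n \<Longrightarrow> \<zeta>' i \<cdot> \<zeta> i = ide C (src C (g' i))"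
      "\<And>i. i \<le> Suc n \<Longrightarrow> \<zeta> i \<cdot> \<zeta>' i = ide C (src C (g i))" by (rule sisoE) blast
  note [simp] = mor_simps[OF t(1)] mor_simps[OF t(2)] mor_simps[OF z(1)] mor_simps[OF z(2)] t(3,4) z(3,4)
    t(3)[THEN cmp_eq_assoc] z(3)[THEN cmp_eq_assoc] t(4)[THEN cmp_eq_assoc] z(4)[THEN cmp_eq_assoc]
    nseqD[OF nseq_morphismD(1)[OF t(1)]] nseqD[OF nseq_morphismD(2)[OF t(1)]]
    nseqD[OF nseq_morphismD(1)[OF z(1)]] nseqD[OF nseq_morphismD(2)[OF z(1)]]
  have [simp]: "a \<in> arr C" "src C a = src C (f' 0)" "tgt C a = src C (g' 0)" "b \<in> arr C"
    "src C b = src C (f' (Suc 0))" "tgt C b = src C (g' (Suc 0))" using a by simp_all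
  have "\<exists>\<phi> h. mor f g \<phi> \<and> \<phi> 0 = \<zeta> 0 \<cdot> (a \<cdot> \<theta>' 0) \<and> \<phi> 1 = \<zeta> 1 \<cdot> (b \<cdot> \<theta>' 1) \<and> mapping_cone n C T f g \<phi> h \<and> h \<in> R"
  proof (rule F4)
    have "\<zeta> 1 \<cdot> (b \<cdot> \<theta>' 1) \<cdot> f 0 = \<zeta> 1 \<cdot> (b \<cdot> f' 0) \<cdot> \<theta>' 0" by simp
    also have "\<dots> = g 0 \<cdot> (\<zeta> 0 \<cdot> (a \<cdot> \<theta>' 0))" unfolding a(3) by simp
    finally show "(\<zeta> 1 \<cdot> (b \<cdot> \<theta>' 1)) \<cdot> f 0 = g 0 \<cdot> (\<zeta> 0 \<cdot> (a \<cdot> \<theta>' 0))" by simp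
  qed simp_all
  then obtain \<phi> h where p: "mor f g \<phi>" "\<phi> 0 = \<zeta> 0 \<cdot> (a \<cdot> \<theta>' 0)" "\<phi> (Suc 0) = \<zeta> 1 \<cdot> (b \<cdot> \<theta>' 1)"
    "mapping_cone n C T f g \<phi> h" "h \<in> R" by auto
  show ?thesis
    by (rule exI[of _ "\<lambda>i. \<zeta>' i \<cdot> (\<phi> i \<cdot> \<theta> i)"], rule exI[of _ h])
      (use mor_cmp[OF mor_cmp[OF t(1) p(1)] z(2)] cone_iso[OF t z p(1) p(4)] p(2,3,5) in simp_all)
qed

text \<open>The isomorphism consists of the projections with the signs \<open>(-1)\<^sup>j\<close>.\<close>

lemma cone_zero_rot:
  assumes c: "mapping_cone n C T f g \<phi> h" and f: "sq f"
    and z: "\<And>j. j \<le> Suc n \<Longrightarrow> zero_object C (src C (g j))"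
  shows "siso h (rot f)"
proof -
  from c obtain i1 i2 p1 p2 where h: "sq h"
    "\<And>j. j \<le> Suc n \<Longrightarrow> biproduct C (tgt C (f j)) (src C (g j)) (src C (h j)) (i1 j) (i2 j) (p1 j) (p2 j)"
    "\<And>j. j \<le> n \<Longrightarrow> p1 (Suc j) \<cdot> (h j \<cdot> i1 j) = mneg C (f (Suc j))"
    "ar T (p1 0) \<cdot> (h (Suc n) \<cdot> i1 (Suc n)) = mneg C (ar T (f 0))"
    by (rule coneE) blast
  note [simp] = nseqD[OF f] nseqD[OF h(1)] biproduct_simps[OF h(2)]
  have [simp]: "i1 j \<cdot> p1 j = ide C (src C (h j))" if j: "j \<le> Suc n" for j
  proof -
    have "i2 j \<cdot> p2 j = mzero C (src C (h j)) (src C (h j))"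
      using zero_objectD(1)[OF z[OF j], of "p2 j"] j by simp
    then show ?thesis using biproductD(17)[OF h(2)[OF j]] j by simp
  qed
  have h1: "p1 (Suc j) \<cdot> h j = mneg C (f (Suc j) \<cdot> p1 j)" if "j \<le> n" for j
  proof -
    have "p1 (Suc j) \<cdot> h j = p1 (Suc j) \<cdot> (h j \<cdot> (i1 j \<cdot> p1 j))" using that by simp
    also have "\<dots> = (p1 (Suc j) \<cdot> (h j \<cdot> i1 j)) \<cdot> p1 j" using that by (simp del: \<open>\<And>j. j \<le> Suc n \<Longrightarrow> i1 j \<cdot> p1 j = ide C (src C (h j))\<close>)
    finally show ?thesis using that by (simp add: h(3) del: assoc)
  qed
  have h2: "ar T (p1 0) \<cdot> h (Suc n) = mneg C (ar T (f 0) \<cdot> p1 (Suc n))"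
  proof -
    have "ar T (p1 0) \<cdot> h (Suc n) = ar T (p1 0) \<cdot> (h (Suc n) \<cdot> (i1 (Suc n) \<cdot> p1 (Suc n)))" by simp
    also have "\<dots> = (ar T (p1 0) \<cdot> (h (Suc n) \<cdot> i1 (Suc n))) \<cdot> p1 (Suc n)" by (simp del: \<open>\<And>j. j \<le> Suc n \<Longrightarrow> i1 j \<cdot> p1 j = ide C (src C (h j))\<close>)
    finally show ?thesis by (simp add: h(4) del: assoc)
  qed
  have m: "mor h (rot f) (\<lambda>j. sgn_mor C j (p1 j))"
  proof (rule nseq_morphismI)
    show "sgn_mor C i (p1 i) \<in> Hom C (src C (h i)) (src C (rot f i))" if "i \<le> Suc n" for i
    proof -
      consider "i \<le> n" | "i = Suc n" using \<open>i \<le> Suc n\<close> by linarith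
      then show ?thesis by cases (simp_all add: rotate_nseq_sgn)
    qed
    show "sgn_mor C (Suc i) (p1 (Suc i)) \<cdot> h i = rot f i \<cdot> sgn_mor C i (p1 i)" if "i \<le> n" for i
      using that by (simp add: rotate_nseq_sgn h1) (simp add: sgn_mor_def)
    \<comment> \<open>The sign (-1)^n of the rotation and the sign (-1)^(n+1) of the last component
      multiply to the -1 in the cone.\<close>
    show "ar T (sgn_mor C 0 (p1 0)) \<cdot> h (Suc n) = rot f (Suc n) \<cdot> sgn_mor C (Suc n) (p1 (Suc n))"
      using h2 by (simp add: rotate_nseq_sgn) (simp add: sgn_mor_def)
  qed (use h f sq_rot in auto)
  show ?thesis
  proof (rule sisoI[OF m], rule iso_sgn)
    show "is_iso C (p1 i)" if "i \<le> Suc n" for i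
      by (rule is_isoI[of _ "i1 i"]) (use that in simp_all)
  qed
qed

end

section \<open>Idempotents and exactness of angles\<close>

context preadditive_category
begin

lemma add_cancel_far [simp]:
  assumes "f \<in> arr C" "g \<in> arr C" "h \<in> arr C" "src C f = src C g" "src C g = src C h"
    "tgt C f = tgt C g" "tgt C g = tgt C h"
  shows "f \<oplus> (g \<oplus> (mneg C f \<oplus> h)) = g \<oplus> h" "mneg C f \<oplus> (g \<oplus> (f \<oplus> h)) = g \<oplus> h"
    "f \<oplus> (g \<oplus> (h \<oplus> mneg C f)) = g \<oplus> h" "mneg C f \<oplus> (g \<oplus> (h \<oplus> f)) = g \<oplus> h"
proof -
  show 1: "f \<oplus> (g \<oplus> (mneg C f \<oplus> h)) = g \<oplus> h" "mneg C f \<oplus> (g \<oplus> (f \<oplus> h)) = g \<oplus> h"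
    using assms add_left_commute[of g "mneg C f" h] add_left_commute[of g f h] by simp_all
  show "f \<oplus> (g \<oplus> (h \<oplus> mneg C f)) = g \<oplus> h" "mneg C f \<oplus> (g \<oplus> (h \<oplus> f)) = g \<oplus> h"
    using assms 1 add_commute[of h "mneg C f"] add_commute[of h f] by simp_all
qed

lemma eq_diffI:
  assumes "f = g \<oplus> h" "g \<in> arr C" "h \<in> arr C" "src C g = src C h" "tgt C g = tgt C h"
  shows "h = f \<oplus> mneg C g"
  using assms by simp

definition splits :: "'b \<Rightarrow> bool" where
  "splits e \<longleftrightarrow> (\<exists>Z. \<exists>\<zeta>\<in>Hom C Z (src C e). \<exists>\<rho>\<in>Hom C (src C e) Z. \<rho> \<cdot> \<zeta> = ide C Z \<and> \<zeta> \<cdot> \<rho> = e)"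

lemma splitsI:
  assumes "\<zeta> \<in> Hom C Z (src C e)" "\<rho> \<in> Hom C (src C e) Z" "\<rho> \<cdot> \<zeta> = ide C Z" "\<zeta> \<cdot> \<rho> = e"
  shows "splits e"
  using assms unfolding splits_def by blast

lemma splitsE:
  assumes "splits e"
  obtains Z \<zeta> \<rho> where "\<zeta> \<in> Hom C Z (src C e)" "\<rho> \<in> Hom C (src C e) Z" "\<rho> \<cdot> \<zeta> = ide C Z" "\<zeta> \<cdot> \<rho> = e"
  using assms unfolding splits_def by blast

end

context additive_category
begin

text \<open>An idempotent of \<open>A \<oplus> B\<close> whose \<open>(A, A)\<close>-entry is invertible contains a copy of \<open>A\<close> in its
  image, and the rest of it is an idempotent of \<open>B\<close>.\<close>

lemma splits_step:
  assumes P: "biproduct C A B P iA iB pA pB"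
    and e: "e \<in> Hom C P P" "e \<cdot> e = e" and u: "is_iso C (pA \<cdot> (e \<cdot> iA))"
    and IH: "\<And>e. e \<in> Hom C B B \<Longrightarrow> e \<cdot> e = e \<Longrightarrow> splits e"
  shows "splits e" "splits (ide C P \<oplus> mneg C e)"
proof -
  note [simp] = biproduct_simps[OF P]
  have e1 [simp]: "e \<in> arr C" "src C e = P" "tgt C e = P" "e \<cdot> e = e" using e by auto
  note [simp] = e1(4)[THEN cmp_eq_assoc]
  obtain v where v [simp]: "v \<in> arr C" "src C v = A" "tgt C v = A" "pA \<cdot> (e \<cdot> (iA \<cdot> v)) = ide C A"
    using u by (rule is_isoE) simp
  define j r where "j = e \<cdot> (iA \<cdot> v)" and "r = pA \<cdot> e"
  have j [simp]: "j \<in> arr C" "src C j = A" "tgt C j = P" "r \<in> arr C" "src C r = P" "tgt C r = A"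
    "r \<cdot> j = ide C A" "pA \<cdot> j = ide C A" "e \<cdot> j = j" "r \<cdot> e = r"
    unfolding j_def r_def by simp_all
  note [simp] = j(7-10)[THEN cmp_eq_assoc]
  \<comment> \<open>Together with the new inclusion \<open>j\<close> and projection \<open>r\<close>
    of \<open>A\<close> these form a second biproduct structure on \<open>P\<close>. Since
    \<open>e \<cdot> j = j\<close> and \<open>r \<cdot> e = r\<close>, in this structure
    \<open>e\<close> is the identity of \<open>A\<close> plus an idempotent of
    \<open>B\<close>.\<close>
  define b c where "b = iB \<oplus> mneg C (j \<cdot> (r \<cdot> iB))" and "c = pB \<oplus> mneg C (pB \<cdot> (j \<cdot> pA))"
  have [simp]: "b \<in> arr C" "src C b = B" "tgt C b = P" "c \<in> arr C" "src C c = P" "tgt C c = B"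
    unfolding b_def c_def by simp_all
  have b1: "biproduct C A B P j b r c"
  proof -
    have jB: "iB \<cdot> (pB \<cdot> j) = j \<oplus> mneg C iA"
      by (rule eq_diffI) (use biproduct_split(2)[OF P, of j] in simp_all)
    have "r \<cdot> b = mzero C B A" "c \<cdot> j = mzero C A B" "c \<cdot> b = ide C B" unfolding b_def c_def by simp_all
    moreover have "(j \<cdot> r) \<oplus> (b \<cdot> c) = ide C P"
    proof (rule biproduct_eqI(1)[OF P])
      have "c \<cdot> iA = mneg C (pB \<cdot> j)" unfolding c_def by simp
      then have "b \<cdot> (c \<cdot> iA) = mneg C (iB \<cdot> (pB \<cdot> j)) \<oplus> (j \<cdot> (r \<cdot> (iB \<cdot> (pB \<cdot> j))))"
        unfolding b_def by simp
      also have "\<dots> = iA \<oplus> mneg C (j \<cdot> (r \<cdot> iA))"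
        unfolding jB by simp
      finally show "((j \<cdot> r) \<oplus> (b \<cdot> c)) \<cdot> iA = ide C P \<cdot> iA" by simp
      have "c \<cdot> iB = ide C B" unfolding c_def by simp
      then show "((j \<cdot> r) \<oplus> (b \<cdot> c)) \<cdot> iB = ide C P \<cdot> iB" by (simp add: b_def)
    qed simp_all
    ultimately show ?thesis by (simp add: biproduct_def)
  qed
  note [simp] = biproduct_simps[OF b1]
  have bc: "b \<cdot> c = ide C P \<oplus> mneg C (j \<cdot> r)"
    by (rule eq_diffI) (use biproductD(17)[OF b1] in simp_all)
  have bc': "b \<cdot> (c \<cdot> x) = x \<oplus> mneg C (j \<cdot> (r \<cdot> x))" if "x \<in> arr C" "tgt C x = P" for x
    using bc[THEN cmp_eq_assoc, of x] that by simp
  define e' where "e' = c \<cdot> (e \<cdot> b)"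
  have e' [simp]: "e' \<in> arr C" "src C e' = B" "tgt C e' = B" unfolding e'_def by simp_all
  have rb [simp]: "r \<cdot> (e \<cdot> x) = r \<cdot> x" if "x \<in> arr C" "tgt C x = P" for x
    using that by (simp flip: assoc)
  have ee: "e' \<cdot> e' = e'" unfolding e'_def by (simp add: bc')
  have be: "b \<cdot> (e' \<cdot> c) = e \<oplus> mneg C (j \<cdot> r)" unfolding e'_def by (simp add: bc' bc)
  have "splits e'" using IH[of e'] ee by simp
  then obtain Z \<zeta> \<rho> where "\<zeta> \<in> Hom C Z (src C e')" "\<rho> \<in> Hom C (src C e') Z" "\<rho> \<cdot> \<zeta> = ide C Z" "\<zeta> \<cdot> \<rho> = e'"
    by (rule splitsE)
  then have z: "\<zeta> \<in> arr C" "src C \<zeta> = Z" "tgt C \<zeta> = B" "\<rho> \<in> arr C" "src C \<rho> = B" "tgt C \<rho> = Z"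
    "\<rho> \<cdot> \<zeta> = ide C Z" "\<zeta> \<cdot> \<rho> = e'" by simp_all
  obtain Q k1 k2 q1 q2 where Q: "biproduct C A Z Q k1 k2 q1 q2"
    using has_direct_sums[of A Z] unfolding direct_sum_def by blast
  show "splits e"
  proof (rule splitsI[where \<zeta> = "(j \<cdot> q1) \<oplus> (b \<cdot> (\<zeta> \<cdot> q2))" and \<rho> = "(k1 \<cdot> r) \<oplus> (k2 \<cdot> (\<rho> \<cdot> c))"])
    note [simp] = biproduct_simps[OF Q] z z(7)[THEN cmp_eq_assoc] z(8)[THEN cmp_eq_assoc]
    show "((k1 \<cdot> r) \<oplus> (k2 \<cdot> (\<rho> \<cdot> c))) \<cdot> ((j \<cdot> q1) \<oplus> (b \<cdot> (\<zeta> \<cdot> q2))) = ide C Q"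
      using biproductD(17)[OF Q] by simp
    show "((j \<cdot> q1) \<oplus> (b \<cdot> (\<zeta> \<cdot> q2))) \<cdot> ((k1 \<cdot> r) \<oplus> (k2 \<cdot> (\<rho> \<cdot> c))) = e"
      by (simp add: be)
  qed (use z in \<open>simp_all add: biproduct_simps[OF Q]\<close>)
  \<comment> \<open>In the complement of \<open>e\<close> the identity of \<open>A\<close> drops
    out, which leaves the complementary idempotent of \<open>B\<close>.\<close>
  define e2 where "e2 = ide C B \<oplus> mneg C e'"
  have e2: "e2 \<in> Hom C B B" "e2 \<cdot> e2 = e2" unfolding e2_def using ee by simp_all
  obtain Y \<xi> \<pi> where "\<xi> \<in> Hom C Y (src C e2)" "\<pi> \<in> Hom C (src C e2) Y" "\<pi> \<cdot> \<xi> = ide C Y" "\<xi> \<cdot> \<pi> = e2"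
    using IH[OF e2] by (rule splitsE)
  then have y: "\<xi> \<in> arr C" "src C \<xi> = Y" "tgt C \<xi> = B" "\<pi> \<in> arr C" "src C \<pi> = B" "tgt C \<pi> = Y"
    "\<pi> \<cdot> \<xi> = ide C Y" "\<xi> \<cdot> \<pi> = e2" using e2(1) by simp_all
  show "splits (ide C P \<oplus> mneg C e)"
  proof (rule splitsI[where \<zeta> = "b \<cdot> \<xi>" and \<rho> = "\<pi> \<cdot> c"])
    note [simp] = y y(7)[THEN cmp_eq_assoc] y(8)[THEN cmp_eq_assoc]
    show "(\<pi> \<cdot> c) \<cdot> (b \<cdot> \<xi>) = ide C Y" by simp
    have "(b \<cdot> \<xi>) \<cdot> (\<pi> \<cdot> c) = b \<cdot> (e2 \<cdot> c)" by simp
    also have "\<dots> = ide C P \<oplus> mneg C e" unfolding e2_def by (simp add: bc be)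
    finally show "(b \<cdot> \<xi>) \<cdot> (\<pi> \<cdot> c) = ide C P \<oplus> mneg C e" .
  qed (use y in simp_all)
qed

text \<open>The \<open>A\<close>-corners of \<open>e\<close> and of its complement add up to the
  identity of the local object \<open>A\<close>, so one of them is invertible. Then
  \<open>splits_step\<close> reduces to \<open>B\<close>, and its second claim passes from the
  complement back to \<open>e\<close>.\<close>

lemma sum_of_locals_splits:
  assumes "sum_of_locals C P" "e \<in> Hom C P P" "e \<cdot> e = e"
  shows "splits e"
  using assms
proof (induction arbitrary: e rule: sum_of_locals.induct)
  case (empty Z)
  have "e = mzero C Z Z" using empty zero_objectD[of Z e] by auto
  then show ?case using empty by (intro splitsI[of "mzero C Z Z" Z _ "mzero C Z Z"]) (auto simp: zero_object_iff)
next
  case (add A B P)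
  then obtain iA iB pA pB where P: "biproduct C A B P iA iB pA pB" unfolding direct_sum_def by blast
  note [simp] = biproduct_simps[OF P]
  have [simp]: "e \<in> arr C" "src C e = P" "tgt C e = P" "e \<cdot> e = e" using add.prems by auto
  define e2 where "e2 = ide C P \<oplus> mneg C e"
  have e2: "e2 \<in> Hom C P P" "e2 \<cdot> e2 = e2" unfolding e2_def by simp_all
  have "(pA \<cdot> (e \<cdot> iA)) \<oplus> (pA \<cdot> (e2 \<cdot> iA)) = ide C A" unfolding e2_def by simp
  then have "is_iso C (pA \<cdot> (e \<cdot> iA)) \<or> is_iso C (pA \<cdot> (e2 \<cdot> iA))"
    using add.hyps(1) e2(1) unfolding local_End_def by (metis (no_types, lifting) Hom_iff \<open>e \<in> arr C\<close> \<open>src C e = P\<close> \<open>tgt C e = P\<close> arr_cmp biproductD(1-3,7-9)[OF P] iso_ide)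
  then show ?case
  proof
    assume "is_iso C (pA \<cdot> (e \<cdot> iA))"
    then show ?thesis using splits_step(1)[OF P add.prems] add.IH by blast
  next
    assume u: "is_iso C (pA \<cdot> (e2 \<cdot> iA))"
    have "splits (ide C P \<oplus> mneg C e2)" by (rule splits_step(2)[OF P e2 u]) (rule add.IH)
    then show ?thesis unfolding e2_def by simp
  qed
qed

end

text \<open>This part of the axioms suffices for exactness of angles. It is separated because it is
  verified for the quotient before closure under summands, so the exactness lemmas below serve
  \<open>C\<close> and the quotient alike.\<close>

locale pre_angulation = seq_functor C T n + additive_category C
  for C :: "('o, 'm, 'z) precat_scheme" (structure) and T :: "('o, 'm) endo" and n :: nat +
  fixes \<Theta> :: "(nat \<Rightarrow> 'm) set"
  assumes n1: "1 \<le> n"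
    and full: "y \<in> Hom C (ob T A) (ob T B) \<Longrightarrow> \<exists>x\<in>Hom C A B. ar T x = y"
    and faithful: "x \<in> Hom C A B \<Longrightarrow> y \<in> Hom C A B \<Longrightarrow> ar T x = ar T y \<Longrightarrow> x = y"
    and angle_sq: "f \<in> \<Theta> \<Longrightarrow> sq f"
    and angle_iso: "f \<in> \<Theta> \<Longrightarrow> siso f g \<Longrightarrow> g \<in> \<Theta>"
    and angle_trivial: "trivial_nseq n C T A f \<Longrightarrow> f \<in> \<Theta>"
    and angle_rot: "sq f \<Longrightarrow> f \<in> \<Theta> \<longleftrightarrow> rot f \<in> \<Theta>"
    and angle_F3: "f \<in> \<Theta> \<Longrightarrow> g \<in> \<Theta> \<Longrightarrow>
      a \<in> Hom C (src C (f 0)) (src C (g 0)) \<Longrightarrow> b \<in> Hom C (src C (f (Suc 0))) (src C (g (Suc 0))) \<Longrightarrow>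
      b \<cdot> f 0 = g 0 \<cdot> a \<Longrightarrow> \<exists>\<phi>. mor f g \<phi> \<and> \<phi> 0 = a \<and> \<phi> (Suc 0) = b"
begin

text \<open>Isomorphisms of sequences only see positions up to n + 1, so membership in \<Theta> does
  not depend on the remaining values.\<close>

lemma angle_cong:
  assumes "f \<in> \<Theta>" "\<And>i. i \<le> Suc n \<Longrightarrow> g i = f i"
  shows "g \<in> \<Theta>"
proof (rule angle_iso[OF assms(1)])
  note [simp] = nseqD[OF angle_sq[OF assms(1)]] assms(2)
  have g: "sq g" by (rule nseqI) simp_all
  show "siso f g"
    by (rule sisoI[of _ _ "\<lambda>i. ide C (src C (f i))"], rule nseq_morphismI)
      (use g angle_sq[OF assms(1)] in simp_all)
qed

lemma trivial_exists:
  obtains t where "t \<in> \<Theta>" "t 0 = ide C A" "src C (t (Suc 0)) = A"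
    "\<And>i. 2 \<le> i \<Longrightarrow> i \<le> Suc n \<Longrightarrow> zero_object C (src C (t i))"
proof -
  obtain Z where Z: "zero_object C Z" using has_zero_object by blast
  define t where "t i = (if i = 0 then ide C A else if i = 1 then mzero C A Z
    else if i \<le> n then mzero C Z Z else mzero C Z (ob T A))" for i :: nat
  have "sq t" by (rule nseqI) (use n1 in \<open>auto simp: t_def\<close>)
  then have "trivial_nseq n C T A t" using Z unfolding trivial_nseq_def by (auto simp: t_def)
  then show thesis
    by (intro that[of t]) (use angle_trivial Z in \<open>auto simp: t_def\<close>)
qed

lemma cotrivial_exists:
  obtains z where "z \<in> \<Theta>" "zero_object C (src C (z 0))" "src C (z (Suc 0)) = A" "z (Suc 0) = ide C A"
proof -
  obtain Z where Z: "zero_object C Z" using has_zero_object by blast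
  \<comment> \<open>For n = 1 position 2 is already the last one, and its map must end in
    \<open>ob T Z\<close>.\<close>
  define z where "z i = (if i = 0 then mzero C Z A else if i = 1 then ide C A else if i = 2
    then (if n = 1 then mzero C A (ob T Z) else mzero C A Z)
    else if i \<le> n then mzero C Z Z else mzero C Z (ob T Z))" for i :: nat
  have z: "sq z" by (rule nseqI) (use n1 in \<open>auto simp: z_def\<close>)
  have "trivial_nseq n C T A (rot z)"
    unfolding trivial_nseq_def
  proof (intro conjI ballI)
    show "zero_object C (src C (rot z i))" if "i \<in> {2..n+1}" for i
      using that n1 Z ob_zero[OF Z] by (auto simp: rotate_nseq_sgn z_def)
    show "rot z 0 = ide C A" by (simp add: rotate_nseq_sgn z_def)
  qed (use sq_rot[OF z] in simp)
  then have "z \<in> \<Theta>" using angle_trivial angle_rot[OF z] by blast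
  then show thesis
    by (intro that[of z]) (use Z in \<open>auto simp: z_def\<close>)
qed

text \<open>Compare with the trivial angle on the first object: in the morphism extending the
  identity and \<open>f 0\<close>, the component at position 2 starts at a zero object.\<close>

lemma comp_zero_0:
  assumes f: "f \<in> \<Theta>"
  shows "f (Suc 0) \<cdot> f 0 = mzero C (src C (f 0)) (tgt C (f (Suc 0)))"
proof -
  note [simp] = nseqD[OF angle_sq[OF f]]
  obtain t where t: "t \<in> \<Theta>" "t 0 = ide C (src C (f 0))" "src C (t (Suc 0)) = src C (f 0)"
    "\<And>i. 2 \<le> i \<Longrightarrow> i \<le> Suc n \<Longrightarrow> zero_object C (src C (t i))" by (rule trivial_exists) blast
  note tD = nseqD[OF angle_sq[OF t(1)]]
  obtain \<phi> where p: "mor t f \<phi>" "\<phi> 0 = ide C (src C (f 0))" "\<phi> (Suc 0) = f 0"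
    using angle_F3[OF t(1) f, of "ide C (src C (f 0))" "f 0"] t by auto
  have "\<phi> (Suc (Suc 0)) = mzero C (src C (t (Suc (Suc 0)))) (src C (f (Suc (Suc 0))))"
    using zero_objectD(2)[OF t(4)[of 2], of "\<phi> 2"] mor_simps(1-3)[OF p(1), of 2] n1 by (simp add: numeral_2_eq_2)
  then show ?thesis using mor_simps(4)[OF p(1), of "Suc 0"] n1 p(3) tD(4)[of "Suc 0"] tD(3) t(3) by simp
qed

text \<open>Compare with the angle that has a zero object first and the identity as its second map:
  the pair (0, t) extends to a morphism, whose component at position 2 is the factor.\<close>

lemma wcoker_0:
  assumes f: "f \<in> \<Theta>" and t: "t \<in> arr C" "src C t = src C (f (Suc 0))" "t \<cdot> f 0 = mzero C (src C (f 0)) (tgt C t)"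
  shows "\<exists>s\<in>Hom C (tgt C (f (Suc 0))) (tgt C t). t = s \<cdot> f (Suc 0)"
proof -
  note [simp] = nseqD[OF angle_sq[OF f]]
  obtain z where z: "z \<in> \<Theta>" "zero_object C (src C (z 0))" "src C (z (Suc 0)) = tgt C t" "z (Suc 0) = ide C (tgt C t)"
    by (rule cotrivial_exists)
  note [simp] = nseqD[OF angle_sq[OF z(1)]]
  obtain \<phi> where p: "mor f z \<phi>" "\<phi> (Suc 0) = t"
    using angle_F3[OF f z(1), of "mzero C (src C (f 0)) (src C (z 0))" t] t z by auto
  have "\<phi> (Suc (Suc 0)) \<cdot> f (Suc 0) = t" using mor_simps(4)[OF p(1), of "Suc 0"] n1 z p t by simp
  moreover have "\<phi> (Suc (Suc 0)) \<in> Hom C (tgt C (f (Suc 0))) (tgt C t)"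
  proof -
    have "tgt C (z (Suc 0)) = tgt C t" using z(4) by simp
    then show ?thesis using mor_simps(1-3)[OF p(1), of "Suc (Suc 0)"] n1 nseqD(4)[OF angle_sq[OF z(1)], of "Suc 0"]
        nseqD(4)[OF angle_sq[OF f], of "Suc 0"] by simp
  qed
  ultimately show ?thesis by (metis)
qed

text \<open>F3 prescribes components at positions 0 and 1, whereas here \<open>t\<close> sits at
  position 1 and the factor at position 0. So \<open>f\<close> and the trivial angle on the source
  of \<open>t\<close> are rotated first; the factor is then the last component, pulled back along
  the fully faithful \<open>T\<close>.\<close>

lemma wker_0:
  assumes f: "f \<in> \<Theta>" and t: "t \<in> arr C" "tgt C t = src C (f (Suc 0))"
    "f (Suc 0) \<cdot> t = mzero C (src C t) (tgt C (f (Suc 0)))"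
  shows "\<exists>s\<in>Hom C (src C t) (src C (f 0)). t = f 0 \<cdot> s"
proof -
  note [simp] = nseqD[OF angle_sq[OF f]] t(1,2)
  obtain z where z: "z \<in> \<Theta>" "z 0 = ide C (src C t)" "src C (z (Suc 0)) = src C t"
    "\<And>i. 2 \<le> i \<Longrightarrow> i \<le> Suc n \<Longrightarrow> zero_object C (src C (z i))" by (rule trivial_exists) blast
  note zD [simp] = nseqD[OF angle_sq[OF z(1)]]
  have r: "rot z \<in> \<Theta>" "rot f \<in> \<Theta>" using angle_rot angle_sq f z(1) by blast+
  have [simp]: "rot z 0 = z (Suc 0)" "rot f 0 = f (Suc 0)" "rot z (Suc 0) = z (Suc (Suc 0))"
     "rot f (Suc 0) = f (Suc (Suc 0))" using n1 by (simp_all add: rotate_nseq_sgn)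
  have z1: "z (Suc 0) = mzero C (src C t) (src C (z (Suc (Suc 0))))"
    using zero_objectD(1)[OF z(4)[of "Suc (Suc 0)"], of "z (Suc 0)"] z(3) n1 zD(4)[of "Suc 0"] by simp
  obtain \<phi> where p: "mor (rot z) (rot f) \<phi>" "\<phi> 0 = t"
    using angle_F3[OF r, of t "mzero C (src C (z (Suc (Suc 0)))) (src C (f (Suc (Suc 0))))"] n1 z(3) t(3)
      z1 nseqD(4)[OF angle_sq[OF f], of "Suc 0"] by auto
  have s: "src C (rot f (Suc n)) = ob T (src C (f 0))" "src C (rot z (Suc n)) = ob T (src C t)"
    using z(2) by (simp_all add: rotate_nseq_sgn)
  have q: "\<phi> (Suc n) \<in> Hom C (ob T (src C t)) (ob T (src C (f 0)))"
    using mor_simps(1-3)[OF p(1), of "Suc n"] s by simp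
  then obtain s where s: "s \<in> Hom C (src C t) (src C (f 0))" "ar T s = \<phi> (Suc n)" using full by blast
  have "sgn_mor C n (ar T t) = sgn_mor C n (ar T (f 0) \<cdot> \<phi> (Suc n))"
    using mor_simps(5)[OF p(1)] p(2) z(2) q by (simp add: rotate_nseq_sgn)
  then have "ar T t = ar T (f 0) \<cdot> \<phi> (Suc n)" using q by (simp add: sgn_eq_iff)
  then have "ar T t = ar T (f 0 \<cdot> s)" using s by simp
  then have "t = f 0 \<cdot> s" by (rule faithful[of t "src C t" "tgt C t" "f 0 \<cdot> s", rotated 2]) (use s in simp_all)
  then show ?thesis using s by blast
qed

lemma rot_pow_in: "f \<in> \<Theta> \<Longrightarrow> (rot ^^ k) f \<in> \<Theta>"
  by (induction k) (use angle_rot angle_sq in auto)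

lemma rot_pow: "i + k \<le> Suc n \<Longrightarrow> (rot ^^ k) f i = f (i + k)"
proof (induction k arbitrary: i)
  case (Suc k)
  then show ?case by (simp add: rotate_nseq_sgn)
qed simp

lemma rot_pow_last: "(rot ^^ Suc n) f 0 = f (Suc n)" "(rot ^^ Suc n) f (Suc 0) = sgn_mor C n (ar T (f 0))"
proof -
  show "(rot ^^ Suc n) f 0 = f (Suc n)" using rot_pow[of 0 "Suc n" f] by simp
  have "(rot ^^ Suc n) f (Suc 0) = (rot ^^ n) (rot f) (Suc 0)" by (simp add: funpow_swap1)
  also have "\<dots> = rot f (Suc n)" using rot_pow[of "Suc 0" n "rot f"] by simp
  finally show "(rot ^^ Suc n) f (Suc 0) = sgn_mor C n (ar T (f 0))" by (simp add: rotate_nseq_sgn)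
qed

text \<open>This and the next two lemmas follow from the statements at position 0 by rotating. After
  n + 1 rotations the second map is \<open>ar T (f 0)\<close> up to a sign, which is
  absorbed.\<close>

lemma comp_zero:
  assumes f: "f \<in> \<Theta>"
  shows "i \<le> n \<Longrightarrow> f (Suc i) \<cdot> f i = mzero C (src C (f i)) (tgt C (f (Suc i)))"
    and "ar T (f 0) \<cdot> f (Suc n) = mzero C (src C (f (Suc n))) (ob T (tgt C (f 0)))"
proof -
  note [simp] = nseqD[OF angle_sq[OF f]]
  show "f (Suc i) \<cdot> f i = mzero C (src C (f i)) (tgt C (f (Suc i)))" if "i \<le> n"
    using comp_zero_0[OF rot_pow_in[OF f, of i]] that by (simp add: rot_pow)
  have "sgn_mor C n (ar T (f 0) \<cdot> f (Suc n)) = mzero C (src C (f (Suc n))) (ob T (tgt C (f 0)))"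
    using comp_zero_0[OF rot_pow_in[OF f, of "Suc n"]] unfolding rot_pow_last by simp
  then have "sgn_mor C n (sgn_mor C n (ar T (f 0) \<cdot> f (Suc n))) = mzero C (src C (f (Suc n))) (ob T (tgt C (f 0)))" by simp
  then show "ar T (f 0) \<cdot> f (Suc n) = mzero C (src C (f (Suc n))) (ob T (tgt C (f 0)))" by (subst (asm) sgn_sgn) simp_all
qed

lemma comp_zero_assoc:
  assumes f: "f \<in> \<Theta>"
  shows "i \<le> n \<Longrightarrow> x \<in> arr C \<Longrightarrow> tgt C x = src C (f i) \<Longrightarrow>
      f (Suc i) \<cdot> (f i \<cdot> x) = mzero C (src C x) (tgt C (f (Suc i)))"
    "x \<in> arr C \<Longrightarrow> tgt C x = src C (f (Suc n)) \<Longrightarrow>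
      ar T (f 0) \<cdot> (f (Suc n) \<cdot> x) = mzero C (src C x) (ob T (tgt C (f 0)))"
  using comp_zero(1)[OF f, THEN cmp_eq_assoc, of i x] comp_zero(2)[OF f, THEN cmp_eq_assoc, of x]
  by (simp_all add: nseqD[OF angle_sq[OF f]])

lemma wcoker:
  assumes f: "f \<in> \<Theta>" and t: "t \<in> arr C"
  shows "i \<le> n \<Longrightarrow> src C t = src C (f (Suc i)) \<Longrightarrow> t \<cdot> f i = mzero C (src C (f i)) (tgt C t) \<Longrightarrow>
      \<exists>s\<in>Hom C (tgt C (f (Suc i))) (tgt C t). t = s \<cdot> f (Suc i)"
    and "src C t = ob T (src C (f 0)) \<Longrightarrow> t \<cdot> f (Suc n) = mzero C (src C (f (Suc n))) (tgt C t) \<Longrightarrow>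
      \<exists>s\<in>Hom C (ob T (tgt C (f 0))) (tgt C t). t = s \<cdot> ar T (f 0)"
proof -
  note [simp] = nseqD[OF angle_sq[OF f]] t
  show "\<exists>s\<in>Hom C (tgt C (f (Suc i))) (tgt C t). t = s \<cdot> f (Suc i)"
    if "i \<le> n" "src C t = src C (f (Suc i))" "t \<cdot> f i = mzero C (src C (f i)) (tgt C t)"
    using wcoker_0[OF rot_pow_in[OF f, of i], of t] that by (simp add: rot_pow)
  assume a: "src C t = ob T (src C (f 0))" "t \<cdot> f (Suc n) = mzero C (src C (f (Suc n))) (tgt C t)"
  have "\<exists>s\<in>Hom C (tgt C (sgn_mor C n (ar T (f 0)))) (tgt C t). t = s \<cdot> sgn_mor C n (ar T (f 0))"
    using wcoker_0[OF rot_pow_in[OF f, of "Suc n"], of t] a unfolding rot_pow_last by simp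
  then obtain s where s: "s \<in> Hom C (ob T (tgt C (f 0))) (tgt C t)" "t = s \<cdot> sgn_mor C n (ar T (f 0))"
    by (simp only: arr_sgn arr_ar \<open>f 0 \<in> arr C\<close>) blast
  show "\<exists>s\<in>Hom C (ob T (tgt C (f 0))) (tgt C t). t = s \<cdot> ar T (f 0)"
  proof (rule bexI[of _ "sgn_mor C n s"])
    show "t = sgn_mor C n s \<cdot> ar T (f 0)" using s(1) by (subst s(2)) simp
    show "sgn_mor C n s \<in> Hom C (ob T (tgt C (f 0))) (tgt C t)" using s(1) by simp
  qed
qed

lemma wker:
  assumes f: "f \<in> \<Theta>" and t: "t \<in> arr C"
  shows "i \<le> n \<Longrightarrow> tgt C t = src C (f (Suc i)) \<Longrightarrow> f (Suc i) \<cdot> t = mzero C (src C t) (tgt C (f (Suc i))) \<Longrightarrow>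
      \<exists>s\<in>Hom C (src C t) (src C (f i)). t = f i \<cdot> s"
    and "tgt C t = ob T (src C (f 0)) \<Longrightarrow> ar T (f 0) \<cdot> t = mzero C (src C t) (ob T (tgt C (f 0))) \<Longrightarrow>
      \<exists>s\<in>Hom C (src C t) (src C (f (Suc n))). t = f (Suc n) \<cdot> s"
proof -
  note [simp] = nseqD[OF angle_sq[OF f]] t
  show "\<exists>s\<in>Hom C (src C t) (src C (f i)). t = f i \<cdot> s"
    if "i \<le> n" "tgt C t = src C (f (Suc i))" "f (Suc i) \<cdot> t = mzero C (src C t) (tgt C (f (Suc i)))"
    using wker_0[OF rot_pow_in[OF f, of i], of t] that by (simp add: rot_pow)
  assume a: "tgt C t = ob T (src C (f 0))" "ar T (f 0) \<cdot> t = mzero C (src C t) (ob T (tgt C (f 0)))"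
  then show "\<exists>s\<in>Hom C (src C t) (src C (f (Suc n))). t = f (Suc n) \<cdot> s"
    using wker_0[OF rot_pow_in[OF f, of "Suc n"], of t] unfolding rot_pow_last by simp
qed

text \<open>Rotating back puts a preimage under \<open>T\<close> of the signed last map in front;
  hence the condition that the last object be of the form \<open>ob T A\<close>.\<close>

lemma unrot_exists:
  assumes r: "r \<in> \<Theta>" and A: "src C (r (Suc n)) = ob T A"
  obtains f where "f \<in> \<Theta>" "\<And>i. i \<le> n \<Longrightarrow> f (Suc i) = r i" "src C (f 0) = A" "ar T (f 0) = sgn_mor C n (r (Suc n))"
proof -
  note [simp] = nseqD[OF angle_sq[OF r]]
  obtain a where a: "a \<in> Hom C A (src C (r 0))" "ar T a = sgn_mor C n (r (Suc n))"
    using full[of "sgn_mor C n (r (Suc n))" A "src C (r 0)"] A by auto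
  define f where "f i = (case i of 0 \<Rightarrow> a | Suc j \<Rightarrow> r j)" for i
  have f: "sq f"
  proof (rule nseqI)
    show "f i \<in> arr C" if "i \<le> Suc n" for i using that a by (cases i) (simp_all add: f_def)
    show "tgt C (f i) = src C (f (Suc i))" if "i \<le> n" for i using that a by (cases i) (simp_all add: f_def)
    show "tgt C (f (Suc n)) = ob T (src C (f 0))" using a A by (simp add: f_def)
  qed
  have "rot f \<in> \<Theta>"
  proof (rule angle_cong[OF r])
    fix i assume "i \<le> Suc n"
    then consider "i \<le> n" | "i = Suc n" by linarith
    then show "rot f i = r i" using a by cases (simp_all add: rotate_nseq_sgn f_def)
  qed
  then have "f \<in> \<Theta>" using angle_rot[OF f] by simp
  then show thesis by (intro that[of f]) (use a in \<open>simp_all add: f_def\<close>)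
qed

end

section \<open>Changing objects of angles\<close>

context seq_functor
begin

lemma nseqI_nxt:
  assumes "\<And>i. i \<le> Suc n \<Longrightarrow> f i \<in> arr C"
    "\<And>i. i \<le> Suc n \<Longrightarrow> tgt C (f i) = (if i \<le> n then src C (f (Suc i)) else ob T (src C (f 0)))"
  shows "sq f"
  using assms(1) assms(2)[of "Suc n"] assms(2) by (intro nseqI) auto

lemma mor_nxtI:
  assumes "sq f" "sq g" "\<And>i. i \<le> Suc n \<Longrightarrow> \<phi> i \<in> Hom C (src C (f i)) (src C (g i))"
    "\<And>i. i \<le> Suc n \<Longrightarrow> nxt \<phi> i \<cdot> f i = g i \<cdot> \<phi> i"
  shows "mor f g \<phi>"
proof (rule nseq_morphismI[OF assms(1-3)])
  show "\<phi> (Suc i) \<cdot> f i = g i \<cdot> \<phi> i" if "i \<le> n" for i using assms(4)[of i] that by simp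
  show "ar T (\<phi> 0) \<cdot> f (Suc n) = g (Suc n) \<cdot> \<phi> (Suc n)" using assms(4)[of "Suc n"] by simp
qed

end

locale angulated = pre_angulation +
  assumes angle_sum: "f \<in> \<Theta> \<Longrightarrow> g \<in> \<Theta> \<Longrightarrow> dsum f g h \<Longrightarrow> h \<in> \<Theta>"
    and angle_summand: "h \<in> \<Theta> \<Longrightarrow> dsum f g h \<Longrightarrow> f \<in> \<Theta>"
    and angle_extend: "x \<in> arr C \<Longrightarrow> \<exists>f\<in>\<Theta>. f 0 = x"
    and angle_F4: "f \<in> \<Theta> \<Longrightarrow> g \<in> \<Theta> \<Longrightarrow>
      a \<in> Hom C (src C (f 0)) (src C (g 0)) \<Longrightarrow> b \<in> Hom C (src C (f (Suc 0))) (src C (g (Suc 0))) \<Longrightarrow>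
      b \<cdot> f 0 = g 0 \<cdot> a \<Longrightarrow> \<exists>\<phi> h. mor f g \<phi> \<and> \<phi> 0 = a \<and> \<phi> (Suc 0) = b \<and>
        mapping_cone n C T f g \<phi> h \<and> h \<in> \<Theta>"
    and idem_splits: "x \<in> Hom C A A \<Longrightarrow> x \<cdot> x = x \<Longrightarrow> splits x"
    and ob_surj: "\<exists>A'. ob T A' = A"
begin

lemma angle_retract:
  assumes h: "h \<in> \<Theta>" and m: "mor f h \<iota>" "mor h f \<pi>" "\<And>i. i \<le> Suc n \<Longrightarrow> \<pi> i \<cdot> \<iota> i = ide C (src C (f i))"
  shows "f \<in> \<Theta>"
proof -
  have "\<exists>g. dsum f g h"
  proof (rule retract_dsum[OF _ m])
    show "\<exists>Z. \<exists>\<zeta>\<in>Hom C Z A. \<exists>\<rho>\<in>Hom C A Z. \<rho> \<cdot> \<zeta> = ide C Z \<and> \<zeta> \<cdot> \<rho> = e"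
      if "e \<in> Hom C A A" "e \<cdot> e = e" for A e
      using idem_splits[OF that] that(1) unfolding splits_def by simp
  qed
  then show ?thesis using angle_summand[OF h] by blast
qed

lemma trivial_at:
  assumes "sq w" "j \<le> n" "w j = ide C W"
    "\<And>i. i \<le> Suc n \<Longrightarrow> i \<noteq> j \<Longrightarrow> i \<noteq> Suc j \<Longrightarrow> zero_object C (src C (w i))"
  shows "w \<in> \<Theta>"
  using assms
proof (induction j arbitrary: w)
  case 0
  then have "trivial_nseq n C T W w" by (auto simp: trivial_nseq_def)
  then show ?case by (rule angle_trivial)
next
  case (Suc j)
  have "rot w \<in> \<Theta>"
  proof (rule Suc.IH)
    show "sq (rot w)" using sq_rot Suc.prems by blast
    show "rot w j = ide C W" using Suc.prems by (simp add: rotate_nseq_sgn)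
    show "zero_object C (src C (rot w i))" if i: "i \<le> Suc n" "i \<noteq> j" "i \<noteq> Suc j" for i
    proof (cases "i \<le> n")
      case True
      then show ?thesis using Suc.prems(4)[of "Suc i"] i by (simp add: rotate_nseq_sgn)
    next
      case False
      have "zero_object C (src C (w 0))" using Suc.prems(4)[of 0] by simp
      then show ?thesis using False nseqD[OF Suc.prems(1)] by (simp add: rotate_nseq_sgn ob_zero)
    qed
  qed (use Suc.prems in simp)
  then show ?case using angle_rot Suc.prems(1) by blast
qed

lemma trivial_at_exists:
  assumes "j \<le> n"
  obtains w where "w \<in> \<Theta>" "w j = ide C W" "src C (w (Suc j)) = W"
    "\<And>i. i \<le> Suc n \<Longrightarrow> i \<noteq> j \<Longrightarrow> i \<noteq> Suc j \<Longrightarrow> zero_object C (src C (w i))"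
proof -
  obtain Z where Z: "zero_object C Z" using has_zero_object by blast
  define V where "V i = (if i = j \<or> i = Suc j then W else Z)" for i
  define w where "w i = (if i = j then ide C W else if i \<le> n then mzero C (V i) (V (Suc i))
    else mzero C (V i) (ob T (V 0)))" for i
  have [simp]: "w i \<in> arr C" "src C (w i) = V i" for i by (auto simp: w_def V_def)
  have w: "sq w" by (rule nseqI) (use assms in \<open>auto simp: w_def V_def\<close>)
  show thesis
    by (rule that[of w, OF trivial_at[OF w assms, of W]]) (use Z in \<open>auto simp: V_def w_def\<close>)
qed

text \<open>Adding the trivial angle \<open>W = W\<close> at the positions \<open>k + 1, k + 2\<close> and then splitting off
  the trivial angle on the \<open>(k + 1)\<close>-st object replaces that object by \<open>W\<close>.\<close>

lemma exchange:
  assumes e: "e \<in> \<Theta>" and k: "k < n"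
    and c: "c \<in> Hom C (src C (e (Suc k))) W" and r1: "r1 \<in> Hom C (tgt C (e (Suc k))) (src C (e (Suc k)))"
    and rW: "rW \<in> Hom C W (src C (e (Suc k)))"
    and eq: "(r1 \<cdot> e (Suc k)) \<oplus> (rW \<cdot> c) = ide C (src C (e (Suc k)))"
  obtains N s1 s2 t1 t2 Z \<zeta> \<rho> where "biproduct C (tgt C (e (Suc k))) W N s1 s2 t1 t2"
    "\<zeta> \<in> Hom C Z N" "\<rho> \<in> Hom C N Z" "\<rho> \<cdot> \<zeta> = ide C Z"
    "\<zeta> \<cdot> \<rho> = ide C N \<oplus> mneg C (((s1 \<cdot> e (Suc k)) \<oplus> (s2 \<cdot> c)) \<cdot> ((r1 \<cdot> t1) \<oplus> (rW \<cdot> t2)))"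
    "e(k := mneg C (c \<cdot> e k), Suc k := \<rho> \<cdot> s2, Suc (Suc k) := e (Suc (Suc k)) \<cdot> (t1 \<cdot> \<zeta>)) \<in> \<Theta>"
proof -
  note eD = nseqD[OF angle_sq[OF e]]
  define j where "j = Suc k"
  have j: "j \<le> n" "k \<noteq> j" "k \<le> n" "k \<noteq> Suc j" "Suc j \<noteq> k" "Suc j \<noteq> j" using k by (auto simp: j_def)
  obtain w where w: "w \<in> \<Theta>" "w j = ide C W" "src C (w (Suc j)) = W"
    "\<And>i. i \<le> Suc n \<Longrightarrow> i \<noteq> j \<Longrightarrow> i \<noteq> Suc j \<Longrightarrow> zero_object C (src C (w i))"
    by (rule trivial_at_exists[OF j(1)]) blast
  note wD = nseqD[OF angle_sq[OF w(1)]]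
  obtain h where hs: "dsum e w h" using dsum_exists[OF angle_sq[OF e] angle_sq[OF w(1)] has_direct_sums] by blast
  have h: "h \<in> \<Theta>" by (rule angle_sum[OF e w(1) hs])
  note hD = nseqD[OF angle_sq[OF h]]
  from hs obtain i1 i2 p1 p2 where d: "mor e h i1" "mor w h i2" "mor h e p1" "mor h w p2"
    "\<And>j. j \<le> Suc n \<Longrightarrow> biproduct C (src C (e j)) (src C (w j)) (src C (h j)) (i1 j) (i2 j) (p1 j) (p2 j)"
    by (rule dsumE) blast
  define E N where "E = src C (e j)" and "N = src C (h (Suc j))"
  define s1 s2 t1 t2 where "s1 = i1 (Suc j)" and "s2 = i2 (Suc j)" and "t1 = p1 (Suc j)" and "t2 = p2 (Suc j)"
  have bN: "biproduct C (tgt C (e j)) W N s1 s2 t1 t2"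
    using d(5)[of "Suc j"] j w(3) eD(4)[of j] by (simp add: s1_def s2_def t1_def t2_def N_def)
  have src_wj: "src C (w j) = W" using w(2) by simp
  have bj: "biproduct C E W (src C (h j)) (i1 j) (i2 j) (p1 j) (p2 j)"
    using d(5)[of j] j src_wj by (simp add: E_def)
  note [simp] = biproduct_simps[OF bN] biproduct_simps[OF bj]
  have [simp]: "c \<in> arr C" "src C c = E" "tgt C c = W" "r1 \<in> arr C" "src C r1 = tgt C (e j)" "tgt C r1 = E"
    "rW \<in> arr C" "src C rW = W" "tgt C rW = E" "e j \<in> arr C" "src C (e j) = E" "e k \<in> arr C" "tgt C (e k) = E"
    "h j \<in> arr C" "tgt C (h j) = N" "tgt C (h k) = src C (h j)" "h k \<in> arr C" "e (Suc j) \<in> arr C" "src C (e (Suc j)) = tgt C (e j)"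
    "h (Suc j) \<in> arr C" "src C (h (Suc j)) = N"
    using c r1 rW eD(1)[of j] eD(4)[of k] eD(4)[of j] hD(4)[of k] hD(4)[of j] j eD(1)[of k] hD(1)[of j] hD(1)[of k] eD(1)[of "Suc j"] hD(1)[of "Suc j"]
    by (simp_all add: E_def N_def j_def)
  have eq' : "(r1 \<cdot> e j) \<oplus> (rW \<cdot> c) = ide C E" using eq by (simp add: j_def E_def)
  have hi1: "h j \<cdot> i1 j = s1 \<cdot> e j" using mor_simps(4)[OF d(1), of j] j by (simp add: s1_def)
  have hi2: "h j \<cdot> i2 j = s2" using mor_simps(4)[OF d(2), of j] j w(2) biproductD(4-6)[OF bN] by (simp add: s2_def)
  \<comment> \<open>\<open>u\<close> is \<open>h j\<close> restricted to the graph of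
    \<open>c\<close>. By \<open>eq\<close> it is a split monomorphism with retraction
    \<open>r\<close>, so a copy of \<open>E\<close> can be cancelled at the positions
    \<open>j\<close> and \<open>Suc j\<close> of the sum.\<close>
  define u r where "u = (s1 \<cdot> e j) \<oplus> (s2 \<cdot> c)" and "r = (r1 \<cdot> t1) \<oplus> (rW \<cdot> t2)"
  have [simp]: "u \<in> arr C" "src C u = E" "tgt C u = N" "r \<in> arr C" "src C r = N" "tgt C r = E"
    by (simp_all add: u_def r_def)
  have ru: "r \<cdot> u = ide C E" unfolding r_def u_def using eq' by simp
  note [simp] = ru ru[THEN cmp_eq_assoc]
  define q where "q = ide C N \<oplus> mneg C (u \<cdot> r)"
  have q: "q \<in> Hom C N N" "q \<cdot> q = q" by (simp_all add: q_def)
  have "splits q" by (rule idem_splits[OF q])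
  then obtain Z \<zeta> \<rho> where "\<zeta> \<in> Hom C Z (src C q)" "\<rho> \<in> Hom C (src C q) Z" and z0: "\<rho> \<cdot> \<zeta> = ide C Z" "\<zeta> \<cdot> \<rho> = q"
    by (rule splitsE)
  then have [simp]: "\<zeta> \<in> arr C" "src C \<zeta> = Z" "tgt C \<zeta> = N" "\<rho> \<in> arr C" "src C \<rho> = N" "tgt C \<rho> = Z"
    using q by simp_all
  note [simp] = z0 z0(1)[THEN cmp_eq_assoc]
  have zr: "\<zeta> \<cdot> (\<rho> \<cdot> x) = x \<oplus> mneg C (u \<cdot> (r \<cdot> x))" if "x \<in> arr C" "tgt C x = N" for x
    using z0(2)[THEN cmp_eq_assoc, of x] that by (simp add: q_def)
  have ru0 [simp]: "\<rho> \<cdot> u = mzero C E Z"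
  proof -
    have "\<rho> \<cdot> u = \<rho> \<cdot> (\<zeta> \<cdot> (\<rho> \<cdot> u))" by simp
    also have "\<dots> = \<rho> \<cdot> mzero C E N" by (subst zr) simp_all
    finally show ?thesis by simp
  qed
  have rs: "\<rho> \<cdot> (s1 \<cdot> e j) = mneg C (\<rho> \<cdot> (s2 \<cdot> c))"
    by (rule eq_neg[of _ _ E Z]) (use ru0 add_commute[of "\<rho> \<cdot> (s1 \<cdot> e j)" "\<rho> \<cdot> (s2 \<cdot> c)"] in \<open>simp_all add: u_def\<close>)
  \<comment> \<open>After \<open>e k\<close> the part of the identity of \<open>E\<close> that
    passes through \<open>e j\<close> vanishes, so \<open>rW \<cdot> c\<close> acts there as the
    identity.\<close>
  have rce: "rW \<cdot> (c \<cdot> e k) = e k"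
  proof -
    have "rW \<cdot> c = ide C E \<oplus> mneg C (r1 \<cdot> e j)" by (rule eq_diffI[OF eq'[symmetric]]) simp_all
    then have "rW \<cdot> (c \<cdot> e k) = (ide C E \<oplus> mneg C (r1 \<cdot> e j)) \<cdot> e k" by (simp flip: assoc)
    also have "\<dots> = e k" using comp_zero(1)[OF e, of k] k by (simp add: j_def[symmetric])
    finally show ?thesis .
  qed
  have w0: "w k = mzero C (src C (w k)) W" "nxt i2 (Suc j) \<cdot> w (Suc j) = mzero C W (tgt C (h (Suc j)))"
  proof -
    show "w k = mzero C (src C (w k)) W"
      using zero_objectD(2)[OF w(4)[of k], of "w k"] j wD(4)[of k] wD(1)[of k] src_wj by (simp add: j_def)
    have "zero_object C (tgt C (w (Suc j)))"
    proof (cases "Suc j \<le> n")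
      case True
      then show ?thesis using w(4)[of "Suc (Suc j)"] wD(4)[of "Suc j"] by simp
    next
      case False
      then have "Suc j = Suc n" using j by simp
      then show ?thesis using w(4)[of 0] wD(6) by (simp add: j_def ob_zero)
    qed
    from zero_objectD(1)[OF this, of "w (Suc j)"]
    have "w (Suc j) = mzero C W (tgt C (w (Suc j)))" using wD(1)[of "Suc j"] w(3) j by simp
    then show "nxt i2 (Suc j) \<cdot> w (Suc j) = mzero C W (tgt C (h (Suc j)))"
      using nxt_simps(1-3)[OF d(2), of "Suc j"] j
        cmp_zero(2)[of "nxt i2 (Suc j)" "tgt C (w (Suc j))" W] by (simp del: cmp_zero)
  qed
  have hSj: "h (Suc j) = nxt i1 (Suc j) \<cdot> (e (Suc j) \<cdot> t1)"
  proof -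
    note [simp] = nxt_simps(1-3)[OF d(1), of "Suc j"] nxt_simps(1-3)[OF d(2), of "Suc j"]
    have 1: "h (Suc j) \<cdot> s1 = nxt i1 (Suc j) \<cdot> e (Suc j)" "h (Suc j) \<cdot> s2 = nxt i2 (Suc j) \<cdot> w (Suc j)"
      using nxt_simps(4)[OF d(1), of "Suc j"] nxt_simps(4)[OF d(2), of "Suc j"] j by (simp_all add: s1_def s2_def)
    have "h (Suc j) = ((h (Suc j) \<cdot> s1) \<cdot> t1) \<oplus> ((h (Suc j) \<cdot> s2) \<cdot> t2)"
      by (rule biproduct_split(1)[OF bN]) simp_all
    then show ?thesis unfolding 1 w0(2) using j by (simp del: One_nat_def)
  qed
  define e' where "e' = e(k := mneg C (c \<cdot> e k), j := \<rho> \<cdot> s2, Suc j := e (Suc j) \<cdot> (t1 \<cdot> \<zeta>))"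
  have e'k: "e' k = mneg C (c \<cdot> e k)" "e' j = \<rho> \<cdot> s2" "e' (Suc j) = e (Suc j) \<cdot> (t1 \<cdot> \<zeta>)"
    "i \<noteq> k \<Longrightarrow> i \<noteq> j \<Longrightarrow> i \<noteq> Suc j \<Longrightarrow> e' i = e i" for i
    by (simp_all add: e'_def j_def)
  have src': "i \<noteq> j \<Longrightarrow> i \<noteq> Suc j \<Longrightarrow> i \<le> Suc n \<Longrightarrow> src C (e' i) = src C (e i)" "src C (e' j) = W" "src C (e' (Suc j)) = Z" for i
    by (cases "i = k"; simp add: e'k) (simp_all add: e'k)
  have src0: "src C (e' 0) = src C (e 0)" using src'(1)[of 0] by (simp add: j_def)
  have e': "sq e'"
  proof (rule nseqI_nxt)
    fix i assume i: "i \<le> Suc n"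
    consider "i = k" | "i = j" | "i = Suc j" | "i \<noteq> k" "i \<noteq> j" "i \<noteq> Suc j" by blast
    note cs = this
    show "e' i \<in> arr C" using cs by cases (use i eD(1)[of i] in \<open>simp_all add: e'k\<close>)
    show "tgt C (e' i) = (if i \<le> n then src C (e' (Suc i)) else ob T (src C (e' 0)))"
      using cs
    proof cases
      case 3
      show ?thesis
      proof (cases "Suc j \<le> n")
        case True
        then show ?thesis using 3 eD(4)[of "Suc j"] src'(1)[of "Suc (Suc j)"] by (simp add: e'k)
      next
        case False
        then have "j = n" using j by simp
        moreover have "tgt C (e' (Suc j)) = tgt C (e (Suc j))" by (simp add: e'k)
        ultimately show ?thesis using 3 eD(6) by (simp add: src0)
      qed
    next
      case 4
      then have "Suc i \<noteq> j" by (simp add: j_def)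
      show ?thesis
      proof (cases "i \<le> n")
        case True
        then show ?thesis using 4 e'k(4)[OF 4] \<open>Suc i \<noteq> j\<close> eD(4)[of i] src'(1)[of "Suc i"] by simp
      next
        case False
        then have "i = Suc n" using i by simp
        then show ?thesis using e'k(4)[OF 4] eD(6) by (simp add: src0)
      qed
    qed (use j src'(2,3) in \<open>simp_all add: e'k j_def[symmetric]\<close>)
  qed
  \<comment> \<open>At position \<open>j\<close> a complement of the graph of \<open>c\<close> is a
    copy of \<open>W\<close>: the projection \<open>\<pi> j\<close> vanishes on the graph, and its
    section \<open>\<iota> j\<close> is the one for which \<open>h j \<cdot> \<iota> j\<close> lands
    in the image of \<zeta>, the complement of \<open>u\<close>.\<close>
  define \<iota> where "\<iota> = i1(j := (i2 j \<cdot> (ide C W \<oplus> mneg C (c \<cdot> rW))) \<oplus> mneg C (i1 j \<cdot> rW), Suc j := \<zeta>)"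
  define \<pi> where "\<pi> = p1(j := p2 j \<oplus> mneg C (c \<cdot> p1 j), Suc j := \<rho>)"
  have ij: "\<iota> j = (i2 j \<cdot> (ide C W \<oplus> mneg C (c \<cdot> rW))) \<oplus> mneg C (i1 j \<cdot> rW)" "\<iota> (Suc j) = \<zeta>"
    "i \<noteq> j \<Longrightarrow> i \<noteq> Suc j \<Longrightarrow> \<iota> i = i1 i" "\<pi> j = p2 j \<oplus> mneg C (c \<cdot> p1 j)" "\<pi> (Suc j) = \<rho>"
    "i \<noteq> j \<Longrightarrow> i \<noteq> Suc j \<Longrightarrow> \<pi> i = p1 i" "\<iota> 0 = i1 0" "\<pi> 0 = p1 0" for i
    by (simp_all add: \<iota>_def \<pi>_def j_def)
  have nx: "nxt \<iota> k = \<iota> j" "nxt \<iota> j = \<zeta>" "nxt \<pi> k = \<pi> j" "nxt \<pi> j = \<rho>"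
    "i \<noteq> k \<Longrightarrow> i \<noteq> j \<Longrightarrow> nxt \<iota> i = nxt i1 i" "i \<noteq> k \<Longrightarrow> i \<noteq> j \<Longrightarrow> nxt \<pi> i = nxt p1 i" for i
    using j ij by (auto simp: j_def)
  have m1: "mor e' h \<iota>"
  proof (rule mor_nxtI[OF e' angle_sq[OF h]])
    fix i assume i: "i \<le> Suc n"
    show "\<iota> i \<in> Hom C (src C (e' i)) (src C (h i))"
    proof -
      consider "i = j" | "i = Suc j" | "i \<noteq> j" "i \<noteq> Suc j" by blast
      then show ?thesis by cases (use i mor_simps(1-3)[OF d(1), of i] src' in \<open>simp_all add: ij N_def[symmetric]\<close>)
    qed
    consider "i = k" | "i = j" | "i = Suc j" | "i \<noteq> k" "i \<noteq> j" "i \<noteq> Suc j" by blast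
    then show "nxt \<iota> i \<cdot> e' i = h i \<cdot> \<iota> i"
    proof cases
      case 1
      have "h k \<cdot> i1 k = i1 j \<cdot> e k" using mor_simps(4)[OF d(1), of k] j by (simp add: j_def)
      then show ?thesis using j unfolding 1 nx e'k ij(1) by (simp add: ij(3)[OF j(2,4)] rce)
    next
      case 2
      then show ?thesis unfolding 2 nx e'k ij(1)
        by (simp add: zr hi1 hi2 hi1[THEN cmp_eq_assoc] hi2[THEN cmp_eq_assoc]) (simp add: u_def r_def add_ac)
    next
      case 3
      then show ?thesis using nxt_simps(1-3)[OF d(1), of "Suc j"] j
        unfolding 3 e'k ij(2) nx(5)[OF j(5,6)] hSj by simp
    next
      case 4
      then show ?thesis using nxt_simps(4)[OF d(1) i] unfolding nx(5)[OF 4(1,2)] e'k(4)[OF 4] by (simp add: ij)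
    qed
  qed
  have m2: "mor h e' \<pi>"
  proof (rule mor_nxtI[OF angle_sq[OF h] e'])
    fix i assume i: "i \<le> Suc n"
    show "\<pi> i \<in> Hom C (src C (h i)) (src C (e' i))"
    proof -
      consider "i = j" | "i = Suc j" | "i \<noteq> j" "i \<noteq> Suc j" by blast
      then show ?thesis by cases (use i mor_simps(1-3)[OF d(3), of i] src' in \<open>simp_all add: ij N_def[symmetric]\<close>)
    qed
    consider "i = k" | "i = j" | "i = Suc j" | "i \<noteq> k" "i \<noteq> j" "i \<noteq> Suc j" by blast
    then show "nxt \<pi> i \<cdot> h i = e' i \<cdot> \<pi> i"
    proof cases
      case 1
      have "p1 j \<cdot> h k = e k \<cdot> p1 k" "p2 j \<cdot> h k = w k \<cdot> p2 k"
        using mor_simps(4)[OF d(3), of k] mor_simps(4)[OF d(4), of k] j by (simp_all add: j_def)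
      moreover have "w k \<cdot> p2 k = mzero C (src C (h k)) W"
        using mor_simps(1-3)[OF d(4), of k] j by (subst w0(1)) simp
      ultimately show ?thesis using j mor_simps(1-3)[OF d(3), of k] unfolding 1 nx e'k ij(4) by (simp add: ij(6)[OF j(2,4)])
    next
      case 2
      have hj: "h j = ((s1 \<cdot> e j) \<cdot> p1 j) \<oplus> (s2 \<cdot> p2 j)"
        by (rule biproduct_split(1)[OF bj, of "h j", unfolded hi1 hi2]) simp_all
      have "\<rho> \<cdot> h j = (\<rho> \<cdot> (s1 \<cdot> e j) \<cdot> p1 j) \<oplus> (\<rho> \<cdot> (s2 \<cdot> p2 j))" by (subst hj) simp
      moreover have "\<rho> \<cdot> (s1 \<cdot> e j) \<cdot> p1 j = mneg C (\<rho> \<cdot> (s2 \<cdot> (c \<cdot> p1 j)))"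
        using rs[THEN cmp_eq_assoc3, of "p1 j"] by simp
      ultimately show ?thesis unfolding 2 nx e'k ij(4)
        using add_commute[of "mneg C (\<rho> \<cdot> (s2 \<cdot> (c \<cdot> p1 j)))" "\<rho> \<cdot> (s2 \<cdot> p2 j)"] by simp
    next
      case 3
      have "nxt p1 (Suc j) \<cdot> h (Suc j) = e (Suc j) \<cdot> t1"
        using nxt_simps(4)[OF d(3), of "Suc j"] j by (simp add: t1_def)
      moreover have "t1 \<cdot> u = e j" unfolding u_def by simp
      then have "e (Suc j) \<cdot> (t1 \<cdot> (\<zeta> \<cdot> \<rho>)) = e (Suc j) \<cdot> t1"
        unfolding z0(2) q_def using comp_zero_assoc(1)[OF e, of j r] j by (simp add: \<open>t1 \<cdot> u = e j\<close>[THEN cmp_eq_assoc])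
      ultimately show ?thesis
        unfolding 3 e'k ij(5) nx(6)[OF j(5,6)] by (simp del: z0(2))
    next
      case 4
      then show ?thesis using nxt_simps(4)[OF d(3) i] unfolding nx(6)[OF 4(1,2)] e'k(4)[OF 4] by (simp add: ij)
    qed
  qed
  have "e' \<in> \<Theta>"
  proof (rule angle_retract[OF h m1 m2])
    fix i assume i: "i \<le> Suc n"
    consider "i = j" | "i = Suc j" | "i \<noteq> j" "i \<noteq> Suc j" by blast
    then show "\<pi> i \<cdot> \<iota> i = ide C (src C (e' i))"
      by cases (use biproductD(13)[OF d(5)[OF i]] i in \<open>simp_all add: ij src'\<close>)
  qed
  then show thesis
    by (intro that[of N s1 s2 t1 t2 \<zeta> Z \<rho>]) (use bN in \<open>simp_all add: e'_def j_def[symmetric] q_def u_def r_def\<close>)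
qed

end

section \<open>Cones of morphisms whose first component is a split monomorphism\<close>

context angulated
begin

text \<open>If the first component of the morphism is a split monomorphism with complement \<open>P\<close>, then the
  trivial angle on \<open>A\<^sub>0\<close>, placed at the positions \<open>n + 1\<close> and \<open>0\<close>, splits off the mapping cone.\<close>

lemma reduced_cone:
  assumes f: "f \<in> \<Theta>" and g: "g \<in> \<Theta>"
    and bP: "biproduct C (src C (f 0)) P (src C (g 0)) a j q w"
    and b: "b \<in> Hom C (src C (f (Suc 0))) (src C (g (Suc 0)))" and sq0: "b \<cdot> f 0 = g 0 \<cdot> a"
    and bM: "biproduct C (tgt C (f 0)) P M k1 k2 r1 r2"
  obtains \<phi> m i1 i2 p1 p2 where "mor f g \<phi>" "\<phi> 0 = a" "\<phi> (Suc 0) = b" "m \<in> \<Theta>" "src C (m 0) = M"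
    "src C (m (Suc n)) = src C (g (Suc n))"
    "\<And>i. 1 \<le> i \<Longrightarrow> i \<le> n \<Longrightarrow>
      biproduct C (tgt C (f i)) (src C (g i)) (src C (m i)) (i1 i) (i2 i) (p1 i) (p2 i)"
    "p1 (Suc 0) \<cdot> (m 0 \<cdot> k1) = mneg C (f (Suc 0))" "p2 (Suc 0) \<cdot> (m 0 \<cdot> k1) = b"
    "p1 (Suc 0) \<cdot> (m 0 \<cdot> k2) = mzero C P (tgt C (f (Suc 0)))" "p2 (Suc 0) \<cdot> (m 0 \<cdot> k2) = g 0 \<cdot> j"
    "\<And>i. 1 \<le> i \<Longrightarrow> i < n \<Longrightarrow> p1 (Suc i) \<cdot> (m i \<cdot> i1 i) = mneg C (f (Suc i))"
    "\<And>i. 1 \<le> i \<Longrightarrow> i < n \<Longrightarrow> p2 (Suc i) \<cdot> (m i \<cdot> i1 i) = \<phi> (Suc i)"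
    "\<And>i. 1 \<le> i \<Longrightarrow> i < n \<Longrightarrow> p1 (Suc i) \<cdot> (m i \<cdot> i2 i) = mzero C (src C (g i)) (tgt C (f (Suc i)))"
    "\<And>i. 1 \<le> i \<Longrightarrow> i < n \<Longrightarrow> p2 (Suc i) \<cdot> (m i \<cdot> i2 i) = g i"
    "m n \<cdot> i1 n = \<phi> (Suc n)" "m n \<cdot> i2 n = g n"
    "ar T r1 \<cdot> m (Suc n) = ar T (f 0) \<cdot> (ar T q \<cdot> g (Suc n))" "ar T r2 \<cdot> m (Suc n) = ar T w \<cdot> g (Suc n)"
proof -
  note [simp] = nseqD(1-3)[OF angle_sq[OF f]] nseqD(1-3)[OF angle_sq[OF g]]
    nseqD(6)[OF angle_sq[OF f]] nseqD(6)[OF angle_sq[OF g]]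
  have srcf [simp]: "src C (f (Suc i)) = tgt C (f i)" "src C (g (Suc i)) = tgt C (g i)" if "i \<le> n" for i
    using nseqD(4)[OF angle_sq[OF f] that] nseqD(4)[OF angle_sq[OF g] that] by simp_all
  note bPs [simp] = biproduct_simps[OF bP] biproduct_simps[OF bM]
  note bPT [simp] = biproduct_simps[OF ar_biproduct[OF bP]] biproduct_simps[OF ar_biproduct[OF bM]]
  note [simp] = comp_zero[OF f] comp_zero[OF g] comp_zero_assoc[OF f] comp_zero_assoc[OF g]
  have [simp]: "b \<in> arr C" "src C b = tgt C (f 0)" "tgt C b = tgt C (g 0)" using b by simp_all
  obtain \<phi> h where p: "mor f g \<phi>" "\<phi> 0 = a" "\<phi> (Suc 0) = b" and c: "mapping_cone n C T f g \<phi> h" and h: "h \<in> \<Theta>"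
    using angle_F4[OF f g _ b sq0] by auto
  from c obtain i1 i2 p1 p2 where hD:
    "\<And>j. j \<le> Suc n \<Longrightarrow> biproduct C (tgt C (f j)) (src C (g j)) (src C (h j)) (i1 j) (i2 j) (p1 j) (p2 j)"
    "\<And>j. j \<le> n \<Longrightarrow> p1 (Suc j) \<cdot> (h j \<cdot> i1 j) = mneg C (f (Suc j))"
    "\<And>j. j \<le> n \<Longrightarrow> p1 (Suc j) \<cdot> (h j \<cdot> i2 j) = mzero C (src C (g j)) (tgt C (f (Suc j)))"
    "\<And>j. j \<le> n \<Longrightarrow> p2 (Suc j) \<cdot> (h j \<cdot> i1 j) = \<phi> (Suc j)"
    "\<And>j. j \<le> n \<Longrightarrow> p2 (Suc j) \<cdot> (h j \<cdot> i2 j) = g j"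
    "ar T (p1 0) \<cdot> (h (Suc n) \<cdot> i1 (Suc n)) = mneg C (ar T (f 0))"
    "ar T (p1 0) \<cdot> (h (Suc n) \<cdot> i2 (Suc n)) = mzero C (src C (g (Suc n))) (ob T (tgt C (f 0)))"
    "ar T (p2 0) \<cdot> (h (Suc n) \<cdot> i1 (Suc n)) = ar T (\<phi> 0)"
    "ar T (p2 0) \<cdot> (h (Suc n) \<cdot> i2 (Suc n)) = g (Suc n)"
    by (rule coneE) blast
  define H where "H i = src C (h i)" for i
  have B: "biproduct C (tgt C (f j)) (src C (g j)) (H j) (i1 j) (i2 j) (p1 j) (p2 j)" if "j \<le> Suc n" for j
    using hD(1)[OF that] by (simp add: H_def)
  note Bs [simp] = biproduct_simps[OF B]
  have hH [simp]: "i \<le> Suc n \<Longrightarrow> h i \<in> arr C" "i \<le> Suc n \<Longrightarrow> src C (h i) = H i" "i \<le> n \<Longrightarrow> tgt C (h i) = H (Suc i)"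
    "tgt C (h (Suc n)) = ob T (H 0)" for i
    using nseqD[OF angle_sq[OF h]] by (simp_all add: H_def)
  have ph [simp]: "\<phi> (Suc i) \<in> arr C" "src C (\<phi> (Suc i)) = tgt C (f i)" "tgt C (\<phi> (Suc i)) = tgt C (g i)" if "i \<le> n" for i
    using mor_simps(1-3)[OF p(1), of "Suc i"] that by simp_all
  note hs [simp] = hD(2-9)
  note hsa [simp] = hD(2)[THEN cmp_eq_assoc3] hD(3)[THEN cmp_eq_assoc3] hD(4)[THEN cmp_eq_assoc3] hD(5)[THEN cmp_eq_assoc3]
    hD(6)[THEN cmp_eq_assoc3] hD(7)[THEN cmp_eq_assoc3] hD(8)[THEN cmp_eq_assoc3] hD(9)[THEN cmp_eq_assoc3]
  \<comment> \<open>\<open>h 0\<close> takes the same value on \<open>f 0\<close> in the first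
    summand and on \<open>a\<close> in the second, so it kills the copy of the first object embedded
    by the difference of the two; \<open>\<rho>0\<close> divides by this copy.\<close>
  define \<iota>0 \<rho>0 where "\<iota>0 = (i1 0 \<cdot> r1) \<oplus> (i2 0 \<cdot> (j \<cdot> r2))"
    and "\<rho>0 = (k1 \<cdot> (p1 0 \<oplus> (f 0 \<cdot> (q \<cdot> p2 0)))) \<oplus> (k2 \<cdot> (w \<cdot> p2 0))"
  \<comment> \<open>The image of \<open>h n\<close> lies in the graph of the negative of
    \<open>ar T q \<cdot> g (Suc n)\<close>, which \<open>\<iota>1\<close> parametrizes; this
    disposes of the summand \<open>T\<close> of the first object at the end.\<close>
  define \<iota>1 where "\<iota>1 = i2 (Suc n) \<oplus> mneg C (i1 (Suc n) \<cdot> (ar T q \<cdot> g (Suc n)))"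
  let ?G = "src C (g (Suc n))"
  have I [simp]: "\<iota>0 \<in> arr C" "src C \<iota>0 = M" "tgt C \<iota>0 = H 0" "\<rho>0 \<in> arr C" "src C \<rho>0 = H 0" "tgt C \<rho>0 = M"
    "\<iota>1 \<in> arr C" "src C \<iota>1 = src C (g (Suc n))" "tgt C \<iota>1 = H (Suc n)"
    by (simp_all add: \<iota>0_def \<rho>0_def \<iota>1_def)
  have r0: "\<rho>0 \<cdot> \<iota>0 = ide C M"
    using biproductD(17)[OF bM] by (simp add: \<iota>0_def \<rho>0_def)
  have r1': "p2 (Suc n) \<cdot> \<iota>1 = ide C (src C (g (Suc n)))" by (simp add: \<iota>1_def)
  have jw: "j \<cdot> w = ide C (src C (g 0)) \<oplus> mneg C (a \<cdot> q)"
    by (rule eq_diffI) (use biproductD(17)[OF bP] in simp_all)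
  have hfa: "h 0 \<cdot> (i1 0 \<cdot> f 0) = h 0 \<cdot> (i2 0 \<cdot> a)"
    by (rule biproduct_eqI(2)[OF B[of "Suc 0"]]) (use n1 sq0 p(3) in simp_all)
  have h0: "h 0 \<cdot> (\<iota>0 \<cdot> \<rho>0) = h 0"
  proof (rule biproduct_eqI(1)[OF B[of 0]])
    show "(h 0 \<cdot> (\<iota>0 \<cdot> \<rho>0)) \<cdot> i1 0 = h 0 \<cdot> i1 0" by (simp add: \<iota>0_def \<rho>0_def)
    have "(h 0 \<cdot> (\<iota>0 \<cdot> \<rho>0)) \<cdot> i2 0 = (h 0 \<cdot> (i1 0 \<cdot> f 0)) \<cdot> q \<oplus> (h 0 \<cdot> (i2 0 \<cdot> (j \<cdot> w)))"
      by (simp add: \<iota>0_def \<rho>0_def)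
    also have "\<dots> = h 0 \<cdot> i2 0" unfolding hfa jw by simp
    finally show "(h 0 \<cdot> (\<iota>0 \<cdot> \<rho>0)) \<cdot> i2 0 = h 0 \<cdot> i2 0" .
  qed simp_all
  have hn: "\<iota>1 \<cdot> (p2 (Suc n) \<cdot> h n) = h n"
  proof (rule biproduct_eqI(1)[OF B[of n]])
    have fn: "ar T q \<cdot> (g (Suc n) \<cdot> \<phi> (Suc n)) = f (Suc n)"
    proof -
      have "ar T q \<cdot> (ar T a \<cdot> f (Suc n)) = f (Suc n)" by simp
      then show ?thesis unfolding mor_simps(5)[OF p(1), unfolded p(2)] .
    qed
    show "(\<iota>1 \<cdot> (p2 (Suc n) \<cdot> h n)) \<cdot> i1 n = h n \<cdot> i1 n"
      by (rule biproduct_eqI(2)[OF B[of "Suc n"]]) (simp_all add: \<iota>1_def fn)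
    show "(\<iota>1 \<cdot> (p2 (Suc n) \<cdot> h n)) \<cdot> i2 n = h n \<cdot> i2 n"
      by (rule biproduct_eqI(2)[OF B[of "Suc n"]]) (simp_all add: \<iota>1_def)
  qed simp_all
  note BT [simp] = biproduct_simps[OF ar_biproduct[OF B]]
  have l1: "ar T \<iota>0 \<cdot> (ar T \<rho>0 \<cdot> (h (Suc n) \<cdot> \<iota>1)) = h (Suc n) \<cdot> \<iota>1"
  proof -
    have x: "ar T (p1 0) \<cdot> (h (Suc n) \<cdot> \<iota>1) = ar T (f 0) \<cdot> (ar T q \<cdot> g (Suc n))"
      "ar T (p2 0) \<cdot> (h (Suc n) \<cdot> \<iota>1) = g (Suc n) \<oplus> mneg C (ar T a \<cdot> (ar T q \<cdot> g (Suc n)))"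
      by (simp_all add: \<iota>1_def p(2))
    have "ar T j \<cdot> (ar T w \<cdot> g (Suc n)) = g (Suc n) \<oplus> mneg C (ar T a \<cdot> (ar T q \<cdot> g (Suc n)))"
      by (rule eq_diffI) (use biproduct_split(2)[OF ar_biproduct[OF bP], of "g (Suc n)"] in simp_all)
    then show ?thesis
      by - (rule biproduct_eqI(2)[OF ar_biproduct[OF B[of 0]]], simp_all add: x \<iota>0_def \<rho>0_def)
  qed
  have l2: "ar T \<rho>0 \<cdot> (h (Suc n) \<cdot> (\<iota>1 \<cdot> p2 (Suc n))) = ar T \<rho>0 \<cdot> h (Suc n)"
  proof (rule biproduct_eqI(1)[OF B[of "Suc n"]])
    have z: "ar T \<rho>0 \<cdot> (h (Suc n) \<cdot> i1 (Suc n)) = mzero C (tgt C (f (Suc n))) (ob T M)"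
      by (simp add: \<rho>0_def p(2))
    have z': "ar T \<rho>0 \<cdot> (h (Suc n) \<cdot> (i1 (Suc n) \<cdot> x)) = mzero C (src C x) (ob T M)"
      if "x \<in> arr C" "tgt C x = tgt C (f (Suc n))" for x
      using that z[THEN cmp_eq_assoc3, of x] by simp
    show "(ar T \<rho>0 \<cdot> (h (Suc n) \<cdot> (\<iota>1 \<cdot> p2 (Suc n)))) \<cdot> i1 (Suc n) = (ar T \<rho>0 \<cdot> h (Suc n)) \<cdot> i1 (Suc n)"
       "(ar T \<rho>0 \<cdot> (h (Suc n) \<cdot> (\<iota>1 \<cdot> p2 (Suc n)))) \<cdot> i2 (Suc n) = (ar T \<rho>0 \<cdot> h (Suc n)) \<cdot> i2 (Suc n)"
      by (simp_all add: \<iota>1_def z z')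
  qed simp_all
  define \<iota> \<rho> where "\<iota> i = (if i = 0 then \<iota>0 else if i \<le> n then ide C (H i) else \<iota>1)"
    and "\<rho> i = (if i = 0 then \<rho>0 else if i \<le> n then ide C (H i) else p2 (Suc n))" for i
  define m where "m i = (if i = 0 then h 0 \<cdot> \<iota>0 else h i)" for i
  define m' where "m' i = (if i = n then p2 (Suc n) \<cdot> m n else if i = Suc n then ar T \<rho>0 \<cdot> (h (Suc n) \<cdot> \<iota>1) else m i)" for i
  have mi: "i < n \<Longrightarrow> m' i = m i" "m' n = p2 (Suc n) \<cdot> m n" "m' (Suc n) = ar T \<rho>0 \<cdot> (h (Suc n) \<cdot> \<iota>1)" for i
    by (simp_all add: m'_def)
  have m0: "m 0 = h 0 \<cdot> \<iota>0" "i \<noteq> 0 \<Longrightarrow> m i = h i" for i by (simp_all add: m_def)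
  have nn: "n \<noteq> 0" "0 < n" "0 \<noteq> n" using n1 by auto
  have sm: "src C (m i) = (if i = 0 then M else H i)" "m i \<in> arr C" "tgt C (m i) = H (Suc i)" if "i \<le> n" for i
    using that by (auto simp: m_def)
  have sm': "src C (m' i) = (if i = 0 then M else if i \<le> n then H i else src C (g (Suc n)))" if "i \<le> Suc n" for i
  proof -
    consider "i < n" | "i = n" | "i = Suc n" using \<open>i \<le> Suc n\<close> by linarith
    then show ?thesis by cases (use nn in \<open>simp_all add: mi sm\<close>)
  qed
  have m's: "sq m'"
  proof (rule nseqI_nxt)
    fix i assume "i \<le> Suc n"
    then consider "i < n" | "i = n" | "i = Suc n" by linarith
    note cs = this
    show "m' i \<in> arr C" using cs by cases (simp_all add: mi sm)
    show "tgt C (m' i) = (if i \<le> n then src C (m' (Suc i)) else ob T (src C (m' 0)))"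
      using cs by cases (simp_all add: mi sm sm')
  qed
  have mh: "mor m' h \<iota>"
  proof (rule mor_nxtI[OF m's angle_sq[OF h]])
    fix i assume "i \<le> Suc n"
    then consider "i = 0" | "0 < i" "i \<le> n" | "i = Suc n" by linarith
    then show "\<iota> i \<in> Hom C (src C (m' i)) (src C (h i))" by cases (simp_all add: \<iota>_def sm')
    from \<open>i \<le> Suc n\<close> consider "i < n" | "i = n" | "i = Suc n" by linarith
    then show "nxt \<iota> i \<cdot> m' i = h i \<cdot> \<iota> i"
    proof cases
      case 1
      then show ?thesis by (auto simp: mi \<iota>_def sm m0)
    next
      case 2
      then show ?thesis using nn hn by (simp add: mi \<iota>_def m0)
    next
      case 3
      then show ?thesis using l1 by (simp add: mi \<iota>_def)
    qed
  qed
  have hm: "mor h m' \<rho>"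
  proof (rule mor_nxtI[OF angle_sq[OF h] m's])
    fix i assume "i \<le> Suc n"
    then consider "i = 0" | "0 < i" "i \<le> n" | "i = Suc n" by linarith
    then show "\<rho> i \<in> Hom C (src C (h i)) (src C (m' i))" by cases (simp_all add: \<rho>_def sm')
    have hr: "m i \<cdot> \<rho> i = h i" if "i \<le> n" for i using that h0 by (simp add: m_def \<rho>_def)
    from \<open>i \<le> Suc n\<close> consider "i < n" | "i = n" | "i = Suc n" by linarith
    then show "nxt \<rho> i \<cdot> h i = m' i \<cdot> \<rho> i"
    proof cases
      case 1
      then show ?thesis using hr[of i] by (simp add: mi) (simp add: \<rho>_def)
    next
      case 2
      have "\<rho> n \<in> arr C" "tgt C (\<rho> n) = src C (m n)" using nn by (simp_all add: \<rho>_def sm)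
      then show ?thesis using 2 nn hr[of n] sm[of n] by (simp add: mi) (simp add: \<rho>_def)
    next
      case 3
      then show ?thesis using l2 by (simp add: mi \<rho>_def)
    qed
  qed
  have m': "m' \<in> \<Theta>"
  proof (rule angle_retract[OF h mh hm])
    fix i assume "i \<le> Suc n"
    then consider "i = 0" | "0 < i" "i \<le> n" | "i = Suc n" by linarith
    then show "\<rho> i \<cdot> \<iota> i = ide C (src C (m' i))"
      by cases (use r0 r1' in \<open>simp_all add: \<iota>_def \<rho>_def sm'\<close>)
  qed
  define i1' where "i1' i = i1 i" for i
  define p1' p2' where "p1' i = p1 i" and "p2' i = p2 i" for i
  have m'1: "p1 (Suc 0) \<cdot> (m' 0 \<cdot> x) = p1 (Suc 0) \<cdot> (h 0 \<cdot> (\<iota>0 \<cdot> x))"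
    "p2 (Suc 0) \<cdot> (m' 0 \<cdot> x) = p2 (Suc 0) \<cdot> (h 0 \<cdot> (\<iota>0 \<cdot> x))" if "x \<in> arr C" "tgt C x = M" for x
    using that nn by (simp_all add: mi m0)
  have ik: "\<iota>0 \<cdot> k1 = i1 0" "\<iota>0 \<cdot> k2 = i2 0 \<cdot> j" by (simp_all add: \<iota>0_def)
  have mid: "m' i = h i" if "1 \<le> i" "i < n" for i using that by (simp add: mi m0)
  have mn: "m' n = p2 (Suc n) \<cdot> h n" using nn by (simp add: mi m0)
  have x: "ar T (p1 0) \<cdot> (h (Suc n) \<cdot> \<iota>1) = ar T (f 0) \<cdot> (ar T q \<cdot> g (Suc n))"
    "ar T (p2 0) \<cdot> (h (Suc n) \<cdot> \<iota>1) = g (Suc n) \<oplus> mneg C (ar T a \<cdot> (ar T q \<cdot> g (Suc n)))"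
    by (simp_all add: \<iota>1_def p(2))
  show thesis
  proof (rule that[of \<phi> m' i1 i2 p1 p2])
    show "biproduct C (tgt C (f i)) (src C (g i)) (src C (m' i)) (i1 i) (i2 i) (p1 i) (p2 i)" if "1 \<le> i" "i \<le> n" for i
      using B[of i] that sm'[of i] by simp
    show "ar T r1 \<cdot> m' (Suc n) = ar T (f 0) \<cdot> (ar T q \<cdot> g (Suc n))" "ar T r2 \<cdot> m' (Suc n) = ar T w \<cdot> g (Suc n)"
      by (simp_all add: mi(3) \<rho>0_def x)
    show "p1 (Suc 0) \<cdot> (m' 0 \<cdot> k1) = mneg C (f (Suc 0))" "p2 (Suc 0) \<cdot> (m' 0 \<cdot> k1) = b"
      "p1 (Suc 0) \<cdot> (m' 0 \<cdot> k2) = mzero C P (tgt C (f (Suc 0)))" "p2 (Suc 0) \<cdot> (m' 0 \<cdot> k2) = g 0 \<cdot> j"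
      using p(3) by (simp_all add: m'1 ik)
  qed (use p m' sm' nn in \<open>simp_all add: mid mn\<close>)
qed

end

section \<open>The quotient category\<close>

lemma (in category) X_monic_iff:
  "X_monic C X f \<longleftrightarrow> f \<in> arr C \<and> (\<forall>D\<in>X. \<forall>g\<in>Hom C (src C f) D. \<exists>g'\<in>Hom C (tgt C f) D. g = g' \<cdot> f)"
  unfolding X_monic_def
proof (intro iffI; elim conjE; intro conjI)
  assume f: "f \<in> arr C" and *: "\<forall>D\<in>X. (\<lambda>h. h \<cdot> f) ` Hom C (tgt C f) D = Hom C (src C f) D"
  show "\<forall>D\<in>X. \<forall>g\<in>Hom C (src C f) D. \<exists>g'\<in>Hom C (tgt C f) D. g = g' \<cdot> f"
  proof (intro ballI)
    fix D g assume "D \<in> X" "g \<in> Hom C (src C f) D"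
    then have "g \<in> (\<lambda>h. h \<cdot> f) ` Hom C (tgt C f) D" using * by blast
    then show "\<exists>g'\<in>Hom C (tgt C f) D. g = g' \<cdot> f" by blast
  qed
next
  assume f: "f \<in> arr C" and *: "\<forall>D\<in>X. \<forall>g\<in>Hom C (src C f) D. \<exists>g'\<in>Hom C (tgt C f) D. g = g' \<cdot> f"
  show "\<forall>D\<in>X. (\<lambda>h. h \<cdot> f) ` Hom C (tgt C f) D = Hom C (src C f) D"
  proof
    fix D assume "D \<in> X"
    then show "(\<lambda>h. h \<cdot> f) ` Hom C (tgt C f) D = Hom C (src C f) D"
      using * f by (fastforce simp: image_iff)
  qed
qed auto

locale quotient = additive_category C
  for C :: "('o, 'm, 'z) precat_scheme" (structure) +
  fixes X :: "'o set"
  assumes subcat: "additive_subcategory C X"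
begin

abbreviation Q where "Q \<equiv> quotient_cat C X"
abbreviation cl where "cl \<equiv> cls C X"
abbreviation thr where "thr \<equiv> factors_through C X"

lemma X_zero: "zero_object C Z \<Longrightarrow> Z \<in> X"
  using subcat unfolding additive_subcategory_def by blast

lemma X_sum: "A \<in> X \<Longrightarrow> B \<in> X \<Longrightarrow> direct_sum C A B P \<Longrightarrow> P \<in> X"
  using subcat unfolding additive_subcategory_def by blast

lemma X_summand: "P \<in> X \<Longrightarrow> direct_sum C A B P \<Longrightarrow> A \<in> X"
  using subcat unfolding additive_subcategory_def by blast

lemma thrI: "g \<in> arr C \<Longrightarrow> h \<in> arr C \<Longrightarrow> tgt C g = src C h \<Longrightarrow> tgt C g \<in> X \<Longrightarrow> thr (h \<cdot> g)"
  unfolding factors_through_def by (intro bexI[of _ "tgt C g"] bexI[of _ g] bexI[of _ h]) auto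

lemma thrE:
  assumes "thr f"
  obtains D g h where "D \<in> X" "g \<in> arr C" "src C g = src C f" "tgt C g = D" "h \<in> arr C" "src C h = D"
    "tgt C h = tgt C f" "h \<cdot> g = f"
proof -
  from assms obtain D g h where d: "D \<in> X" "g \<in> Hom C (src C f) D" "h \<in> Hom C D (tgt C f)" "f = h \<cdot> g"
    unfolding factors_through_def by blast
  show thesis by (rule that[OF d(1), of g h]) (use d(2,3) d(4)[symmetric] in simp_all)
qed

lemma thr_arr: "thr f \<Longrightarrow> f \<in> arr C"
  by (erule thrE) (metis arr_cmp(1))

lemma thr_ob:
  assumes "f \<in> arr C" "src C f \<in> X \<or> tgt C f \<in> X"
  shows "thr f"
  using thrI[of "ide C (src C f)" f] thrI[of f "ide C (tgt C f)"] assms by auto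

lemma thr_zero [simp]: "thr (mzero C A B)"
proof -
  obtain Z where Z: "zero_object C Z" using has_zero_object by blast
  show ?thesis using thrI[of "mzero C A Z" "mzero C Z B"] X_zero[OF Z] by simp
qed

lemma thr_cmp:
  assumes "f \<in> arr C" "g \<in> arr C" "tgt C f = src C g" "thr f \<or> thr g"
  shows "thr (g \<cdot> f)"
  using assms(4)
proof
  assume "thr f"
  then obtain D a b where *: "D \<in> X" "a \<in> arr C" "src C a = src C f" "tgt C a = D" "b \<in> arr C" "src C b = D"
    "tgt C b = tgt C f" "b \<cdot> a = f" by (rule thrE)
  then have "g \<cdot> f = (g \<cdot> b) \<cdot> a" using assms by simp
  then show ?thesis using thrI[of a "g \<cdot> b"] * assms by simp
next
  assume "thr g"
  then obtain D a b where *: "D \<in> X" "a \<in> arr C" "src C a = src C g" "tgt C a = D" "b \<in> arr C" "src C b = D"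
    "tgt C b = tgt C g" "b \<cdot> a = g" by (rule thrE)
  have "b \<cdot> (a \<cdot> f) = g \<cdot> f" using *(8)[THEN cmp_eq_assoc, of f] *(2-7) assms(1-3) by simp
  then show ?thesis using thrI[of "a \<cdot> f" b] * assms by simp
qed

lemma thr_neg:
  assumes "thr f"
  shows "thr (mneg C f)"
proof -
  from assms obtain D a b where *: "D \<in> X" "a \<in> arr C" "src C a = src C f" "tgt C a = D" "b \<in> arr C" "src C b = D"
    "tgt C b = tgt C f" "b \<cdot> a = f" by (rule thrE)
  then have "mneg C f = mneg C b \<cdot> a" by simp
  then show ?thesis using thrI[of a "mneg C b"] * by simp
qed

text \<open>The sum factors through a direct sum of the two middle objects.\<close>

lemma thr_add:
  assumes "thr f" "thr f'" "src C f = src C f'" "tgt C f = tgt C f'"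
  shows "thr (f \<oplus> f')"
proof -
  from assms(1) obtain D a b where 1: "D \<in> X" "a \<in> arr C" "src C a = src C f" "tgt C a = D" "b \<in> arr C" "src C b = D"
    "tgt C b = tgt C f" "b \<cdot> a = f" by (rule thrE)
  from assms(2) obtain D' a' b' where 2: "D' \<in> X" "a' \<in> arr C" "src C a' = src C f'" "tgt C a' = D'" "b' \<in> arr C" "src C b' = D'"
    "tgt C b' = tgt C f'" "b' \<cdot> a' = f'" by (rule thrE)
  obtain P i1 i2 p1 p2 where P: "biproduct C D D' P i1 i2 p1 p2"
    using has_direct_sums[of D D'] unfolding direct_sum_def by blast
  then have "P \<in> X" using X_sum 1 2 unfolding direct_sum_def by blast
  moreover have "f \<oplus> f' = ((b \<cdot> p1) \<oplus> (b' \<cdot> p2)) \<cdot> ((i1 \<cdot> a) \<oplus> (i2 \<cdot> a'))"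
    using 1(2-7) 2(2-7) assms(3,4) thr_arr[OF assms(1)] thr_arr[OF assms(2)] by (simp add: biproduct_simps[OF P] 1(8) 2(8))
  ultimately show ?thesis
    using thrI[of "(i1 \<cdot> a) \<oplus> (i2 \<cdot> a')" "(b \<cdot> p1) \<oplus> (b' \<cdot> p2)"] 1(2-7) 2(2-7) assms(3,4) biproductD[OF P] by simp
qed

lemma thr_diff_trans:
  assumes "thr (f \<oplus> mneg C g)" "thr (g \<oplus> mneg C h)" "f \<in> arr C" "g \<in> arr C" "h \<in> arr C"
    "src C f = src C g" "src C g = src C h" "tgt C f = tgt C g" "tgt C g = tgt C h"
  shows "thr (f \<oplus> mneg C h)"
proof -
  have "thr ((f \<oplus> mneg C g) \<oplus> (g \<oplus> mneg C h))" by (rule thr_add) (use assms in simp_all)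
  then show ?thesis using assms(3-) by simp
qed

lemma thr_diff_sym:
  assumes "thr (f \<oplus> mneg C g)" "f \<in> arr C" "g \<in> arr C" "src C f = src C g" "tgt C f = tgt C g"
  shows "thr (g \<oplus> mneg C f)"
  using thr_neg[OF assms(1)] assms(2-) add_commute[of "mneg C f" g] by simp

lemma cl_eq_iff:
  assumes "f \<in> arr C" "g \<in> arr C" "src C f = src C g" "tgt C f = tgt C g"
  shows "cl f = cl g \<longleftrightarrow> thr (f \<oplus> mneg C g)"
proof
  assume "cl f = cl g"
  moreover have "g \<in> cl g" using assms by (simp add: cls_def)
  ultimately have "g \<in> cl f" by simp
  then show "thr (f \<oplus> mneg C g)" by (simp add: cls_def)
next
  assume *: "thr (f \<oplus> mneg C g)"
  have **: "thr (g \<oplus> mneg C f)" by (rule thr_diff_sym[OF * assms])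
  have "thr (f \<oplus> mneg C h) \<longleftrightarrow> thr (g \<oplus> mneg C h)" if "h \<in> Hom C (src C g) (tgt C g)" for h
    using thr_diff_trans[OF *, of h] thr_diff_trans[OF **, of h] assms that by auto
  then show "cl f = cl g" using assms by (auto simp: cls_def)
qed

lemma cl_eqI:
  "f \<in> arr C \<Longrightarrow> g \<in> arr C \<Longrightarrow> src C f = src C g \<Longrightarrow> tgt C f = tgt C g \<Longrightarrow> thr (f \<oplus> mneg C g) \<Longrightarrow> cl f = cl g"
  by (simp add: cl_eq_iff)

lemma cl_zero_iff:
  "f \<in> arr C \<Longrightarrow> src C f = A \<Longrightarrow> tgt C f = B \<Longrightarrow> cl f = cl (mzero C A B) \<longleftrightarrow> thr f"
  by (subst cl_eq_iff) simp_all

lemma rep_cl: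
  assumes "f \<in> arr C"
  shows "rep (cl f) \<in> arr C" "src C (rep (cl f)) = src C f" "tgt C (rep (cl f)) = tgt C f" "cl (rep (cl f)) = cl f"
proof -
  have "f \<in> cl f" using assms by (simp add: cls_def)
  then have "rep (cl f) \<in> cl f" unfolding rep_def by (rule someI)
  then have *: "rep (cl f) \<in> Hom C (src C f) (tgt C f)" "thr (f \<oplus> mneg C (rep (cl f)))" by (auto simp: cls_def)
  then show "rep (cl f) \<in> arr C" "src C (rep (cl f)) = src C f" "tgt C (rep (cl f)) = tgt C f" by auto
  then show "cl (rep (cl f)) = cl f" using *(2) assms cl_eq_iff[of f "rep (cl f)"] by simp
qed

lemma arr_Q [simp]:
  assumes "f \<in> arr C"
  shows "cl f \<in> arr Q" "src Q (cl f) = src C f" "tgt Q (cl f) = tgt C f"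
  using assms rep_cl[OF assms] by (simp_all add: quotient_cat_def)

lemma arr_QE:
  assumes "F \<in> arr Q"
  obtains f where "f \<in> arr C" "F = cl f" "src Q F = src C f" "tgt Q F = tgt C f"
  using assms arr_Q by (force simp: quotient_cat_def)

lemma Q_ide: "ide Q A = cl (ide C A)" and Q_mzero: "mzero Q A B = cl (mzero C A B)"
  by (simp_all add: quotient_cat_def)

lemma thr_rep:
  assumes "f \<in> arr C"
  shows "thr (rep (cl f) \<oplus> mneg C f)" "thr (f \<oplus> mneg C (rep (cl f)))"
  using cl_eq_iff[of "rep (cl f)" f] cl_eq_iff[of f "rep (cl f)"] rep_cl[OF assms] assms by simp_all

lemma Q_cmp [simp]:
  assumes "f \<in> arr C" "g \<in> arr C" "tgt C f = src C g"
  shows "cl g \<cdot>\<^bsub>Q\<^esub> cl f = cl (g \<cdot> f)"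
proof -
  note [simp] = rep_cl[OF assms(1)] rep_cl[OF assms(2)] assms
  \<comment> \<open>The difference of the two composites telescopes through
    \<open>g \<cdot> rep (cl f)\<close>.\<close>
  have "thr (((rep (cl g) \<oplus> mneg C g) \<cdot> rep (cl f)) \<oplus> (g \<cdot> (rep (cl f) \<oplus> mneg C f)))"
    using thr_rep[OF assms(1)] thr_rep[OF assms(2)]
    by (intro thr_add thr_cmp) simp_all
  then have "thr ((rep (cl g) \<cdot> rep (cl f)) \<oplus> mneg C (g \<cdot> f))" by simp
  then have "cl (rep (cl g) \<cdot> rep (cl f)) = cl (g \<cdot> f)" by (intro cl_eqI) simp_all
  then show ?thesis by (simp add: quotient_cat_def)
qed

lemma Q_add [simp]:
  assumes "f \<in> arr C" "g \<in> arr C" "src C f = src C g" "tgt C f = tgt C g"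
  shows "cl f \<oplus>\<^bsub>Q\<^esub> cl g = cl (f \<oplus> g)"
proof -
  note [simp] = rep_cl[OF assms(1)] rep_cl[OF assms(2)] assms
  have "thr ((rep (cl f) \<oplus> mneg C f) \<oplus> (rep (cl g) \<oplus> mneg C g))"
    by (rule thr_add) (use thr_rep[OF assms(1)] thr_rep[OF assms(2)] in simp_all)
  then have "thr ((rep (cl f) \<oplus> rep (cl g)) \<oplus> mneg C (f \<oplus> g))" by (simp add: add_ac)
  then have "cl (rep (cl f) \<oplus> rep (cl g)) = cl (f \<oplus> g)" by (intro cl_eqI) simp_all
  then show ?thesis by (simp add: quotient_cat_def)
qed

lemma Q_neg [simp]:
  assumes "f \<in> arr C"
  shows "mneg Q (cl f) = cl (mneg C f)"
proof -
  note [simp] = rep_cl[OF assms(1)] assms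
  have "thr (mneg C (rep (cl f) \<oplus> mneg C f))"
    using thr_rep[OF assms(1)] by (intro thr_neg) simp_all
  then have "thr ((mneg C (rep (cl f))) \<oplus> mneg C (mneg C f))" by (simp add: add_ac)
  then have "cl (mneg C (rep (cl f))) = cl (mneg C f)" by (intro cl_eqI) simp_all
  then show ?thesis by (simp add: quotient_cat_def)
qed

lemma Hom_QE:
  assumes "F \<in> Hom Q A B"
  obtains f where "f \<in> arr C" "F = cl f" "src C f = A" "tgt C f = B"
  using assms by (auto elim: arr_QE)

lemma preadditive_Q: "preadditive_category Q"
proof
  show "ide Q A \<in> Hom Q A A" for A by (simp add: Q_ide)
  fix F A B assume F: "F \<in> Hom Q A B"
  from F obtain f where f [simp]: "f \<in> arr C" "F = cl f" "src C f = A" "tgt C f = B" by (rule Hom_QE)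
  show "F \<cdot>\<^bsub>Q\<^esub> ide Q A = F" "ide Q B \<cdot>\<^bsub>Q\<^esub> F = F" by (simp_all add: Q_ide)
  show "mneg Q F \<in> Hom Q A B" "F \<oplus>\<^bsub>Q\<^esub> mzero Q A B = F" "F \<oplus>\<^bsub>Q\<^esub> mneg Q F = mzero Q A B"
    by (simp_all add: Q_mzero)
  show "G \<cdot>\<^bsub>Q\<^esub> F \<in> Hom Q A D" if "G \<in> Hom Q B D" for G D
    using that by (rule Hom_QE) simp
  show "(H \<cdot>\<^bsub>Q\<^esub> G) \<cdot>\<^bsub>Q\<^esub> F = H \<cdot>\<^bsub>Q\<^esub> (G \<cdot>\<^bsub>Q\<^esub> F)" if "G \<in> Hom Q B D" "H \<in> Hom Q D E" for G H D E
    by (rule Hom_QE[OF that(1)], rule Hom_QE[OF that(2)]) simp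
  fix G assume G: "G \<in> Hom Q A B"
  from G obtain g where g [simp]: "g \<in> arr C" "G = cl g" "src C g = A" "tgt C g = B" by (rule Hom_QE)
  show "F \<oplus>\<^bsub>Q\<^esub> G \<in> Hom Q A B" "F \<oplus>\<^bsub>Q\<^esub> G = G \<oplus>\<^bsub>Q\<^esub> F" by (simp_all add: add_commute[of f g])
  show "(F \<oplus>\<^bsub>Q\<^esub> G) \<oplus>\<^bsub>Q\<^esub> H = F \<oplus>\<^bsub>Q\<^esub> (G \<oplus>\<^bsub>Q\<^esub> H)" if "H \<in> Hom Q A B" for H
    by (rule Hom_QE[OF that]) simp
  show "H \<cdot>\<^bsub>Q\<^esub> (F \<oplus>\<^bsub>Q\<^esub> G) = (H \<cdot>\<^bsub>Q\<^esub> F) \<oplus>\<^bsub>Q\<^esub> (H \<cdot>\<^bsub>Q\<^esub> G)" if "H \<in> Hom Q B D" for H D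
    by (rule Hom_QE[OF that]) simp
  show "(F \<oplus>\<^bsub>Q\<^esub> G) \<cdot>\<^bsub>Q\<^esub> H = (F \<cdot>\<^bsub>Q\<^esub> H) \<oplus>\<^bsub>Q\<^esub> (G \<cdot>\<^bsub>Q\<^esub> H)" if "H \<in> Hom Q D A" for H D
    by (rule Hom_QE[OF that]) simp
qed (simp_all add: Q_mzero)

end

sublocale quotient \<subseteq> Q: preadditive_category "quotient_cat C X"
  by (rule preadditive_Q)

context quotient
begin

lemma Q_biproduct:
  assumes "biproduct C A B P i1 i2 p1 p2"
  shows "biproduct Q A B P (cl i1) (cl i2) (cl p1) (cl p2)"
  using biproductD[OF assms] unfolding biproduct_def by (simp add: Q_ide Q_mzero)

lemma Q_zero_object: "D \<in> X \<Longrightarrow> zero_object Q D"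
  unfolding Q.zero_object_iff Q_ide Q_mzero
  by (subst cl_zero_iff) (simp_all add: thr_ob)

end

sublocale quotient \<subseteq> Q: additive_category "quotient_cat C X"
proof
  show "\<exists>Z. zero_object Q Z" using has_zero_object X_zero Q_zero_object by blast
  show "\<exists>P. direct_sum Q A B P" for A B
    using has_direct_sums[of A B] Q_biproduct unfolding direct_sum_def by blast
qed

context quotient
begin

text \<open>Objects of \<open>X\<close> become zero objects, so discarding such a summand is
  invertible in the quotient.\<close>

lemma Q_biproduct_iso:
  assumes "biproduct C A B P i1 i2 p1 p2"
  shows "A \<in> X \<Longrightarrow> is_iso Q (cl p2)" "B \<in> X \<Longrightarrow> is_iso Q (cl p1)"
proof -
  note b = biproductD[OF assms]
  have "cl ((i1 \<cdot> p1) \<oplus> (i2 \<cdot> p2)) = cl (i2 \<cdot> p2)" if "A \<in> X"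
    using b(1-12) thrI[of p1 i1] that by (intro cl_eqI) simp_all
  then show "is_iso Q (cl p2)" if "A \<in> X"
    using that b by (intro Q.is_isoI[of _ "cl i2"]) (simp_all add: Q_ide)
  have "cl ((i1 \<cdot> p1) \<oplus> (i2 \<cdot> p2)) = cl (i1 \<cdot> p1)" if "B \<in> X"
    using b(1-12) thrI[of p2 i2] that by (intro cl_eqI) simp_all
  then show "is_iso Q (cl p1)" if "B \<in> X"
    using that b by (intro Q.is_isoI[of _ "cl i1"]) (simp_all add: Q_ide)
qed

text \<open>Closure of \<open>X\<close> is postulated for direct summands; splitting the
  complementary idempotent turns a retract into one.\<close>

lemma X_retract:
  assumes i: "i \<in> Hom C A D" "p \<in> Hom C D A" "p \<cdot> i = ide C A" "D \<in> X"
    and s: "\<And>e. e \<in> Hom C D D \<Longrightarrow> e \<cdot> e = e \<Longrightarrow> splits e"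
  shows "A \<in> X"
proof -
  define e where "e = ide C D \<oplus> mneg C (i \<cdot> p)"
  have [simp]: "i \<in> arr C" "src C i = A" "tgt C i = D" "p \<in> arr C" "src C p = D" "tgt C p = A" "p \<cdot> i = ide C A"
    using i by auto
  note [simp] = i(3)[THEN cmp_eq_assoc]
  have e: "e \<in> Hom C D D" "e \<cdot> e = e" by (simp_all add: e_def)
  obtain Z \<zeta> \<rho> where "\<zeta> \<in> Hom C Z (src C e)" "\<rho> \<in> Hom C (src C e) Z" and z: "\<rho> \<cdot> \<zeta> = ide C Z" "\<zeta> \<cdot> \<rho> = e"
    using s[OF e] by (rule splitsE)
  then have [simp]: "\<zeta> \<in> arr C" "src C \<zeta> = Z" "tgt C \<zeta> = D" "\<rho> \<in> arr C" "src C \<rho> = D" "tgt C \<rho> = Z"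
    using e by simp_all
  have "p \<cdot> \<zeta> = p \<cdot> ((\<zeta> \<cdot> \<rho>) \<cdot> \<zeta>)" using z(1) by simp
  also have "\<dots> = mzero C Z A" unfolding z(2) e_def by simp
  finally have 1: "p \<cdot> \<zeta> = mzero C Z A" .
  have "\<rho> \<cdot> i = \<rho> \<cdot> ((\<zeta> \<cdot> \<rho>) \<cdot> i)" using z(1)[THEN cmp_eq_assoc, of "\<rho> \<cdot> i"] by simp
  also have "\<dots> = mzero C A Z" unfolding z(2) e_def by simp
  finally have 2: "\<rho> \<cdot> i = mzero C A Z" .
  have "biproduct C A Z D i \<zeta> p \<rho>" unfolding biproduct_def using 1 2 z by (simp add: e_def)
  then show ?thesis using X_summand i(4) unfolding direct_sum_def by blast
qed

end

section \<open>The functor \<open>G\<close> and the connecting morphisms of the chosen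
  angles\<close>

locale approx = angulated C T n \<Theta> + quotient C X
  for C :: "('o, 'm, 'z) precat_scheme" (structure) and T :: "('o, 'm) endo" and n :: nat
    and \<Theta> :: "(nat \<Rightarrow> 'm) set" and X :: "'o set" +
  fixes L :: "'o \<Rightarrow> nat \<Rightarrow> 'm"
  assumes L: "left_approximation_angle n C \<Theta> X A (L A)"
    and R: "\<exists>f. right_approximation_angle n C \<Theta> X A f"
begin

abbreviation G where "G \<equiv> G_functor n C T X L"
text \<open>The connecting morphism from \<open>ob G A\<close> to \<open>ob T A\<close>. Up to maps
  through \<open>X\<close>, a morphism into \<open>ob G A\<close> is determined by its composite
  with it, see \<open>thr_of_l_eq\<close>.\<close>

abbreviation l where "l A \<equiv> L A (Suc n)"

lemma L_angle: "L A \<in> \<Theta>" and L_sq: "sq (L A)"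
  using L[of A] angle_sq unfolding left_approximation_angle_def by auto

lemma L_simps [simp]: "i \<le> Suc n \<Longrightarrow> L A i \<in> arr C" "src C (L A 0) = A" "src C (l A) = ob G A"
    "tgt C (l A) = ob T A" "tgt C (L A n) = ob G A"
  using L[of A] nseqD[OF L_sq[of A]] unfolding left_approximation_angle_def by (simp_all add: G_functor_def)

lemma L_X: "1 \<le> i \<Longrightarrow> i \<le> n \<Longrightarrow> src C (L A i) \<in> X" "tgt C (L A 0) \<in> X"
  using L[of A] unfolding left_approximation_angle_def left_approximation_def by auto

lemma L_monic: "X_monic C X (L A 0)"
  using L[of A] unfolding left_approximation_angle_def left_approximation_def X_monic_iff by auto

lemma X_monicE:
  assumes "X_monic C X f" "g \<in> arr C" "src C g = src C f" "tgt C g \<in> X"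
  obtains g' where "g' \<in> arr C" "src C g' = tgt C f" "tgt C g' = tgt C g" "g' \<cdot> f = g"
proof -
  have "g \<in> Hom C (src C f) (tgt C g)" using assms(2,3) by simp
  then have "\<exists>g'\<in>Hom C (tgt C f) (tgt C g). g = g' \<cdot> f"
    using assms(1,4) unfolding X_monic_iff by blast
  then obtain g' where d: "g' \<in> Hom C (tgt C f) (tgt C g)" "g = g' \<cdot> f" by blast
  show thesis by (rule that[of g']) (use d(1) d(2)[symmetric] in simp_all)
qed

text \<open>A map through \<open>X\<close> factors through the \<open>X\<close>-monic
  \<open>e 0\<close>, and \<open>ar T (e 0)\<close> vanishes after \<open>e (Suc n)\<close>.\<close>

lemma monic_kill:
  assumes e: "e \<in> \<Theta>" "X_monic C X (e 0)" and z: "thr z" "src C z = src C (e 0)"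
  shows "ar T z \<cdot> e (Suc n) = mzero C (src C (e (Suc n))) (ob T (tgt C z))"
proof -
  note [simp] = nseqD[OF angle_sq[OF e(1)]]
  from z(1) obtain D g h where d: "D \<in> X" "g \<in> arr C" "src C g = src C z" "tgt C g = D" "h \<in> arr C" "src C h = D"
    "tgt C h = tgt C z" "h \<cdot> g = z" by (rule thrE)
  obtain g' where g': "g' \<in> arr C" "src C g' = tgt C (e 0)" "tgt C g' = tgt C g" "g' \<cdot> e 0 = g"
    using X_monicE[OF e(2), of g] d z by metis
  have "h \<cdot> (g' \<cdot> e 0) = z" using d(8) g'(4) by simp
  moreover have "ar T (h \<cdot> (g' \<cdot> e 0)) = ar T h \<cdot> (ar T g' \<cdot> ar T (e 0))"
    using d(1-7) g'(1-3) by simp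
  ultimately have "ar T z = ar T h \<cdot> (ar T g' \<cdot> ar T (e 0))" by simp
  then show ?thesis
    using d(1-7) g'(1-3) comp_zero(2)[OF e(1)] by simp
qed

lemma l_kill: "thr z \<Longrightarrow> src C z = A \<Longrightarrow> ar T z \<cdot> l A = mzero C (ob G A) (ob T (tgt C z))"
  using monic_kill[OF L_angle L_monic, of z] by simp

text \<open>What \<open>e (Suc n)\<close> kills factors through \<open>e n\<close>, whose source
  lies in \<open>X\<close>.\<close>

lemma thr_of_last:
  assumes e: "e \<in> \<Theta>" "src C (e n) \<in> X" and w: "w \<in> arr C" "tgt C w = src C (e (Suc n))"
    "e (Suc n) \<cdot> w = mzero C (src C w) (tgt C (e (Suc n)))"
  shows "thr w"
proof -
  obtain s where "s \<in> Hom C (src C w) (src C (e n))" "w = e n \<cdot> s"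
    using wker(1)[OF e(1) w(1) le_refl w(2,3)] by blast
  then show ?thesis using thrI[of s "e n"] e nseqD[OF angle_sq[OF e(1)]] by simp
qed

lemma thr_of_l:
  assumes "w \<in> arr C" "tgt C w = ob G A" "l A \<cdot> w = mzero C (src C w) (ob T A)"
  shows "thr w"
  using thr_of_last[OF L_angle L_X(1)[OF n1 le_refl], of w A] assms by simp

lemma thr_of_l_eq:
  assumes "w \<in> arr C" "tgt C w = ob G A" "w' \<in> arr C" "tgt C w' = ob G A" "src C w = src C w'" "l A \<cdot> w = l A \<cdot> w'"
  shows "cl w = cl w'"
  by (rule cl_eqI) (use assms thr_of_l[of "w \<oplus> mneg C w'"] in simp_all)

text \<open>The second object of \<open>L A\<close> lies in \<open>X\<close>, so
  \<open>X\<close>-monicity of \<open>e 0\<close> supplies the component at position 1; F3 does the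
  rest.\<close>

lemma L_extend:
  assumes "e \<in> \<Theta>" "X_monic C X (e 0)" "f \<in> arr C" "src C f = src C (e 0)" "tgt C f = A"
  shows "\<exists>\<mu>. mor e (L A) \<mu> \<and> \<mu> 0 = f"
proof -
  note [simp] = nseqD[OF angle_sq[OF assms(1)]] nseqD[OF L_sq] assms(3-5)
  obtain g where g: "g \<in> arr C" "src C g = tgt C (e 0)" "tgt C g = tgt C (L A 0)" "g \<cdot> e 0 = L A 0 \<cdot> f"
    using X_monicE[OF assms(2), of "L A 0 \<cdot> f"] L_X(2)[of A] by auto
  then show ?thesis using angle_F3[OF assms(1) L_angle[of A], of f g] by auto
qed

lemma G_lift:
  assumes "f \<in> arr C"
  obtains \<psi> where "\<psi> \<in> arr C" "src C \<psi> = ob G (src C f)" "tgt C \<psi> = ob G (tgt C f)"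
    "l (tgt C f) \<cdot> \<psi> = ar T f \<cdot> l (src C f)"
proof -
  obtain \<mu> where m: "mor (L (src C f)) (L (tgt C f)) \<mu>" "\<mu> 0 = f"
    using L_extend[OF L_angle L_monic, of f "src C f" "tgt C f"] assms by auto
  show thesis
    by (rule that[of "\<mu> (Suc n)"]) (use mor_simps[OF m(1)] m(2) in simp_all)
qed

text \<open>The value of \<open>G\<close> is detected by the last square alone, so computations with
  \<open>G\<close> do not need full morphisms of angles. The description by \<open>THE\<close> is
  unique: first components that differ by a map through \<open>X\<close> give last components that
  agree after \<open>l\<close>, because \<open>T\<close> of such a map vanishes after
  \<open>l\<close>.\<close>

lemma G_ar:
  assumes f: "f \<in> arr C" and p: "\<psi> \<in> arr C" "src C \<psi> = ob G (src C f)" "tgt C \<psi> = ob G (tgt C f)"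
    "l (tgt C f) \<cdot> \<psi> = ar T f \<cdot> l (src C f)"
  shows "ar G (cl f) = cl \<psi>"
proof -
  let ?A = "src C f" and ?B = "tgt C f"
  have "ar G (cl f) = (THE \<Psi>. \<exists>\<mu>. mor (L ?A) (L ?B) \<mu> \<and> cl (\<mu> 0) = cl f \<and> cl (\<mu> (Suc n)) = \<Psi>)"
    using rep_cl[OF f] by (simp add: G_functor_def del: L_simps)
  also have "\<dots> = cl \<psi>"
  proof (rule the_equality)
    have u: "cl (\<mu> (Suc n)) = cl \<psi>" if m: "mor (L ?A) (L ?B) \<mu>" "cl (\<mu> 0) = cl f" for \<mu>
    proof (rule thr_of_l_eq)
      have m0: "\<mu> 0 \<in> arr C" "src C (\<mu> 0) = ?A" "tgt C (\<mu> 0) = ?B"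
        "\<mu> (Suc n) \<in> arr C" "src C (\<mu> (Suc n)) = ob G ?A" "tgt C (\<mu> (Suc n)) = ob G ?B"
        using mor_simps(1-3)[OF m(1), of 0] mor_simps(1-3)[OF m(1), of "Suc n"] by simp_all
      then have "thr (\<mu> 0 \<oplus> mneg C f)" using m(2) f cl_eq_iff[of "\<mu> 0" f] by simp
      then have "ar T (\<mu> 0 \<oplus> mneg C f) \<cdot> l ?A = mzero C (ob G ?A) (ob T ?B)"
        using l_kill[of "\<mu> 0 \<oplus> mneg C f" ?A] m0 f by simp
      then have "(ar T (\<mu> 0) \<cdot> l ?A) \<oplus> mneg C (ar T f \<cdot> l ?A) = mzero C (ob G ?A) (ob T ?B)"
        using m0 f by simp
      then have "ar T (\<mu> 0) \<cdot> l ?A = ar T f \<cdot> l ?A"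
        using diff_zero_iff[of "ar T (\<mu> 0) \<cdot> l ?A" "ar T f \<cdot> l ?A"] m0 f by simp
      then show "l ?B \<cdot> \<mu> (Suc n) = l ?B \<cdot> \<psi>" using p(4) mor_simps(5)[OF m(1)] by simp
      show "\<mu> (Suc n) \<in> arr C" "tgt C (\<mu> (Suc n)) = ob G ?B" "src C (\<mu> (Suc n)) = src C \<psi>"
        using m0 p by simp_all
    qed (use p in simp_all)
    obtain \<mu> where m: "mor (L ?A) (L ?B) \<mu>" "\<mu> 0 = f"
      using L_extend[OF L_angle L_monic, of f ?A ?B] f by auto
    show "\<exists>\<mu>. mor (L ?A) (L ?B) \<mu> \<and> cl (\<mu> 0) = cl f \<and> cl (\<mu> (Suc n)) = cl \<psi>"
      using m u[OF m(1)] by auto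
    show "\<Psi> = cl \<psi>" if "\<exists>\<mu>. mor (L ?A) (L ?B) \<mu> \<and> cl (\<mu> 0) = cl f \<and> cl (\<mu> (Suc n)) = \<Psi>" for \<Psi>
      using that u by blast
  qed
  finally show ?thesis .
qed

lemma G_arE:
  assumes "f \<in> arr C"
  obtains \<psi> where "\<psi> \<in> arr C" "src C \<psi> = ob G (src C f)" "tgt C \<psi> = ob G (tgt C f)"
    "l (tgt C f) \<cdot> \<psi> = ar T f \<cdot> l (src C f)" "ar G (cl f) = cl \<psi>"
  using G_lift[OF assms] G_ar[OF assms] by metis

lemma G_additive: "additive_endofunctor Q G"
  unfolding additive_endofunctor_def endofunctor_def
proof (intro conjI allI ballI)
  show "ar G (ide Q A) = ide Q (ob G A)" for A
    unfolding Q_ide by (rule G_ar) simp_all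
  fix A B F assume "F \<in> Hom Q A B"
  then obtain f where f [simp]: "f \<in> arr C" "F = cl f" "src C f = A" "tgt C f = B" by (rule Hom_QE)
  obtain p where p: "p \<in> arr C" "src C p = ob G A" "tgt C p = ob G B" "l B \<cdot> p = ar T f \<cdot> l A" "ar G (cl f) = cl p"
    using G_arE[OF f(1)] by (metis f(3,4))
  note [simp] = p p(4)[THEN cmp_eq_assoc]
  show "ar G F \<in> Hom Q (ob G A) (ob G B)" by simp
  show "ar G (H \<cdot>\<^bsub>Q\<^esub> F) = ar G H \<cdot>\<^bsub>Q\<^esub> ar G F" if "H \<in> Hom Q B D" for H D
  proof -
    from that obtain g where g [simp]: "g \<in> arr C" "H = cl g" "src C g = B" "tgt C g = D" by (rule Hom_QE)
    obtain q where q: "q \<in> arr C" "src C q = ob G B" "tgt C q = ob G D" "l D \<cdot> q = ar T g \<cdot> l B" "ar G (cl g) = cl q"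
      using G_arE[OF g(1)] by (metis g(3,4))
    note [simp] = q q(4)[THEN cmp_eq_assoc]
    have "ar G (cl (g \<cdot> f)) = cl (q \<cdot> p)" by (rule G_ar) simp_all
    then show ?thesis by simp
  qed
  show "ar G (F \<oplus>\<^bsub>Q\<^esub> H) = ar G F \<oplus>\<^bsub>Q\<^esub> ar G H" if "H \<in> Hom Q A B" for H
  proof -
    from that obtain g where g [simp]: "g \<in> arr C" "H = cl g" "src C g = A" "tgt C g = B" by (rule Hom_QE)
    obtain q where q: "q \<in> arr C" "src C q = ob G A" "tgt C q = ob G B" "l B \<cdot> q = ar T g \<cdot> l A" "ar G (cl g) = cl q"
      using G_arE[OF g(1)] by (metis g(3,4))
    note [simp] = q q(4)[THEN cmp_eq_assoc]
    have "ar G (cl (f \<oplus> g)) = cl (p \<oplus> q)" by (rule G_ar) simp_all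
    then show ?thesis by simp
  qed
qed

text \<open>An angle (2), with its approximation property in the form used later: every map from an
  object of \<open>X\<close> factors through \<open>r n\<close> and is therefore annihilated by the
  connecting map.\<close>

lemma right_angleE:
  obtains r where "r \<in> \<Theta>" "src C (r (Suc n)) = A" "\<And>i. 1 \<le> i \<Longrightarrow> i \<le> n \<Longrightarrow> src C (r i) \<in> X"
    "\<And>v. v \<in> arr C \<Longrightarrow> src C v \<in> X \<Longrightarrow> tgt C v = A \<Longrightarrow> r (Suc n) \<cdot> v = mzero C (src C v) (tgt C (r (Suc n)))"
proof -
  from R obtain r where r: "right_approximation_angle n C \<Theta> X A r" by blast
  then have r1: "r \<in> \<Theta>" "src C (r (Suc n)) = A" "\<And>i. 1 \<le> i \<Longrightarrow> i \<le> n \<Longrightarrow> src C (r i) \<in> X"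
    unfolding right_approximation_angle_def by auto
  note [simp] = nseqD(1)[OF angle_sq[OF r1(1)]]
  show thesis
  proof (rule that[OF r1])
    fix v assume v: "v \<in> arr C" "src C v \<in> X" "tgt C v = A"
    then have "v \<in> Hom C (src C v) A" by simp
    then obtain v' where v': "v' \<in> Hom C (src C v) (src C (r n))" "v = r n \<cdot> v'"
      using r v(2) unfolding right_approximation_angle_def right_approximation_def by blast
    show "r (Suc n) \<cdot> v = mzero C (src C v) (tgt C (r (Suc n)))"
      using comp_zero_assoc(1)[OF r1(1) le_refl, of v'] v'(1) v'(2)[symmetric] by simp
  qed
qed

end

sublocale approx \<subseteq> Q: seq_functor "quotient_cat C X" "G_functor n C T X L" n
  by unfold_locales (rule G_additive)

section \<open>The Frobenius condition\<close>

text \<open>The Serre functor does not occur in this locale: for the construction of the angulation,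
  this condition is all that the equality of the two images contributes.\<close>

locale frobenius = approx +
  assumes frob: "e \<in> \<Theta> \<Longrightarrow> X_monic C X (e 0) \<longleftrightarrow>
    (\<forall>v\<in>arr C. src C v \<in> X \<longrightarrow> tgt C v = src C (e (Suc n)) \<longrightarrow>
      e (Suc n) \<cdot> v = mzero C (src C v) (tgt C (e (Suc n))))"
begin

lemma last_kill:
  assumes e: "e \<in> \<Theta>" "X_monic C X (e 0)" and w: "thr w" "tgt C w = src C (e (Suc n))"
  shows "e (Suc n) \<cdot> w = mzero C (src C w) (tgt C (e (Suc n)))"
proof -
  note [simp] = nseqD(1)[OF angle_sq[OF e(1)]]
  from w(1) obtain D g h where d: "D \<in> X" "g \<in> arr C" "src C g = src C w" "tgt C g = D" "h \<in> arr C" "src C h = D"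
    "tgt C h = tgt C w" "h \<cdot> g = w" by (rule thrE)
  have "e (Suc n) \<cdot> h = mzero C D (tgt C (e (Suc n)))" using frob[OF e(1)] e(2) d w(2) by auto
  then have "e (Suc n) \<cdot> (h \<cdot> g) = mzero C D (tgt C (e (Suc n))) \<cdot> g"
    using d(2-7) w(2) by (rule_tac cmp_eq_assoc) simp_all
  then show ?thesis using d by simp
qed

lemma l_thr: "thr w \<Longrightarrow> tgt C w = ob G A \<Longrightarrow> l A \<cdot> w = mzero C (src C w) (ob T A)"
  using last_kill[OF L_angle L_monic, of w A] by simp

text \<open>The converse of \<open>thr_of_l_eq\<close>, since under the Frobenius condition
  \<open>l A\<close> kills maps through \<open>X\<close>. With both directions, equality of classes
  of maps into \<open>ob G A\<close> becomes an equation in \<open>C\<close>.\<close>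

lemma l_eq:
  assumes "w \<in> arr C" "w' \<in> arr C" "src C w = src C w'" "tgt C w = ob G A" "tgt C w' = ob G A" "cl w = cl w'"
  shows "l A \<cdot> w = l A \<cdot> w'"
proof -
  have "thr (w \<oplus> mneg C w')" using assms cl_eq_iff[of w w'] by simp
  then have "l A \<cdot> (w \<oplus> mneg C w') = mzero C (src C w') (ob T A)" using l_thr[of "w \<oplus> mneg C w'" A] assms by simp
  then have "(l A \<cdot> w) \<oplus> mneg C (l A \<cdot> w') = mzero C (src C w') (ob T A)" using assms by simp
  then show ?thesis using diff_zero_iff[of "l A \<cdot> w" "l A \<cdot> w'"] assms by simp
qed

text \<open>Under the Frobenius condition an angle (2) also has an \<open>X\<close>-monic first map,
  so it can play the role of an angle (1) of its first object.\<close>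

lemma right_angle_exists:
  obtains r where "r \<in> \<Theta>" "src C (r (Suc n)) = A" "\<And>i. 1 \<le> i \<Longrightarrow> i \<le> n \<Longrightarrow> src C (r i) \<in> X" "X_monic C X (r 0)"
proof -
  obtain r where r: "r \<in> \<Theta>" "src C (r (Suc n)) = A" "\<And>i. 1 \<le> i \<Longrightarrow> i \<le> n \<Longrightarrow> src C (r i) \<in> X"
    "\<And>v. v \<in> arr C \<Longrightarrow> src C v \<in> X \<Longrightarrow> tgt C v = A \<Longrightarrow> r (Suc n) \<cdot> v = mzero C (src C v) (tgt C (r (Suc n)))"
    by (rule right_angleE[of A]) blast
  have "X_monic C X (r 0)" unfolding frob[OF r(1)] using r(2,4) by simp
  then show thesis using that r(1-3) by blast
qed

text \<open>The difference \<open>d\<close> satisfies \<open>ar T d \<cdot> l A = 0\<close>, hence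
  \<open>ar T d\<close> factors through \<open>ar T (L A 0)\<close>. Pulled back along
  \<open>T\<close>, this factors \<open>d\<close> through an object of \<open>X\<close>.\<close>

lemma G_faithful:
  assumes "F \<in> Hom Q A B" "F' \<in> Hom Q A B" "ar G F = ar G F'"
  shows "F = F'"
proof -
  from assms(1) obtain f where f [simp]: "f \<in> arr C" "F = cl f" "src C f = A" "tgt C f = B" by (rule Hom_QE)
  from assms(2) obtain f' where f' [simp]: "f' \<in> arr C" "F' = cl f'" "src C f' = A" "tgt C f' = B" by (rule Hom_QE)
  obtain p where p: "p \<in> arr C" "src C p = ob G A" "tgt C p = ob G B" "l B \<cdot> p = ar T f \<cdot> l A" "ar G (cl f) = cl p"
    using G_arE[OF f(1)] by (metis f(3,4))
  obtain p' where p': "p' \<in> arr C" "src C p' = ob G A" "tgt C p' = ob G B" "l B \<cdot> p' = ar T f' \<cdot> l A" "ar G (cl f') = cl p'"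
    using G_arE[OF f'(1)] by (metis f'(3,4))
  have "l B \<cdot> p = l B \<cdot> p'" by (rule l_eq) (use p p' assms(3) in simp_all)
  then have e: "ar T f \<cdot> l A = ar T f' \<cdot> l A" using p p' by simp
  define d where "d = f \<oplus> mneg C f'"
  have d: "d \<in> arr C" "src C d = A" "tgt C d = B" by (simp_all add: d_def)
  have "ar T d \<cdot> l A = mzero C (ob G A) (ob T B)" using e by (simp add: d_def)
  then obtain s where s: "s \<in> Hom C (ob T (tgt C (L A 0))) (ob T B)" "ar T d = s \<cdot> ar T (L A 0)"
    using wcoker(2)[OF L_angle[of A], of "ar T d"] d by auto
  obtain x where x: "x \<in> Hom C (tgt C (L A 0)) B" "ar T x = s" using full[OF s(1)] by blast
  have "x \<cdot> L A 0 = d"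
    by (rule faithful[of _ A B]) (use x s d in simp_all)
  moreover have "thr (x \<cdot> L A 0)" by (rule thrI) (use x L_X(2) in simp_all)
  ultimately show ?thesis using cl_eqI[of f f'] by (simp add: d_def)
qed

text \<open>\<open>h \<cdot> L A n\<close> factors through \<open>X\<close> and dies after
  \<open>l B\<close>. So \<open>l B \<cdot> h\<close> factors through \<open>l A\<close>, and the
  factor is \<open>T\<close> of the preimage sought.\<close>

lemma G_full:
  assumes "H \<in> Hom Q (ob G A) (ob G B)"
  shows "\<exists>F\<in>Hom Q A B. ar G F = H"
proof -
  from assms obtain h where h [simp]: "h \<in> arr C" "H = cl h" "src C h = ob G A" "tgt C h = ob G B" by (rule Hom_QE)
  have "thr (h \<cdot> L A n)" by (rule thr_cmp) (use thr_ob[of "L A n"] L_X(1)[of n A] n1 in simp_all)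
  then have "l B \<cdot> (h \<cdot> L A n) = mzero C (src C (L A n)) (ob T B)" using l_thr[of "h \<cdot> L A n" B] by simp
  then obtain s where s: "s \<in> Hom C (ob T A) (ob T B)" "l B \<cdot> h = s \<cdot> l A"
    using wcoker(1)[OF L_angle[of A], of "l B \<cdot> h" n] by auto
  obtain f where f: "f \<in> Hom C A B" "ar T f = s" using full[OF s(1)] by blast
  have "ar G (cl f) = cl h" by (rule G_ar) (use f s in simp_all)
  then show ?thesis using f by (intro bexI[of _ "cl f"]) simp_all
qed

text \<open>Uniqueness of angles (1) up to isomorphism in the quotient. The inverse exists because
  \<open>r 0\<close> factors through \<open>X\<close>: then \<open>ar T (r 0)\<close> kills the
  connecting morphism \<open>l\<close>, which therefore factors through
  \<open>r (Suc n)\<close>.\<close>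

lemma right_angle_iso:
  assumes r: "r \<in> \<Theta>" "\<And>i. 1 \<le> i \<Longrightarrow> i \<le> n \<Longrightarrow> src C (r i) \<in> X" "X_monic C X (r 0)"
    and e: "\<epsilon> \<in> arr C" "src C \<epsilon> = src C (r (Suc n))" "tgt C \<epsilon> = ob G (src C (r 0))" "l (src C (r 0)) \<cdot> \<epsilon> = r (Suc n)"
  shows "is_iso Q (cl \<epsilon>)"
proof -
  let ?H = "src C (r 0)"
  note [simp] = nseqD[OF angle_sq[OF r(1)]] e
  have "tgt C (r 0) \<in> X" using r(2)[of 1] n1 by simp
  then have "thr (r 0)" by (intro thr_ob) simp_all
  then have "ar T (r 0) \<cdot> l ?H = mzero C (ob G ?H) (ob T (tgt C (r 0)))" using l_kill[of "r 0" ?H] by simp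
  then obtain k where k: "k \<in> Hom C (ob G ?H) (src C (r (Suc n)))" "l ?H = r (Suc n) \<cdot> k"
    using wker(2)[OF r(1), of "l ?H"] by auto
  note ea = e(4)[THEN cmp_eq_assoc]
  have "cl (\<epsilon> \<cdot> k) = cl (ide C (ob G ?H))"
    by (rule thr_of_l_eq[of _ ?H]) (use k(1) k(2)[symmetric] ea[of k] in simp_all)
  moreover have "thr ((k \<cdot> \<epsilon>) \<oplus> mneg C (ide C (src C (r (Suc n)))))"
  proof (rule thr_of_last[OF r(1)])
    show "src C (r n) \<in> X" using r(2)[of n] n1 by simp
    have "r (Suc n) \<cdot> (k \<cdot> \<epsilon>) = r (Suc n)" using k(2)[symmetric, THEN cmp_eq_assoc, of \<epsilon>] k(1) by simp
    then show "r (Suc n) \<cdot> ((k \<cdot> \<epsilon>) \<oplus> mneg C (ide C (src C (r (Suc n))))) =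
      mzero C (src C ((k \<cdot> \<epsilon>) \<oplus> mneg C (ide C (src C (r (Suc n)))))) (tgt C (r (Suc n)))"
      using k(1) by simp
  qed (use k(1) in simp_all)
  then have "cl (k \<cdot> \<epsilon>) = cl (ide C (src C (r (Suc n))))"
    using k(1) by (intro cl_eqI) simp_all
  ultimately show ?thesis
    using k(1) by (intro Q.is_isoI[of _ "cl k"]) (simp_all add: Q_ide)
qed

text \<open>An \<open>X\<close>-monic angle with the comparison map from its last object to
  \<open>G\<close> of its first one. Of the morphism to the chosen angle only this last component is
  recorded: it is characterized by one equation, all of whose solutions have the same class.\<close>

definition conf :: "(nat \<Rightarrow> 'b) \<Rightarrow> 'b \<Rightarrow> bool" where
  "conf e w \<longleftrightarrow> e \<in> \<Theta> \<and> X_monic C X (e 0) \<and> w \<in> arr C \<and> src C w = src C (e (Suc n)) \<and>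
    tgt C w = ob G (src C (e 0)) \<and> l (src C (e 0)) \<cdot> w = e (Suc n)"

definition std :: "(nat \<Rightarrow> 'b) \<Rightarrow> 'b \<Rightarrow> nat \<Rightarrow> 'b set" where
  "std e w i = (if i \<le> n then cl (e i) else cl w)"

abbreviation RA where "RA \<equiv> right_angles n C T \<Theta> X L"

lemma confD:
  assumes "conf e w"
  shows "e \<in> \<Theta>" "X_monic C X (e 0)" "w \<in> arr C" "src C w = src C (e (Suc n))" "tgt C w = ob G (src C (e 0))"
    "l (src C (e 0)) \<cdot> w = e (Suc n)" "sq e"
    "x \<in> arr C \<Longrightarrow> tgt C x = src C (e (Suc n)) \<Longrightarrow> l (src C (e 0)) \<cdot> (w \<cdot> x) = e (Suc n) \<cdot> x"
  using assms angle_sq cmp_eq_assoc[of "l (src C (e 0))" w "e (Suc n)" x] unfolding conf_def by simp_all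

lemma conf_exists:
  assumes "e \<in> \<Theta>" "X_monic C X (e 0)"
  obtains w where "conf e w"
proof -
  note [simp] = nseqD[OF angle_sq[OF assms(1)]]
  obtain \<mu> where m: "mor e (L (src C (e 0))) \<mu>" "\<mu> 0 = ide C (src C (e 0))"
    using L_extend[OF assms, of "ide C (src C (e 0))"] by auto
  show thesis
    by (rule that[of "\<mu> (Suc n)"])
      (use assms m(2) mor_simps(1-3)[OF m(1), of "Suc n"] mor_simps(5)[OF m(1), symmetric] in \<open>simp_all add: conf_def\<close>)
qed

lemma std_sq:
  assumes "conf e w"
  shows "Q.sq (std e w)"
proof (rule nseqI)
  note [simp] = nseqD[OF confD(7)[OF assms]] confD[OF assms]
  show "tgt Q (std e w i) = src Q (std e w (Suc i))" if "i \<le> n" for i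
    using that by (cases "i = n") (simp_all add: std_def)
qed (use nseqD[OF confD(7)[OF assms]] confD[OF assms] in \<open>simp_all add: std_def\<close>)

lemma std_src:
  assumes "conf e w" "i \<le> Suc n"
  shows "src Q (std e w i) = src C (e i)"
proof -
  consider "i \<le> n" | "i = Suc n" using assms by linarith
  then show ?thesis using nseqD[OF confD(7)[OF assms(1)]] confD[OF assms(1)] by cases (simp_all add: std_def)
qed

lemma std_RA:
  assumes "conf e w"
  shows "std e w \<in> RA"
proof -
  note [simp] = nseqD[OF confD(7)[OF assms]] confD[OF assms]
  obtain \<mu> where m: "mor e (L (src C (e 0))) \<mu>" "\<mu> 0 = ide C (src C (e 0))"
    using L_extend[OF confD(1,2)[OF assms], of "ide C (src C (e 0))"] by auto
  have "cl (\<mu> (Suc n)) = cl w"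
    by (rule thr_of_l_eq[of _ "src C (e 0)"]) (use mor_simps(1-3)[OF m(1), of "Suc n"] mor_simps(5)[OF m(1), symmetric] m(2) in simp_all)
  then have "standard_right_angle n C T \<Theta> X L (std e w)"
    unfolding standard_right_angle_def using confD(1,2)[OF assms] m
    by (intro bexI[of _ e] exI[of _ \<mu>]) (auto simp: std_def fun_eq_iff)
  then show ?thesis unfolding right_angles_def using Q.siso_refl[OF std_sq[OF assms]] by blast
qed

lemma RA_iso: "F \<in> RA \<Longrightarrow> Q.siso F F' \<Longrightarrow> F' \<in> RA"
  unfolding right_angles_def using Q.siso_trans by blast

lemma RAE:
  assumes "F \<in> RA"
  obtains e w where "conf e w" "Q.siso (std e w) F"
proof -
  obtain E where E: "standard_right_angle n C T \<Theta> X L E" "Q.siso E F" using assms unfolding right_angles_def by blast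
  from E(1) obtain e \<mu> where e: "e \<in> \<Theta>" "X_monic C X (e 0)" "mor e (L (src C (e 0))) \<mu>" "\<mu> 0 = ide C (src C (e 0))"
    "E = (\<lambda>i. if i \<le> n then cl (e i) else cl (\<mu> (Suc n)))"
    unfolding standard_right_angle_def Suc_eq_plus1 by blast
  have "conf e (\<mu> (Suc n))"
    unfolding conf_def using e(1,2,4) mor_simps(1-3)[OF e(3), of "Suc n"] mor_simps(5)[OF e(3), symmetric]
      nseqD(1-3,6)[OF angle_sq[OF e(1)]] by simp
  moreover have "E = std e (\<mu> (Suc n))" unfolding e(5) std_def by auto
  ultimately show thesis using that E(2) by simp
qed

lemma RA_sq: "F \<in> RA \<Longrightarrow> Q.sq F"
  by (erule RAE) (auto simp: nseq_isomorphic_def dest: nseq_morphismD)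

text \<open>Composites with a value of \<open>G\<close> are computed after \<open>l\<close>, where
  \<open>G\<close> turns into \<open>T\<close>.\<close>

lemma G_cmp:
  assumes "f \<in> arr C" "w \<in> arr C" "tgt C w = ob G (src C f)" "v \<in> arr C" "tgt C v = ob G (tgt C f)"
    "src C v = src C w" "l (tgt C f) \<cdot> v = ar T f \<cdot> (l (src C f) \<cdot> w)"
  shows "ar G (cl f) \<cdot>\<^bsub>Q\<^esub> cl w = cl v"
proof -
  obtain \<psi> where p: "\<psi> \<in> arr C" "src C \<psi> = ob G (src C f)" "tgt C \<psi> = ob G (tgt C f)"
    "l (tgt C f) \<cdot> \<psi> = ar T f \<cdot> l (src C f)" "ar G (cl f) = cl \<psi>" by (rule G_arE[OF assms(1)])
  have "cl (\<psi> \<cdot> w) = cl v"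
    by (rule thr_of_l_eq[of _ "tgt C f"]) (use assms p p(4)[THEN cmp_eq_assoc, of w] in simp_all)
  then show ?thesis using p assms by simp
qed

lemma std_mor:
  assumes "conf e w" "conf e' w'" "mor e e' \<mu>"
  shows "Q.mor (std e w) (std e' w') (\<lambda>i. cl (\<mu> i))"
proof (rule nseq_morphismI[OF std_sq[OF assms(1)] std_sq[OF assms(2)]])
  note [simp] = nseqD[OF confD(7)[OF assms(1)]] nseqD[OF confD(7)[OF assms(2)]] confD[OF assms(1)] confD[OF assms(2)]
    mor_simps[OF assms(3)] std_src[OF assms(1)] std_src[OF assms(2)]
  show "cl (\<mu> i) \<in> Hom Q (src Q (std e w i)) (src Q (std e' w' i))" if "i \<le> Suc n" for i
    using that by simp
  show "cl (\<mu> (Suc i)) \<cdot>\<^bsub>Q\<^esub> std e w i = std e' w' i \<cdot>\<^bsub>Q\<^esub> cl (\<mu> i)" if "i \<le> n" for i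
    using that by (simp add: std_def)
  have "ar G (cl (\<mu> 0)) \<cdot>\<^bsub>Q\<^esub> cl w = cl (w' \<cdot> \<mu> (Suc n))" by (rule G_cmp) simp_all
  then show "ar G (cl (\<mu> 0)) \<cdot>\<^bsub>Q\<^esub> std e w (Suc n) = std e' w' (Suc n) \<cdot>\<^bsub>Q\<^esub> cl (\<mu> (Suc n))"
    by (simp add: std_def)
qed

text \<open>The failure of commutativity factors through \<open>X\<close> as
  \<open>y \<cdot> x\<close>. The map \<open>x\<close> extends along the \<open>X\<close>-monic
  \<open>f\<close>, and subtracting \<open>y \<cdot> x'\<close> from \<open>b\<close> repairs the
  square without changing the class of \<open>b\<close>.\<close>

lemma square_lift:
  assumes f: "f \<in> arr C" "X_monic C X f" and g: "g \<in> arr C" and a: "a \<in> arr C" "src C a = src C f" "tgt C a = src C g"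
    and b: "b \<in> arr C" "src C b = tgt C f" "tgt C b = tgt C g" and eq: "cl (b \<cdot> f) = cl (g \<cdot> a)"
  obtains b' where "b' \<in> arr C" "src C b' = tgt C f" "tgt C b' = tgt C g" "cl b' = cl b" "b' \<cdot> f = g \<cdot> a"
proof -
  note [simp] = f(1) g a b
  define d where "d = (b \<cdot> f) \<oplus> mneg C (g \<cdot> a)"
  have "thr d" unfolding d_def using eq by (subst (asm) cl_eq_iff) simp_all
  then obtain D x y where x: "D \<in> X" "x \<in> arr C" "src C x = src C d" "tgt C x = D" "y \<in> arr C" "src C y = D"
    "tgt C y = tgt C d" "y \<cdot> x = d" by (rule thrE)
  have sd: "src C d = src C f" "tgt C d = tgt C g" by (simp_all add: d_def)
  obtain x' where x': "x' \<in> arr C" "src C x' = tgt C f" "tgt C x' = D" "x' \<cdot> f = x"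
    using X_monicE[OF f(2), of x] x sd by metis
  show thesis
  proof (rule that[of "b \<oplus> mneg C (y \<cdot> x')"])
    have "(b \<oplus> mneg C (y \<cdot> x')) \<cdot> f = (b \<cdot> f) \<oplus> mneg C d" using x x' sd by simp
    also have "\<dots> = g \<cdot> a" unfolding d_def by (simp add: add_ac)
    finally show "(b \<oplus> mneg C (y \<cdot> x')) \<cdot> f = g \<cdot> a" .
    have "thr (mneg C (y \<cdot> x'))" using x x' by (intro thr_neg thrI) simp_all
    then show "cl (b \<oplus> mneg C (y \<cdot> x')) = cl b"
      using x x' sd by (intro cl_eqI) simp_all
  qed (use x x' sd in simp_all)
qed

lemma F4_std:
  assumes f: "conf f wF" and g: "conf g wG" and a: "a \<in> Hom Q (src C (f 0)) (src C (g 0))"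
    and b: "b \<in> Hom Q (tgt C (f 0)) (tgt C (g 0))" and eq: "b \<cdot>\<^bsub>Q\<^esub> cl (f 0) = cl (g 0) \<cdot>\<^bsub>Q\<^esub> a"
  shows "\<exists>\<phi> h. Q.mor (std f wF) (std g wG) \<phi> \<and> \<phi> 0 = a \<and> \<phi> (Suc 0) = b \<and>
    mapping_cone n Q G (std f wF) (std g wG) \<phi> h \<and> h \<in> RA"
proof -
  let ?A = "src C (f 0)" and ?B = "src C (g 0)"
  have srcf [simp]: "src C (f (Suc i)) = tgt C (f i)" "src C (g (Suc i)) = tgt C (g i)"
     "src C (L ?A (Suc i)) = tgt C (L ?A i)" if "i \<le> n" for i
    using nseqD(4)[OF confD(7)[OF f] that] nseqD(4)[OF confD(7)[OF g] that] nseqD(4)[OF L_sq that] by simp_all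
  note [simp] = nseqD(1-3,6)[OF confD(7)[OF f]] nseqD(1-3,6)[OF confD(7)[OF g]] confD[OF f] confD[OF g]
  from a obtain a' where a' [simp]: "a' \<in> arr C" "a = cl a'" "src C a' = ?A" "tgt C a' = ?B" by (rule Hom_QE)
  from b obtain b0 where b0: "b0 \<in> arr C" "b = cl b0" "src C b0 = tgt C (f 0)" "tgt C b0 = tgt C (g 0)" by (rule Hom_QE)
  have "cl (b0 \<cdot> f 0) = cl (g 0 \<cdot> a')" using eq b0 by simp
  then obtain b' where b' [simp]: "b' \<in> arr C" "src C b' = tgt C (f 0)" "tgt C b' = tgt C (g 0)" "cl b' = cl b0"
    and sqb: "b' \<cdot> f 0 = g 0 \<cdot> a'"
    using square_lift[of "f 0" "g 0" a' b0] b0 by auto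
  \<comment> \<open>Adding the angle (1) of \<open>?A\<close> makes the first component (a', 1) a
    split monomorphism. In the quotient the middle objects do not change, and the last object
    \<open>ob G ?A\<close> takes the place of the summand \<open>ob T ?A\<close> that the reduced
    cone drops.\<close>
  obtain k where ks: "dsum g (L ?A) k" using dsum_exists[OF confD(7)[OF g] L_sq has_direct_sums] by blast
  have k: "k \<in> \<Theta>" by (rule angle_sum[OF confD(1)[OF g] L_angle ks])
  from ks obtain u1 u2 v1 v2 where d: "mor g k u1" "mor (L ?A) k u2" "mor k g v1" "mor k (L ?A) v2"
    "\<And>j. j \<le> Suc n \<Longrightarrow> biproduct C (src C (g j)) (src C (L ?A j)) (src C (k j)) (u1 j) (u2 j) (v1 j) (v2 j)"
    by (rule dsumE) blast
  have kD [simp]: "i \<le> Suc n \<Longrightarrow> k i \<in> arr C" "i \<le> n \<Longrightarrow> src C (k (Suc i)) = tgt C (k i)"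
    "tgt C (k (Suc n)) = ob T (src C (k 0))" for i
    using nseqD[OF angle_sq[OF k]] by simp_all
  note ds [simp] = biproduct_simps[OF d(5)]
  note dT [simp] = biproduct_simps[OF ar_biproduct[OF d(5)]]
  note [simp] = mor_simps(4-)[OF d(1)] mor_simps(4-)[OF d(2)] mor_simps(4-)[OF d(3)] mor_simps(4-)[OF d(4)]
  obtain \<alpha> where al [simp]: "\<alpha> \<in> arr C" "src C \<alpha> = tgt C (f 0)" "tgt C \<alpha> = tgt C (L ?A 0)" and al4: "\<alpha> \<cdot> f 0 = L ?A 0"
    using X_monicE[OF confD(2)[OF f], of "L ?A 0"] L_X(2)[of ?A] by auto
  define \<phi>0 \<phi>1 where "\<phi>0 = (u1 0 \<cdot> a') \<oplus> u2 0" and "\<phi>1 = (u1 (Suc 0) \<cdot> b') \<oplus> (u2 (Suc 0) \<cdot> \<alpha>)"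
  \<comment> \<open>The image of \<open>\<phi>0\<close> is the graph of \<open>a'\<close>, with the
    summand \<open>?B\<close> as a complement.\<close>
  have bP: "biproduct C ?A ?B (src C (k 0)) \<phi>0 (u1 0) (v2 0) (v1 0 \<oplus> mneg C (a' \<cdot> v2 0))"
    unfolding biproduct_def using biproductD(17)[OF d(5)[of 0]] by (simp add: \<phi>0_def add_ac)
  have p1: "\<phi>1 \<in> Hom C (src C (f (Suc 0))) (src C (k (Suc 0)))" by (simp add: \<phi>1_def)
  have sq1: "\<phi>1 \<cdot> f 0 = k 0 \<cdot> \<phi>0"
    by (simp add: \<phi>1_def \<phi>0_def sqb al4)
  obtain M k1 k2 r1 r2 where bM: "biproduct C (tgt C (f 0)) ?B M k1 k2 r1 r2"
    using has_direct_sums[of "tgt C (f 0)" ?B] unfolding direct_sum_def by blast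
  obtain \<phi> m i1 i2 p1 p2 where ph: "mor f k \<phi>" "\<phi> 0 = \<phi>0" "\<phi> (Suc 0) = \<phi>1" and m: "m \<in> \<Theta>" "src C (m 0) = M"
    "src C (m (Suc n)) = src C (k (Suc n))"
    and bm: "\<And>i. 1 \<le> i \<Longrightarrow> i \<le> n \<Longrightarrow>
      biproduct C (tgt C (f i)) (src C (k i)) (src C (m i)) (i1 i) (i2 i) (p1 i) (p2 i)"
    and m0: "p1 (Suc 0) \<cdot> (m 0 \<cdot> k1) = mneg C (f (Suc 0))" "p2 (Suc 0) \<cdot> (m 0 \<cdot> k1) = \<phi>1"
    "p1 (Suc 0) \<cdot> (m 0 \<cdot> k2) = mzero C ?B (tgt C (f (Suc 0)))" "p2 (Suc 0) \<cdot> (m 0 \<cdot> k2) = k 0 \<cdot> u1 0"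
    and mi: "\<And>i. 1 \<le> i \<Longrightarrow> i < n \<Longrightarrow> p1 (Suc i) \<cdot> (m i \<cdot> i1 i) = mneg C (f (Suc i))"
    "\<And>i. 1 \<le> i \<Longrightarrow> i < n \<Longrightarrow> p2 (Suc i) \<cdot> (m i \<cdot> i1 i) = \<phi> (Suc i)"
    "\<And>i. 1 \<le> i \<Longrightarrow> i < n \<Longrightarrow> p1 (Suc i) \<cdot> (m i \<cdot> i2 i) = mzero C (src C (k i)) (tgt C (f (Suc i)))"
    "\<And>i. 1 \<le> i \<Longrightarrow> i < n \<Longrightarrow> p2 (Suc i) \<cdot> (m i \<cdot> i2 i) = k i"
    and mn: "m n \<cdot> i1 n = \<phi> (Suc n)" "m n \<cdot> i2 n = k n"
    and ml: "ar T r1 \<cdot> m (Suc n) = ar T (f 0) \<cdot> (ar T (v2 0) \<cdot> k (Suc n))"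
      "ar T r2 \<cdot> m (Suc n) = ar T (v1 0 \<oplus> mneg C (a' \<cdot> v2 0)) \<cdot> k (Suc n)"
    using reduced_cone[OF confD(1)[OF f] k bP p1 sq1 bM] by blast
  have mD [simp]: "i \<le> Suc n \<Longrightarrow> m i \<in> arr C" "i \<le> n \<Longrightarrow> tgt C (m i) = src C (m (Suc i))"
    "tgt C (m (Suc n)) = ob T M" for i
    using nseqD[OF angle_sq[OF m(1)]] m(2) by simp_all
  note [simp] = m(2,3) biproduct_simps[OF bM] biproduct_simps[OF ar_biproduct[OF bM]]
  note bms [simp] = biproduct_simps[OF bm]
  note m0a = m0(1)[THEN cmp_eq_assoc3] m0(2)[THEN cmp_eq_assoc3] m0(3)[THEN cmp_eq_assoc3] m0(4)[THEN cmp_eq_assoc3]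
  note mia = mi(1)[THEN cmp_eq_assoc3] mi(2)[THEN cmp_eq_assoc3] mi(3)[THEN cmp_eq_assoc3] mi(4)[THEN cmp_eq_assoc3]
  have monic: "X_monic C X (m 0)"
    unfolding X_monic_iff
  proof (intro conjI ballI)
    fix D x assume D: "D \<in> X" and "x \<in> Hom C (src C (m 0)) D"
    then have x [simp]: "x \<in> arr C" "src C x = M" "tgt C x = D" by simp_all
    \<comment> \<open>To extend \<open>x\<close> along \<open>m 0\<close>, \<open>y\<close> takes
      care of the summand \<open>?B\<close>. The remainder \<open>x1\<close> need not kill
      \<open>f 0\<close>, but \<open>x1 \<cdot> f 0\<close> extends along \<open>L ?A 0\<close>,
      which is what the added angle is for; after this correction \<open>x1\<close> factors through
      \<open>f (Suc 0)\<close>.\<close>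
    obtain y where y [simp]: "y \<in> arr C" "src C y = tgt C (g 0)" "tgt C y = D" and y4: "y \<cdot> g 0 = x \<cdot> k2"
      using X_monicE[OF confD(2)[OF g], of "x \<cdot> k2"] D by auto
    define x1 where "x1 = (x \<cdot> k1) \<oplus> mneg C (y \<cdot> b')"
    have x1 [simp]: "x1 \<in> arr C" "src C x1 = tgt C (f 0)" "tgt C x1 = D" by (simp_all add: x1_def)
    obtain z where z [simp]: "z \<in> arr C" "src C z = tgt C (L ?A 0)" "tgt C z = D" and z4: "z \<cdot> L ?A 0 = x1 \<cdot> f 0"
      using X_monicE[OF L_monic[of ?A], of "x1 \<cdot> f 0"] D by auto
    have "(x1 \<oplus> mneg C (z \<cdot> \<alpha>)) \<cdot> f 0 = mzero C ?A D" by (simp add: al4 z4)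
    then have "\<exists>t\<in>Hom C (tgt C (f (Suc 0))) D. x1 \<oplus> mneg C (z \<cdot> \<alpha>) = t \<cdot> f (Suc 0)"
      using wcoker(1)[OF confD(1)[OF f], of "x1 \<oplus> mneg C (z \<cdot> \<alpha>)" 0] by simp
    then obtain t where t: "t \<in> Hom C (tgt C (f (Suc 0))) D" "x1 \<oplus> mneg C (z \<cdot> \<alpha>) = t \<cdot> f (Suc 0)" by blast
    then have t1 [simp]: "t \<in> arr C" "src C t = tgt C (f (Suc 0))" "tgt C t = D" by simp_all
    define c where "c = (y \<cdot> v1 (Suc 0)) \<oplus> (z \<cdot> v2 (Suc 0))"
    have c [simp]: "c \<in> arr C" "src C c = src C (k (Suc 0))" "tgt C c = D" by (simp_all add: c_def)
    show "\<exists>g'\<in>Hom C (tgt C (m 0)) D. x = g' \<cdot> m 0"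
    proof (rule bexI[of _ "(c \<cdot> p2 (Suc 0)) \<oplus> mneg C (t \<cdot> p1 (Suc 0))"])
      show "x = ((c \<cdot> p2 (Suc 0)) \<oplus> mneg C (t \<cdot> p1 (Suc 0))) \<cdot> m 0"
      proof (rule biproduct_eqI(1)[OF bM])
        have "(((c \<cdot> p2 (Suc 0)) \<oplus> mneg C (t \<cdot> p1 (Suc 0))) \<cdot> m 0) \<cdot> k1 = (c \<cdot> \<phi>1) \<oplus> (t \<cdot> f (Suc 0))"
          using n1 by (simp add: m0)
        also have "\<dots> = x \<cdot> k1" unfolding t(2)[symmetric] by (simp add: c_def \<phi>1_def x1_def add_ac)
        finally show "x \<cdot> k1 = (((c \<cdot> p2 (Suc 0)) \<oplus> mneg C (t \<cdot> p1 (Suc 0))) \<cdot> m 0) \<cdot> k1" by simp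
        have "c \<cdot> (k 0 \<cdot> u1 0) = y \<cdot> g 0" by (simp add: c_def)
        then show "x \<cdot> k2 = (((c \<cdot> p2 (Suc 0)) \<oplus> mneg C (t \<cdot> p1 (Suc 0))) \<cdot> m 0) \<cdot> k2"
          using n1 by (simp add: m0 y4 del: mor_simps(4)[OF d(1)])
      qed (use n1 in simp_all)
    qed (use n1 in simp_all)
  qed simp_all
  obtain w where w: "conf m w" by (rule conf_exists[OF m(1) monic])
  have w1 [simp]: "w \<in> arr C" "src C w = src C (k (Suc n))" "tgt C w = ob G M" "l M \<cdot> w = m (Suc n)"
    using confD[OF w] by simp_all
  note [simp] = w1(4)[THEN cmp_eq_assoc]
  define \<theta> where "\<theta> i = (if i = 0 then a' else if i = 1 then b' else v1 i \<cdot> \<phi> i)" for i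
  have th: "\<theta> i = v1 i \<cdot> \<phi> i" if "i \<le> Suc n" for i
    using ph(2,3) by (simp add: \<theta>_def \<phi>0_def \<phi>1_def)
  have phs [simp]: "\<phi> (Suc i) \<in> arr C" "src C (\<phi> (Suc i)) = tgt C (f i)" "tgt C (\<phi> (Suc i)) = tgt C (k i)" if "i \<le> n" for i
    using mor_simps(1-3)[OF ph(1), of "Suc i"] that by simp_all
  have ths: "mor f g \<theta>"
  proof -
    have "mor f g (\<lambda>i. v1 i \<cdot> \<phi> i)" by (rule mor_cmp[OF ph(1) d(3)])
    then show ?thesis using th by (simp add: nseq_morphism_def)
  qed
  have tm: "Q.mor (std f wF) (std g wG) (\<lambda>i. cl (\<theta> i))" by (rule std_mor[OF f g ths])
  \<comment> \<open>The component of \<phi> in the summand \<open>L ?A\<close> starts with the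
    identity, so its last entry is a comparison map of \<open>f\<close>.\<close>
  have wFv: "cl (v2 (Suc n) \<cdot> \<phi> (Suc n)) = cl wF"
  proof (rule thr_of_l_eq[of _ ?A])
    have "ar T (v2 0) \<cdot> (ar T (\<phi> 0) \<cdot> f (Suc n)) = f (Suc n)"
      using ph(2) by (simp add: \<phi>0_def)
    then have "ar T (v2 0) \<cdot> (k (Suc n) \<cdot> \<phi> (Suc n)) = f (Suc n)" unfolding mor_simps(5)[OF ph(1)] .
    then show "l ?A \<cdot> (v2 (Suc n) \<cdot> \<phi> (Suc n)) = l ?A \<cdot> wF" by simp
  qed simp_all
  have wFv': "cl (mneg C (v2 (Suc n) \<cdot> \<phi> (Suc n))) = cl (mneg C wF)"
    using arg_cong[OF wFv, of "mneg Q"] by simp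
  \<comment> \<open>In the middle the summands from \<open>L ?A\<close> lie in \<open>X\<close> and
    are ignored. At the end the summand \<open>ob G ?A\<close> is embedded with sign -1, because the
    cone requires the entry -wF there while \<phi> provides wF.\<close>
  define I1 I2 P1 P2 where "I1 i = (if i = 0 then k1 else if i \<le> n then i1 i else mneg C (u2 i))"
    and "I2 i = (if i = 0 then k2 else if i \<le> n then i2 i \<cdot> u1 i else u1 i)"
    and "P1 i = (if i = 0 then r1 else if i \<le> n then p1 i else mneg C (v2 i))"
    and "P2 i = (if i = 0 then r2 else if i \<le> n then v1 i \<cdot> p2 i else v1 i)" for i
  have bQ: "biproduct Q (tgt Q (std f wF j)) (src Q (std g wG j)) (src Q (std m w j))
      (cl (I1 j)) (cl (I2 j)) (cl (P1 j)) (cl (P2 j))" if j: "j \<le> Suc n" for j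
  proof -
    consider "j = 0" | "1 \<le> j" "j \<le> n" | "j = Suc n" using j by linarith
    then show ?thesis
    proof cases
      case 1
      then show ?thesis using Q_biproduct[OF bM]
        by (simp add: I1_def I2_def P1_def P2_def std_def)
    next
      case 2
      have L1: "src C (L ?A j) \<in> X" using L_X(1) 2 by simp
      have uv: "cl (u1 j \<cdot> v1 j) = cl (ide C (src C (k j)))"
      proof -
        have 0: "u1 j \<cdot> v1 j = ide C (src C (k j)) \<oplus> mneg C (u2 j \<cdot> v2 j)"
          by (rule eq_diffI[OF biproductD(17)[OF biproduct_sym[OF d(5)[OF j]], symmetric]]) (use j in simp_all)
        have "thr (mneg C (u2 j \<cdot> v2 j))" using L1 j by (intro thr_neg thrI) simp_all
        then show ?thesis unfolding 0 using j by (intro cl_eqI) (simp_all add: add_ac)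
      qed
      have "cl (u1 j \<cdot> (v1 j \<cdot> p2 j)) = cl (p2 j)"
        using 2 j arg_cong[OF uv, of "\<lambda>z. z \<cdot>\<^bsub>Q\<^esub> cl (p2 j)"] by simp
      then have "cl (i2 j) \<cdot>\<^bsub>Q\<^esub> cl (u1 j \<cdot> (v1 j \<cdot> p2 j)) = cl (i2 j) \<cdot>\<^bsub>Q\<^esub> cl (p2 j)" by (rule arg_cong)
      then have "cl (i2 j \<cdot> (u1 j \<cdot> (v1 j \<cdot> p2 j))) = cl (i2 j \<cdot> p2 j)" using 2 j by simp
      then have "cl (i1 j \<cdot> p1 j) \<oplus>\<^bsub>Q\<^esub> cl (i2 j \<cdot> (u1 j \<cdot> (v1 j \<cdot> p2 j))) = cl (ide C (src C (m j)))"
        using 2 j biproductD(17)[OF bm[OF 2]] by simp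
      then show ?thesis
        using 2 j by (simp add: I1_def I2_def P1_def P2_def std_def biproduct_def Q_ide Q_mzero)
    next
      case 3
      have "(u2 j \<cdot> v2 j) \<oplus> (u1 j \<cdot> v1 j) = ide C (src C (k j))"
        by (rule biproductD(17)[OF biproduct_sym[OF d(5)[OF j]]])
      then show ?thesis using 3 j by (simp add: I1_def I2_def P1_def P2_def std_def biproduct_def Q_ide Q_mzero)
    qed
  qed
  have cone: "mapping_cone n Q G (std f wF) (std g wG) (\<lambda>i. cl (\<theta> i)) (std m w)"
  proof (rule Q.coneI[OF std_sq[OF w] bQ])
    fix j assume j: "j \<le> n"
    then consider "j = 0" | "1 \<le> j" "j < n" | "j = n" "1 \<le> j" by linarith
    note cs = this
    have n0: "Suc 0 \<le> n" "0 < n" "n \<noteq> 0" using n1 by auto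
    note defs = I1_def I2_def P1_def P2_def std_def
    show "cl (P1 (Suc j)) \<cdot>\<^bsub>Q\<^esub> (std m w j \<cdot>\<^bsub>Q\<^esub> cl (I1 j)) = mneg Q (std f wF (Suc j))"
      using cs by cases (use n0 j wFv' in \<open>simp_all add: defs m0 mi mn Q_mzero\<close>)
    show "cl (P1 (Suc j)) \<cdot>\<^bsub>Q\<^esub> (std m w j \<cdot>\<^bsub>Q\<^esub> cl (I2 j)) =
        mzero Q (src Q (std g wG j)) (tgt Q (std f wF (Suc j)))"
      using cs by cases (use n0 j in \<open>simp_all add: defs m0 mi mn m0a mia mn[THEN cmp_eq_assoc] Q_mzero\<close>)
    show "cl (P2 (Suc j)) \<cdot>\<^bsub>Q\<^esub> (std m w j \<cdot>\<^bsub>Q\<^esub> cl (I1 j)) = cl (\<theta> (Suc j))"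
      using cs by cases (use n0 j ph(3) in \<open>simp_all add: th defs m0 mi mn\<close>)
    show "cl (P2 (Suc j)) \<cdot>\<^bsub>Q\<^esub> (std m w j \<cdot>\<^bsub>Q\<^esub> cl (I2 j)) = std g wG j"
      using cs by cases (use n0 j in \<open>simp_all add: defs m0 mi mn m0a mia mn[THEN cmp_eq_assoc]\<close>)
  next
    \<comment> \<open>In the closing differential \<open>G\<close> replaces \<open>T\<close>. Each
      entry is checked by \<open>G_cmp\<close> against the equations \<open>ml\<close> of the
      reduced cone.\<close>
    have e: "I1 0 = k1" "I2 0 = k2" "P1 0 = r1" "P2 0 = r2" "I1 (Suc n) = mneg C (u2 (Suc n))" "I2 (Suc n) = u1 (Suc n)"
      "std m w (Suc n) = cl w" "std f wF 0 = cl (f 0)" "std g wG (Suc n) = cl wG" "std f wF (Suc n) = cl wF"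
      by (simp_all add: I1_def I2_def P1_def P2_def std_def)
    note mla = ml[THEN cmp_eq_assoc]
    have t0: "\<theta> 0 = a'" by (simp add: \<theta>_def)
    obtain pf where pf: "pf \<in> arr C" "src C pf = ob G ?A" "tgt C pf = ob G (tgt C (f 0))" "l (tgt C (f 0)) \<cdot> pf = ar T (f 0) \<cdot> l ?A"
       "ar G (cl (f 0)) = cl pf" using G_arE[of "f 0"] by auto
    obtain pa where pa: "pa \<in> arr C" "src C pa = ob G ?A" "tgt C pa = ob G ?B" "l ?B \<cdot> pa = ar T a' \<cdot> l ?A"
       "ar G (cl a') = cl pa" using G_arE[of a'] by auto
    have "ar G (cl r1) \<cdot>\<^bsub>Q\<^esub> cl (w \<cdot> mneg C (u2 (Suc n))) = cl (mneg C pf)"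
      by (rule G_cmp) (use pf in \<open>simp_all add: mla\<close>)
    then show "ar G (cl (P1 0)) \<cdot>\<^bsub>Q\<^esub> (std m w (Suc n) \<cdot>\<^bsub>Q\<^esub> cl (I1 (Suc n))) = mneg Q (ar G (std f wF 0))"
      using pf by (simp add: e)
    have "ar G (cl r1) \<cdot>\<^bsub>Q\<^esub> cl (w \<cdot> u1 (Suc n)) = cl (mzero C (src C (g (Suc n))) (ob G (tgt C (f 0))))"
      by (rule G_cmp) (simp_all add: mla)
    then show "ar G (cl (P1 0)) \<cdot>\<^bsub>Q\<^esub> (std m w (Suc n) \<cdot>\<^bsub>Q\<^esub> cl (I2 (Suc n))) =
        mzero Q (src Q (std g wG (Suc n))) (ob G (tgt Q (std f wF 0)))"
      by (simp add: e Q_mzero)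
    have "ar G (cl r2) \<cdot>\<^bsub>Q\<^esub> cl (w \<cdot> mneg C (u2 (Suc n))) = cl pa"
      by (rule G_cmp) (use pa in \<open>simp_all add: mla\<close>)
    then show "ar G (cl (P2 0)) \<cdot>\<^bsub>Q\<^esub> (std m w (Suc n) \<cdot>\<^bsub>Q\<^esub> cl (I1 (Suc n))) = ar G (cl (\<theta> 0))"
      using pa by (simp add: e t0)
    have "ar G (cl r2) \<cdot>\<^bsub>Q\<^esub> cl (w \<cdot> u1 (Suc n)) = cl wG"
      by (rule G_cmp) (simp_all add: mla)
    then show "ar G (cl (P2 0)) \<cdot>\<^bsub>Q\<^esub> (std m w (Suc n) \<cdot>\<^bsub>Q\<^esub> cl (I2 (Suc n))) = std g wG (Suc n)"
      by (simp add: e)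
  qed
  show ?thesis
    using tm cone std_RA[OF w] b0
    by (intro exI[of _ "\<lambda>i. cl (\<theta> i)"] exI[of _ "std m w"]) (simp add: \<theta>_def)
qed

end

text \<open>The last component of an isomorphism of rotated sequences is \<open>T\<close> of an
  isomorphism of the first objects, because \<open>T\<close> is fully faithful. It is applied with
  \<open>G\<close> in place of \<open>T\<close>.\<close>

lemma (in seq_functor) siso_unrot_ff:
  assumes full: "\<And>A B y. y \<in> Hom C (ob T A) (ob T B) \<Longrightarrow> \<exists>x\<in>Hom C A B. ar T x = y"
    and faithful: "\<And>A B x y. x \<in> Hom C A B \<Longrightarrow> y \<in> Hom C A B \<Longrightarrow> ar T x = ar T y \<Longrightarrow> x = y"
    and s: "siso (rot f) (rot g)" and f: "sq f" and g: "sq g"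
  shows "siso f g"
proof -
  obtain \<phi> where p: "mor (rot f) (rot g) \<phi>" "\<And>i. i \<le> Suc n \<Longrightarrow> is_iso C (\<phi> i)"
    using s by (auto simp: nseq_isomorphic_def)
  note [simp] = nseqD[OF f] nseqD[OF g]
  have s: "i \<le> n \<Longrightarrow> \<phi> i \<in> arr C \<and> src C (\<phi> i) = src C (f (Suc i)) \<and> tgt C (\<phi> i) = src C (g (Suc i))"
    "\<phi> (Suc n) \<in> arr C" "src C (\<phi> (Suc n)) = ob T (src C (f 0))" "tgt C (\<phi> (Suc n)) = ob T (src C (g 0))" for i
    using mor_simps(1-3)[OF p(1), of i] mor_simps(1-3)[OF p(1), of "Suc n"] by (simp_all add: rotate_nseq_sgn)
  have c: "i < n \<Longrightarrow> \<phi> (Suc i) \<cdot> f (Suc i) = g (Suc i) \<cdot> \<phi> i"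
    "\<phi> (Suc n) \<cdot> f (Suc n) = g (Suc n) \<cdot> \<phi> n" "ar T (\<phi> 0) \<cdot> ar T (f 0) = ar T (g 0) \<cdot> \<phi> (Suc n)" for i
    using mor_simps(4)[OF p(1), of i] mor_simps(4)[OF p(1), of n] mor_simps(5)[OF p(1)] s(2-4) s(1)[of 0]
    by (simp_all add: rotate_nseq_sgn sgn_eq_iff)
  obtain a where a: "a \<in> Hom C (src C (f 0)) (src C (g 0))" "ar T a = \<phi> (Suc n)"
    using full[of "\<phi> (Suc n)" "src C (f 0)" "src C (g 0)"] s by auto
  have iso_a: "is_iso C a"
  proof (rule iso_reflect[OF endo])
    show "\<exists>x\<in>Hom C A B. ar T x = y" if "y \<in> Hom C (ob T A) (ob T B)" for A B y using full that .
    show "x = y" if "x \<in> Hom C A B" "y \<in> Hom C A B" "ar T x = ar T y" for A B x y using faithful that .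
  qed (use a p(2)[of "Suc n"] in simp_all)
  define \<psi> where "\<psi> i = (case i of 0 \<Rightarrow> a | Suc j \<Rightarrow> \<phi> j)" for i
  have m: "mor f g \<psi>"
  proof (rule nseq_morphismI[OF f g])
    show "\<psi> i \<in> Hom C (src C (f i)) (src C (g i))" if "i \<le> Suc n" for i
      using that a s(1) by (cases i) (simp_all add: \<psi>_def)
    show "\<psi> (Suc i) \<cdot> f i = g i \<cdot> \<psi> i" if "i \<le> n" for i
    proof (cases i)
      case 0
      have "\<phi> 0 \<cdot> f 0 = g 0 \<cdot> a"
        by (rule faithful[of _ "src C (f 0)" "tgt C (g 0)"]) (use a s(1)[of 0] c(3) in simp_all)
      then show ?thesis using 0 by (simp add: \<psi>_def)
    next
      case (Suc j)
      then show ?thesis using c(1)[of j] that by (simp add: \<psi>_def)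
    qed
    show "ar T (\<psi> 0) \<cdot> f (Suc n) = g (Suc n) \<cdot> \<psi> (Suc n)" using a c(2) by (simp add: \<psi>_def)
  qed
  show ?thesis
    by (rule sisoI[OF m]) (use iso_a p(2) in \<open>auto simp: \<psi>_def split: nat.split\<close>)
qed

lemma (in quotient) Q_sgn: "f \<in> arr C \<Longrightarrow> sgn_mor Q k (cl f) = cl (sgn_mor C k f)"
  by (simp add: sgn_mor_def)

section \<open>The axioms for right angles, except closure under summands\<close>

context frobenius
begin

lemma G_autoequivalence: "autoequivalence Q G"
proof (rule Q.autoequivalenceI[OF Q.endo])
  show "\<exists>f\<in>Hom Q A B. ar G f = g" if "g \<in> Hom Q (ob G A) (ob G B)" for A B g using G_full[OF that] .
  show "f = g" if "f \<in> Hom Q A B" "g \<in> Hom Q A B" "ar G f = ar G g" for A B f g using G_faithful[OF that] .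
  show "\<exists>B. isomorphic Q (ob G B) A" for A
  proof -
    obtain r where r: "r \<in> \<Theta>" "src C (r (Suc n)) = A" "\<And>i. 1 \<le> i \<Longrightarrow> i \<le> n \<Longrightarrow> src C (r i) \<in> X" "X_monic C X (r 0)"
      by (rule right_angle_exists) blast
    obtain \<epsilon> where e: "conf r \<epsilon>" by (rule conf_exists[OF r(1,4)])
    have "is_iso Q (cl \<epsilon>)" by (rule right_angle_iso[OF r(1,3,4)]) (use confD[OF e] in simp_all)
    moreover have "cl \<epsilon> \<in> Hom Q A (ob G (src C (r 0)))" using confD[OF e] r(2) by simp
    ultimately have "isomorphic Q A (ob G (src C (r 0)))" unfolding isomorphic_def by blast
    then show ?thesis using Q.isomorphic_sym by blast
  qed
qed

text \<open>Objects that vanish in the quotient need not vanish in \<open>C\<close>, so the sequence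
  is compared with the image of the trivial angle of \<open>C\<close> by zero maps, which are
  invertible between zero objects.\<close>

lemma RA_trivial:
  assumes F: "trivial_nseq n Q G A F"
  shows "F \<in> RA"
proof -
  from F have F: "Q.sq F" "F 0 = ide Q A" "\<And>i. 2 \<le> i \<Longrightarrow> i \<le> Suc n \<Longrightarrow> zero_object Q (src Q (F i))"
    unfolding trivial_nseq_def by auto
  note FD = nseqD[OF F(1)]
  obtain t where t: "t \<in> \<Theta>" "t 0 = ide C A" "src C (t (Suc 0)) = A"
    "\<And>i. 2 \<le> i \<Longrightarrow> i \<le> Suc n \<Longrightarrow> zero_object C (src C (t i))" by (rule trivial_exists) blast
  have "X_monic C X (t 0)" unfolding X_monic_iff t(2) by (auto intro!: bexI)
  with t(1) obtain w where w: "conf t w" by (rule conf_exists)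
  have s0: "src Q (F 0) = A" "src Q (F (Suc 0)) = A" using FD(5) F(2) by simp_all
  note ss = std_src[OF w] and sD = nseqD[OF std_sq[OF w]]
  have z: "zero_object Q (src Q (std t w i))" if "2 \<le> i" "i \<le> Suc n" for i
    using ss[OF that(2)] t(4)[OF that] Q_zero_object X_zero by simp
  define \<phi> where "\<phi> i = (if i \<le> 1 then ide Q A else mzero Q (src Q (std t w i)) (src Q (F i)))" for i :: nat
  have st: "src Q (std t w 0) = A" "src Q (std t w (Suc 0)) = A" using ss[of 0] ss[of "Suc 0"] t(2,3) by simp_all
  have ph: "\<phi> i \<in> arr Q" "src Q (\<phi> i) = src Q (std t w i)" "tgt Q (\<phi> i) = src Q (F i)" if "i \<le> Suc n" for i
  proof -
    have "i = 0 \<or> i = Suc 0 \<or> \<not> i \<le> 1" by linarith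
    then show "\<phi> i \<in> arr Q" "src Q (\<phi> i) = src Q (std t w i)" "tgt Q (\<phi> i) = src Q (F i)"
      using st s0 by (auto simp: \<phi>_def)
  qed
  have m: "Q.mor (std t w) F \<phi>"
  proof (rule nseq_morphismI[OF std_sq[OF w] F(1)])
    show "\<phi> i \<in> Hom Q (src Q (std t w i)) (src Q (F i))" if "i \<le> Suc n" for i using ph[OF that] by simp
    show "\<phi> (Suc i) \<cdot>\<^bsub>Q\<^esub> std t w i = F i \<cdot>\<^bsub>Q\<^esub> \<phi> i" if i: "i \<le> n" for i
    proof (cases "i = 0")
      case True
      then show ?thesis using F(2) t(2) by (simp add: \<phi>_def std_def Q_ide)
    next
      case False
      then have "zero_object Q (src Q (F (Suc i)))" using F(3)[of "Suc i"] i by simp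
      then show ?thesis
        by (rule Q.zero_eqI) (use ph[of i] ph[of "Suc i"] sD FD i in simp_all)
    qed
    have "zero_object Q (src Q (std t w (Suc n)))" using z[of "Suc n"] n1 by simp
    then show "ar G (\<phi> 0) \<cdot>\<^bsub>Q\<^esub> std t w (Suc n) = F (Suc n) \<cdot>\<^bsub>Q\<^esub> \<phi> (Suc n)"
      by (rule Q.zero_eqI) (use ph[of 0] ph[of "Suc n"] sD FD st s0 in simp_all)
  qed
  have "Q.siso (std t w) F"
  proof (rule Q.sisoI[OF m])
    show "is_iso Q (\<phi> i)" if "i \<le> Suc n" for i
      using that z[of i] F(3)[of i] by (cases "i \<le> 1") (simp_all add: \<phi>_def Q.iso_zero)
  qed
  then show ?thesis using RA_iso std_RA[OF w] by blast
qed

lemma RA_F4: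
  assumes F: "F \<in> RA" and F': "F' \<in> RA" and a: "a \<in> Hom Q (src Q (F 0)) (src Q (F' 0))"
    and b: "b \<in> Hom Q (src Q (F 1)) (src Q (F' 1))" and eq: "b \<cdot>\<^bsub>Q\<^esub> F 0 = F' 0 \<cdot>\<^bsub>Q\<^esub> a"
  shows "\<exists>\<phi> h. Q.mor F F' \<phi> \<and> \<phi> 0 = a \<and> \<phi> 1 = b \<and> mapping_cone n Q G F F' \<phi> h \<and> h \<in> RA"
proof -
  from F obtain e w where e: "conf e w" "Q.siso (std e w) F" by (rule RAE)
  from F' obtain e' w' where e': "conf e' w'" "Q.siso (std e' w') F'" by (rule RAE)
  show ?thesis
  proof (rule Q.F4_iso[OF Q.siso_sym[OF e(2)] Q.siso_sym[OF e'(2)] _ a b eq])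
    fix a b assume "a \<in> Hom Q (src Q (std e w 0)) (src Q (std e' w' 0))"
      "b \<in> Hom Q (src Q (std e w 1)) (src Q (std e' w' 1))" "b \<cdot>\<^bsub>Q\<^esub> std e w 0 = std e' w' 0 \<cdot>\<^bsub>Q\<^esub> a"
    moreover have "src Q (std e w 1) = tgt C (e 0)" "src Q (std e' w' 1) = tgt C (e' 0)"
      using std_src[OF e(1), of 1] std_src[OF e'(1), of 1] nseqD(5)[OF confD(7)[OF e(1)]] nseqD(5)[OF confD(7)[OF e'(1)]]
      by simp_all
    moreover have "src Q (std e w 0) = src C (e 0)" "src Q (std e' w' 0) = src C (e' 0)"
      using std_src[OF e(1), of 0] std_src[OF e'(1), of 0] by simp_all
    ultimately show "\<exists>\<phi> h. Q.mor (std e w) (std e' w') \<phi> \<and> \<phi> 0 = a \<and> \<phi> 1 = b \<and>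
        mapping_cone n Q G (std e w) (std e' w') \<phi> h \<and> h \<in> RA"
      using F4_std[OF e(1) e'(1), of a b] by (simp add: std_def)
  qed
qed

text \<open>Adjoining the left approximation as a second component makes \<open>f\<close> into an
  \<open>X\<close>-monic map; in the quotient nothing changes up to isomorphism.\<close>

lemma RA_extend:
  assumes "x \<in> arr Q"
  shows "\<exists>F\<in>RA. F 0 = x"
proof -
  from assms obtain f where f [simp]: "f \<in> arr C" "x = cl f" by (rule arr_QE)
  let ?A = "src C f" and ?B = "tgt C f"
  obtain P i1 i2 p1 p2 where P: "biproduct C ?B (tgt C (L ?A 0)) P i1 i2 p1 p2"
    using has_direct_sums[of ?B "tgt C (L ?A 0)"] unfolding direct_sum_def by blast
  note [simp] = biproduct_simps[OF P]
  define e0 where "e0 = (i1 \<cdot> f) \<oplus> (i2 \<cdot> L ?A 0)"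
  have e0 [simp]: "e0 \<in> arr C" "src C e0 = ?A" "tgt C e0 = P" by (simp_all add: e0_def)
  obtain e where e: "e \<in> \<Theta>" "e 0 = e0" using angle_extend[OF e0(1)] by blast
  have "X_monic C X e0"
    unfolding X_monic_iff
  proof (intro conjI ballI)
    fix D g assume D: "D \<in> X" "g \<in> Hom C (src C e0) D"
    then obtain g' where g': "g' \<in> arr C" "src C g' = tgt C (L ?A 0)" "tgt C g' = D" "g' \<cdot> L ?A 0 = g"
      using X_monicE[OF L_monic[of ?A], of g] by auto
    show "\<exists>g'\<in>Hom C (tgt C e0) D. g = g' \<cdot> e0"
      by (rule bexI[of _ "g' \<cdot> p2"]) (use g' D(2) in \<open>simp_all add: e0_def\<close>)
  qed simp
  then obtain w where w: "conf e w" using conf_exists[of e] e by metis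
  note eD [simp] = nseqD(1-3,6)[OF confD(7)[OF w]] confD(3-5)[OF w]
  have e1 [simp]: "src C (e (Suc 0)) = P" using nseqD(5)[OF confD(7)[OF w]] e(2) by simp
  \<comment> \<open>The axiom demands \<open>x\<close> itself as first map, not an isomorphic one,
    so the second object is changed back from \<open>P\<close> to \<open>?B\<close>.\<close>
  define F where "F = (std e w)(0 := cl f, Suc 0 := cl (e (Suc 0) \<cdot> i1))"
  define \<phi> where "\<phi> i = (if i = 1 then cl p1 else ide Q (src C (e i)))" for i :: nat
  have F0: "F 0 = cl f" "F (Suc 0) = cl (e (Suc 0) \<cdot> i1)" "2 \<le> i \<Longrightarrow> F i = std e w i" for i
    by (auto simp: F_def)
  note sD = nseqD[OF std_sq[OF w]] and ss = std_src[OF w]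
  have s1: "std e w (Suc 0) = cl (e (Suc 0))" "std e w 0 = cl e0" using n1 e(2) by (simp_all add: std_def)
  have srcF: "src Q (F i) = (if i = 1 then ?B else src C (e i))" if "i \<le> Suc n" for i
  proof -
    consider "i = 0" | "i = 1" | "2 \<le> i" by linarith
    then show ?thesis by cases (use that ss e(2) in \<open>simp_all add: F0\<close>)
  qed
  have FS: "Q.sq F"
  proof (rule Q.nseqI_nxt)
    fix i assume i: "i \<le> Suc n"
    consider "i = 0" | "i = 1" | "2 \<le> i" by linarith
    note cs = this
    show "F i \<in> arr Q" using cs by cases (use i sD in \<open>simp_all add: F0\<close>)
    show "tgt Q (F i) = (if i \<le> n then src Q (F (Suc i)) else ob G (src Q (F 0)))"
      using cs
    proof cases
      case 2
      then show ?thesis using n1 srcF[of 2] sD(4)[of "Suc 0"] ss[of 2] s1 by (simp add: F0 numeral_2_eq_2)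
    next
      case 3
      show ?thesis
      proof (cases "i \<le> n")
        case True
        then show ?thesis using 3 sD(4)[of i] srcF[of "Suc i"] ss[of "Suc i"] by (simp add: F0)
      next
        case False
        then have "i = Suc n" using i by simp
        then show ?thesis using F0(3)[OF 3] sD(6) ss[of 0] e(2) by (simp add: F0)
      qed
    qed (use n1 srcF[of 1] in \<open>simp add: F0\<close>)
  qed
  have ip: "cl (i1 \<cdot> p1) = cl (ide C P)"
  proof -
    have 0: "i1 \<cdot> p1 = ide C P \<oplus> mneg C (i2 \<cdot> p2)"
      by (rule eq_diffI[OF biproductD(17)[OF biproduct_sym[OF P], symmetric]]) simp_all
    have "thr (mneg C (i2 \<cdot> p2))" using L_X(2) by (intro thr_neg thrI) simp_all
    then show ?thesis unfolding 0 by (intro cl_eqI) (simp_all add: add_ac)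
  qed
  have m: "Q.mor (std e w) F \<phi>"
  proof (rule Q.mor_nxtI[OF std_sq[OF w] FS])
    fix i assume i: "i \<le> Suc n"
    show "\<phi> i \<in> Hom Q (src Q (std e w i)) (src Q (F i))"
      using srcF[OF i] ss[OF i] by (auto simp: \<phi>_def)
    consider "i = 0" | "i = 1" | "2 \<le> i" by linarith
    then show "Q.nxt \<phi> i \<cdot>\<^bsub>Q\<^esub> std e w i = F i \<cdot>\<^bsub>Q\<^esub> \<phi> i"
    proof cases
      case 1
      have "p1 \<cdot> e0 = f" by (simp add: e0_def)
      then show ?thesis using 1 n1 s1 e(2) by (simp add: F0 \<phi>_def Q_ide)
    next
      case 2
      have "cl (e (Suc 0)) \<cdot>\<^bsub>Q\<^esub> cl (i1 \<cdot> p1) = cl (e (Suc 0)) \<cdot>\<^bsub>Q\<^esub> cl (ide C P)" unfolding ip ..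
      then have "cl (e (Suc 0) \<cdot> (i1 \<cdot> p1)) = cl (e (Suc 0))" by simp
      moreover have "tgt Q (std e w (Suc 0)) = src C (e (Suc (Suc 0)))" using sD(4)[of "Suc 0"] ss[of "Suc (Suc 0)"] n1 by simp
      ultimately show ?thesis using 2 n1 s1 by (simp add: F0 \<phi>_def)
    next
      case 3
      show ?thesis
      proof (cases "i \<le> n")
        case True
        then show ?thesis using 3 sD(1)[OF i] sD(4)[of i] ss[OF i] ss[of "Suc i"] by (simp add: F0 \<phi>_def)
      next
        case False
        then have "i = Suc n" using i by simp
        then show ?thesis using F0(3)[OF 3] 3 sD(1)[of "Suc n"] sD(6) ss[of 0] ss[of "Suc n"] by (simp add: \<phi>_def)
      qed
    qed
  qed
  have "Q.siso (std e w) F"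
    by (rule Q.sisoI[OF m]) (use Q_biproduct_iso(2)[OF P L_X(2)] in \<open>simp add: \<phi>_def\<close>)
  then have "F \<in> RA" by (rule RA_iso[OF std_RA[OF w]])
  moreover have "F 0 = x" by (simp add: F0)
  ultimately show ?thesis by blast
qed

lemma RA_sum:
  assumes F: "F \<in> RA" and F': "F' \<in> RA" and H: "Q.dsum F F' H"
  shows "H \<in> RA"
proof -
  from F obtain e w where e: "conf e w" "Q.siso (std e w) F" by (rule RAE)
  from F' obtain e' w' where e': "conf e' w'" "Q.siso (std e' w') F'" by (rule RAE)
  obtain k where ks: "dsum e e' k" using dsum_exists[OF confD(7)[OF e(1)] confD(7)[OF e'(1)] has_direct_sums] by blast
  have k: "k \<in> \<Theta>" by (rule angle_sum[OF confD(1)[OF e(1)] confD(1)[OF e'(1)] ks])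
  from ks obtain i1 i2 p1 p2 where d: "mor e k i1" "mor e' k i2" "mor k e p1" "mor k e' p2"
    "\<And>j. j \<le> Suc n \<Longrightarrow> biproduct C (src C (e j)) (src C (e' j)) (src C (k j)) (i1 j) (i2 j) (p1 j) (p2 j)"
    by (rule dsumE) blast
  have "X_monic C X (k 0)"
    unfolding X_monic_iff
  proof (intro conjI ballI)
    note [simp] = nseqD[OF angle_sq[OF k]] nseqD[OF confD(7)[OF e(1)]] nseqD[OF confD(7)[OF e'(1)]] biproduct_simps[OF d(5)]
    show "k 0 \<in> arr C" by simp
    fix D g assume D: "D \<in> X" "g \<in> Hom C (src C (k 0)) D"
    then have [simp]: "g \<in> arr C" "src C g = src C (k 0)" "tgt C g = D" by simp_all
    obtain y where y: "y \<in> arr C" "src C y = tgt C (e 0)" "tgt C y = D" "y \<cdot> e 0 = g \<cdot> i1 0"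
      using X_monicE[OF confD(2)[OF e(1)], of "g \<cdot> i1 0"] D by auto
    obtain y' where y': "y' \<in> arr C" "src C y' = tgt C (e' 0)" "tgt C y' = D" "y' \<cdot> e' 0 = g \<cdot> i2 0"
      using X_monicE[OF confD(2)[OF e'(1)], of "g \<cdot> i2 0"] D by auto
    have [simp]: "k 0 \<cdot> i1 0 = i1 (Suc 0) \<cdot> e 0" "k 0 \<cdot> i2 0 = i2 (Suc 0) \<cdot> e' 0"
      using mor_simps(4)[OF d(1), of 0] mor_simps(4)[OF d(2), of 0] by simp_all
    show "\<exists>g'\<in>Hom C (tgt C (k 0)) D. g = g' \<cdot> k 0"
    proof (rule bexI[of _ "(y \<cdot> p1 (Suc 0)) \<oplus> (y' \<cdot> p2 (Suc 0))"])
      show "g = ((y \<cdot> p1 (Suc 0)) \<oplus> (y' \<cdot> p2 (Suc 0))) \<cdot> k 0"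
        by (rule biproduct_eqI(1)[OF d(5)[of 0]]) (use y y' in simp_all)
    qed (use y y' in simp_all)
  qed
  with k obtain v where v: "conf k v" by (rule conf_exists)
  have "Q.dsum (std e w) (std e' w') (std k v)"
    by (rule Q.dsumI[OF std_mor[OF e(1) v d(1)] std_mor[OF e'(1) v d(2)] std_mor[OF v e(1) d(3)] std_mor[OF v e'(1) d(4)]])
      (simp add: std_src[OF e(1)] std_src[OF e'(1)] std_src[OF v] Q_biproduct[OF d(5)])
  then have "Q.siso (std k v) H" using Q.dsum_unique[OF e(2) e'(2) _ H] by blast
  then show ?thesis using RA_iso[OF std_RA[OF v]] by blast
qed

text \<open>Up to isomorphism the rotation is the cone of the zero morphism to the right angle on a
  zero object, so F4 provides it.\<close>

lemma RA_rot:
  assumes F: "F \<in> RA"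
  shows "Q.rot F \<in> RA"
proof -
  obtain Z where Z: "zero_object C Z" using has_zero_object by blast
  obtain t where t: "t \<in> \<Theta>" "t 0 = ide C Z" "src C (t (Suc 0)) = Z"
    "\<And>i. 2 \<le> i \<Longrightarrow> i \<le> Suc n \<Longrightarrow> zero_object C (src C (t i))" by (rule trivial_exists) blast
  have "X_monic C X (t 0)" unfolding X_monic_iff t(2) by (auto intro!: bexI)
  with t(1) obtain w where w: "conf t w" by (rule conf_exists)
  have z: "zero_object Q (src Q (std t w i))" if "i \<le> Suc n" for i
  proof -
    consider "i = 0" | "i = Suc 0" | "2 \<le> i" by linarith
    then have "zero_object C (src C (t i))" by cases (use t Z that in simp_all)
    then show ?thesis using std_src[OF w that] Q_zero_object X_zero by simp
  qed
  note FD = nseqD[OF RA_sq[OF F]] and sD = nseqD[OF std_sq[OF w]]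
  let ?a = "mzero Q (src Q (F 0)) (src Q (std t w 0))" and ?b = "mzero Q (src Q (F 1)) (src Q (std t w 1))"
  have "?b \<cdot>\<^bsub>Q\<^esub> F 0 = std t w 0 \<cdot>\<^bsub>Q\<^esub> ?a"
    by (rule Q.zero_eqI[OF z[of 1]]) (use FD sD in simp_all)
  then obtain \<phi> h where h: "mapping_cone n Q G F (std t w) \<phi> h" "h \<in> RA"
    using RA_F4[OF F std_RA[OF w], of ?a ?b] by auto
  show ?thesis by (rule RA_iso[OF h(2) Q.cone_zero_rot[OF h(1) RA_sq[OF F] z]])
qed

text \<open>Inverse rotation up to isomorphism. An angle (2) ending in the last object
  \<open>?A\<close> starts at an object \<open>?H\<close> with \<open>ob G ?H\<close> isomorphic to
  \<open>?A\<close> in the quotient. The wanted right angle from \<open>?H\<close> to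
  \<open>?B\<close> and onwards is the reduced cone of a morphism from this angle to
  \<open>f\<close>, both rotated back; the middle objects of the angle (2) in it vanish in the
  quotient.\<close>

lemma RA_rot_surj:
  assumes f: "conf f w"
  shows "\<exists>K\<in>RA. Q.siso (std f w) (Q.rot K)"
proof -
  let ?A = "src C (f (Suc n))" and ?B = "src C (f 0)"
  note fD [simp] = nseqD(1-3,6)[OF confD(7)[OF f]] confD(3-6)[OF f]
  have fT: "src C (f (Suc i)) = tgt C (f i)" if "i \<le> n" for i using nseqD(4)[OF confD(7)[OF f] that] by simp
  obtain r where r: "r \<in> \<Theta>" "src C (r (Suc n)) = ?A" "\<And>i. 1 \<le> i \<Longrightarrow> i \<le> n \<Longrightarrow> src C (r i) \<in> X" "X_monic C X (r 0)"
    by (rule right_angle_exists) blast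
  note rD [simp] = nseqD(1-3,6)[OF angle_sq[OF r(1)]] r(2)
  have rT: "src C (r (Suc i)) = tgt C (r i)" if "i \<le> n" for i using nseqD(4)[OF angle_sq[OF r(1)] that] by simp
  let ?H = "src C (r 0)"
  obtain \<epsilon> where e: "conf r \<epsilon>" by (rule conf_exists[OF r(1,4)])
  note eD [simp] = confD(3-6)[OF e]
  have ea: "l ?H \<cdot> (\<epsilon> \<cdot> x) = r (Suc n) \<cdot> x" if "x \<in> arr C" "tgt C x = ?A" for x
    using confD(8)[OF e, of x] that by simp
  have iso_e: "is_iso Q (cl \<epsilon>)" by (rule right_angle_iso[OF r(1,3,4)]) simp_all
  have "thr (r n)" using thr_ob[of "r n"] r(3)[of n] n1 by simp
  then have "f (Suc n) \<cdot> r n = mzero C (src C (r n)) (tgt C (f (Suc n)))"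
    using last_kill[OF confD(1,2)[OF f], of "r n"] nseqD(4)[OF angle_sq[OF r(1)], of n] by simp
  then have "\<exists>s\<in>Hom C (tgt C (r (Suc n))) (tgt C (f (Suc n))). f (Suc n) = s \<cdot> r (Suc n)"
    by (intro wcoker(1)[OF r(1)]) simp_all
  moreover have "tgt C (r (Suc n)) = ob T ?H" "tgt C (f (Suc n)) = ob T ?B" by simp_all
  ultimately obtain s where s: "s \<in> Hom C (ob T ?H) (ob T ?B)" "f (Suc n) = s \<cdot> r (Suc n)" by metis
  \<comment> \<open>The first map of the right angle sought. It exists because
    \<open>f (Suc n)\<close> kills \<open>r n\<close>, a map that starts in
    \<open>X\<close>.\<close>
  obtain \<xi> where xi: "\<xi> \<in> Hom C ?H ?B" "ar T \<xi> = s" using full[OF s(1)] by blast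
  have xi1 [simp]: "\<xi> \<in> arr C" "src C \<xi> = ?H" "tgt C \<xi> = ?B" and xi2: "ar T \<xi> \<cdot> r (Suc n) = f (Suc n)"
    using xi s(2)[symmetric] by simp_all
  \<comment> \<open>Both angles, rotated back, start at this object, so the morphism between them
    begins with the identity and \<open>reduced_cone\<close> applies with a zero complement.\<close>
  obtain A' where A': "?A = ob T A'" using ob_surj[of ?A] by metis
  obtain f' where f': "f' \<in> \<Theta>" "\<And>i. i \<le> n \<Longrightarrow> f' (Suc i) = r i" "src C (f' 0) = A'" "ar T (f' 0) = sgn_mor C n (r (Suc n))"
    using unrot_exists[OF r(1), of A'] A' by auto
  obtain g' where g': "g' \<in> \<Theta>" "\<And>i. i \<le> n \<Longrightarrow> g' (Suc i) = f i" "src C (g' 0) = A'" "ar T (g' 0) = sgn_mor C n (f (Suc n))"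
    using unrot_exists[OF confD(1)[OF f], of A'] A' by auto
  note f'D = nseqD[OF angle_sq[OF f'(1)]] and g'D = nseqD[OF angle_sq[OF g'(1)]]
  have s0: "tgt C (f' 0) = ?H" "tgt C (g' 0) = ?B" "f' (Suc 0) = r 0" "g' (Suc 0) = f 0"
    using f'D(5) g'D(5) f'(2)[of 0] g'(2)[of 0] by simp_all
  have sq0: "\<xi> \<cdot> f' 0 = g' 0 \<cdot> ide C A'"
    by (rule faithful[of _ A' ?B]) (use f' g' f'D(2) g'D(2) s0 xi2 in simp_all)
  obtain Z where Z: "zero_object C Z" using has_zero_object by blast
  have bP: "biproduct C (src C (f' 0)) Z (src C (g' 0)) (ide C A') (mzero C Z A') (ide C A') (mzero C A' Z)"
    using biproduct_zero[OF Z, of A'] f'(3) g'(3) by simp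
  have bM: "biproduct C (tgt C (f' 0)) Z ?H (ide C ?H) (mzero C Z ?H) (ide C ?H) (mzero C ?H Z)"
    using biproduct_zero[OF Z, of ?H] s0 by simp
  have xiH: "\<xi> \<in> Hom C (src C (f' (Suc 0))) (src C (g' (Suc 0)))" using s0 by simp
  obtain \<phi> m i1 i2 p1 p2 where ph: "mor f' g' \<phi>" "\<phi> 0 = ide C A'" "\<phi> (Suc 0) = \<xi>" and m: "m \<in> \<Theta>" "src C (m 0) = ?H"
    "src C (m (Suc n)) = src C (g' (Suc n))"
    and bm: "\<And>i. 1 \<le> i \<Longrightarrow> i \<le> n \<Longrightarrow>
      biproduct C (tgt C (f' i)) (src C (g' i)) (src C (m i)) (i1 i) (i2 i) (p1 i) (p2 i)"
    and m0: "p1 (Suc 0) \<cdot> (m 0 \<cdot> ide C ?H) = mneg C (f' (Suc 0))" "p2 (Suc 0) \<cdot> (m 0 \<cdot> ide C ?H) = \<xi>"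
    "p1 (Suc 0) \<cdot> (m 0 \<cdot> mzero C Z ?H) = mzero C Z (tgt C (f' (Suc 0)))"
    "p2 (Suc 0) \<cdot> (m 0 \<cdot> mzero C Z ?H) = g' 0 \<cdot> mzero C Z A'"
    and mi: "\<And>i. 1 \<le> i \<Longrightarrow> i < n \<Longrightarrow> p1 (Suc i) \<cdot> (m i \<cdot> i1 i) = mneg C (f' (Suc i))"
    "\<And>i. 1 \<le> i \<Longrightarrow> i < n \<Longrightarrow> p2 (Suc i) \<cdot> (m i \<cdot> i1 i) = \<phi> (Suc i)"
    "\<And>i. 1 \<le> i \<Longrightarrow> i < n \<Longrightarrow> p1 (Suc i) \<cdot> (m i \<cdot> i2 i) = mzero C (src C (g' i)) (tgt C (f' (Suc i)))"
    "\<And>i. 1 \<le> i \<Longrightarrow> i < n \<Longrightarrow> p2 (Suc i) \<cdot> (m i \<cdot> i2 i) = g' i"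
    and mn: "m n \<cdot> i1 n = \<phi> (Suc n)" "m n \<cdot> i2 n = g' n"
    and ml: "ar T (ide C ?H) \<cdot> m (Suc n) = ar T (f' 0) \<cdot> (ar T (ide C A') \<cdot> g' (Suc n))"
      "ar T (mzero C ?H Z) \<cdot> m (Suc n) = ar T (mzero C A' Z) \<cdot> g' (Suc n)"
    using reduced_cone[OF f'(1) g'(1) bP xiH sq0 bM] by blast
  note mD = nseqD[OF angle_sq[OF m(1)]]
  have msn: "src C (m (Suc n)) = src C (f n)" "m (Suc n) \<in> arr C" using m(3) g'(2)[of n] mD(1) by simp_all
  have bm': "biproduct C (src C (r (Suc i))) (src C (f i)) (src C (m (Suc i))) (i1 (Suc i)) (i2 (Suc i)) (p1 (Suc i)) (p2 (Suc i))"
    if "i < n" for i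
    using bm[of "Suc i"] that f'(2)[of i] g'(2)[of i] rT[of i] by simp
  have m0': "p1 (Suc 0) \<cdot> m 0 = mneg C (r 0)" "p2 (Suc 0) \<cdot> m 0 = \<xi>"
    using m0 m(2) mD(2) s0 by simp_all
  have b1: "biproduct C (src C (r (Suc 0))) ?B (src C (m (Suc 0))) (i1 (Suc 0)) (i2 (Suc 0)) (p1 (Suc 0)) (p2 (Suc 0))"
    using bm'[of 0] n1 by simp
  have "X_monic C X (m 0)"
    unfolding X_monic_iff
  proof (intro conjI ballI)
    fix D g assume D: "D \<in> X" "g \<in> Hom C (src C (m 0)) D"
    then obtain y where y: "y \<in> arr C" "src C y = tgt C (r 0)" "tgt C y = D" "y \<cdot> r 0 = g"
      using X_monicE[OF r(4), of g] m(2) by auto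
    show "\<exists>g'\<in>Hom C (tgt C (m 0)) D. g = g' \<cdot> m 0"
      by (rule bexI[of _ "mneg C (y \<cdot> p1 (Suc 0))"])
        (use y D(2) m0' biproductD(7-9)[OF b1] mD(2,5) rT[of 0] in simp_all)
  qed (simp add: mD)
  with m(1) obtain wm where wm: "conf m wm" by (rule conf_exists)
  \<comment> \<open>The last map passes through \<epsilon>, which identifies \<open>?A\<close> with
    \<open>ob G ?H\<close>; its sign is the one introduced by rotating back.\<close>
  define K where "K i = (case i of 0 \<Rightarrow> cl \<xi> | Suc j \<Rightarrow> if j < n then cl (f j) else cl (sgn_mor C n (\<epsilon> \<cdot> f n)))" for i
  have K: "K 0 = cl \<xi>" "j < n \<Longrightarrow> K (Suc j) = cl (f j)" "K (Suc n) = cl (sgn_mor C n (\<epsilon> \<cdot> f n))" for j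
    by (simp_all add: K_def)
  have tf [simp]: "tgt C (f n) = src C (f (Suc n))" using fT[of n] by simp
  have Ks: "Q.sq K"
  proof (rule nseqI)
    show "K i \<in> arr Q" if "i \<le> Suc n" for i by (cases i) (use that in \<open>simp_all add: K_def\<close>)
    show "tgt Q (K i) = src Q (K (Suc i))" if "i \<le> n" for i
    proof (cases i)
      case 0
      then show ?thesis using n1 by (simp add: K_def)
    next
      case (Suc j)
      then show ?thesis using that fT[of j] by (cases "Suc j < n") (auto simp: K_def dest: le_antisym)
    qed
    show "tgt Q (K (Suc n)) = ob G (src Q (K 0))" by (simp add: K)
  qed
  have srcK: "src Q (K 0) = ?H" "j \<le> n \<Longrightarrow> src Q (K (Suc j)) = src C (f j)" for j
    by (cases "j < n") (simp_all add: K_def)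
  define \<theta> where "\<theta> i = (if i = 0 then ide C ?H else if i \<le> n then p2 i else ide C (src C (f n)))" for i
  have th: "\<theta> 0 = ide C ?H" "i < n \<Longrightarrow> \<theta> (Suc i) = p2 (Suc i)" "\<theta> (Suc n) = ide C (src C (f n))" for i
    by (simp_all add: \<theta>_def)
  have cs: "i = 0 \<or> (\<exists>j<n. i = Suc j) \<or> i = Suc n" if "i \<le> Suc n" for i
    using that by (cases i) (auto simp: le_less)
  have thD': "\<theta> i \<in> arr C \<and> src C (\<theta> i) = src C (m i) \<and> tgt C (\<theta> i) = src Q (K i)" if "i \<le> Suc n" for i
    using cs[OF that]
    by (elim disjE exE conjE) (use m(2) msn biproductD(10-12)[OF bm'] srcK in \<open>simp_all add: th\<close>)
  have thD: "\<theta> i \<in> arr C" "src C (\<theta> i) = src C (m i)" "tgt C (\<theta> i) = src Q (K i)" if "i \<le> Suc n" for i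
    using thD'[OF that] by simp_all
  \<comment> \<open>In the quotient only the restriction to the summand from \<open>f\<close>
    matters, since the other summand lies in \<open>X\<close>.\<close>
  have mid: "cl y = cl (f j \<cdot> p2 (Suc j))" if j: "j < n" and y: "y \<in> arr C" "src C y = src C (m (Suc j))" "tgt C y = tgt C (f j)"
      "y \<cdot> i2 (Suc j) = f j" for y j
  proof (rule cl_eqI)
    note b = biproductD[OF bm'[OF j]]
    have yy: "y = ((y \<cdot> i1 (Suc j)) \<cdot> p1 (Suc j)) \<oplus> (f j \<cdot> p2 (Suc j))"
      using biproduct_split(1)[OF bm'[OF j] y(1,2)] y(4) by simp
    have "thr ((y \<cdot> i1 (Suc j)) \<cdot> p1 (Suc j))" by (rule thrI) (use b y r(3)[of "Suc j"] j in simp_all)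
    moreover have "y \<oplus> mneg C (f j \<cdot> p2 (Suc j)) = (y \<cdot> i1 (Suc j)) \<cdot> p1 (Suc j)"
      by (subst yy) (use b(1-12) y(1-3) j in simp)
    ultimately show "thr (y \<oplus> mneg C (f j \<cdot> p2 (Suc j)))" by simp
  qed (use biproductD[OF bm'[OF j]] y j in simp_all)
  have "Q.siso (std m wm) K"
  proof (rule Q.sisoI)
    show "Q.mor (std m wm) K (\<lambda>i. cl (\<theta> i))"
    proof (rule nseq_morphismI[OF std_sq[OF wm] Ks])
      show "cl (\<theta> i) \<in> Hom Q (src Q (std m wm i)) (src Q (K i))" if "i \<le> Suc n" for i
        using thD[OF that] std_src[OF wm that] by simp
      show "cl (\<theta> (Suc i)) \<cdot>\<^bsub>Q\<^esub> std m wm i = K i \<cdot>\<^bsub>Q\<^esub> cl (\<theta> i)" if "i \<le> n" for i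
      proof (cases i)
        case 0
        then show ?thesis using n1 m0' biproductD(10-12)[OF b1] mD(2,5) by (simp add: std_def th K)
      next
        case (Suc j)
        then have j: "j < n" using that by simp
        note b = biproductD[OF bm'[OF j]]
        show ?thesis
        proof (cases "Suc j < n")
          case True
          have "cl (p2 (Suc (Suc j)) \<cdot> m (Suc j)) = cl (f j \<cdot> p2 (Suc j))"
            by (rule mid[OF j]) (use True mi(4)[of "Suc j"] g'(2)[of j] mD biproductD[OF bm'[OF True]] fT[of j] b in simp_all)
          then show ?thesis using Suc True j mD biproductD(10-12)[OF bm'[OF True]] b by (simp add: std_def th K)
        next
          case False
          then have n: "n = Suc j" using j by simp
          have "cl (m (Suc j)) = cl (f j \<cdot> p2 (Suc j))"
            by (rule mid[OF j]) (use n mn(2) g'(2)[of j] mD msn fT[of j] b in simp_all)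
          moreover have "tgt C (m (Suc j)) = src C (f (Suc j))" "m (Suc j) \<in> arr C" "\<theta> (Suc (Suc j)) = ide C (src C (f (Suc j)))"
            using mD(4)[of n] msn mD(1)[of n] th(3) n by simp_all
          moreover have "std m wm (Suc j) = cl (m (Suc j))" using j by (simp add: std_def)
          ultimately show ?thesis using Suc j b(1-12) fT[of j] by (simp add: th K)
        qed
      qed
      have "cl wm = cl (sgn_mor C n (\<epsilon> \<cdot> f n))"
      proof (rule thr_of_l_eq[of _ ?H])
        have "m (Suc n) = sgn_mor C n (r (Suc n) \<cdot> f n)"
          using ml(1) msn mD(6) m(2) g'(2)[of n] f'(4) A' by simp
        then show "l ?H \<cdot> wm = l ?H \<cdot> sgn_mor C n (\<epsilon> \<cdot> f n)" using confD(6)[OF wm] m(2) ea[of "f n"] by simp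
      qed (use confD[OF wm] m(2) msn in simp_all)
      then show "ar G (cl (\<theta> 0)) \<cdot>\<^bsub>Q\<^esub> std m wm (Suc n) = K (Suc n) \<cdot>\<^bsub>Q\<^esub> cl (\<theta> (Suc n))"
        using confD[OF wm] m(2) msn Q.ar_ide[of ?H] by (simp add: std_def th K Q_ide)
    qed
    fix i assume "i \<le> Suc n"
    from cs[OF this] show "is_iso Q (cl (\<theta> i))"
      by (elim disjE exE conjE) (use Q_biproduct_iso(1)[OF bm'] r(3) in \<open>simp_all add: th flip: Q_ide\<close>)
  qed
  then have KR: "K \<in> RA" using RA_iso[OF std_RA[OF wm]] by blast
  have "Q.siso (std f w) (Q.rot K)"
  proof (rule Q.sisoI)
    let ?\<psi> = "\<lambda>i. if i \<le> n then ide Q (src C (f i)) else cl (sgn_mor C n \<epsilon>)"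
    have rK: "i < n \<Longrightarrow> Q.rot K i = cl (f i)" "Q.rot K n = cl (sgn_mor C n (\<epsilon> \<cdot> f n))"
      "Q.rot K (Suc n) = sgn_mor Q n (ar G (cl \<xi>))" for i
      by (simp_all add: rotate_nseq_sgn K)
    obtain \<psi>x where px: "\<psi>x \<in> arr C" "src C \<psi>x = ob G ?H" "tgt C \<psi>x = ob G ?B" "ar G (cl \<xi>) = cl \<psi>x"
      using G_arE[of \<xi>] by auto
    show "Q.mor (std f w) (Q.rot K) ?\<psi>"
    proof (rule nseq_morphismI[OF std_sq[OF f] Q.sq_rot[OF Ks]])
      show "?\<psi> i \<in> Hom Q (src Q (std f w i)) (src Q (Q.rot K i))" if "i \<le> Suc n" for i
      proof -
        consider "i < n" | "i = n" | "i = Suc n" using \<open>i \<le> Suc n\<close> by linarith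
        then show ?thesis by cases (use px std_src[OF f] in \<open>simp_all add: rK Q_sgn\<close>)
      qed
      show "?\<psi> (Suc i) \<cdot>\<^bsub>Q\<^esub> std f w i = Q.rot K i \<cdot>\<^bsub>Q\<^esub> ?\<psi> i" if "i \<le> n" for i
      proof (cases "i = n")
        case True
        then show ?thesis by (simp add: rK std_def Q_ide)
      next
        case False
        then show ?thesis using that fT[of i] by (simp add: rK std_def Q_ide)
      qed
      have "ar G (cl \<xi>) \<cdot>\<^bsub>Q\<^esub> cl \<epsilon> = cl w" by (rule G_cmp) (simp_all add: xi2)
      then have "cl (\<psi>x \<cdot> \<epsilon>) = cl w" using px by simp
      then show "ar G (?\<psi> 0) \<cdot>\<^bsub>Q\<^esub> std f w (Suc n) = Q.rot K (Suc n) \<cdot>\<^bsub>Q\<^esub> ?\<psi> (Suc n)"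
        using px Q.ar_ide[of ?B] by (simp add: rK std_def Q_sgn Q_ide)
    qed
    show "is_iso Q (?\<psi> i)" for i using Q.iso_sgn[OF iso_e, of n] by (simp add: Q_sgn)
  qed
  with KR show ?thesis by blast
qed

lemma RA_rot_iff:
  assumes "Q.sq F"
  shows "F \<in> RA \<longleftrightarrow> Q.rot F \<in> RA"
proof
  assume "Q.rot F \<in> RA"
  then obtain e w where e: "conf e w" "Q.siso (std e w) (Q.rot F)" by (rule RAE)
  obtain K where K: "K \<in> RA" "Q.siso (std e w) (Q.rot K)" using RA_rot_surj[OF e(1)] by blast
  have "Q.siso (Q.rot K) (Q.rot F)" using Q.siso_trans[OF Q.siso_sym[OF K(2)] e(2)] .
  then have "Q.siso K F"
    by (rule Q.siso_unrot_ff[rotated 2]) (use G_full G_faithful RA_sq[OF K(1)] assms in blast)+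
  then show "F \<in> RA" by (rule RA_iso[OF K(1)])
qed (rule RA_rot)

end

text \<open>Closure under summands is now the only axiom left. This instance makes the right angles
  of the quotient exact, which is the tool for proving it.\<close>

sublocale frobenius \<subseteq> QA: pre_angulation "quotient_cat C X" "G_functor n C T X L" n "right_angles n C T \<Theta> X L"
proof
  show "\<exists>\<phi>. Q.mor f g \<phi> \<and> \<phi> 0 = a \<and> \<phi> (Suc 0) = b"
    if "f \<in> RA" "g \<in> RA" "a \<in> Hom Q (src Q (f 0)) (src Q (g 0))"
      "b \<in> Hom Q (src Q (f (Suc 0))) (src Q (g (Suc 0)))" "b \<cdot>\<^bsub>Q\<^esub> f 0 = g 0 \<cdot>\<^bsub>Q\<^esub> a" for f g a b
    using RA_F4[OF that(1,2,3)] that(4,5) by auto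
  show "1 \<le> n" by (rule n1)
  show "\<exists>x\<in>Hom Q A B. ar G x = y" if "y \<in> Hom Q (ob G A) (ob G B)" for y A B by (rule G_full[OF that])
  show "x = y" if "x \<in> Hom Q A B" "y \<in> Hom Q A B" "ar G x = ar G y" for x y A B by (rule G_faithful[OF that])
  show "Q.sq f" if "f \<in> RA" for f by (rule RA_sq[OF that])
  show "g \<in> RA" if "f \<in> RA" "Q.siso f g" for f g by (rule RA_iso[OF that])
  show "f \<in> RA" if "trivial_nseq n Q G A f" for A f by (rule RA_trivial[OF that])
  show "f \<in> RA \<longleftrightarrow> Q.rot f \<in> RA" if "Q.sq f" for f by (rule RA_rot_iff[OF that])
qed

section \<open>Direct summands of right angles\<close>

context pre_angulation
begin

text \<open>Exactness of the inner part of a sequence under all covariant and contravariant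
  representable functors, phrased with weak kernels and weak cokernels. Unlike being an angle, it
  visibly passes to retracts.\<close>

definition exact_nseq :: "(nat \<Rightarrow> 'm) \<Rightarrow> bool" where
  "exact_nseq f \<longleftrightarrow> sq f \<and> (\<forall>i\<le>n. f (Suc i) \<cdot> f i = mzero C (src C (f i)) (tgt C (f (Suc i)))) \<and>
    ar T (f 0) \<cdot> f (Suc n) = mzero C (src C (f (Suc n))) (ob T (tgt C (f 0))) \<and>
    (\<forall>i\<le>n. \<forall>t\<in>arr C. src C t = src C (f (Suc i)) \<longrightarrow> t \<cdot> f i = mzero C (src C (f i)) (tgt C t) \<longrightarrow>
      (\<exists>s\<in>Hom C (tgt C (f (Suc i))) (tgt C t). t = s \<cdot> f (Suc i))) \<and>
    (\<forall>i\<le>n. \<forall>t\<in>arr C. tgt C t = src C (f (Suc i)) \<longrightarrow> f (Suc i) \<cdot> t = mzero C (src C t) (tgt C (f (Suc i))) \<longrightarrow>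
      (\<exists>s\<in>Hom C (src C t) (src C (f i)). t = f i \<cdot> s))"

lemma exact_comp_zero:
  assumes "exact_nseq f"
  shows "sq f" "i \<le> n \<Longrightarrow> f (Suc i) \<cdot> f i = mzero C (src C (f i)) (tgt C (f (Suc i)))"
    "ar T (f 0) \<cdot> f (Suc n) = mzero C (src C (f (Suc n))) (ob T (tgt C (f 0)))"
  using assms unfolding exact_nseq_def by auto

lemma exact_wcoker:
  assumes "exact_nseq f" "i \<le> n" "t \<in> arr C" "src C t = src C (f (Suc i))" "t \<cdot> f i = mzero C (src C (f i)) (tgt C t)"
  obtains s where "s \<in> arr C" "src C s = tgt C (f (Suc i))" "tgt C s = tgt C t" "s \<cdot> f (Suc i) = t"
proof -
  have "\<exists>s\<in>Hom C (tgt C (f (Suc i))) (tgt C t). t = s \<cdot> f (Suc i)"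
    using assms unfolding exact_nseq_def by blast
  then show thesis using that by (metis Hom_iff)
qed

lemma exact_wker:
  assumes "exact_nseq f" "i \<le> n" "t \<in> arr C" "tgt C t = src C (f (Suc i))"
    "f (Suc i) \<cdot> t = mzero C (src C t) (tgt C (f (Suc i)))"
  obtains s where "s \<in> arr C" "src C s = src C t" "tgt C s = src C (f i)" "f i \<cdot> s = t"
proof -
  have "\<exists>s\<in>Hom C (src C t) (src C (f i)). t = f i \<cdot> s"
    using assms unfolding exact_nseq_def by blast
  then show thesis using that by (metis Hom_iff)
qed

text \<open>A factorization problem for \<open>f\<close> is moved to the angle \<open>h\<close> by
  \<iota> or \<pi>, solved there, and the solution is cut back down.\<close>

lemma retract_exact:
  assumes h: "h \<in> \<Theta>" and m: "mor f h \<iota>" "mor h f \<pi>" and r: "\<And>i. i \<le> Suc n \<Longrightarrow> \<pi> i \<cdot> \<iota> i = ide C (src C (f i))"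
  shows "exact_nseq f"
proof -
  note hD [simp] = nseqD[OF angle_sq[OF h]] and fD [simp] = nseqD[OF nseq_morphismD(1)[OF m(1)]]
  note ms1 [simp] = mor_simps(1-3)[OF m(1)] mor_simps(1-3)[OF m(2)] r r[THEN cmp_eq_assoc]
  note n1s = nxt_simps[OF m(1)] and n2s = nxt_simps[OF m(2)]
  have inv: "nxt \<pi> i \<cdot> nxt \<iota> i = ide C (tgt C (f i))" if "i \<le> Suc n" for i
    by (rule nxt_inv[OF m r that])
  have mono: "x = y" if "nxt \<iota> i \<cdot> x = nxt \<iota> i \<cdot> y" "i \<le> Suc n" "x \<in> arr C" "y \<in> arr C" "tgt C x = tgt C (f i)" "tgt C y = tgt C (f i)" for x y i
  proof -
    have "x = nxt \<pi> i \<cdot> (nxt \<iota> i \<cdot> x)"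
      using that(2-) n1s(1-3)[of i] n2s(1-3)[of i] inv[OF that(2), THEN cmp_eq_assoc, of x] by simp
    also have "\<dots> = y" unfolding that(1)
      using that(2-) n1s(1-3)[of i] n2s(1-3)[of i] inv[OF that(2), THEN cmp_eq_assoc, of y] by simp
    finally show ?thesis .
  qed
  have 1: "f (Suc i) \<cdot> f i = mzero C (src C (f i)) (tgt C (f (Suc i)))" if i: "i \<le> n" for i
  proof (rule mono[of "Suc i"])
    have "nxt \<iota> (Suc i) \<cdot> (f (Suc i) \<cdot> f i) = h (Suc i) \<cdot> (\<iota> (Suc i) \<cdot> f i)"
      by (rule n1s(5)) (use i in simp_all)
    also have "\<dots> = h (Suc i) \<cdot> (h i \<cdot> \<iota> i)" using i mor_simps(4)[OF m(1) i] by simp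
    also have "\<dots> = mzero C (src C (f i)) (tgt C (h (Suc i)))" using i comp_zero_assoc(1)[OF h i, of "\<iota> i"] by simp
    also have "\<dots> = nxt \<iota> (Suc i) \<cdot> mzero C (src C (f i)) (tgt C (f (Suc i)))"
      by (subst cmp_zero) (use i n1s(1-3)[of "Suc i"] in simp_all)
    finally show "nxt \<iota> (Suc i) \<cdot> (f (Suc i) \<cdot> f i) = nxt \<iota> (Suc i) \<cdot> mzero C (src C (f i)) (tgt C (f (Suc i)))" .
  qed (use i in simp_all)
  have 2: "ar T (f 0) \<cdot> f (Suc n) = mzero C (src C (f (Suc n))) (ob T (tgt C (f 0)))"
  proof -
    have "ar T (\<pi> (Suc 0)) \<cdot> ar T (\<iota> (Suc 0)) = ide C (ob T (src C (f (Suc 0))))" by (simp flip: ar_cmp)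
    then have "ar T (\<pi> (Suc 0)) \<cdot> (ar T (\<iota> (Suc 0)) \<cdot> (ar T (f 0) \<cdot> f (Suc n))) = ide C (ob T (src C (f (Suc 0)))) \<cdot> (ar T (f 0) \<cdot> f (Suc n))"
      by (rule cmp_eq_assoc) simp_all
    also have "\<dots> = ar T (f 0) \<cdot> f (Suc n)" by (rule cmp_ide(2)) simp_all
    finally have "ar T (f 0) \<cdot> f (Suc n) = ar T (\<pi> (Suc 0)) \<cdot> (ar T (\<iota> (Suc 0)) \<cdot> (ar T (f 0) \<cdot> f (Suc n)))" ..
    also have "ar T (\<iota> (Suc 0)) \<cdot> (ar T (f 0) \<cdot> f (Suc n)) = ar T (h 0) \<cdot> (ar T (\<iota> 0) \<cdot> f (Suc n))"
    proof -
      have "ar T (\<iota> (Suc 0) \<cdot> f 0) = ar T (h 0 \<cdot> \<iota> 0)" using mor_simps(4)[OF m(1), of 0] by simp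
      then have "ar T (\<iota> (Suc 0)) \<cdot> ar T (f 0) = ar T (h 0) \<cdot> ar T (\<iota> 0)" by simp
      then have "(ar T (\<iota> (Suc 0)) \<cdot> ar T (f 0)) \<cdot> f (Suc n) = (ar T (h 0) \<cdot> ar T (\<iota> 0)) \<cdot> f (Suc n)" by simp
      then show ?thesis by simp
    qed
    also have "ar T (h 0) \<cdot> (ar T (\<iota> 0) \<cdot> f (Suc n)) = mzero C (src C (f (Suc n))) (ob T (tgt C (h 0)))"
      unfolding mor_simps(5)[OF m(1)] using comp_zero_assoc(2)[OF h, of "\<iota> (Suc n)"] by simp
    finally show ?thesis by simp
  qed
  have 3: "\<exists>s\<in>Hom C (tgt C (f (Suc i))) (tgt C t). t = s \<cdot> f (Suc i)"
    if i: "i \<le> n" and t: "t \<in> arr C" "src C t = src C (f (Suc i))" "t \<cdot> f i = mzero C (src C (f i)) (tgt C t)" for i t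
  proof -
    have "t \<cdot> (\<pi> (Suc i) \<cdot> h i) = t \<cdot> (f i \<cdot> \<pi> i)" using mor_simps(4)[OF m(2) i] by simp
    also have "\<dots> = mzero C (src C (h i)) (tgt C t)" using t i t(3)[THEN cmp_eq_assoc, of "\<pi> i"] by simp
    finally have "(t \<cdot> \<pi> (Suc i)) \<cdot> h i = mzero C (src C (h i)) (tgt C t)" using t i by simp
    then obtain s where s: "s \<in> Hom C (tgt C (h (Suc i))) (tgt C t)" "t \<cdot> \<pi> (Suc i) = s \<cdot> h (Suc i)"
      using wcoker(1)[OF h, of "t \<cdot> \<pi> (Suc i)" i] t i by auto
    have "t = (t \<cdot> \<pi> (Suc i)) \<cdot> \<iota> (Suc i)" using t i by simp
    also have "\<dots> = s \<cdot> (h (Suc i) \<cdot> \<iota> (Suc i))" unfolding s(2) using s(1) i by simp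
    also have "\<dots> = s \<cdot> (nxt \<iota> (Suc i) \<cdot> f (Suc i))" using n1s(4)[of "Suc i"] i by simp
    also have "\<dots> = (s \<cdot> nxt \<iota> (Suc i)) \<cdot> f (Suc i)"
      by (rule assoc[symmetric]) (use s(1) n1s(1-3)[of "Suc i"] i in simp_all)
    finally have "t = (s \<cdot> nxt \<iota> (Suc i)) \<cdot> f (Suc i)" .
    moreover have "s \<cdot> nxt \<iota> (Suc i) \<in> Hom C (tgt C (f (Suc i))) (tgt C t)"
      using s(1) n1s(1-3)[of "Suc i"] i by simp
    ultimately show ?thesis by blast
  qed
  have 4: "\<exists>s\<in>Hom C (src C t) (src C (f i)). t = f i \<cdot> s"
    if i: "i \<le> n" and t: "t \<in> arr C" "tgt C t = src C (f (Suc i))"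
      "f (Suc i) \<cdot> t = mzero C (src C t) (tgt C (f (Suc i)))" for i t
  proof -
    have "h (Suc i) \<cdot> (\<iota> (Suc i) \<cdot> t) = nxt \<iota> (Suc i) \<cdot> (f (Suc i) \<cdot> t)"
      by (rule n1s(5)[symmetric]) (use t i in simp_all)
    also have "\<dots> = mzero C (src C t) (tgt C (h (Suc i)))"
      unfolding t(3) by (subst cmp_zero) (use i n1s(1-3)[of "Suc i"] in simp_all)
    finally obtain s where s: "s \<in> Hom C (src C t) (src C (h i))" "\<iota> (Suc i) \<cdot> t = h i \<cdot> s"
      using wker(1)[OF h, of "\<iota> (Suc i) \<cdot> t" i] t i by auto
    have "t = \<pi> (Suc i) \<cdot> (\<iota> (Suc i) \<cdot> t)" using t i by simp
    also have "\<dots> = f i \<cdot> (\<pi> i \<cdot> s)" unfolding s(2) using s(1) i mor_assoc(1)[OF m(2) i, of s] by simp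
    finally have "t = f i \<cdot> (\<pi> i \<cdot> s)" .
    moreover have "\<pi> i \<cdot> s \<in> Hom C (src C t) (src C (f i))" using s(1) i by simp
    ultimately show ?thesis by blast
  qed
  show ?thesis unfolding exact_nseq_def using nseq_morphismD(1)[OF m(1)] 1 2 3 4 by blast
qed

lemma iso_square_inv:
  assumes m: "mor e f \<alpha>" and i: "i \<le> n" and a: "a \<cdot> \<alpha> i = ide C (src C (e i))" "\<alpha> i \<cdot> a = ide C (src C (f i))" "a \<in> arr C"
     "src C a = src C (f i)" "tgt C a = src C (e i)"
    and b: "b \<cdot> \<alpha> (Suc i) = ide C (src C (e (Suc i)))" "b \<in> arr C" "src C b = src C (f (Suc i))" "tgt C b = src C (e (Suc i))"
  shows "b \<cdot> f i = e i \<cdot> a"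
proof -
  note [simp] = nseqD[OF nseq_morphismD(1)[OF m]] nseqD[OF nseq_morphismD(2)[OF m]] mor_simps(1-3)[OF m] a b
  have "b \<cdot> f i = b \<cdot> (f i \<cdot> (\<alpha> i \<cdot> a))" using i by simp
  also have "\<dots> = b \<cdot> (\<alpha> (Suc i) \<cdot> (e i \<cdot> a))" using i mor_simps(4)[OF m i, THEN cmp_eq_assoc, of a] by simp
  also have "\<dots> = e i \<cdot> a" using i b(1)[THEN cmp_eq_assoc, of "e i \<cdot> a"] by simp
  finally show ?thesis .
qed

text \<open>Two consecutive isomorphisms contract the comparison one place further on:
  \<open>e (Suc i)\<close> factors up to sign as \<open>r2\<close> after \<open>f (Suc i)\<close>
  and \<open>\<alpha> (Suc i)\<close>, so 1 + r2 \<alpha> kills \<open>e (Suc i)\<close> and factors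
  through the next map. The outcome says that the pair of \<open>e\<close> and \<alpha> at position
  i + 2 is a split monomorphism, which is the hypothesis of \<open>exchange\<close>.\<close>

lemma contract_step:
  assumes e: "e \<in> \<Theta>" and f: "exact_nseq f" and m: "mor e f \<alpha>" and i: "Suc (Suc i) \<le> n"
    and a: "is_iso C (\<alpha> i)" and b: "is_iso C (\<alpha> (Suc i))"
  obtains r1 r2 where "r1 \<in> Hom C (tgt C (e (Suc (Suc i)))) (src C (e (Suc (Suc i))))"
    "r2 \<in> Hom C (src C (f (Suc (Suc i)))) (src C (e (Suc (Suc i))))"
    "(r1 \<cdot> e (Suc (Suc i))) \<oplus> mneg C (r2 \<cdot> \<alpha> (Suc (Suc i))) = ide C (src C (e (Suc (Suc i))))"
proof -
  let ?k = "Suc i" and ?j = "Suc (Suc i)"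
  note [simp] = nseqD[OF nseq_morphismD(1)[OF m]] nseqD[OF nseq_morphismD(2)[OF m]] mor_simps(1-3)[OF m]
  from a obtain a' where a': "a' \<in> arr C" "src C a' = tgt C (\<alpha> i)" "tgt C a' = src C (\<alpha> i)"
    "a' \<cdot> \<alpha> i = ide C (src C (\<alpha> i))" "\<alpha> i \<cdot> a' = ide C (tgt C (\<alpha> i))" by (rule is_isoE)
  from b obtain b' where b': "b' \<in> arr C" "src C b' = tgt C (\<alpha> ?k)" "tgt C b' = src C (\<alpha> ?k)"
    "b' \<cdot> \<alpha> ?k = ide C (src C (\<alpha> ?k))" "\<alpha> ?k \<cdot> b' = ide C (tgt C (\<alpha> ?k))" by (rule is_isoE)
  have bf: "b' \<cdot> f i = e i \<cdot> a'"
    by (rule iso_square_inv[OF m]) (use a' b' i in simp_all)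
  note [simp] = a'(1) b'(1)
  have [simp]: "src C a' = src C (f i)" "tgt C a' = src C (e i)" "src C b' = src C (f ?k)" "tgt C b' = src C (e ?k)"
    using a' b' i by simp_all
  have "mneg C (e ?k \<cdot> b') \<cdot> f i = mzero C (src C (f i)) (tgt C (e ?k))"
    using i bf comp_zero_assoc(1)[OF e, of i a'] by simp
  then obtain r2 where r2: "r2 \<in> arr C" "src C r2 = tgt C (f ?k)" "tgt C r2 = tgt C (e ?k)" "r2 \<cdot> f ?k = mneg C (e ?k \<cdot> b')"
    using exact_wcoker[OF f, of i "mneg C (e ?k \<cdot> b')"] i by auto
  have r2': "r2 \<in> Hom C (src C (f ?j)) (src C (e ?j))" using r2 i by simp
  have "(ide C (src C (e ?j)) \<oplus> (r2 \<cdot> \<alpha> ?j)) \<cdot> e ?k = e ?k \<oplus> (r2 \<cdot> (f ?k \<cdot> \<alpha> ?k))"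
    using i r2' mor_simps(4)[OF m, of ?k] by simp
  also have "r2 \<cdot> (f ?k \<cdot> \<alpha> ?k) = mneg C (e ?k)"
    using i r2 r2(4)[THEN cmp_eq_assoc, of "\<alpha> ?k"] b'(4) by simp
  finally have "(ide C (src C (e ?j)) \<oplus> (r2 \<cdot> \<alpha> ?j)) \<cdot> e ?k = mzero C (src C (e ?k)) (src C (e ?j))"
    using i by simp
  then obtain r1 where r1: "r1 \<in> Hom C (tgt C (e ?j)) (src C (e ?j))" "ide C (src C (e ?j)) \<oplus> (r2 \<cdot> \<alpha> ?j) = r1 \<cdot> e ?j"
    using wcoker(1)[OF e, of "ide C (src C (e ?j)) \<oplus> (r2 \<cdot> \<alpha> ?j)" ?k] i r2' by auto
  show thesis
  proof (rule that[OF r1(1) r2'])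
    show "(r1 \<cdot> e ?j) \<oplus> mneg C (r2 \<cdot> \<alpha> ?j) = ide C (src C (e ?j))"
      unfolding r1(2)[symmetric] using i r2' by simp
  qed
qed

text \<open>The component in question is the last one, so its right-hand neighbours in the chase are
  \<open>T\<close> of the first two components; they enter through the inverses \<beta>.\<close>

lemma five_lemma:
  assumes e: "e \<in> \<Theta>" and f: "exact_nseq f" and m: "mor e f \<alpha>" and a: "\<And>i. i \<le> n \<Longrightarrow> is_iso C (\<alpha> i)"
  shows "is_iso C (\<alpha> (Suc n))"
proof -
  note [simp] = nseqD[OF nseq_morphismD(1)[OF m]] nseqD[OF nseq_morphismD(2)[OF m]] mor_simps(1-3)[OF m]
  have "\<exists>b. i \<le> n \<longrightarrow> b \<in> arr C \<and> src C b = src C (f i) \<and> tgt C b = src C (e i) \<and>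
    b \<cdot> \<alpha> i = ide C (src C (e i)) \<and> \<alpha> i \<cdot> b = ide C (src C (f i))" for i
  proof (cases "i \<le> n")
    case True
    from a[OF True] show ?thesis by (rule is_isoE) (use True in auto)
  qed simp
  then obtain \<beta> where b': "\<And>i. i \<le> n \<longrightarrow> \<beta> i \<in> arr C \<and> src C (\<beta> i) = src C (f i) \<and> tgt C (\<beta> i) = src C (e i) \<and>
    \<beta> i \<cdot> \<alpha> i = ide C (src C (e i)) \<and> \<alpha> i \<cdot> \<beta> i = ide C (src C (f i))" by metis
  have b [simp]: "\<beta> i \<in> arr C" "src C (\<beta> i) = src C (f i)" "tgt C (\<beta> i) = src C (e i)"
    "\<beta> i \<cdot> \<alpha> i = ide C (src C (e i))" "\<alpha> i \<cdot> \<beta> i = ide C (src C (f i))" if "i \<le> n" for i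
    using b' that by blast+
  note ba [simp] = b(4)[THEN cmp_eq_assoc] b(5)[THEN cmp_eq_assoc]
  have bT: "ar T (\<beta> 0) \<cdot> ar T (\<alpha> 0) = ide C (ob T (src C (e 0)))" "ar T (\<alpha> 0) \<cdot> ar T (\<beta> 0) = ide C (ob T (src C (f 0)))"
    by (simp_all flip: ar_cmp)
  note bTa = bT[THEN cmp_eq_assoc]
  have bf: "\<beta> (Suc i) \<cdot> f i = e i \<cdot> \<beta> i" if "Suc i \<le> n" for i
    by (rule iso_square_inv[OF m]) (use that in simp_all)
  let ?a = "\<alpha> (Suc n)"
  have fa: "ar T (\<alpha> 0) \<cdot> (e (Suc n) \<cdot> x) = f (Suc n) \<cdot> (?a \<cdot> x)" if "x \<in> arr C" "tgt C x = src C (e (Suc n))" for x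
    using mor_assoc(2)[OF m, of x] that by simp
  have fn: "?a \<cdot> (e n \<cdot> x) = f n \<cdot> (\<alpha> n \<cdot> x)" if "x \<in> arr C" "tgt C x = src C (e n)" for x
    using mor_assoc(1)[OF m le_refl, of x] that by simp
  obtain w where w: "w \<in> Hom C (src C (f (Suc n))) (src C (e (Suc n)))" "ar T (\<beta> 0) \<cdot> f (Suc n) = e (Suc n) \<cdot> w"
  proof -
    have "ar T (\<beta> (Suc 0) \<cdot> f 0) = ar T (e 0 \<cdot> \<beta> 0)" using bf[of 0] n1 by simp
    then have "ar T (e 0) \<cdot> ar T (\<beta> 0) = ar T (\<beta> (Suc 0)) \<cdot> ar T (f 0)" using n1 by simp
    then have "(ar T (e 0) \<cdot> ar T (\<beta> 0)) \<cdot> f (Suc n) = (ar T (\<beta> (Suc 0)) \<cdot> ar T (f 0)) \<cdot> f (Suc n)" by simp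
    then have "ar T (e 0) \<cdot> (ar T (\<beta> 0) \<cdot> f (Suc n)) = mzero C (src C (f (Suc n))) (ob T (tgt C (e 0)))"
      using exact_comp_zero(3)[OF f] n1 by simp
    then show thesis using wker(2)[OF e, of "ar T (\<beta> 0) \<cdot> f (Suc n)"] that by auto
  qed
  have w1 [simp]: "w \<in> arr C" "src C w = src C (f (Suc n))" "tgt C w = src C (e (Suc n))" using w(1) by simp_all
  have "f (Suc n) \<cdot> (?a \<cdot> w) = ar T (\<alpha> 0) \<cdot> (e (Suc n) \<cdot> w)" using fa[of w] by simp
  also have "\<dots> = f (Suc n)" unfolding w(2)[symmetric] using bTa(2)[of "f (Suc n)"] by simp
  finally have "f (Suc n) \<cdot> (ide C (src C (f (Suc n))) \<oplus> mneg C (?a \<cdot> w)) = mzero C (src C (f (Suc n))) (tgt C (f (Suc n)))"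
    by simp
  then obtain y where y: "y \<in> arr C" "src C y = src C (f (Suc n))" "tgt C y = src C (f n)"
    "f n \<cdot> y = ide C (src C (f (Suc n))) \<oplus> mneg C (?a \<cdot> w)"
    using exact_wker[OF f le_refl, of "ide C (src C (f (Suc n))) \<oplus> mneg C (?a \<cdot> w)"] by auto
  \<comment> \<open>\<open>w\<close> is a right inverse of \<open>?a\<close> up to an error killed
    by \<open>f (Suc n)\<close>, hence of the form \<open>f n \<cdot> y\<close>; the second summand
    lifts this error to \<open>e\<close>.\<close>
  define s where "s = w \<oplus> (e n \<cdot> (\<beta> n \<cdot> y))"
  have s [simp]: "s \<in> arr C" "src C s = src C (f (Suc n))" "tgt C s = src C (e (Suc n))" using y by (simp_all add: s_def)
  have as: "?a \<cdot> s = ide C (src C (f (Suc n)))"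
  proof -
    have "?a \<cdot> s = (?a \<cdot> w) \<oplus> (f n \<cdot> y)" unfolding s_def using y(1-3) fn[of "\<beta> n \<cdot> y"] by simp
    then show ?thesis unfolding y(4) by simp
  qed
  \<comment> \<open>The defect of \<open>s\<close> as a left inverse is killed by \<open>?a\<close>
    and by \<open>e (Suc n)\<close>. It therefore factors first through \<open>e n\<close> and then
    through two consecutive maps of \<open>e\<close>, whose composite is zero.\<close>
  define d where "d = ide C (src C (e (Suc n))) \<oplus> mneg C (s \<cdot> ?a)"
  have d [simp]: "d \<in> arr C" "src C d = src C (e (Suc n))" "tgt C d = src C (e (Suc n))" by (simp_all add: d_def)
  have ad: "?a \<cdot> d = mzero C (src C (e (Suc n))) (src C (f (Suc n)))"
    unfolding d_def using as[THEN cmp_eq_assoc, of ?a] by simp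
  have "e (Suc n) \<cdot> d = ar T (\<beta> 0) \<cdot> (ar T (\<alpha> 0) \<cdot> (e (Suc n) \<cdot> d))" using bTa(1)[of "e (Suc n) \<cdot> d"] by simp
  also have "\<dots> = mzero C (src C (e (Suc n))) (tgt C (e (Suc n)))" unfolding fa[OF d(1,3)] ad by simp
  finally have ed: "e (Suc n) \<cdot> d = mzero C (src C (e (Suc n))) (tgt C (e (Suc n)))" .
  have "\<exists>z\<in>Hom C (src C d) (src C (e n)). d = e n \<cdot> z"
    by (rule wker(1)[OF e d(1) le_refl]) (use ed in simp_all)
  then obtain z where z: "z \<in> Hom C (src C d) (src C (e n))" "d = e n \<cdot> z" by blast
  have z1 [simp]: "z \<in> arr C" "src C z = src C (e (Suc n))" "tgt C z = src C (e n)" using z(1) by simp_all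
  obtain p where p: "n = Suc p" using n1 by (cases n) auto
  have "f n \<cdot> (\<alpha> n \<cdot> z) = mzero C (src C (e (Suc n))) (src C (f (Suc n)))"
    using fn[of z] ad z(2) by simp
  then obtain x where x: "x \<in> arr C" "src C x = src C z" "tgt C x = src C (f p)" "f p \<cdot> x = \<alpha> n \<cdot> z"
    using exact_wker[OF f, of p "\<alpha> n \<cdot> z"] p by auto
  have "z = \<beta> n \<cdot> (\<alpha> n \<cdot> z)" by simp
  also have "\<dots> = (\<beta> n \<cdot> f p) \<cdot> x" unfolding x(4)[symmetric] using x(1-3) p by simp
  also have "\<dots> = e p \<cdot> (\<beta> p \<cdot> x)" using bf[of p] p x(1-3) by simp
  finally have zz: "z = e p \<cdot> (\<beta> p \<cdot> x)" .
  have "d = mzero C (src C (e (Suc n))) (src C (e (Suc n)))"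
    unfolding z(2) zz using comp_zero_assoc(1)[OF e, of p "\<beta> p \<cdot> x"] p x(1-3) by simp
  then have "s \<cdot> ?a = ide C (src C (e (Suc n)))"
    using diff_zero_iff[of "ide C (src C (e (Suc n)))" "s \<cdot> ?a"] by (simp add: d_def)
  then show ?thesis using as by (intro is_isoI[of _ s]) simp_all
qed

end

section \<open>Replacing the objects of a right angle one at a time\<close>

context frobenius
begin

text \<open>The new object \<open>W\<close> is the object of \<open>F\<close> plus some
  \<open>D\<close> in \<open>X\<close>, so the projection to the former is invertible in the
  quotient. The earlier components are untouched; thus one more component becomes an
  isomorphism.\<close>

lemma exchange_std:
  assumes e: "conf e w" and F: "QA.exact_nseq F" and m: "Q.mor (std e w) F \<alpha>" and i: "Suc (Suc i) \<le> n"
    and a: "\<And>j. j \<le> Suc i \<Longrightarrow> is_iso Q (\<alpha> j)"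
  obtains e' w' \<alpha>' where "conf e' w'" "Q.mor (std e' w') F \<alpha>'" "\<And>j. j \<le> Suc (Suc i) \<Longrightarrow> is_iso Q (\<alpha>' j)"
proof -
  define k where "k = Suc i"
  define j where "j = Suc k"
  have kj: "k \<le> n" "k < n" "j \<le> n" "k \<noteq> 0" "j \<noteq> 0" "k \<noteq> j" "j \<noteq> k" "Suc j \<noteq> k" "Suc j \<noteq> j" "Suc j \<noteq> 0" "0 < k" "0 < j"
    using i by (auto simp: k_def j_def)
  note eD [simp] = nseqD(1-3,6)[OF confD(7)[OF e]] confD(3-6)[OF e]
  note FD [simp] = nseqD[OF QA.exact_comp_zero(1)[OF F]]
  have eT: "src C (e (Suc i)) = tgt C (e i)" if "i \<le> n" for i using nseqD(4)[OF confD(7)[OF e] that] by simp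
  note ss = std_src[OF e]
  have st: "std e w i = cl (e i)" if "i \<le> n" for i using that by (simp add: std_def)
  let ?E = "src C (e j)" and ?F = "src Q (F j)"
  have "is_iso Q (\<alpha> i)" "is_iso Q (\<alpha> (Suc i))" using a by simp_all
  then obtain R1 R2 where R: "R1 \<in> Hom Q (tgt Q (std e w j)) (src Q (std e w j))"
    "R2 \<in> Hom Q ?F (src Q (std e w j))"
    "(R1 \<cdot>\<^bsub>Q\<^esub> std e w j) \<oplus>\<^bsub>Q\<^esub> mneg Q (R2 \<cdot>\<^bsub>Q\<^esub> \<alpha> j) = ide Q (src Q (std e w j))"
    unfolding j_def k_def by (rule QA.contract_step[OF std_RA[OF e] F m i])
  have al: "\<alpha> i \<in> arr Q" "src Q (\<alpha> i) = src C (e i)" "tgt Q (\<alpha> i) = src Q (F i)" if "i \<le> Suc n" for i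
    using Q.mor_simps(1-3)[OF m that] ss[OF that] by simp_all
  have "R1 \<in> Hom Q (tgt C (e j)) ?E" using R(1) st[of j] kj by simp
  then obtain r1 where r1 [simp]: "r1 \<in> arr C" "R1 = cl r1" "src C r1 = tgt C (e j)" "tgt C r1 = ?E"
    by (rule Hom_QE)
  have "R2 \<in> Hom Q ?F ?E" using R(2) st[of j] kj by simp
  then obtain r2 where r2 [simp]: "r2 \<in> arr C" "R2 = cl r2" "src C r2 = ?F" "tgt C r2 = ?E"
    by (rule Hom_QE)
  have "\<alpha> j \<in> Hom Q ?E ?F" using al[of j] kj by simp
  then obtain b where b [simp]: "b \<in> arr C" "\<alpha> j = cl b" "src C b = ?E" "tgt C b = ?F"
    by (rule Hom_QE)
  \<comment> \<open>\<open>contract_step\<close> yields its identity only in the quotient, and the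
    error \<open>g\<close> factors through some \<open>D\<close> in \<open>X\<close>. Enlarging the
    object of \<open>F\<close> by \<open>D\<close> absorbs the error, so that the identity holds in
    \<open>C\<close>, as \<open>exchange\<close> requires.\<close>
  define g where "g = ide C ?E \<oplus> mneg C ((r1 \<cdot> e j) \<oplus> mneg C (r2 \<cdot> b))"
  have "cl (ide C ?E) = cl ((r1 \<cdot> e j) \<oplus> mneg C (r2 \<cdot> b))" using R(3) st[of j] kj by (simp add: Q_ide)
  then have "thr g" unfolding g_def using kj by (subst (asm) cl_eq_iff) simp_all
  then obtain D x v where x: "D \<in> X" "x \<in> arr C" "src C x = src C g" "tgt C x = D" "v \<in> arr C" "src C v = D"
    "tgt C v = tgt C g" "v \<cdot> x = g" by (rule thrE)
  have sg: "src C g = ?E" "tgt C g = ?E" using kj by (simp_all add: g_def)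
  note [simp] = x(2) x(3)[unfolded sg] x(4,5,6) x(7)[unfolded sg]
  obtain W q1 q2 \<pi>1 \<pi>2 where W: "biproduct C ?F D W q1 q2 \<pi>1 \<pi>2"
    using has_direct_sums[of ?F D] unfolding direct_sum_def by blast
  note [simp] = biproduct_simps[OF W]
  define c rW where "c = (q2 \<cdot> x) \<oplus> mneg C (q1 \<cdot> b)" and "rW = (r2 \<cdot> \<pi>1) \<oplus> (v \<cdot> \<pi>2)"
  have c [simp]: "c \<in> arr C" "src C c = ?E" "tgt C c = W" "rW \<in> arr C" "src C rW = W" "tgt C rW = ?E"
    by (simp_all add: c_def rW_def)
  have pc: "\<pi>1 \<cdot> c = mneg C b" by (simp add: c_def)
  have "(r1 \<cdot> e j) \<oplus> (rW \<cdot> c) = ((r1 \<cdot> e j) \<oplus> mneg C (r2 \<cdot> b)) \<oplus> g"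
    unfolding c_def rW_def using x(8) kj add_commute[of g "mneg C (r2 \<cdot> b)"] thr_arr[OF \<open>thr g\<close>] sg by simp
  also have "\<dots> = ide C ?E" unfolding g_def using kj by (simp add: add_ac)
  finally have eq: "(r1 \<cdot> e j) \<oplus> (rW \<cdot> c) = ide C ?E" .
  have hom: "c \<in> Hom C ?E W" "r1 \<in> Hom C (tgt C (e j)) ?E" "rW \<in> Hom C W ?E" by simp_all
  obtain N s1 s2 t1 t2 Z \<zeta> \<rho> where N: "biproduct C (tgt C (e j)) W N s1 s2 t1 t2"
    and z: "\<zeta> \<in> Hom C Z N" "\<rho> \<in> Hom C N Z" "\<rho> \<cdot> \<zeta> = ide C Z"
    "\<zeta> \<cdot> \<rho> = ide C N \<oplus> mneg C (((s1 \<cdot> e j) \<oplus> (s2 \<cdot> c)) \<cdot> ((r1 \<cdot> t1) \<oplus> (rW \<cdot> t2)))"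
    and e'0: "e(k := mneg C (c \<cdot> e k), j := \<rho> \<cdot> s2, Suc j := e (Suc j) \<cdot> (t1 \<cdot> \<zeta>)) \<in> \<Theta>"
    by (rule exchange[OF confD(1)[OF e] kj(2), folded j_def, OF hom eq]) (rule that; assumption)
  note [simp] = biproduct_simps[OF N]
  have z1 [simp]: "\<zeta> \<in> arr C" "src C \<zeta> = Z" "tgt C \<zeta> = N" "\<rho> \<in> arr C" "src C \<rho> = N" "tgt C \<rho> = Z" using z by simp_all
  define e' where "e' = e(k := mneg C (c \<cdot> e k), j := \<rho> \<cdot> s2, Suc j := e (Suc j) \<cdot> (t1 \<cdot> \<zeta>))"
  have e': "e' \<in> \<Theta>" using e'0 by (simp add: e'_def)
  have e'k: "e' k = mneg C (c \<cdot> e k)" "e' j = \<rho> \<cdot> s2" "e' (Suc j) = e (Suc j) \<cdot> (t1 \<cdot> \<zeta>)"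
    "i \<noteq> k \<Longrightarrow> i \<noteq> j \<Longrightarrow> i \<noteq> Suc j \<Longrightarrow> e' i = e i" "e' 0 = e 0" for i
    using kj by (simp_all add: e'_def)
  obtain w' where w': "conf e' w'" using conf_exists[OF e'] confD(2)[OF e] e'k(5) by metis
  note ss' = std_src[OF w']
  have eTj: "src C (e (Suc j)) = tgt C (e j)" "src C (e j) = tgt C (e k)" using eT[of j] eT[of k] kj by (simp_all add: j_def)
  have src': "i \<noteq> k \<Longrightarrow> i \<noteq> j \<Longrightarrow> i \<noteq> Suc j \<Longrightarrow> src C (e' i) = src C (e i)" "src C (e' k) = src C (e k)"
    "src C (e' j) = W" "src C (e' (Suc j)) = Z" for i
    using kj eTj by (simp_all add: e'k)
  \<comment> \<open>If the position after \<open>j\<close> is the last one, then the change of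
    \<open>e (Suc j)\<close> shows up as a change of the comparison map.\<close>
  have wt: "cl w' = cl (w \<cdot> (t1 \<cdot> \<zeta>))" if "j = n"
  proof (rule thr_of_l_eq[of _ "src C (e 0)"])
    have "l (src C (e 0)) \<cdot> w' = e (Suc n) \<cdot> (t1 \<cdot> \<zeta>)" using confD(6)[OF w'] e'k(3,5) that by simp
    then show "l (src C (e 0)) \<cdot> w' = l (src C (e 0)) \<cdot> (w \<cdot> (t1 \<cdot> \<zeta>))"
      using confD(8)[OF e, of "t1 \<cdot> \<zeta>"] eTj that by simp
    show "src C w' = src C (w \<cdot> (t1 \<cdot> \<zeta>))" using confD(4)[OF w'] src'(4) that eTj by simp
  qed (use confD(3,5)[OF w'] e'k(5) eTj that in simp_all)
  have ww: "cl w' = cl w" if "j \<noteq> n"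
  proof (rule thr_of_l_eq[of _ "src C (e 0)"])
    have 1: "Suc n \<noteq> k" "Suc n \<noteq> j" "Suc n \<noteq> Suc j" using kj that by auto
    show "l (src C (e 0)) \<cdot> w' = l (src C (e 0)) \<cdot> w" using confD(6)[OF w'] e'k(4)[OF 1] e'k(5) by simp
    show "src C w' = src C w" using confD(4)[OF w'] src'(1)[OF 1] by simp
  qed (use confD(3,5)[OF w'] e'k(5) in simp_all)
  have sk: "std e' w' k = cl (mneg C (c \<cdot> e k))" "std e' w' j = cl (\<rho> \<cdot> s2)"
    "std e' w' (Suc j) = std e w (Suc j) \<cdot>\<^bsub>Q\<^esub> cl (t1 \<cdot> \<zeta>)"
    "i \<noteq> k \<Longrightarrow> i \<noteq> j \<Longrightarrow> i \<noteq> Suc j \<Longrightarrow> i \<le> Suc n \<Longrightarrow> std e' w' i = std e w i" for i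
  proof -
    show "std e' w' k = cl (mneg C (c \<cdot> e k))" "std e' w' j = cl (\<rho> \<cdot> s2)"
      using kj by (simp_all add: std_def e'k)
    show "std e' w' (Suc j) = std e w (Suc j) \<cdot>\<^bsub>Q\<^esub> cl (t1 \<cdot> \<zeta>)"
    proof (cases "j = n")
      case True
      then show ?thesis using wt eTj by (simp add: std_def)
    next
      case False
      then have "Suc j \<le> n" using kj by simp
      then show ?thesis using eTj by (simp add: std_def e'k)
    qed
    show "std e' w' i = std e w i" if "i \<noteq> k" "i \<noteq> j" "i \<noteq> Suc j" "i \<le> Suc n"
      using e'k(4)[OF that(1-3)] ww that by (auto simp: std_def)
  qed
  \<comment> \<open>\<open>Y\<close> extends \<open>\<alpha> (Suc j)\<close> from the first summand
    to all of \<open>N\<close>. It kills \<open>u\<close>, so restricting it along \<zeta> to the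
    complement of \<open>u\<close> loses nothing.\<close>
  define Y where "Y = (\<alpha> (Suc j) \<cdot>\<^bsub>Q\<^esub> cl t1) \<oplus>\<^bsub>Q\<^esub> (F j \<cdot>\<^bsub>Q\<^esub> cl (\<pi>1 \<cdot> t2))"
  define \<alpha>' where "\<alpha>' = \<alpha>(j := cl \<pi>1, Suc j := Y \<cdot>\<^bsub>Q\<^esub> cl \<zeta>)"
  have alj: "\<alpha> (Suc j) \<in> arr Q" "src Q (\<alpha> (Suc j)) = tgt C (e j)" "tgt Q (\<alpha> (Suc j)) = tgt Q (F j)"
    using al[of "Suc j"] kj eTj by simp_all
  have Fj: "F j \<in> arr Q" "src Q (F j) = ?F" using FD(1)[of j] kj by simp_all
  have Y [simp]: "Y \<in> arr Q" "src Q Y = N" "tgt Q Y = tgt Q (F j)"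
    unfolding Y_def using alj Fj by simp_all
  have a': "\<alpha>' j = cl \<pi>1" "\<alpha>' (Suc j) = Y \<cdot>\<^bsub>Q\<^esub> cl \<zeta>" "i \<noteq> j \<Longrightarrow> i \<noteq> Suc j \<Longrightarrow> \<alpha>' i = \<alpha> i" "\<alpha>' 0 = \<alpha> 0" for i
    using kj by (simp_all add: \<alpha>'_def)
  have nx: "Q.nxt \<alpha>' k = cl \<pi>1" "Q.nxt \<alpha>' j = Y \<cdot>\<^bsub>Q\<^esub> cl \<zeta>"
    "i \<noteq> k \<Longrightarrow> i \<noteq> j \<Longrightarrow> Q.nxt \<alpha>' i = Q.nxt \<alpha> i" for i
    using kj a' by (auto simp: j_def)
  have sqj: "\<alpha> (Suc j) \<cdot>\<^bsub>Q\<^esub> cl (e j) = F j \<cdot>\<^bsub>Q\<^esub> cl b"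
    using Q.mor_simps(4)[OF m, of j] kj st[of j] b(2) by simp
  define u where "u = (s1 \<cdot> e j) \<oplus> (s2 \<cdot> c)"
  define r where "r = (r1 \<cdot> t1) \<oplus> (rW \<cdot> t2)"
  have u [simp]: "u \<in> arr C" "src C u = ?E" "tgt C u = N" "r \<in> arr C" "src C r = N" "tgt C r = ?E"
    using kj by (simp_all add: u_def r_def)
  have Ys2: "Y \<cdot>\<^bsub>Q\<^esub> cl s2 = F j \<cdot>\<^bsub>Q\<^esub> cl \<pi>1" and Ys1: "Y \<cdot>\<^bsub>Q\<^esub> cl s1 = \<alpha> (Suc j)"
    unfolding Y_def using alj Fj Q.cmp_zero(2)[of "\<alpha> (Suc j)" _ W] Q.cmp_zero(2)[of "F j" _ "tgt C (e j)"]
    by (simp_all add: Q_mzero[symmetric] Q_ide[symmetric])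
  have Yu: "Y \<cdot>\<^bsub>Q\<^esub> cl u = mzero Q ?E (tgt Q (F j))"
  proof -
    have "cl u = (cl s1 \<cdot>\<^bsub>Q\<^esub> cl (e j)) \<oplus>\<^bsub>Q\<^esub> (cl s2 \<cdot>\<^bsub>Q\<^esub> cl c)" unfolding u_def using kj by simp
    then have "Y \<cdot>\<^bsub>Q\<^esub> cl u = Y \<cdot>\<^bsub>Q\<^esub> ((cl s1 \<cdot>\<^bsub>Q\<^esub> cl (e j)) \<oplus>\<^bsub>Q\<^esub> (cl s2 \<cdot>\<^bsub>Q\<^esub> cl c))" by simp
    also have "\<dots> = ((Y \<cdot>\<^bsub>Q\<^esub> cl s1) \<cdot>\<^bsub>Q\<^esub> cl (e j)) \<oplus>\<^bsub>Q\<^esub> ((Y \<cdot>\<^bsub>Q\<^esub> cl s2) \<cdot>\<^bsub>Q\<^esub> cl c)"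
      using kj by (simp del: Q_cmp)
    also have "\<dots> = (F j \<cdot>\<^bsub>Q\<^esub> cl b) \<oplus>\<^bsub>Q\<^esub> (F j \<cdot>\<^bsub>Q\<^esub> cl (\<pi>1 \<cdot> c))" unfolding Ys1 Ys2 sqj using Fj by simp
    also have "\<dots> = mzero Q ?E (tgt Q (F j))" unfolding pc using Fj by (simp flip: Q_neg)
    finally show ?thesis .
  qed
  have Yz: "Y \<cdot>\<^bsub>Q\<^esub> cl (\<zeta> \<cdot> (\<rho> \<cdot> y)) = Y \<cdot>\<^bsub>Q\<^esub> cl y" if y: "y \<in> arr C" "tgt C y = N" for y
  proof -
    have "\<zeta> \<cdot> (\<rho> \<cdot> y) = y \<oplus> mneg C (u \<cdot> (r \<cdot> y))"
      using z(4)[THEN cmp_eq_assoc, of y] y by (simp add: u_def[symmetric] r_def[symmetric])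
    then have "cl (\<zeta> \<cdot> (\<rho> \<cdot> y)) = cl y \<oplus>\<^bsub>Q\<^esub> mneg Q (cl u \<cdot>\<^bsub>Q\<^esub> cl (r \<cdot> y))" using y by simp
    then have "Y \<cdot>\<^bsub>Q\<^esub> cl (\<zeta> \<cdot> (\<rho> \<cdot> y)) = (Y \<cdot>\<^bsub>Q\<^esub> cl y) \<oplus>\<^bsub>Q\<^esub> mneg Q ((Y \<cdot>\<^bsub>Q\<^esub> cl u) \<cdot>\<^bsub>Q\<^esub> cl (r \<cdot> y))"
      using y by (simp del: Q_cmp)
    then show ?thesis unfolding Yu using y by simp
  qed
  have m': "Q.mor (std e' w') F \<alpha>'"
  proof (rule Q.mor_nxtI[OF std_sq[OF w'] QA.exact_comp_zero(1)[OF F]])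
    fix i assume i: "i \<le> Suc n"
    show "\<alpha>' i \<in> Hom Q (src Q (std e' w' i)) (src Q (F i))"
    proof -
      consider "i = k" | "i = j" | "i = Suc j" | "i \<noteq> k" "i \<noteq> j" "i \<noteq> Suc j" by blast
      then show ?thesis by cases (use i al[OF i] ss'[OF i] src' kj in \<open>simp_all add: a'\<close>)
    qed
    consider "i = k" | "i = j" | "i = Suc j" | "i \<noteq> k" "i \<noteq> j" "i \<noteq> Suc j" by blast
    then show "Q.nxt \<alpha>' i \<cdot>\<^bsub>Q\<^esub> std e' w' i = F i \<cdot>\<^bsub>Q\<^esub> \<alpha>' i"
    proof cases
      case 1
      have "cl \<pi>1 \<cdot>\<^bsub>Q\<^esub> cl (mneg C (c \<cdot> e k)) = cl (b \<cdot> e k)"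
        using kj eTj pc[THEN cmp_eq_assoc, of "e k"] by simp
      also have "\<dots> = \<alpha> (Suc k) \<cdot>\<^bsub>Q\<^esub> std e w k" using kj eTj st[of k] b(2) by (simp add: j_def)
      also have "\<dots> = F k \<cdot>\<^bsub>Q\<^esub> \<alpha> k" using Q.mor_simps(4)[OF m, of k] kj by simp
      finally show ?thesis unfolding 1 nx sk using a'(3)[of k] kj by simp
    next
      case 2
      show ?thesis unfolding 2 nx(2) unfolding sk(2) a'(1) using Yz[of s2] Ys2 by simp
    next
      case 3
      have F1: "F (Suc j) \<in> arr Q" using FD(1)[of "Suc j"] kj by simp
      have "F (Suc j) \<cdot>\<^bsub>Q\<^esub> F j = mzero Q (src Q (F j)) (tgt Q (F (Suc j)))"
        using QA.exact_comp_zero(2)[OF F, of j] kj by simp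
      from this[THEN Q.cmp_eq_assoc, of "cl (\<pi>1 \<cdot> t2)"]
      have "F (Suc j) \<cdot>\<^bsub>Q\<^esub> (F j \<cdot>\<^bsub>Q\<^esub> cl (\<pi>1 \<cdot> t2)) = mzero Q N (tgt Q (F (Suc j)))"
        using Fj F1 FD(4)[of j] kj(3) by simp
      then have FY: "F (Suc j) \<cdot>\<^bsub>Q\<^esub> Y = F (Suc j) \<cdot>\<^bsub>Q\<^esub> (\<alpha> (Suc j) \<cdot>\<^bsub>Q\<^esub> cl t1)"
        unfolding Y_def using alj Fj F1 FD(4)[of j] kj(3) by simp
      have n4: "Q.nxt \<alpha> (Suc j) \<cdot>\<^bsub>Q\<^esub> (std e w (Suc j) \<cdot>\<^bsub>Q\<^esub> cl (t1 \<cdot> \<zeta>)) = F (Suc j) \<cdot>\<^bsub>Q\<^esub> (\<alpha> (Suc j) \<cdot>\<^bsub>Q\<^esub> cl (t1 \<cdot> \<zeta>))"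
        by (rule Q.nxt_simps(5)[OF m]) (use kj ss[of "Suc j"] eTj in simp_all)
      have "F (Suc j) \<cdot>\<^bsub>Q\<^esub> (Y \<cdot>\<^bsub>Q\<^esub> cl \<zeta>) = (F (Suc j) \<cdot>\<^bsub>Q\<^esub> Y) \<cdot>\<^bsub>Q\<^esub> cl \<zeta>"
        by (rule Q.assoc[symmetric]) (use F1 kj(3) in simp_all)
      also have "\<dots> = F (Suc j) \<cdot>\<^bsub>Q\<^esub> (\<alpha> (Suc j) \<cdot>\<^bsub>Q\<^esub> (cl t1 \<cdot>\<^bsub>Q\<^esub> cl \<zeta>))" unfolding FY
        using F1 alj kj(3) by (simp del: Q_cmp)
      also have "cl t1 \<cdot>\<^bsub>Q\<^esub> cl \<zeta> = cl (t1 \<cdot> \<zeta>)" by simp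
      finally show ?thesis unfolding 3 nx(3)[OF kj(8,9)] unfolding sk(3) a'(2) n4 ..
    next
      case 4
      then show ?thesis using Q.nxt_simps(4)[OF m i] unfolding nx(3)[OF 4(1,2)] sk(4)[OF 4 i] a'(3)[OF 4(2,3)] by simp
    qed
  qed
  show thesis
  proof (rule that[OF w' m'])
    fix i' assume i': "i' \<le> Suc (Suc i)"
    show "is_iso Q (\<alpha>' i')"
    proof (cases "i' = j")
      case True
      then show ?thesis using Q_biproduct_iso(2)[OF W x(1)] by (simp add: a')
    next
      case False
      then have "i' \<le> Suc i" using i' by (simp add: j_def k_def)
      then show ?thesis using a a'(3)[of i'] False by (simp add: j_def k_def)
    qed
  qed
qed

lemma RA_summand:
  assumes H: "H \<in> RA" and d: "Q.dsum F F' H"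
  shows "F \<in> RA"
proof -
  from d obtain i1 i2 p1 p2 where d: "Q.mor F H i1" "Q.mor H F p1"
    "\<And>j. j \<le> Suc n \<Longrightarrow> biproduct Q (src Q (F j)) (src Q (F' j)) (src Q (H j)) (i1 j) (i2 j) (p1 j) (p2 j)"
    by (rule Q.dsumE) blast
  have pi: "p1 i \<cdot>\<^bsub>Q\<^esub> i1 i = ide Q (src Q (F i))" if "i \<le> Suc n" for i using biproductD(13)[OF d(3)[OF that]] .
  have F: "QA.exact_nseq F" by (rule QA.retract_exact[OF H d(1,2) pi])
  note Fs = QA.exact_comp_zero(1)[OF F]
  note FD [simp] = nseqD[OF Fs] and m1 = Q.mor_simps[OF d(1)]
  \<comment> \<open>A right angle with the same first map as the summand. By F4 it maps to
    \<open>H\<close>, and hence to \<open>F\<close>, with identities at positions 0 and 1; this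
    starts the exchange.\<close>
  obtain E where E: "E \<in> RA" "E 0 = F 0" using RA_extend[of "F 0"] by auto
  have E1: "src Q (E 1) = src Q (F 1)" using nseqD(5)[OF RA_sq[OF E(1)]] E(2) by simp
  obtain \<phi> h where ph: "Q.mor E H \<phi>" "\<phi> 0 = i1 0" "\<phi> 1 = i1 1"
    using RA_F4[OF E(1) H, of "i1 0" "i1 1"] m1(1-3)[of 0] m1(1-3)[of 1] m1(4)[of 0] E(2) E1 by auto
  have pm: "Q.mor E F (\<lambda>i. p1 i \<cdot>\<^bsub>Q\<^esub> \<phi> i)" by (rule Q.mor_cmp[OF ph(1) d(2)])
  from E(1) obtain e w where e: "conf e w" "Q.siso (std e w) E" by (rule RAE)
  then obtain \<theta> where t: "Q.mor (std e w) E \<theta>" "\<And>i. i \<le> Suc n \<Longrightarrow> is_iso Q (\<theta> i)"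
    by (auto simp: nseq_isomorphic_def)
  have start: "\<exists>e w \<alpha>. conf e w \<and> Q.mor (std e w) F \<alpha> \<and> (\<forall>j\<le>Suc 0. is_iso Q (\<alpha> j))"
  proof (intro exI conjI allI impI)
    show "conf e w" by fact
    show "Q.mor (std e w) F (\<lambda>i. (p1 i \<cdot>\<^bsub>Q\<^esub> \<phi> i) \<cdot>\<^bsub>Q\<^esub> \<theta> i)" by (rule Q.mor_cmp[OF t(1) pm])
    fix j assume j: "j \<le> Suc 0"
    then have j1: "j \<le> Suc n" by simp
    have "p1 j \<cdot>\<^bsub>Q\<^esub> \<phi> j = ide Q (src Q (F j))" using j ph(2,3) pi[OF j1] by (auto simp: le_Suc_eq)
    then show "is_iso Q ((p1 j \<cdot>\<^bsub>Q\<^esub> \<phi> j) \<cdot>\<^bsub>Q\<^esub> \<theta> j)"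
      by (rule_tac Q.iso_cmp) (use j t(2)[OF j1] Q.mor_simps(1-3)[OF t(1) j1] Q.mor_simps(1-3)[OF pm j1] in simp_all)
  qed
  have "\<exists>e w \<alpha>. conf e w \<and> Q.mor (std e w) F \<alpha> \<and> (\<forall>j\<le>k. is_iso Q (\<alpha> j))" if "1 \<le> k" "k \<le> n" for k
    using that
  proof (induction k rule: dec_induct)
    case base
    then show ?case using start by simp
  next
    case (step k)
    then obtain e w \<alpha> where ih: "conf e w" "Q.mor (std e w) F \<alpha>" "\<And>j. j \<le> k \<Longrightarrow> is_iso Q (\<alpha> j)" by auto
    obtain i where i: "k = Suc i" using step(1) by (cases k) auto
    have "\<exists>e' w' \<alpha>'. conf e' w' \<and> Q.mor (std e' w') F \<alpha>' \<and> (\<forall>j\<le>Suc (Suc i). is_iso Q (\<alpha>' j))"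
      by (rule exchange_std[OF ih(1) F ih(2), of i]) (use step i ih(3) in auto)
    then show ?case using i by simp
  qed
  from this[OF n1 le_refl] obtain e w \<alpha> where a: "conf e w" "Q.mor (std e w) F \<alpha>" "\<And>j. j \<le> n \<Longrightarrow> is_iso Q (\<alpha> j)" by auto
  have "is_iso Q (\<alpha> (Suc n))" by (rule QA.five_lemma[OF std_RA[OF a(1)] F a(2,3)])
  then have "Q.siso (std e w) F" using a(3) by (intro Q.sisoI[OF a(2)]) (auto simp: le_Suc_eq)
  then show ?thesis by (rule RA_iso[OF std_RA[OF a(1)]])
qed

lemma RA_angulation: "angulation_axioms n Q G RA"
proof
  show "nseq n Q G f" if "f \<in> RA" for f by (rule RA_sq[OF that])
  show "g \<in> RA" if "f \<in> RA" "Q.siso f g" for f g by (rule RA_iso[OF that])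
  show "h \<in> RA" if "f \<in> RA" "g \<in> RA" "Q.dsum f g h" for f g h by (rule RA_sum[OF that])
  show "f \<in> RA" if "h \<in> RA" "Q.dsum f g h" for f g h by (rule RA_summand[OF that])
  show "f \<in> RA" if "trivial_nseq n Q G A f" for A f by (rule RA_trivial[OF that])
  show "\<exists>f\<in>RA. f 0 = a" if "a \<in> arr Q" for a by (rule RA_extend[OF that])
  show "f \<in> RA \<longleftrightarrow> Q.rot f \<in> RA" if "Q.sq f" for f by (rule RA_rot_iff[OF that])
  fix f g a b assume *: "f \<in> RA" "g \<in> RA" "a \<in> Hom Q (src Q (f 0)) (src Q (g 0))"
    "b \<in> Hom Q (src Q (f 1)) (src Q (g 1))" "b \<cdot>\<^bsub>Q\<^esub> f 0 = g 0 \<cdot>\<^bsub>Q\<^esub> a"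
  show "\<exists>\<phi> h. Q.mor f g \<phi> \<and> \<phi> 0 = a \<and> \<phi> 1 = b \<and> mapping_cone n Q G f g \<phi> h \<and> h \<in> RA" by (rule RA_F4[OF *])
  then show "\<exists>\<phi>. Q.mor f g \<phi> \<and> \<phi> 0 = a \<and> \<phi> 1 = b" by blast
qed

lemma quotient_weakly_angulated: "weakly_angulated_category n Q G RA"
  unfolding weakly_angulated_category_def
  using Q.additive_category_axioms G_additive G_autoequivalence RA_angulation by blast

end

section \<open>Serre duality\<close>

context linear_category
begin

lemma arr_smul [simp]:
  assumes "f \<in> arr C"
  shows "smul C c f \<in> arr C" "src C (smul C c f) = src C f" "tgt C (smul C c f) = tgt C f"
  using smul_Hom[of f "src C f" "tgt C f" c] assms by simp_all

lemma smul_simps [simp]: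
  assumes "f \<in> arr C"
  shows "smul C 0 f = mzero C (src C f) (tgt C f)" "smul C 1 f = f" "smul C c (smul C d f) = smul C (c * d) f"
    "smul C (-1) f = mneg C f"
proof -
  have f: "f \<in> Hom C (src C f) (tgt C f)" using assms by simp
  have "smul C 0 f \<oplus> smul C 0 f = smul C 0 f" using smul_add[OF f, of 0 0] by simp
  then show 0: "smul C 0 f = mzero C (src C f) (tgt C f)" using add_self_zero[of "smul C 0 f"] assms by simp
  show 1: "smul C 1 f = f" using smul_one[OF f] .
  show "smul C c (smul C d f) = smul C (c * d) f" using smul_smul[OF f] .
  show "smul C (-1) f = mneg C f"
    by (rule eq_neg[of _ _ "src C f" "tgt C f"]) (use assms smul_add[OF f, of 1 "-1"] 0 1 in simp_all)
qed

lemma smul_neg [simp]: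
  assumes "f \<in> arr C"
  shows "smul C (- c) f = mneg C (smul C c f)" "smul C c (mneg C f) = mneg C (smul C c f)"
  using smul_simps(3)[OF assms, of "-1" c] smul_simps(3)[OF assms, of c "-1"] smul_simps(4)[OF assms]
    smul_simps(4)[of "smul C c f"] assms by simp_all

lemma Hom_subspaceD:
  assumes "Hom_subspace C A B V"
  shows "f \<in> V \<Longrightarrow> f \<in> Hom C A B" "mzero C A B \<in> V" "f \<in> V \<Longrightarrow> g \<in> V \<Longrightarrow> f \<oplus> g \<in> V"
    "f \<in> V \<Longrightarrow> smul C c f \<in> V" "f \<in> V \<Longrightarrow> mneg C f \<in> V"
proof -
  show 1: "f \<in> V \<Longrightarrow> f \<in> Hom C A B" using assms unfolding Hom_subspace_def by blast
  show "mzero C A B \<in> V" "f \<in> V \<Longrightarrow> g \<in> V \<Longrightarrow> f \<oplus> g \<in> V" and 2: "f \<in> V \<Longrightarrow> smul C c f \<in> V" for c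
    using assms unfolding Hom_subspace_def by blast+
  show "f \<in> V \<Longrightarrow> mneg C f \<in> V" using 2[of "-1"] 1 smul_simps(4)[of f] by simp
qed

text \<open>A maximal subspace containing \<open>W\<close> but not \<open>v\<close> is a complement of the line spanned by \<open>v\<close>; the
  functional is the coordinate along \<open>v\<close>.\<close>

lemma functional_exists:
  assumes W: "Hom_subspace C A B W" and v: "v \<in> Hom C A B" "v \<notin> W"
  obtains u where "u \<in> Hom_dual C A B" "u v = 1" "\<And>x. x \<in> W \<Longrightarrow> u x = 0"
proof -
  define \<W> where "\<W> = {V. Hom_subspace C A B V \<and> W \<subseteq> V \<and> v \<notin> V}"
  have "\<exists>M\<in>\<W>. \<forall>V\<in>\<W>. M \<subseteq> V \<longrightarrow> V = M"
  proof (rule subset_Zorn_nonempty)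
    show "\<W> \<noteq> {}" using W v by (auto simp: \<W>_def)
    fix \<C> assume c: "\<C> \<noteq> {}" "subset.chain \<W> \<C>"
    have sub: "Hom_subspace C A B V" "W \<subseteq> V" "v \<notin> V" if "V \<in> \<C>" for V
      using c(2) that unfolding subset.chain_def \<W>_def by auto
    have lin: "V \<subseteq> V' \<or> V' \<subseteq> V" if "V \<in> \<C>" "V' \<in> \<C>" for V V'
      using c(2) that unfolding subset.chain_def by auto
    have "Hom_subspace C A B (\<Union>\<C>)"
      unfolding Hom_subspace_def
    proof (intro conjI ballI allI)
      show "\<Union>\<C> \<subseteq> Hom C A B" using sub(1) unfolding Hom_subspace_def by blast
      show "mzero C A B \<in> \<Union>\<C>" using c(1) sub(1) unfolding Hom_subspace_def by blast
      show "smul C c f \<in> \<Union>\<C>" if "f \<in> \<Union>\<C>" for c f using that sub(1) unfolding Hom_subspace_def by blast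
      fix f g assume "f \<in> \<Union>\<C>" "g \<in> \<Union>\<C>"
      then obtain V V' where V: "V \<in> \<C>" "f \<in> V" "V' \<in> \<C>" "g \<in> V'" by blast
      then obtain U where "U \<in> \<C>" "f \<in> U" "g \<in> U" using lin[OF V(1,3)] by blast
      then show "f \<oplus> g \<in> \<Union>\<C>" using sub(1) unfolding Hom_subspace_def by blast
    qed
    then show "\<Union>\<C> \<in> \<W>" using c(1) sub(2,3) unfolding \<W>_def by blast
  qed
  then obtain M where MW: "M \<in> \<W>" and MV: "\<forall>V\<in>\<W>. M \<subseteq> V \<longrightarrow> V = M" by (rule bexE)
  from MW have M: "Hom_subspace C A B M" "W \<subseteq> M" "v \<notin> M" by (simp_all add: \<W>_def)
  have max: "V = M" if "Hom_subspace C A B V" "M \<subseteq> V" "v \<notin> V" for V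
  proof -
    have "V \<in> \<W>" using that M(2) by (simp add: \<W>_def)
    then show ?thesis using bspec[OF MV, of V] that(2) by simp
  qed
  note MD = Hom_subspaceD[OF M(1)]
  have v1 [simp]: "v \<in> arr C" "src C v = A" "tgt C v = B" using v(1) by simp_all
  have Mh: "x \<in> arr C" "src C x = A" "tgt C x = B" if "x \<in> M" for x using MD(1)[OF that] by simp_all
  have ex: "\<exists>c. x \<oplus> mneg C (smul C c v) \<in> M" if x: "x \<in> Hom C A B" for x
  proof (cases "x \<in> M")
    case True
    then show ?thesis using Mh[OF True] by (intro exI[of _ 0]) simp
  next
    case False
    have x1 [simp]: "x \<in> arr C" "src C x = A" "tgt C x = B" using x by simp_all
    \<comment> \<open>Maximality of \<open>M\<close> forces \<open>v\<close> into the span of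
      \<open>M\<close> and \<open>x\<close>. The coefficient of \<open>x\<close> is nonzero there,
      so \<open>x\<close> lies in \<open>M\<close> plus the line of \<open>v\<close>.\<close>
    define V where "V = {m \<oplus> smul C c x | m c. m \<in> M}"
    have "Hom_subspace C A B V"
      unfolding Hom_subspace_def
    proof (intro conjI ballI allI)
      show "V \<subseteq> Hom C A B" using Mh by (auto simp: V_def)
      have "mzero C A B = mzero C A B \<oplus> smul C 0 x" by simp
      then show "mzero C A B \<in> V" using MD(2) unfolding V_def by blast
      fix f assume "f \<in> V"
      then obtain m c where f: "f = m \<oplus> smul C c x" "m \<in> M" unfolding V_def by blast
      show "smul C d f \<in> V" for d
      proof -
        have "smul C d f = smul C d m \<oplus> smul C (d * c) x"
          using smul_madd[of m A B "smul C c x" d] Mh[OF f(2)] unfolding f(1) by simp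
        then show ?thesis using MD(4)[OF f(2)] unfolding V_def by blast
      qed
      fix g assume "g \<in> V"
      then obtain m' c' where g: "g = m' \<oplus> smul C c' x" "m' \<in> M" unfolding V_def by blast
      have "f \<oplus> g = (m \<oplus> m') \<oplus> smul C (c + c') x"
        using smul_add[OF x, of c c'] Mh[OF f(2)] Mh[OF g(2)]
          add_left_commute[of "smul C c x" m' "smul C c' x"] unfolding f(1) g(1) by simp
      then show "f \<oplus> g \<in> V" using MD(3)[OF f(2) g(2)] unfolding V_def by blast
    qed
    moreover have "M \<subseteq> V"
    proof
      fix m assume m: "m \<in> M"
      then have "m = m \<oplus> smul C 0 x" using Mh[OF m] by simp
      then show "m \<in> V" using m unfolding V_def by blast
    qed
    moreover have "x \<in> V"
    proof -
      have "x = mzero C A B \<oplus> smul C 1 x" by simp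
      then show ?thesis using MD(2) unfolding V_def by blast
    qed
    ultimately have "v \<in> V" using max[of V] False by blast
    then obtain m c where m: "v = m \<oplus> smul C c x" "m \<in> M" unfolding V_def by blast
    have "c \<noteq> 0"
    proof
      assume "c = 0"
      then have "v = m" using m(1) Mh[OF m(2)] by simp
      then show False using m(2) M(3) by simp
    qed
    have "smul C (inverse c) v = smul C (inverse c) m \<oplus> x"
      unfolding m(1) using smul_madd[of m A B "smul C c x" "inverse c"] Mh[OF m(2)] \<open>c \<noteq> 0\<close> by simp
    then have "x \<oplus> mneg C (smul C (inverse c) v) = mneg C (smul C (inverse c) m)"
      using Mh[OF m(2)] by (simp add: add_ac)
    then show ?thesis using MD(4,5) m(2) by metis
  qed
  have uniq: "c = d" if "x \<oplus> mneg C (smul C c v) \<in> M" "x \<oplus> mneg C (smul C d v) \<in> M" "x \<in> Hom C A B" for x c d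
  proof (rule ccontr)
    assume cd: "c \<noteq> d"
    have x1 [simp]: "x \<in> arr C" "src C x = A" "tgt C x = B" using that(3) by simp_all
    have "(x \<oplus> mneg C (smul C c v)) \<oplus> mneg C (x \<oplus> mneg C (smul C d v)) \<in> M" using MD(3,5) that(1,2) by blast
    then have "smul C d v \<oplus> mneg C (smul C c v) \<in> M" by (simp add: add_ac)
    moreover have "smul C d v \<oplus> mneg C (smul C c v) = smul C (d - c) v"
      using smul_add[OF v(1), of d "- c"] by simp
    ultimately have "smul C (d - c) v \<in> M" by simp
    from MD(4)[OF this, of "inverse (d - c)"] show False using cd M(3) by simp
  qed
  \<comment> \<open>Outside the space the value is \<open>undefined\<close>, because
    \<open>Hom_dual\<close> consists of extensional functions.\<close>
  define u where "u x = (if x \<in> Hom C A B then THE c. x \<oplus> mneg C (smul C c v) \<in> M else undefined)" for x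
  have u: "u x = c" if "x \<oplus> mneg C (smul C c v) \<in> M" "x \<in> Hom C A B" for x c
    unfolding u_def using that uniq by auto
  have uM: "x \<oplus> mneg C (smul C (u x) v) \<in> M" if "x \<in> Hom C A B" for x
    using ex[OF that] u[OF _ that] by metis
  show thesis
  proof (rule that[of u])
    show "u v = 1" by (rule u) (use MD(2) in simp_all)
    show "u x = 0" if "x \<in> W" for x
    proof (rule u)
      have "x \<in> M" using that M(2) by blast
      then show "x \<oplus> mneg C (smul C 0 v) \<in> M" "x \<in> Hom C A B" using Mh[of x] by simp_all
    qed
    show "u \<in> Hom_dual C A B"
      unfolding Hom_dual_def mem_Collect_eq
    proof (intro conjI ballI allI)
      show "u \<in> extensional (Hom C A B)" by (simp add: u_def extensional_def)
      fix f assume f: "f \<in> Hom C A B"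
      then have f1 [simp]: "f \<in> arr C" "src C f = A" "tgt C f = B" by simp_all
      show "u (smul C c f) = c * u f" for c
      proof (rule u)
        have "smul C c (f \<oplus> mneg C (smul C (u f) v)) \<in> M" using MD(4) uM[OF f] .
        moreover have "smul C c (f \<oplus> mneg C (smul C (u f) v)) = smul C c f \<oplus> mneg C (smul C (c * u f) v)"
          using smul_madd[of f A B "mneg C (smul C (u f) v)" c] by simp
        ultimately show "smul C c f \<oplus> mneg C (smul C (c * u f) v) \<in> M" by simp
      qed simp
      fix g assume g: "g \<in> Hom C A B"
      then have g1 [simp]: "g \<in> arr C" "src C g = A" "tgt C g = B" by simp_all
      show "u (f \<oplus> g) = u f + u g"
      proof (rule u)
        have "(f \<oplus> mneg C (smul C (u f) v)) \<oplus> (g \<oplus> mneg C (smul C (u g) v)) \<in> M" using MD(3) uM[OF f] uM[OF g] .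
        then show "(f \<oplus> g) \<oplus> mneg C (smul C (u f + u g) v) \<in> M"
          using smul_add[OF v(1), of "u f" "u g"] by (simp add: add_ac)
      qed simp
    qed
  qed
qed

lemma Hom_dualD:
  assumes "u \<in> Hom_dual C A B" "f \<in> Hom C A B"
  shows "g \<in> Hom C A B \<Longrightarrow> u (f \<oplus> g) = u f + u g" "u (smul C c f) = c * u f" "u (mneg C f) = - u f"
    "u (mzero C A B) = 0"
proof -
  show 1: "g \<in> Hom C A B \<Longrightarrow> u (f \<oplus> g) = u f + u g" and 2: "u (smul C c f) = c * u f" for c g
    using assms unfolding Hom_dual_def by blast+
  show "u (mneg C f) = - u f" using 2[of "-1"] assms(2) by simp
  show "u (mzero C A B) = 0" using 2[of 0] assms(2) by simp
qed

lemma dual_separates: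
  assumes "f \<in> Hom C A B" "g \<in> Hom C A B" "\<And>u. u \<in> Hom_dual C A B \<Longrightarrow> u f = u g"
  shows "f = g"
proof (rule ccontr)
  assume "f \<noteq> g"
  define d where "d = f \<oplus> mneg C g"
  have d: "d \<in> Hom C A B" using assms(1,2) by (simp add: d_def)
  have "d \<noteq> mzero C A B" using \<open>f \<noteq> g\<close> diff_zero_iff[of f g] assms(1,2) by (simp add: d_def)
  moreover have "Hom_subspace C A B {mzero C A B}"
    unfolding Hom_subspace_def using smul_simps(3)[of "mzero C A B" _ 0] by auto
  ultimately obtain u where u: "u \<in> Hom_dual C A B" "u d = 1"
    using functional_exists[OF _ d] by blast
  have "u d = u f - u g"
    using Hom_dualD(1)[OF u(1) assms(1), of "mneg C g"] Hom_dualD(3)[OF u(1) assms(2)] assms(2) by (simp add: d_def)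
  then show False using assms(3)[OF u(1)] u(2) by simp
qed

end

section \<open>Local objects, and reduction of statements about \<open>X\<close> to them\<close>

lemma (in preadditive_category) local_End_iso:
  assumes A: "local_End C A" and AB: "isomorphic C A B"
  shows "local_End C B"
proof -
  obtain t where t: "t \<in> Hom C A B" "is_iso C t" using AB unfolding isomorphic_def by blast
  have t0 [simp]: "t \<in> arr C" "src C t = A" "tgt C t = B" using t(1) by simp_all
  obtain t' where t': "t' \<in> arr C" "src C t' = tgt C t" "tgt C t' = src C t"
    "t' \<cdot> t = ide C (src C t)" "t \<cdot> t' = ide C (tgt C t)" using t(2) by (rule is_isoE)
  have t1 [simp]: "t' \<in> arr C" "src C t' = B" "tgt C t' = A" "t' \<cdot> t = ide C A" "t \<cdot> t' = ide C B" using t' by simp_all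
  note [simp] = t1(4)[THEN cmp_eq_assoc] t1(5)[THEN cmp_eq_assoc]
  have it': "is_iso C t'" by (rule is_isoI[of _ t]) simp_all
  have conj: "is_iso C (t' \<cdot> (f \<cdot> t)) \<longleftrightarrow> is_iso C f" if f: "f \<in> Hom C B B" for f
  proof
    assume "is_iso C f"
    then have "is_iso C (f \<cdot> t)" by (rule iso_cmp[OF t(2)]) (use f in simp)
    then show "is_iso C (t' \<cdot> (f \<cdot> t))" by (rule iso_cmp[OF _ it']) (use f in simp)
  next
    assume "is_iso C (t' \<cdot> (f \<cdot> t))"
    then have "is_iso C ((t' \<cdot> (f \<cdot> t)) \<cdot> t')" by (rule iso_cmp[OF it']) (use f in simp)
    then have "is_iso C (t \<cdot> ((t' \<cdot> (f \<cdot> t)) \<cdot> t'))" by (rule iso_cmp[OF _ t(2)]) (use f in simp)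
    then show "is_iso C f" using f by simp
  qed
  show ?thesis
    unfolding local_End_def
  proof (intro conjI ballI impI)
    show "ide C B \<noteq> mzero C B B"
    proof
      assume "ide C B = mzero C B B"
      then have "t' \<cdot> (ide C B \<cdot> t) = t' \<cdot> (mzero C B B \<cdot> t)" by simp
      then show False using A unfolding local_End_def by simp
    qed
    fix f g assume f: "f \<in> Hom C B B" "\<not> is_iso C f" and g: "g \<in> Hom C B B" "\<not> is_iso C g"
    have "\<not> is_iso C ((t' \<cdot> (f \<cdot> t)) \<oplus> (t' \<cdot> (g \<cdot> t)))"
      using A f g conj[OF f(1)] conj[OF g(1)] unfolding local_End_def by auto
    then show "\<not> is_iso C (f \<oplus> g)" using conj[of "f \<oplus> g"] f(1) g(1) by simp
  qed
qed

lemma (in add_functor) local_End_ff: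
  assumes full: "\<And>A B y. y \<in> Hom C (ob T A) (ob T B) \<Longrightarrow> \<exists>x\<in>Hom C A B. ar T x = y"
    and faithful: "\<And>A B x y. x \<in> Hom C A B \<Longrightarrow> y \<in> Hom C A B \<Longrightarrow> ar T x = ar T y \<Longrightarrow> x = y"
  shows "local_End C (ob T A) \<longleftrightarrow> local_End C A"
proof -
  have iso: "is_iso C (ar T f) \<longleftrightarrow> is_iso C f" if "f \<in> arr C" for f
  proof
    assume i: "is_iso C (ar T f)"
    show "is_iso C f"
    proof (rule iso_reflect[OF endo _ _ that i])
      show "\<exists>x\<in>Hom C A B. ar T x = y" if "y \<in> Hom C (ob T A) (ob T B)" for A B y using full[OF that] .
      show "x = y" if "x \<in> Hom C A B" "y \<in> Hom C A B" "ar T x = ar T y" for A B x y using faithful[OF that] .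
    qed
  qed (rule ar_iso)
  have "ide C (ob T A) = mzero C (ob T A) (ob T A) \<longleftrightarrow> ide C A = mzero C A A"
  proof
    assume "ide C (ob T A) = mzero C (ob T A) (ob T A)"
    then show "ide C A = mzero C A A" using faithful[of "ide C A" A A "mzero C A A"] by simp
  next
    assume "ide C A = mzero C A A"
    from arg_cong[OF this, of "ar T"] show "ide C (ob T A) = mzero C (ob T A) (ob T A)" by simp
  qed
  moreover have "(\<forall>f\<in>Hom C (ob T A) (ob T A). \<forall>g\<in>Hom C (ob T A) (ob T A).
      \<not> is_iso C f \<longrightarrow> \<not> is_iso C g \<longrightarrow> \<not> is_iso C (f \<oplus> g)) \<longleftrightarrow>
    (\<forall>f\<in>Hom C A A. \<forall>g\<in>Hom C A A. \<not> is_iso C f \<longrightarrow> \<not> is_iso C g \<longrightarrow> \<not> is_iso C (f \<oplus> g))" (is "?l \<longleftrightarrow> ?r")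
  proof
    assume l: ?l
    show ?r
    proof (intro ballI impI)
      fix f g assume "f \<in> Hom C A A" "g \<in> Hom C A A" "\<not> is_iso C f" "\<not> is_iso C g"
      then show "\<not> is_iso C (f \<oplus> g)"
        using l[rule_format, of "ar T f" "ar T g"] iso[of f] iso[of g] iso[of "f \<oplus> g"] by simp
    qed
  next
    assume r: ?r
    show ?l
    proof (intro ballI impI)
      fix f g assume f: "f \<in> Hom C (ob T A) (ob T A)" "g \<in> Hom C (ob T A) (ob T A)" "\<not> is_iso C f" "\<not> is_iso C g"
      obtain f' where f': "f' \<in> Hom C A A" "ar T f' = f" using full[OF f(1)] by blast
      obtain g' where g': "g' \<in> Hom C A A" "ar T g' = g" using full[OF f(2)] by blast
      from f' g' show "\<not> is_iso C (f \<oplus> g)"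
        using r[rule_format, of f' g'] f(3,4) iso[of f'] iso[of g'] iso[of "f' \<oplus> g'"] by auto
    qed
  qed
  ultimately show ?thesis unfolding local_End_def by blast
qed

lemma (in preadditive_category) isomorphic_direct_sum:
  assumes "direct_sum C A B P" "direct_sum C A' B' P'" "isomorphic C A A'" "isomorphic C B B'"
  shows "isomorphic C P P'"
proof -
  obtain i1 i2 p1 p2 where b: "biproduct C A B P i1 i2 p1 p2" using assms(1) unfolding direct_sum_def by blast
  obtain j1 j2 q1 q2 where c: "biproduct C A' B' P' j1 j2 q1 q2" using assms(2) unfolding direct_sum_def by blast
  obtain a where a: "a \<in> Hom C A A'" "is_iso C a" using assms(3) unfolding isomorphic_def by blast
  obtain d where d: "d \<in> Hom C B B'" "is_iso C d" using assms(4) unfolding isomorphic_def by blast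
  obtain a' where c1: "biproduct C A B' P' (j1 \<cdot> a) j2 (a' \<cdot> q1) q2"
    by (rule biproduct_iso[OF c a(2)]) (use a(1) in simp, use a(1) in simp, blast)
  obtain d' where c2: "biproduct C B A P' (j2 \<cdot> d) (j1 \<cdot> a) (d' \<cdot> q2) (a' \<cdot> q1)"
    by (rule biproduct_iso[OF biproduct_sym[OF c1] d(2)]) (use d(1) in simp, use d(1) in simp, blast)
  have "is_iso C (((j1 \<cdot> a) \<cdot> p1) \<oplus> ((j2 \<cdot> d) \<cdot> p2))"
    by (rule biproduct_unique[OF b biproduct_sym[OF c2]])
  moreover have "((j1 \<cdot> a) \<cdot> p1) \<oplus> ((j2 \<cdot> d) \<cdot> p2) \<in> Hom C P P'"
    using biproductD[OF b] biproductD[OF c2] by simp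
  ultimately show ?thesis unfolding isomorphic_def by blast
qed

text \<open>Almost vanishing morphisms are constructed for local objects only. This suffices,
  because additive functors preserve decompositions and \<open>X\<close> contains the summands of
  its objects.\<close>

lemma (in quotient) local_to_all:
  assumes F: "additive_endofunctor C F" and K: "additive_endofunctor C K"
    and loc: "\<And>A. local_End C A \<Longrightarrow> A \<in> X \<Longrightarrow> \<exists>A'\<in>X. isomorphic C (ob F A) (ob K A')"
    and A: "sum_of_locals C A" "A \<in> X"
  shows "\<exists>A'\<in>X. isomorphic C (ob F A) (ob K A')"
proof -
  interpret F: add_functor C F by unfold_locales (rule F)
  interpret K: add_functor C K by unfold_locales (rule K)
  show ?thesis using A
  proof (induction rule: sum_of_locals.induct)
    case (empty Z)
    have "mzero C (ob F Z) (ob K Z) \<in> Hom C (ob F Z) (ob K Z)" by simp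
    moreover have "is_iso C (mzero C (ob F Z) (ob K Z))"
      using iso_zero F.ob_zero K.ob_zero empty(1) by blast
    ultimately show ?case using empty(2) unfolding isomorphic_def by blast
  next
    case (add A B P)
    have AB: "A \<in> X" "B \<in> X" using X_summand[OF add.prems] direct_sum_sym add.hyps(3) by blast+
    obtain A' where A': "A' \<in> X" "isomorphic C (ob F A) (ob K A')" using loc[OF add.hyps(1) AB(1)] by blast
    obtain B' where B': "B' \<in> X" "isomorphic C (ob F B) (ob K B')" using add.IH[OF AB(2)] by blast
    obtain P' where P': "direct_sum C A' B' P'" using has_direct_sums by blast
    have "direct_sum C (ob F A) (ob F B) (ob F P)" "direct_sum C (ob K A') (ob K B') (ob K P')"
      using F.ar_biproduct K.ar_biproduct add.hyps(3) P' unfolding direct_sum_def by blast+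
    then have "isomorphic C (ob F P) (ob K P')" using isomorphic_direct_sum A'(2) B'(2) by blast
    then show ?case using X_sum[OF A'(1) B'(1) P'] by blast
  qed
qed

section \<open>The Serre pairing and almost vanishing morphisms\<close>

locale serre_duality = linear_category C
  for C :: "('o, 'm, 'k::field, 'z) lincat_scheme" (structure) +
  fixes S :: "('o, 'm) endo" and \<eta> :: "'o \<Rightarrow> 'o \<Rightarrow> 'm \<Rightarrow> 'm \<Rightarrow> 'k"
  assumes S_auto: "autoequivalence C S"
    and eta_bij: "bij_betw (\<eta> A B) (Hom C A B) (Hom_dual C B (ob S A))"
    and eta_add: "f \<in> Hom C A B \<Longrightarrow> g \<in> Hom C A B \<Longrightarrow> h \<in> Hom C B (ob S A) \<Longrightarrow>
      \<eta> A B (f \<oplus> g) h = \<eta> A B f h + \<eta> A B g h"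
    and eta_nat: "a \<in> Hom C A' A \<Longrightarrow> b \<in> Hom C B B' \<Longrightarrow> f \<in> Hom C A B \<Longrightarrow> h \<in> Hom C B' (ob S A') \<Longrightarrow>
      \<eta> A' B' (b \<cdot> (f \<cdot> a)) h = \<eta> A B f (ar S a \<cdot> (h \<cdot> b))"
begin

lemmas SD = endofunctorD[OF autoequivalenceD(1)[OF S_auto]]

lemma eta_dual: "f \<in> Hom C A B \<Longrightarrow> \<eta> A B f \<in> Hom_dual C B (ob S A)"
  by (rule bij_betwE[OF eta_bij, rule_format])

lemma eta_surj:
  assumes "u \<in> Hom_dual C B (ob S A)"
  obtains f where "f \<in> Hom C A B" "\<eta> A B f = u"
proof -
  have "u \<in> \<eta> A B ` Hom C A B" using bij_betw_imp_surj_on[OF eta_bij[of A B]] assms by simp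
  then show thesis by (rule imageE) (use that in simp)
qed

lemma eta_zero:
  assumes "h \<in> Hom C B (ob S A)"
  shows "\<eta> A B (mzero C A B) h = 0"
proof -
  have "mzero C A B \<oplus> mzero C A B = mzero C A B" by simp
  from eta_add[OF mzero_Hom mzero_Hom assms, unfolded this]
  show ?thesis by (rule iffD1[OF add_cancel_right_right])
qed

lemma eta_eq_zero:
  assumes f: "f \<in> Hom C A B" and "\<And>h. h \<in> Hom C B (ob S A) \<Longrightarrow> \<eta> A B f h = 0"
  shows "f = mzero C A B"
proof -
  have "\<eta> A B f = \<eta> A B (mzero C A B)"
  proof (rule extensionalityI)
    show "\<eta> A B f \<in> extensional (Hom C B (ob S A))" "\<eta> A B (mzero C A B) \<in> extensional (Hom C B (ob S A))"
      using eta_dual[OF f] eta_dual[of "mzero C A B" A B] unfolding Hom_dual_def by auto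
    show "\<eta> A B f x = \<eta> A B (mzero C A B) x" if "x \<in> Hom C B (ob S A)" for x
      using assms(2)[OF that] eta_zero[OF that] by simp
  qed
  then show ?thesis by (rule inj_onD[OF bij_betw_imp_inj_on[OF eta_bij] _ f mzero_Hom])
qed

text \<open>The definition asks only for an autoequivalence. Additivity follows from duality: every
  functional is of the form \<open>\<eta> B (ob S A) x\<close>, and by naturality its value at
  \<open>ar S f\<close> is a value of \<eta> on \<open>x \<cdot> f\<close>, which is additive in
  \<open>f\<close>. Functionals separate morphisms.\<close>

lemma S_additive: "additive_endofunctor C S"
  unfolding additive_endofunctor_def
proof (intro conjI allI ballI)
  show "endofunctor C S" using autoequivalenceD(1)[OF S_auto] .
  fix A B f g assume f: "f \<in> Hom C A B" and g: "g \<in> Hom C A B"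
  show "ar S (f \<oplus> g) = ar S f \<oplus> ar S g"
  proof (rule dual_separates[of _ "ob S A" "ob S B"])
    fix u assume u: "u \<in> Hom_dual C (ob S A) (ob S B)"
    from eta_surj[OF u] obtain x where x: "x \<in> Hom C B (ob S A)" "\<eta> B (ob S A) x = u" .
    have ux: "u (ar S h) = \<eta> A (ob S A) (x \<cdot> h) (ide C (ob S A))" if h: "h \<in> Hom C A B" for h
      using eta_nat[OF h, of "ide C (ob S A)" "ob S A" "ob S A" x "ide C (ob S A)"] x h by (simp add: SD)
    have fg: "f \<oplus> g \<in> Hom C A B" "ar S f \<in> Hom C (ob S A) (ob S B)" "ar S g \<in> Hom C (ob S A) (ob S B)"
      using f g by (simp_all add: SD)
    have "x \<cdot> (f \<oplus> g) = (x \<cdot> f) \<oplus> (x \<cdot> g)" using x f g by simp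
    then have "u (ar S (f \<oplus> g)) = u (ar S f) + u (ar S g)"
      using ux[OF fg(1)] ux[OF f] ux[OF g] eta_add[of "x \<cdot> f" A "ob S A" "x \<cdot> g" "ide C (ob S A)"] x f g by simp
    then show "u (ar S (f \<oplus> g)) = u (ar S f \<oplus> ar S g)" using Hom_dualD(1)[OF u fg(2,3)] by simp
  qed (use f g in \<open>simp_all add: SD\<close>)
qed

text \<open>By naturality, pairing \<open>g \<cdot> v\<close> with \<open>u\<close> is the same as
  pairing \<open>v\<close> with \<open>u \<cdot> g\<close>, and the pairing is nondegenerate on both
  sides.\<close>

lemma serre_orthogonal:
  assumes g: "g \<in> Hom C Y Z"
  shows "(\<forall>u\<in>Hom C Z (ob S D). u \<cdot> g = mzero C Y (ob S D)) \<longleftrightarrow> (\<forall>v\<in>Hom C D Y. g \<cdot> v = mzero C D Z)"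
proof -
  have nat: "\<eta> D Z (g \<cdot> v) u = \<eta> D Y v (u \<cdot> g)" if "v \<in> Hom C D Y" "u \<in> Hom C Z (ob S D)" for u v
    using eta_nat[of "ide C D" D D g Y Z v u] that g by (simp add: SD)
  show ?thesis
  proof (intro iffI ballI)
    fix v assume *: "\<forall>u\<in>Hom C Z (ob S D). u \<cdot> g = mzero C Y (ob S D)" and v: "v \<in> Hom C D Y"
    show "g \<cdot> v = mzero C D Z"
    proof (rule eta_eq_zero)
      show "\<eta> D Z (g \<cdot> v) u = 0" if u: "u \<in> Hom C Z (ob S D)" for u
        using nat[OF v u] * u Hom_dualD(4)[OF eta_dual[OF v], of "mzero C Y (ob S D)"] by simp
    qed (use g v in simp)
  next
    fix u assume *: "\<forall>v\<in>Hom C D Y. g \<cdot> v = mzero C D Z" and u: "u \<in> Hom C Z (ob S D)"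
    show "u \<cdot> g = mzero C Y (ob S D)"
    proof (rule dual_separates[of _ Y "ob S D"])
      fix w assume w: "w \<in> Hom_dual C Y (ob S D)"
      from eta_surj[OF w] obtain v where v: "v \<in> Hom C D Y" "\<eta> D Y v = w" .
      show "w (u \<cdot> g) = w (mzero C Y (ob S D))"
        using nat[OF v(1) u] v * eta_zero[OF u] Hom_dualD(4)[OF w, of "mzero C Y (ob S D)"] by simp
    qed (use g u in simp_all)
  qed
qed

lemma S_local: "local_End C (ob S D) \<longleftrightarrow> local_End C D"
proof -
  interpret S: add_functor C S by unfold_locales (rule S_additive)
  show ?thesis
    by (rule S.local_End_ff) (use autoequivalenceD(2,3)[OF S_auto] in blast)+
qed

text \<open>The connecting morphism of the Auslander--Reiten sequence of \<open>D\<close>: it corresponds to a functional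
  on the endomorphism ring of \<open>S D\<close> that vanishes on the radical.\<close>

lemma almost_vanishing:
  assumes D: "local_End C D"
  obtains h where "h \<in> Hom C D (ob S D)" "h \<noteq> mzero C D (ob S D)"
    "\<And>Y u. u \<in> Hom C (ob S D) Y \<Longrightarrow> \<not> (\<exists>s\<in>Hom C Y (ob S D). s \<cdot> u = ide C (ob S D)) \<Longrightarrow> u \<cdot> h = mzero C D Y"
    "\<And>Y r. r \<in> Hom C Y D \<Longrightarrow> \<not> (\<exists>s\<in>Hom C D Y. r \<cdot> s = ide C D) \<Longrightarrow> h \<cdot> r = mzero C Y (ob S D)"
proof -
  let ?S = "ob S D"
  have loc: "local_End C ?S" using D S_local by simp
  \<comment> \<open>The radical: the non-isomorphisms form a subspace because the endomorphism ring
    is local.\<close>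
  define W where "W = {f \<in> Hom C ?S ?S. \<not> is_iso C f}"
  have W: "Hom_subspace C ?S ?S W"
    unfolding Hom_subspace_def
  proof (intro conjI ballI allI)
    show "W \<subseteq> Hom C ?S ?S" by (auto simp: W_def)
    show z: "mzero C ?S ?S \<in> W"
    proof -
      have "\<not> is_iso C (mzero C ?S ?S)"
      proof
        assume "is_iso C (mzero C ?S ?S)"
        then have "ide C ?S = mzero C ?S ?S" by (rule is_isoE) simp
        then show False using loc unfolding local_End_def by simp
      qed
      then show ?thesis by (simp add: W_def)
    qed
    show "f \<oplus> g \<in> W" if "f \<in> W" "g \<in> W" for f g using that loc unfolding W_def local_End_def by auto
    fix c f assume f: "f \<in> W"
    then have f1 [simp]: "f \<in> arr C" "src C f = ?S" "tgt C f = ?S" "\<not> is_iso C f" by (simp_all add: W_def)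
    show "smul C c f \<in> W"
    proof (cases "c = 0")
      case True
      then show ?thesis using z by simp
    next
      case False
      have "\<not> is_iso C (smul C c f)"
      proof
        assume "is_iso C (smul C c f)"
        then obtain g where g: "g \<in> arr C" "src C g = tgt C (smul C c f)" "tgt C g = src C (smul C c f)"
          "g \<cdot> smul C c f = ide C (src C (smul C c f))" "smul C c f \<cdot> g = ide C (tgt C (smul C c f))" by (rule is_isoE)
        have "smul C c g \<cdot> f = g \<cdot> smul C c f" "f \<cdot> smul C c g = smul C c f \<cdot> g"
          using smul_cmp_left[of f ?S ?S g ?S c] smul_cmp_right[of f ?S ?S g ?S c]
            smul_cmp_left[of g ?S ?S f ?S c] smul_cmp_right[of g ?S ?S f ?S c] g by simp_all
        then have "is_iso C f" using g by (intro is_isoI[of f "smul C c g"]) simp_all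
        then show False by simp
      qed
      then show ?thesis by (simp add: W_def)
    qed
  qed
  have "ide C ?S \<in> Hom C ?S ?S" "ide C ?S \<notin> W" by (simp_all add: W_def)
  then obtain \<Lambda> where L: "\<Lambda> \<in> Hom_dual C ?S ?S" "\<Lambda> (ide C ?S) = 1" "\<And>x. x \<in> W \<Longrightarrow> \<Lambda> x = 0"
    using functional_exists[OF W] by blast
  from eta_surj[OF L(1)] obtain h where h: "h \<in> Hom C D ?S" "\<eta> D ?S h = \<Lambda>" .
  show thesis
  proof (rule that[OF h(1)])
    show "h \<noteq> mzero C D ?S"
    proof
      assume "h = mzero C D ?S"
      then have "\<Lambda> (ide C ?S) = 0" using eta_zero[of "ide C ?S" ?S D] h(2) by simp
      then show False using L(2) by simp
    qed
    fix Y u assume u: "u \<in> Hom C ?S Y" and ns: "\<not> (\<exists>s\<in>Hom C Y ?S. s \<cdot> u = ide C ?S)"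
    show "u \<cdot> h = mzero C D Y"
    proof (rule eta_eq_zero)
      show "u \<cdot> h \<in> Hom C D Y" using u h(1) by simp
      fix g assume g: "g \<in> Hom C Y ?S"
      have "\<not> is_iso C (g \<cdot> u)"
      proof
        assume "is_iso C (g \<cdot> u)"
        then obtain k where "k \<in> arr C" "src C k = tgt C (g \<cdot> u)" "tgt C k = src C (g \<cdot> u)"
          "k \<cdot> (g \<cdot> u) = ide C (src C (g \<cdot> u))" by (rule is_isoE)
        then have "(k \<cdot> g) \<cdot> u = ide C ?S" "k \<cdot> g \<in> Hom C Y ?S" using g u by simp_all
        then show False using ns by blast
      qed
      then have "\<Lambda> (g \<cdot> u) = 0" using L(3) g u by (simp add: W_def)
      then show "\<eta> D Y (u \<cdot> h) g = 0"
        using eta_nat[of "ide C D" D D u ?S Y h g] u g h by (simp add: SD)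
    qed
  next
    fix Y r assume r: "r \<in> Hom C Y D" and ns: "\<not> (\<exists>s\<in>Hom C D Y. r \<cdot> s = ide C D)"
    show "h \<cdot> r = mzero C Y ?S"
    proof (rule eta_eq_zero)
      show "h \<cdot> r \<in> Hom C Y ?S" using r h(1) by simp
      fix g assume g: "g \<in> Hom C ?S (ob S Y)"
      \<comment> \<open>An inverse would give a section of \<open>ar S r\<close>; since
        \<open>S\<close> is full and faithful, it would come from a section of
        \<open>r\<close>.\<close>
      have "\<not> is_iso C (ar S r \<cdot> g)"
      proof
        assume "is_iso C (ar S r \<cdot> g)"
        then obtain k where k: "k \<in> arr C" "src C k = tgt C (ar S r \<cdot> g)" "tgt C k = src C (ar S r \<cdot> g)"
          "k \<cdot> (ar S r \<cdot> g) = ide C (src C (ar S r \<cdot> g))" "(ar S r \<cdot> g) \<cdot> k = ide C (tgt C (ar S r \<cdot> g))" by (rule is_isoE)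
        have "g \<cdot> k \<in> Hom C ?S (ob S Y)" using k(1-3) g r by (simp add: SD)
        then obtain s where s: "s \<in> Hom C D Y" "ar S s = g \<cdot> k" using autoequivalenceD(3)[OF S_auto] by blast
        have "ar S (r \<cdot> s) = ar S (ide C D)" using k(1,2,3,5) g r s by (simp add: SD)
        then have "r \<cdot> s = ide C D" using autoequivalenceD(2)[OF S_auto, of "r \<cdot> s" D D "ide C D"] r s by simp
        then show False using ns s(1) by blast
      qed
      then have "\<Lambda> (ar S r \<cdot> g) = 0" using L(3) g r by (simp add: W_def SD)
      then show "\<eta> Y ?S (h \<cdot> r) g = 0"
        using eta_nat[of r Y D "ide C ?S" ?S ?S h g] r g h by (simp add: SD)
    qed
  qed
qed

end

section \<open>Recovering the image equality\<close>

context approx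
begin

text \<open>Rotate an angle whose first map is the preimage under \<open>T\<close> of
  \<open>h\<close> with the sign of the rotation, which then cancels.\<close>

lemma last_map_exists:
  assumes h: "h \<in> Hom C D (ob T A)"
  obtains f where "f \<in> \<Theta>" "f (Suc n) = h" "src C (f 0) = A"
proof -
  obtain D' where D': "ob T D' = D" using ob_surj by blast
  obtain x where x: "x \<in> Hom C D' A" "ar T x = sgn_mor C n h"
    using full[of "sgn_mor C n h" D' A] h D' by auto
  obtain g where g: "g \<in> \<Theta>" "g 0 = x" using angle_extend[of x] x(1) by auto
  note [simp] = nseqD[OF angle_sq[OF g(1)]]
  show thesis
  proof (rule that[of "rot g"])
    show "rot g \<in> \<Theta>" using angle_rot[OF angle_sq[OF g(1)]] g(1) by simp
    show "rot g (Suc n) = h" using g(2) x h by (simp add: rotate_nseq_sgn)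
    have "src C (g (Suc 0)) = A" using nseqD(5)[OF angle_sq[OF g(1)]] g(2) x by simp
    then show "src C (rot g 0) = A" by (simp add: rotate_nseq_sgn)
  qed
qed

lemma retract_X:
  assumes "i \<in> Hom C A D" "p \<in> Hom C D A" "p \<cdot> i = ide C A" "D \<in> X"
  shows "A \<in> X"
  by (rule X_retract[OF assms idem_splits])

lemma thr_iso_X:
  assumes z: "thr z" "is_iso C z"
  shows "src C z \<in> X"
proof -
  from z(1) obtain D g h where d: "D \<in> X" "g \<in> arr C" "src C g = src C z" "tgt C g = D" "h \<in> arr C" "src C h = D"
    "tgt C h = tgt C z" "h \<cdot> g = z" by (rule thrE)
  from z(2) obtain y where y: "y \<in> arr C" "src C y = tgt C z" "tgt C y = src C z" "y \<cdot> z = ide C (src C z)" by (rule is_isoE)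
  show ?thesis
    by (rule retract_X[of g _ D "y \<cdot> h"]) (use d y in simp_all)
qed

text \<open>In a local ring one of \<open>x\<close> and 1 - x is invertible. Here 1 - x factors
  through \<open>X\<close>, so its invertibility would put \<open>A\<close> into
  \<open>X\<close>.\<close>

lemma local_iso:
  assumes A: "local_End C A" "A \<notin> X" and x: "x \<in> Hom C A A" "cl x = cl (ide C A)"
  shows "is_iso C x"
proof (rule ccontr)
  assume "\<not> is_iso C x"
  moreover have "thr (ide C A \<oplus> mneg C x)" using cl_eq_iff[of "ide C A" x] x by simp
  then have "\<not> is_iso C (ide C A \<oplus> mneg C x)" using thr_iso_X[of "ide C A \<oplus> mneg C x"] x A(2) by auto
  ultimately have "\<not> is_iso C (x \<oplus> (ide C A \<oplus> mneg C x))"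
    using A(1)[unfolded local_End_def, THEN conjunct2, rule_format, of x "ide C A \<oplus> mneg C x"] x(1) by simp
  moreover have "x \<oplus> (ide C A \<oplus> mneg C x) = ide C A" using x(1) by (simp add: add_ac)
  ultimately show False by simp
qed

lemma start_in_X:
  assumes G: "autoequivalence Q G" and D: "D \<in> X" and A: "local_End C A"
    and h: "h \<in> Hom C D (ob T A)" "h \<noteq> mzero C D (ob T A)"
    and kill: "\<And>Y u. u \<in> Hom C (ob T A) Y \<Longrightarrow> \<not> (\<exists>s\<in>Hom C Y (ob T A). s \<cdot> u = ide C (ob T A)) \<Longrightarrow> u \<cdot> h = mzero C D Y"
  shows "A \<in> X"
proof (rule ccontr)
  assume AX: "A \<notin> X"
  have h1 [simp]: "h \<in> arr C" "src C h = D" "tgt C h = ob T A" using h(1) by simp_all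
  obtain f where f: "f \<in> \<Theta>" "f (Suc n) = h" "src C (f 0) = A" using last_map_exists[OF h(1)] .
  note [simp] = nseqD(2,5)[OF angle_sq[OF f(1)]] f(2,3)
  obtain r where r: "r \<in> \<Theta>" "src C (r (Suc n)) = ob G A" "\<And>i. 1 \<le> i \<Longrightarrow> i \<le> n \<Longrightarrow> src C (r i) \<in> X"
    "\<And>v. v \<in> arr C \<Longrightarrow> src C v \<in> X \<Longrightarrow> tgt C v = ob G A \<Longrightarrow> r (Suc n) \<cdot> v = mzero C (src C v) (tgt C (r (Suc n)))"
    by (rule right_angleE[of "ob G A"]) blast
  define H where "H = src C (r 0)"
  note [simp] = nseqD(1,2)[OF angle_sq[OF r(1)]] r(2) H_def[symmetric]
  have [simp]: "tgt C (r (Suc n)) = ob T H" using nseqD(6)[OF angle_sq[OF r(1)]] by simp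
  \<comment> \<open>A retraction of \<open>f 0\<close> would force \<open>h\<close> to vanish, since
    \<open>ar T (f 0)\<close> kills \<open>h\<close>. The rest of the proof constructs such a
    retraction.\<close>
  have nosplit: "s \<cdot> f 0 \<noteq> ide C A" if s: "s \<in> arr C" "src C s = tgt C (f 0)" "tgt C s = A" for s
  proof
    assume "s \<cdot> f 0 = ide C A"
    from arg_cong[OF this, of "ar T"] have "ar T s \<cdot> ar T (f 0) = ide C (ob T A)" using s by simp
    from cmp_eq_assoc[OF this, of h] have "ar T s \<cdot> (ar T (f 0) \<cdot> h) = h" using s by simp
    moreover have "ar T (f 0) \<cdot> h = mzero C D (ob T (tgt C (f 0)))" using comp_zero(2)[OF f(1)] by simp
    ultimately show False using h(2) s by simp
  qed
  \<comment> \<open>As \<open>A\<close> is not in \<open>X\<close>, its approximation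
    \<open>L A 0\<close> does not split; so the almost vanishing \<open>h\<close> is killed by
    \<open>ar T (L A 0)\<close> and lifts along \<open>l A\<close>.\<close>
  have "ar T (L A 0) \<cdot> h = mzero C D (ob T (tgt C (L A 0)))"
  proof (rule kill)
    show "\<not> (\<exists>s\<in>Hom C (ob T (tgt C (L A 0))) (ob T A). s \<cdot> ar T (L A 0) = ide C (ob T A))"
    proof
      assume "\<exists>s\<in>Hom C (ob T (tgt C (L A 0))) (ob T A). s \<cdot> ar T (L A 0) = ide C (ob T A)"
      then obtain s where s: "s \<in> Hom C (ob T (tgt C (L A 0))) (ob T A)" "s \<cdot> ar T (L A 0) = ide C (ob T A)" by (rule bexE)
      obtain x where x: "x \<in> Hom C (tgt C (L A 0)) A" "ar T x = s" using full[OF s(1)] by (rule bexE)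
      have "x \<cdot> L A 0 = ide C A" by (rule faithful[of _ A A]) (use x s in simp_all)
      then show False using retract_X[of "L A 0" A _ x] L_X(2) x(1) AX by simp
    qed
  qed simp
  then obtain h' where h': "h' \<in> Hom C D (ob G A)" "h = l A \<cdot> h'" using wker(2)[OF L_angle[of A], of h] by auto
  have "thr (r 0)" using r(3)[of 1] n1 nseqD(5)[OF angle_sq[OF r(1)]] by (intro thr_ob) simp_all
  then have "ar T (r 0) \<cdot> l H = mzero C (ob G H) (ob T (tgt C (r 0)))" using l_kill[of "r 0" H] by simp
  \<comment> \<open>No Frobenius condition is at hand, so \<open>r\<close> and the chosen angle of
    \<open>H\<close> are related only by \<open>c\<close> and by the map \<open>u\<close> below.
    Fullness of \<open>G\<close> gives a preimage \<open>q\<close> of the class of \<open>c\<close>,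
    and faithfulness makes \<open>q \<cdot> u\<close> the identity of \<open>A\<close> in the
    quotient.\<close>
  then obtain c where c: "c \<in> Hom C (ob G H) (ob G A)" "l H = r (Suc n) \<cdot> c"
    using wker(2)[OF r(1), of "l H"] by auto
  have "r (Suc n) \<cdot> L A n = mzero C (src C (L A n)) (ob T H)" using r(4)[of "L A n"] L_X(1)[of n A] n1 by simp
  then obtain w where w: "w \<in> Hom C (ob T A) (ob T H)" "r (Suc n) = w \<cdot> l A"
    using wcoker(1)[OF L_angle[of A], of "r (Suc n)" n] by auto
  obtain u where u: "u \<in> Hom C A H" "ar T u = w" using full[OF w(1)] by (rule bexE)
  \<comment> \<open>Since \<open>D\<close> is in \<open>X\<close>, the connecting map of
    \<open>r\<close> kills \<open>h'\<close>. So \<open>ar T u\<close> kills \<open>h\<close>, which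
    makes \<open>u\<close> factor through \<open>f 0\<close>.\<close>
  have "ar T u \<cdot> h = w \<cdot> (l A \<cdot> h')" unfolding u(2) h'(2) ..
  also have "\<dots> = r (Suc n) \<cdot> h'" by (rule cmp_eq_assoc[OF w(2)[symmetric]]) (use h' w in simp_all)
  also have "\<dots> = mzero C D (ob T H)" using r(4)[of h'] h'(1) D by simp
  finally obtain s where s: "s \<in> Hom C (ob T (tgt C (f 0))) (ob T H)" "ar T u = s \<cdot> ar T (f 0)"
    using wcoker(2)[OF f(1), of "ar T u"] u(1) by auto
  obtain y where y: "y \<in> Hom C (tgt C (f 0)) H" "ar T y = s" using full[OF s(1)] by (rule bexE)
  have yu: "y \<cdot> f 0 = u" by (rule faithful[of _ A H]) (use y s(2)[symmetric] u(1) in simp_all)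
  have "cl c \<in> Hom Q (ob G H) (ob G A)" using c(1) by simp
  from Q.autoequivalenceD(3)[OF G this] obtain F where "F \<in> Hom Q H A" and F: "ar G F = cl c" by (rule bexE)
  then obtain q where q: "q \<in> arr C" "F = cl q" "src C q = H" "tgt C q = A" using Hom_QE by blast
  obtain \<psi> where p: "\<psi> \<in> arr C" "src C \<psi> = ob G A" "tgt C \<psi> = ob G H" "l H \<cdot> \<psi> = ar T u \<cdot> l A" "ar G (cl u) = cl \<psi>"
    using G_arE[of u] u(1) by (metis Hom_iff)
  have "cl (c \<cdot> \<psi>) = cl (ide C (ob G A))"
  proof (rule cl_eqI)
    show "thr ((c \<cdot> \<psi>) \<oplus> mneg C (ide C (ob G A)))"
    proof (rule thr_of_last[OF r(1)])
      show "src C (r n) \<in> X" using r(3)[of n] n1 by simp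
      have "r (Suc n) \<cdot> (c \<cdot> \<psi>) = l H \<cdot> \<psi>"
        by (rule cmp_eq_assoc[OF c(2)[symmetric]]) (use p(1-3) c(1) in simp_all)
      also have "\<dots> = r (Suc n)" unfolding p(4) u(2) w(2) ..
      finally show "r (Suc n) \<cdot> ((c \<cdot> \<psi>) \<oplus> mneg C (ide C (ob G A))) =
        mzero C (src C ((c \<cdot> \<psi>) \<oplus> mneg C (ide C (ob G A)))) (tgt C (r (Suc n)))"
        using c(1) p(1-3) by simp
    qed (use c(1) p(1-3) in simp_all)
  qed (use c(1) p(1-3) in simp_all)
  then have "cl c \<cdot>\<^bsub>Q\<^esub> cl \<psi> = ide Q (ob G A)" using c(1) p(1-3) by (simp add: Q_ide)
  moreover have "ar G (cl q \<cdot>\<^bsub>Q\<^esub> cl u) = cl c \<cdot>\<^bsub>Q\<^esub> cl \<psi>"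
    using Q.ar_cmp[of "cl u" "cl q"] u(1) q(1,3,4) F p(5) unfolding q(2) by (simp del: Q_cmp)
  moreover have "cl q \<cdot>\<^bsub>Q\<^esub> cl u = cl (q \<cdot> u)" using u(1) q by simp
  ultimately have "ar G (cl (q \<cdot> u)) = ar G (ide Q A)" by (simp only: Q.ar_ide)
  then have "cl (q \<cdot> u) = cl (ide C A)"
    using Q.autoequivalenceD(2)[OF G, of "cl (q \<cdot> u)" A A "ide Q A"] u(1) q by (simp add: Q_ide)
  then have "is_iso C (q \<cdot> u)" using local_iso[OF A AX, of "q \<cdot> u"] u(1) q by simp
  then obtain k where k: "k \<in> arr C" "src C k = A" "tgt C k = A" "k \<cdot> (q \<cdot> u) = ide C A"
    by (rule is_isoE) (use u(1) q in simp)
  have "(k \<cdot> (q \<cdot> y)) \<cdot> f 0 = ide C A" using k q y(1) by (simp add: yu)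
  then show False using nosplit[of "k \<cdot> (q \<cdot> y)"] k q y(1) by simp
qed

lemma end_in_X:
  assumes G: "autoequivalence Q G" and E: "E \<in> X" and D: "local_End C D"
    and h: "h \<in> Hom C D (ob T E)" "h \<noteq> mzero C D (ob T E)"
    and kill: "\<And>Y r. r \<in> Hom C Y D \<Longrightarrow> \<not> (\<exists>s\<in>Hom C D Y. r \<cdot> s = ide C D) \<Longrightarrow> h \<cdot> r = mzero C Y (ob T E)"
  shows "D \<in> X"
proof (rule ccontr)
  assume DX: "D \<notin> X"
  have h1 [simp]: "h \<in> arr C" "src C h = D" "tgt C h = ob T E" using h(1) by simp_all
  obtain f where f: "f \<in> \<Theta>" "f (Suc n) = h" "src C (f 0) = E" using last_map_exists[OF h(1)] .
  have fn [simp]: "f n \<in> arr C" "tgt C (f n) = D"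
    using nseqD(1,4)[OF angle_sq[OF f(1)], of n] f(2) by simp_all
  \<comment> \<open>By density \<open>D\<close> is isomorphic to some \<open>ob G W\<close> in the
    quotient. As \<open>D\<close> is local and not in \<open>X\<close>, it is then a retract of
    \<open>ob G W\<close> in \<open>C\<close> itself.\<close>
  obtain W where "isomorphic Q (ob G W) D" using Q.autoequivalenceD(4)[OF G] by blast
  then obtain F where F: "F \<in> Hom Q (ob G W) D" "is_iso Q F" unfolding isomorphic_def by blast
  from F(1) obtain p where p: "p \<in> arr C" "F = cl p" "src C p = ob G W" "tgt C p = D" by (rule Hom_QE)
  from F(2) obtain F' where "F' \<in> Hom Q D (ob G W)" and F': "F \<cdot>\<^bsub>Q\<^esub> F' = ide Q D"
    by (rule is_isoE) (use p in simp)
  from this(1) obtain q where q: "q \<in> arr C" "F' = cl q" "src C q = D" "tgt C q = ob G W" by (rule Hom_QE)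
  have "is_iso C (p \<cdot> q)" using local_iso[OF D DX, of "p \<cdot> q"] p q F' by (simp add: Q_ide)
  then obtain k where k: "k \<in> arr C" "src C k = D" "tgt C k = D" "(p \<cdot> q) \<cdot> k = ide C D"
    by (rule is_isoE) (use p q in simp)
  have "h \<cdot> (p \<cdot> L W n) = mzero C (src C (L W n)) (ob T E)"
  proof (rule kill)
    show "\<not> (\<exists>s\<in>Hom C D (src C (L W n)). (p \<cdot> L W n) \<cdot> s = ide C D)"
    proof
      assume "\<exists>s\<in>Hom C D (src C (L W n)). (p \<cdot> L W n) \<cdot> s = ide C D"
      then obtain s where "s \<in> Hom C D (src C (L W n))" "(p \<cdot> L W n) \<cdot> s = ide C D" by (rule bexE)
      then show False using retract_X[of s D "src C (L W n)" "p \<cdot> L W n"] L_X(1)[of n W] n1 p DX by simp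
    qed
  qed (use p in simp)
  then obtain s where s: "s \<in> Hom C (ob T W) (ob T E)" "h \<cdot> p = s \<cdot> l W"
    using wcoker(1)[OF L_angle[of W], of "h \<cdot> p" n] p by auto
  obtain x where x: "x \<in> Hom C W E" "ar T x = s" using full[OF s(1)] by (rule bexE)
  \<comment> \<open>The factor \<open>x\<close> ends in the object \<open>E\<close> of
    \<open>X\<close>, and \<open>T\<close> of a map through \<open>X\<close> vanishes after
    \<open>l W\<close>.\<close>
  have "thr x" using x(1) E by (intro thr_ob) simp_all
  then have "h \<cdot> p = mzero C (ob G W) (ob T E)" using l_kill[of x W] x s(2) by simp
  then obtain p' where p': "p' \<in> Hom C (ob G W) (src C (f n))" "p = f n \<cdot> p'"
    using wker(1)[OF f(1) p(1), of n] f(2) p by auto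
  have "h = h \<cdot> ((p \<cdot> q) \<cdot> k)" using k by simp
  also have "\<dots> = h \<cdot> (f n \<cdot> (p' \<cdot> (q \<cdot> k)))" unfolding p'(2) using p' q k by simp
  also have "\<dots> = mzero C D (ob T E)"
    using comp_zero_assoc(1)[OF f(1) le_refl, of "p' \<cdot> (q \<cdot> k)"] f(2) p' q k by simp
  finally show False using h(2) by simp
qed

end

section \<open>Comparing the images of \<open>X\<close> under \<open>S\<close> and
  \<open>T\<close>\<close>

lemma (in category) iso_image_subset:
  assumes "\<And>A. A \<in> X \<Longrightarrow> \<exists>A'\<in>X. isomorphic C (ob F A) (ob K A')"
  shows "iso_image C F X \<subseteq> iso_image C K X"
  using assms isomorphic_trans unfolding iso_image_def by blast

lemma (in category) iso_imageE:
  assumes "iso_image C F X \<subseteq> iso_image C K X" "A \<in> X"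
  obtains A' where "A' \<in> X" "isomorphic C (ob F A) (ob K A')"
  using assms isomorphic_refl[of "ob F A"] unfolding iso_image_def by blast

lemma (in preadditive_category) kill_isomorphic:
  assumes "isomorphic C B B'" and g: "g \<in> Hom C Y Z" and k: "\<And>u. u \<in> Hom C Z B' \<Longrightarrow> u \<cdot> g = mzero C Y B'"
    and u: "u \<in> Hom C Z B"
  shows "u \<cdot> g = mzero C Y B"
proof -
  obtain t where t: "t \<in> Hom C B B'" "is_iso C t" using assms(1) unfolding isomorphic_def by blast
  from t(2) obtain t' where t': "t' \<in> arr C" "src C t' = B'" "tgt C t' = B" "t' \<cdot> t = ide C B"
    by (rule is_isoE) (use t(1) in simp)
  have "(t \<cdot> u) \<cdot> g = mzero C Y B'" using k[of "t \<cdot> u"] t(1) u by simp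
  then have "t' \<cdot> (t \<cdot> (u \<cdot> g)) = mzero C Y B" using t(1) t' u g by simp
  then show ?thesis using cmp_eq_assoc[OF t'(4), of "u \<cdot> g"] t(1) t' u g by simp
qed

locale serre_approx = approx C T n \<Theta> X L + serre_duality C S \<eta>
  for C :: "('o, 'm, 'k::field, 'z) lincat_scheme" (structure) and T :: "('o, 'm) endo" and n :: nat
    and \<Theta> :: "(nat \<Rightarrow> 'm) set" and X :: "'o set" and L :: "'o \<Rightarrow> nat \<Rightarrow> 'm"
    and S :: "('o, 'm) endo" and \<eta> :: "'o \<Rightarrow> 'o \<Rightarrow> 'm \<Rightarrow> 'm \<Rightarrow> 'k" +
  assumes locals: "sum_of_locals C A"
begin

lemma T_local: "local_End C (ob T A) \<longleftrightarrow> local_End C A"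
  by (rule local_End_ff[OF full faithful])

lemma serre_image_eq:
  assumes G: "autoequivalence Q G"
  shows "iso_image C S X = iso_image C T X"
proof
  show "iso_image C S X \<subseteq> iso_image C T X"
  proof (rule iso_image_subset, rule local_to_all[OF S_additive add_endo _ locals])
    fix A assume A: "local_End C A" "A \<in> X"
    obtain A0 where A0: "ob T A0 = ob S A" using ob_surj by blast
    then have loc: "local_End C A0" using A(1) S_local[of A] T_local[of A0] by simp
    show "\<exists>A'\<in>X. isomorphic C (ob S A) (ob T A')"
    proof (rule almost_vanishing[OF A(1)])
      fix h assume h: "h \<in> Hom C A (ob S A)" "h \<noteq> mzero C A (ob S A)"
        "\<And>Y u. u \<in> Hom C (ob S A) Y \<Longrightarrow> \<not> (\<exists>s\<in>Hom C Y (ob S A). s \<cdot> u = ide C (ob S A)) \<Longrightarrow> u \<cdot> h = mzero C A Y"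
        "\<And>Y r. r \<in> Hom C Y A \<Longrightarrow> \<not> (\<exists>s\<in>Hom C A Y. r \<cdot> s = ide C A) \<Longrightarrow> h \<cdot> r = mzero C Y (ob S A)"
      have "A0 \<in> X" by (rule start_in_X[OF G A(2) loc, unfolded A0, OF h(1-3)])
      then show "\<exists>A'\<in>X. isomorphic C (ob S A) (ob T A')" using A0 isomorphic_refl[of "ob S A"] by (intro bexI[of _ A0]) simp_all
    qed
  qed
  show "iso_image C T X \<subseteq> iso_image C S X"
  proof (rule iso_image_subset, rule local_to_all[OF add_endo S_additive _ locals])
    fix E assume E: "local_End C E" "E \<in> X"
    obtain D where D: "isomorphic C (ob S D) (ob T E)" using autoequivalenceD(4)[OF S_auto] by blast
    then have loc: "local_End C D"
      using local_End_iso[OF _ isomorphic_sym[OF D]] E(1) S_local[of D] T_local[of E] by simp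
    \<comment> \<open>Unlike \<open>T\<close>, the functor \<open>S\<close> is only known to reach
      objects up to isomorphism, so the almost vanishing morphism has to be transported along
      \<open>t\<close>.\<close>
    from D obtain t where t: "t \<in> Hom C (ob S D) (ob T E)" "is_iso C t" unfolding isomorphic_def by blast
    from t(2) obtain t' where t': "t' \<in> arr C" "src C t' = ob T E" "tgt C t' = ob S D" "t' \<cdot> t = ide C (ob S D)"
      by (rule is_isoE) (use t(1) in simp)
    show "\<exists>A'\<in>X. isomorphic C (ob T E) (ob S A')"
    proof (rule almost_vanishing[OF loc])
      fix h assume h: "h \<in> Hom C D (ob S D)" "h \<noteq> mzero C D (ob S D)"
        "\<And>Y u. u \<in> Hom C (ob S D) Y \<Longrightarrow> \<not> (\<exists>s\<in>Hom C Y (ob S D). s \<cdot> u = ide C (ob S D)) \<Longrightarrow> u \<cdot> h = mzero C D Y"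
        "\<And>Y r. r \<in> Hom C Y D \<Longrightarrow> \<not> (\<exists>s\<in>Hom C D Y. r \<cdot> s = ide C D) \<Longrightarrow> h \<cdot> r = mzero C Y (ob S D)"
      have "D \<in> X"
      proof (rule end_in_X[OF G E(2) loc])
        show "t \<cdot> h \<in> Hom C D (ob T E)" using t(1) h(1) by simp
        show "t \<cdot> h \<noteq> mzero C D (ob T E)"
        proof
          assume "t \<cdot> h = mzero C D (ob T E)"
          then have "t' \<cdot> (t \<cdot> h) = mzero C D (ob S D)" using t' by simp
          then show False using cmp_eq_assoc[OF t'(4), of h] t(1) t' h(1,2) by simp
        qed
        show "(t \<cdot> h) \<cdot> r = mzero C Y (ob T E)"
          if "r \<in> Hom C Y D" "\<not> (\<exists>s\<in>Hom C D Y. r \<cdot> s = ide C D)" for Y r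
          using h(4)[OF that] that(1) t(1) h(1) by simp
      qed
      then show "\<exists>A'\<in>X. isomorphic C (ob T E) (ob S A')" using isomorphic_sym[OF D] by blast
    qed
  qed
qed

lemma frobenius_of_image_eq:
  assumes eq: "iso_image C S X = iso_image C T X"
  shows "frobenius C T n \<Theta> X L"
proof
  fix e assume e: "e \<in> \<Theta>"
  define A Y where "A = src C (e 0)" and "Y = src C (e (Suc n))"
  note [simp] = nseqD(1,2,6)[OF angle_sq[OF e]] A_def[symmetric] Y_def[symmetric]
  have eh: "e (Suc n) \<in> Hom C Y (ob T A)" by simp
  have "X_monic C X (e 0) \<longleftrightarrow> (\<forall>D\<in>X. \<forall>b\<in>Hom C A D. ar T b \<cdot> e (Suc n) = mzero C Y (ob T D))"
  proof (intro iffI ballI)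
    fix D b assume "X_monic C X (e 0)" "D \<in> X" "b \<in> Hom C A D"
    then show "ar T b \<cdot> e (Suc n) = mzero C Y (ob T D)" using monic_kill[OF e, of b] thr_ob[of b] by simp
  next
    assume *: "\<forall>D\<in>X. \<forall>b\<in>Hom C A D. ar T b \<cdot> e (Suc n) = mzero C Y (ob T D)"
    show "X_monic C X (e 0)"
      unfolding X_monic_iff
    proof (intro conjI ballI)
      fix D b assume D: "D \<in> X" and "b \<in> Hom C (src C (e 0)) D"
      then have b: "b \<in> Hom C A D" by simp
      have "ar T b \<cdot> e (Suc n) = mzero C Y (ob T D)" using * D b by blast
      then obtain s where s: "s \<in> Hom C (ob T (tgt C (e 0))) (ob T D)" "ar T b = s \<cdot> ar T (e 0)"
        using wcoker(2)[OF e, of "ar T b"] b by auto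
      obtain x where x: "x \<in> Hom C (tgt C (e 0)) D" "ar T x = s" using full[OF s(1)] by (rule bexE)
      have "b = x \<cdot> e 0" by (rule faithful[of _ A D]) (use b x s(2) in simp_all)
      then show "\<exists>g'\<in>Hom C (tgt C (e 0)) D. b = g' \<cdot> e 0" using x(1) by blast
    qed simp
  qed
  also have "\<dots> \<longleftrightarrow> (\<forall>D\<in>X. \<forall>u\<in>Hom C (ob T A) (ob T D). u \<cdot> e (Suc n) = mzero C Y (ob T D))"
  proof (intro iffI ballI)
    fix D u assume *: "\<forall>D\<in>X. \<forall>b\<in>Hom C A D. ar T b \<cdot> e (Suc n) = mzero C Y (ob T D)" and D: "D \<in> X"
      and u: "u \<in> Hom C (ob T A) (ob T D)"
    obtain b where "b \<in> Hom C A D" "ar T b = u" using full[OF u] by (rule bexE)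
    then show "u \<cdot> e (Suc n) = mzero C Y (ob T D)" using * D by blast
  next
    fix D b assume *: "\<forall>D\<in>X. \<forall>u\<in>Hom C (ob T A) (ob T D). u \<cdot> e (Suc n) = mzero C Y (ob T D)" and D: "D \<in> X"
      and b: "b \<in> Hom C A D"
    have "ar T b \<in> Hom C (ob T A) (ob T D)" using b by simp
    then show "ar T b \<cdot> e (Suc n) = mzero C Y (ob T D)" using * D by blast
  qed
  \<comment> \<open>Only this equivalence uses the equality of the images; the next one is Serre
    duality for each \<open>D\<close> separately.\<close>
  also have "\<dots> \<longleftrightarrow> (\<forall>D\<in>X. \<forall>u\<in>Hom C (ob T A) (ob S D). u \<cdot> e (Suc n) = mzero C Y (ob S D))"
  proof (intro iffI ballI)
    fix D u assume *: "\<forall>D\<in>X. \<forall>u\<in>Hom C (ob T A) (ob T D). u \<cdot> e (Suc n) = mzero C Y (ob T D)" and D: "D \<in> X"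
      and u: "u \<in> Hom C (ob T A) (ob S D)"
    obtain D' where "D' \<in> X" "isomorphic C (ob S D) (ob T D')" by (rule iso_imageE[OF equalityD1[OF eq] D])
    then show "u \<cdot> e (Suc n) = mzero C Y (ob S D)" using kill_isomorphic[OF _ eh _ u] * by blast
  next
    fix D u assume *: "\<forall>D\<in>X. \<forall>u\<in>Hom C (ob T A) (ob S D). u \<cdot> e (Suc n) = mzero C Y (ob S D)" and D: "D \<in> X"
      and u: "u \<in> Hom C (ob T A) (ob T D)"
    obtain D' where "D' \<in> X" "isomorphic C (ob T D) (ob S D')" by (rule iso_imageE[OF equalityD2[OF eq] D])
    then show "u \<cdot> e (Suc n) = mzero C Y (ob T D)" using kill_isomorphic[OF _ eh _ u] * by blast
  qed
  also have "\<dots> \<longleftrightarrow> (\<forall>D\<in>X. \<forall>v\<in>Hom C D Y. e (Suc n) \<cdot> v = mzero C D (ob T A))"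
    using serre_orthogonal[OF eh] by blast
  also have "\<dots> \<longleftrightarrow> (\<forall>v\<in>arr C. src C v \<in> X \<longrightarrow> tgt C v = src C (e (Suc n)) \<longrightarrow>
      e (Suc n) \<cdot> v = mzero C (src C v) (tgt C (e (Suc n))))" by auto
  finally show "X_monic C X (e 0) \<longleftrightarrow> (\<forall>v\<in>arr C. src C v \<in> X \<longrightarrow> tgt C v = src C (e (Suc n)) \<longrightarrow>
      e (Suc n) \<cdot> v = mzero C (src C v) (tgt C (e (Suc n))))" .
qed

end

lemma angulatedI:
  assumes n: "n \<ge> 1" and C: "angulated_category n C T \<Theta>" and loc: "\<And>A. sum_of_locals C A"
  shows "angulated C T n \<Theta>"
proof -
  interpret additive_category C using C unfolding angulated_category_def by blast
  interpret T: add_functor C T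
    by unfold_locales (use C in \<open>simp add: angulated_category_def\<close>)
  interpret ax: angulation_axioms n C T \<Theta> using C unfolding angulated_category_def by blast
  have bij: "bij (ob T)" "bij_betw (ar T) (arr C) (arr C)"
    using C unfolding angulated_category_def automorphism_def by blast+
  have obD: "A = B" if "ob T A = ob T B" for A B using bij(1) that by (simp add: bij_def inj_eq)
  show ?thesis
  proof unfold_locales
    show "\<exists>x\<in>Hom C A B. ar T x = y" if y: "y \<in> Hom C (ob T A) (ob T B)" for A B y
    proof -
      have "y \<in> ar T ` arr C" using bij_betw_imp_surj_on[OF bij(2)] y by simp
      then obtain x where x: "y = ar T x" "x \<in> arr C" by (rule imageE)
      \<comment> \<open>Injectivity of \<open>T\<close> on objects recovers the source and target of
        the preimage.\<close>
      then have "src C x = A" "tgt C x = B" using y obD[of "src C x" A] obD[of "tgt C x" B] by simp_all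
      then show ?thesis using x by (intro bexI[of _ x]) simp_all
    qed
    show "x = y" if "x \<in> Hom C A B" "y \<in> Hom C A B" "ar T x = ar T y" for A B x y
      using inj_onD[OF bij_betw_imp_inj_on[OF bij(2)] that(3)] that(1,2) by simp
    show "\<exists>A'. ob T A' = A" for A using bij(1) by (metis bij_pointE)
    show "splits x" if "x \<in> Hom C A A" "x \<cdot>\<^bsub>C\<^esub> x = x" for A x using sum_of_locals_splits[OF loc that] .
    show "1 \<le> n" by (rule n)
    show "nseq n C T f" if "f \<in> \<Theta>" for f using ax.angle_nseq[OF that] .
    show "g \<in> \<Theta>" if "f \<in> \<Theta>" "nseq_isomorphic n C T f g" for f g using ax.F1_iso[OF that] .
    show "f \<in> \<Theta>" if "trivial_nseq n C T A f" for A f using ax.F1_trivial[OF that] .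
    show "f \<in> \<Theta> \<longleftrightarrow> rotate_nseq n C T f \<in> \<Theta>" if "nseq n C T f" for f using ax.F2[OF that] .
    show "h \<in> \<Theta>" if "f \<in> \<Theta>" "g \<in> \<Theta>" "nseq_direct_sum n C T f g h" for f g h using ax.F1_sum[OF that] .
    show "f \<in> \<Theta>" if "h \<in> \<Theta>" "nseq_direct_sum n C T f g h" for f g h using ax.F1_summand[OF that] .
    show "\<exists>f\<in>\<Theta>. f 0 = x" if "x \<in> arr C" for x using ax.F1_extend[OF that] .
    fix f g a b assume *: "f \<in> \<Theta>" "g \<in> \<Theta>" "a \<in> Hom C (src C (f 0)) (src C (g 0))"
      "b \<in> Hom C (src C (f (Suc 0))) (src C (g (Suc 0)))" "b \<cdot>\<^bsub>C\<^esub> f 0 = g 0 \<cdot>\<^bsub>C\<^esub> a"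
    show "\<exists>\<phi>. nseq_morphism n C T f g \<phi> \<and> \<phi> 0 = a \<and> \<phi> (Suc 0) = b"
      by (rule ax.F3[OF *(1-3) _ *(5), unfolded One_nat_def, OF *(4)])
    show "\<exists>\<phi> h. nseq_morphism n C T f g \<phi> \<and> \<phi> 0 = a \<and> \<phi> (Suc 0) = b \<and>
        mapping_cone n C T f g \<phi> h \<and> h \<in> \<Theta>"
      by (rule ax.F4[OF *(1-3) _ *(5), unfolded One_nat_def, OF *(4)])
  qed
qed

theorem theorem1p3:
  fixes n :: nat
    and C :: "('o, 'm, 'k::field) lincat"
    and T S :: "('o, 'm) endo"
    and \<Theta> :: "(nat \<Rightarrow> 'm) set"
    and X :: "'o set"
    and L :: "'o \<Rightarrow> nat \<Rightarrow> 'm"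
  assumes "n \<ge> 1"
    and "linear_category C"
    and "Hom_finite C"
    and "krull_schmidt C"
    and "angulated_category n C T \<Theta>"
    and "serre_functor C S"
    and "strongly_functorially_finite n C \<Theta> X"
    and "\<And>A. left_approximation_angle n C \<Theta> X A (L A)"
  shows "weakly_angulated_category n (quotient_cat C X) (G_functor n C T X L)
           (right_angles n C T \<Theta> X L)
         \<longleftrightarrow> iso_image C S X = iso_image C T X"
proof -
  have loc: "sum_of_locals C A" for A using assms(4) unfolding krull_schmidt_def by blast
  interpret angulated C T n \<Theta> by (rule angulatedI[OF assms(1,5) loc])
  interpret linear_category C by (rule assms(2))
  have S: "autoequivalence C S" using assms(6) unfolding serre_functor_def by (rule conjunct1)
  from assms(6)[unfolded serre_functor_def, THEN conjunct2]
  obtain \<eta> :: "'o \<Rightarrow> 'o \<Rightarrow> 'm \<Rightarrow> 'm \<Rightarrow> 'k"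
    where e: "(\<forall>A B. bij_betw (\<eta> A B) (Hom C A B) (Hom_dual C B (ob S A))) \<and>
      (\<forall>A B. \<forall>f \<in> Hom C A B. \<forall>g \<in> Hom C A B. \<forall>h \<in> Hom C B (ob S A).
        \<eta> A B (f \<oplus>\<^bsub>C\<^esub> g) h = \<eta> A B f h + \<eta> A B g h) \<and>
      (\<forall>A B c. \<forall>f \<in> Hom C A B. \<forall>h \<in> Hom C B (ob S A).
        \<eta> A B (smul C c f) h = c * \<eta> A B f h) \<and>
      (\<forall>A A' B B'. \<forall>a \<in> Hom C A' A. \<forall>b \<in> Hom C B B'. \<forall>f \<in> Hom C A B. \<forall>h \<in> Hom C B' (ob S A').
        \<eta> A' B' (b \<cdot>\<^bsub>C\<^esub> (f \<cdot>\<^bsub>C\<^esub> a)) h = \<eta> A B f (ar S a \<cdot>\<^bsub>C\<^esub> (h \<cdot>\<^bsub>C\<^esub> b)))"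
    by (rule exE)
  interpret serre_approx C T n \<Theta> X L S \<eta>
  proof unfold_locales
    show "additive_subcategory C X" "\<exists>f. right_approximation_angle n C \<Theta> X A f" for A
      using assms(7) unfolding strongly_functorially_finite_def by blast+
    show "left_approximation_angle n C \<Theta> X A (L A)" for A by (rule assms(8))
    show "autoequivalence C S" by (rule S)
    show "bij_betw (\<eta> A B) (Hom C A B) (Hom_dual C B (ob S A))" for A B using e[THEN conjunct1, rule_format] .
    show "\<eta> A B (f \<oplus>\<^bsub>C\<^esub> g) h = \<eta> A B f h + \<eta> A B g h"
      if "f \<in> Hom C A B" "g \<in> Hom C A B" "h \<in> Hom C B (ob S A)" for A B f g h using e[THEN conjunct2, THEN conjunct1, rule_format, OF that] .
    show "\<eta> A' B' (b \<cdot>\<^bsub>C\<^esub> (f \<cdot>\<^bsub>C\<^esub> a)) h = \<eta> A B f (ar S a \<cdot>\<^bsub>C\<^esub> (h \<cdot>\<^bsub>C\<^esub> b))"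
      if "a \<in> Hom C A' A" "b \<in> Hom C B B'" "f \<in> Hom C A B" "h \<in> Hom C B' (ob S A')" for A A' B B' a b f h
      using e[THEN conjunct2, THEN conjunct2, THEN conjunct2, rule_format, OF that] .
    show "sum_of_locals C A" for A by (rule loc)
  qed
  show ?thesis
  proof
    assume "weakly_angulated_category n Q G (right_angles n C T \<Theta> X L)"
    then have "autoequivalence Q G" unfolding weakly_angulated_category_def by blast
    then show "iso_image C S X = iso_image C T X" by (rule serre_image_eq)
  next
    assume "iso_image C S X = iso_image C T X"
    then interpret frobenius C T n \<Theta> X L by (rule frobenius_of_image_eq)
    show "weakly_angulated_category n Q G (right_angles n C T \<Theta> X L)" by (rule quotient_weakly_angulated)
  qed
qed

end
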